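(* Let $M$ be a smooth manifold of even dimension $n\geq 2$ and let $g$ be a (pseudo-Riemannian) metric of signature $(p,q)$ on $M$. Let $Q$ be the (critical, order $n$) $Q$-curvature of $g$, let $v^{(2j)}$ $(0\le j\le n/2)$ be the volume coefficients of a Poincaré metric for $g$, let $p_{2k}$ $(1\le k\le n/2-1)$ be the differential operators on $M$ appearing in the expansion of a harmonic function for a Poincaré metric for $g$, and let $p_{2k}^*$ be the formal adjoint of $p_{2k}$ with respect to $dv_g$. Then $$2n\,c_{n/2}\,Q=n\,v^{(n)}+\sum_{k=1}^{n/2-1}(n-2k)\,p_{2k}^*\,v^{(n-2k)},$$ where $c_{n/2}=(-1)^{n/2}\left[2^n\,(n/2)!\,(n/2-1)!\right]^{-1}$.
   Context: Conventions. The Laplacian of any metric is $\Delta=-\nabla^i\nabla_i$. $dv_h$ denotes the volume density of a metric $h$. $O(\cdot)$ statements refer to the limit $x\to 0$, locally uniformly on $M$; for tensors on $M\times(0,a)$ they refer to components in coordinates smooth on $M\times[0,a)$. Poincaré metric. For $n=\dim M$ even, a Poincaré metric for $(M,g)$ is a metric $g_+$ on $M\times(0,a)$, for some $a>0$, of the form $g_+=x^{-2}(dx^2+g_x)$, where $x$ is the coordinate on $(0,a)$ and $g_x$ is a 1-parameter family of metrics on $M$, smooth up to $x=0$, with $g_0=g$, such that $\mathrm{Ric}(g_+)+n g_+=O(x^{n-2})$ and $\mathrm{tr}_{g_+}(\mathrm{Ric}(g_+)+n g_+)=O(x^{n+2})$. It is known that such a $g_+$ always exists; $g_x$ is unique up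 to addition of a term $x^n h_x$, with $h_x$ a smooth 1-parameter family of symmetric 2-tensors on $M$ satisfying $\mathrm{tr}_g(h_0)=0$; and the Taylor expansion of $g_x$ at $x=0$ is even through order $n$. All quantities below are independent of the choice of Poincaré metric. Volume coefficients. The functions $v^{(2k)}\in C^\infty(M)$, $0\le k\le n/2$, are defined by $v^{(0)}=1$ and $$\left(\frac{\det g_x}{\det g}\right)^{1/2}=1+v^{(2)}x^2+v^{(4)}x^4+\cdots+v^{(n)}x^n+\cdots\quad (x\to0),$$ so that $dv_{g_+}=x^{-n-1}dv_{g_x}dx$ and $dv_{g_x}=(1+v^{(2)}x^2+\cdots+v^{(n)}x^n+\cdots)\,dv_g$. Operators $p_{2k}$. For each $f\in C^\infty(M)$ there is a smooth function $u$ on $M\times[0,a)$, unique modulo $O(x^n)$, with $u|_{x=0}=f$ and $\Delta_{g_+}u=O(x^n)$. Its Taylor expansion is even through order $n-2$, and the operators $p_{2k}$ are defined by $$u=f+(p_2f)\,x^2+\cdots+(p_{n-2}f)\,x^{n-2}+O(x^n).$$ Each $p_{2k}$ is a linear differential operator on $M$ of order $2k$, natural in $g$. The formal adjoint $p_{2k}^*$ is taken with respect to $dv_g$: $\int_M (p_{2k}f)\,h\,dv_g=\int_M f\,(p_{2k}^*h)\,dv_g$ for $f,h\in C^\infty(M)$ with $f$ compactly supported. $Q$-curvature. $Q$ is Branson's $Q$-curvature of $g$ in the critical even dimension $n$ (normalized so that $Q=\tfrac12R$ when $n=2$, $R$ being the scalar curvature). It is known to be characterized as follows (Fefferman–Graham),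 and this may be taken as its definition: for a Poincaré metric $g_+$ for $g$ there is a solution $U$, unique modulo $O(x^n)$, of $$\Delta_{g_+}U=n+O(x^{n+1}\log x)$$ of the form $U=\log x+A+B\,x^n\log x+O(x^n)$ with $A,B\in C^\infty(M\times[0,a))$ and $A|_{x=0}=0$; the function $B|_{x=0}$ is uniquely determined by $g$, and $$B|_{x=0}=-2c_{n/2}\,Q.$$ *)

theory Defs
  imports "HOL-Analysis.Analysis"
begin

section \<open>Smooth functions on subsets of coordinate space\<close>

definition partial_deriv :: "'k::finite \<Rightarrow> (real^'k \<Rightarrow> real) \<Rightarrow> real^'k \<Rightarrow> real"
  where "partial_deriv i F z = frechet_derivative F (at z) (axis i 1)"

text \<open>Meant for open sets only.\<close>
fun Ck_on :: "nat \<Rightarrow> (real^'k::finite) set \<Rightarrow> (real^'k \<Rightarrow> real) \<Rightarrow> bool" where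
  "Ck_on 0 W F \<longleftrightarrow> continuous_on W F"
| "Ck_on (Suc r) W F \<longleftrightarrow>
     (\<forall>z\<in>W. F differentiable (at z)) \<and> (\<forall>i. Ck_on r W (partial_deriv i F))"

text \<open>Smoothness on an arbitrary set means local smooth extendability; on an open set this is
  ordinary smoothness, and on a relatively open subset of a half space it is smoothness up to the
  boundary.\<close>
definition smooth_on :: "(real^'k::finite) set \<Rightarrow> (real^'k \<Rightarrow> real) \<Rightarrow> bool"
  where "smooth_on S f \<longleftrightarrow>
    (\<forall>z\<in>S. \<exists>W F. open W \<and> z \<in> W \<and> (\<forall>r. Ck_on r W F) \<and> (\<forall>y\<in>S \<inter> W. F y = f y))"


section \<open>Manifolds, functions and tensors\<close>

text \<open>A chart consists of its domain and its coordinate map, whose values off the domain are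
  irrelevant.  The manifold is the union of the domains of the charts of an atlas, an open subset
  of the ambient topological type.\<close>
type_synonym ('m, 'k) chart = "'m set \<times> ('m \<Rightarrow> real^'k)"

definition chart_inv :: "('m, 'k) chart \<Rightarrow> real^'k \<Rightarrow> 'm"
  where "chart_inv c = inv_into (fst c) (snd c)"

definition chart_image :: "('m, 'k) chart \<Rightarrow> (real^'k) set"
  where "chart_image c = snd c ` fst c"

definition carrier :: "('m, 'k) chart set \<Rightarrow> 'm set"
  where "carrier A = (\<Union>c\<in>A. fst c)"

definition is_chart :: "('m::topological_space, 'k::finite) chart \<Rightarrow> bool"
  where "is_chart c \<longleftrightarrow> open (fst c) \<and> open (chart_image c) \<and>
    homeomorphism (fst c) (chart_image c) (snd c) (chart_inv c)"

definition smooth_atlas :: "('m::topological_space, 'k::finite) chart set \<Rightarrow> bool"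
  where "smooth_atlas A \<longleftrightarrow> (\<forall>c\<in>A. is_chart c) \<and>
    (\<forall>c\<in>A. \<forall>d\<in>A. \<forall>i. smooth_on (snd c ` (fst c \<inter> fst d)) (\<lambda>z. snd d (chart_inv c z) $ i))"

definition smooth_fun :: "('m, 'k::finite) chart set \<Rightarrow> ('m \<Rightarrow> real) \<Rightarrow> bool"
  where "smooth_fun A f \<longleftrightarrow> (\<forall>c\<in>A. smooth_on (chart_image c) (\<lambda>z. f (chart_inv c z)))"

definition compact_support ::
    "('m::topological_space, 'k) chart set \<Rightarrow> ('m \<Rightarrow> real) \<Rightarrow> bool"
  where "compact_support A f \<longleftrightarrow>
    (\<exists>K. compact K \<and> K \<subseteq> carrier A \<and> (\<forall>p\<in>carrier A - K. f p = 0))"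

text \<open>A covariant 2-tensor, given by its component matrix at each point in each chart.\<close>
type_synonym ('m, 'k) tensor2 = "('m, 'k) chart \<Rightarrow> 'm \<Rightarrow> real^'k^'k"

definition transition_jacobian ::
    "('m, 'k::finite) chart \<Rightarrow> ('m, 'k) chart \<Rightarrow> 'm \<Rightarrow> real^'k^'k"
  where "transition_jacobian c d p =
    (\<chi> i j. partial_deriv j (\<lambda>z. snd d (chart_inv c z) $ i) (snd c p))"

definition is_tensor2 :: "('m, 'k::finite) chart set \<Rightarrow> ('m, 'k) tensor2 \<Rightarrow> bool"
  where "is_tensor2 A T \<longleftrightarrow>
    (\<forall>c\<in>A. \<forall>d\<in>A. \<forall>p\<in>fst c \<inter> fst d.
       T c p = transpose (transition_jacobian c d p) ** T d p ** transition_jacobian c d p)"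

definition has_signature :: "nat \<Rightarrow> nat \<Rightarrow> real^'k^'k::finite \<Rightarrow> bool"
  where "has_signature p q G \<longleftrightarrow> transpose G = G \<and>
    (\<exists>(B :: real^'k^'k) \<epsilon>. invertible B \<and>
       transpose B ** G ** B = (\<chi> i j. if i = j then \<epsilon> i else 0) \<and> range \<epsilon> \<subseteq> {1, -1} \<and>
       card {i. \<epsilon> i = 1} = p \<and> card {i. \<epsilon> i = -1} = q)"

definition pseudo_metric ::
    "('m, 'k::finite) chart set \<Rightarrow> nat \<Rightarrow> nat \<Rightarrow> ('m, 'k) tensor2 \<Rightarrow> bool"
  where "pseudo_metric A p q g \<longleftrightarrow> is_tensor2 A g \<and>
    (\<forall>c\<in>A. \<forall>y\<in>fst c. has_signature p q (g c y)) \<and>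
    (\<forall>c\<in>A. \<forall>i j. smooth_on (chart_image c) (\<lambda>z. g c (chart_inv c z) $ i $ j))"


section \<open>Ricci tensor, Laplacian and volume density\<close>

definition christoffel ::
    "(real^'k \<Rightarrow> real^'k^'k) \<Rightarrow> 'k::finite \<Rightarrow> 'k \<Rightarrow> 'k \<Rightarrow> real^'k \<Rightarrow> real"
  where "christoffel G k i j z = (\<Sum>l\<in>UNIV. matrix_inv (G z) $ k $ l *
      (partial_deriv i (\<lambda>w. G w $ j $ l) z + partial_deriv j (\<lambda>w. G w $ i $ l) z
       - partial_deriv l (\<lambda>w. G w $ i $ j) z)) / 2"

text \<open>The sign is such that round spheres have positive Ricci curvature.\<close>
definition ricci :: "('m, 'k::finite) tensor2 \<Rightarrow> ('m, 'k) tensor2"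
  where "ricci g c p =
    (let G = (\<lambda>z. g c (chart_inv c z)); \<Gamma> = christoffel G; z = snd c p in
     \<chi> i j. (\<Sum>k\<in>UNIV. partial_deriv k (\<Gamma> k i j) z - partial_deriv j (\<Gamma> k i k) z)
       + (\<Sum>k\<in>UNIV. \<Sum>l\<in>UNIV. \<Gamma> k k l z * \<Gamma> l i j z - \<Gamma> k j l z * \<Gamma> l i k z))"

text \<open>The Laplacian of a function at a point, computed in a given chart around that point.  Note
  the sign.\<close>
definition laplacian ::
    "('m, 'k::finite) tensor2 \<Rightarrow> ('m, 'k) chart \<Rightarrow> ('m \<Rightarrow> real) \<Rightarrow> 'm \<Rightarrow> real"
  where "laplacian g c u p =
    (let G = (\<lambda>z. g c (chart_inv c z)); F = (\<lambda>z. u (chart_inv c z)); z = snd c p in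
     - (\<Sum>i\<in>UNIV. \<Sum>j\<in>UNIV. matrix_inv (G z) $ i $ j *
         (partial_deriv i (partial_deriv j F) z
          - (\<Sum>k\<in>UNIV. christoffel G k i j z * partial_deriv k F z))))"

definition volume_measure ::
    "('m::topological_space, 'k::finite) chart set \<Rightarrow> ('m, 'k) tensor2 \<Rightarrow> 'm measure \<Rightarrow> bool"
  where "volume_measure A g \<mu> \<longleftrightarrow>
    space \<mu> = carrier A \<and> sets \<mu> = sets (restrict_space borel (carrier A)) \<and>
    (\<forall>c\<in>A. \<forall>E\<in>sets borel. E \<subseteq> fst c \<longrightarrow>
       emeasure \<mu> E =
         (\<integral>\<^sup>+z. ennreal (sqrt \<bar>det (g c (chart_inv c z))\<bar>) * indicator (snd c ` E) z \<partial>lborel))"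

definition formal_adjoint ::
    "('m::topological_space, 'k::finite) chart set \<Rightarrow> 'm measure \<Rightarrow>
     (('m \<Rightarrow> real) \<Rightarrow> 'm \<Rightarrow> real) \<Rightarrow> (('m \<Rightarrow> real) \<Rightarrow> 'm \<Rightarrow> real) \<Rightarrow> bool"
  where "formal_adjoint A \<mu> P P' \<longleftrightarrow>
    (\<forall>h. smooth_fun A h \<longrightarrow> smooth_fun A (P' h) \<and>
       (\<forall>f. smooth_fun A f \<and> compact_support A f \<longrightarrow>
          (\<integral>y. P f y * h y \<partial>\<mu>) = (\<integral>y. f y * P' h y \<partial>\<mu>)))"


section \<open>The product of a manifold with an interval\<close>

text \<open>The charts of \<open>M \<times> I\<close> obtained from those of \<open>M\<close>.  The coordinates are indexed by
  \<open>'n option\<close>, with \<open>None\<close> for the coordinate \<open>x\<close> on \<open>I\<close>.  For \<open>I = {0..<a}\<close> this describes a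
  manifold with boundary; it is then used only to express smoothness up to \<open>x = 0\<close>.\<close>
definition cyl_chart :: "real set \<Rightarrow> ('m, 'n::finite) chart \<Rightarrow> ('m \<times> real, 'n option) chart"
  where "cyl_chart I c =
    (fst c \<times> I, \<lambda>(y, x). \<chi> i. case i of None \<Rightarrow> x | Some j \<Rightarrow> snd c y $ j)"

definition cylinder :: "real set \<Rightarrow> ('m, 'n::finite) chart set \<Rightarrow> ('m \<times> real, 'n option) chart set"
  where "cylinder I A = cyl_chart I ` A"

text \<open>\<open>h = O(w(x))\<close> as \<open>x \<rightarrow> 0+\<close>, locally uniformly on \<open>S\<close>.\<close>
definition locally_bigo ::
    "'m::topological_space set \<Rightarrow> ('m \<times> real \<Rightarrow> real) \<Rightarrow> (real \<Rightarrow> real) \<Rightarrow> bool"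
  where "locally_bigo S h w \<longleftrightarrow>
    (\<forall>p\<in>S. \<exists>W C. open W \<and> p \<in> W \<and>
       (\<forall>\<^sub>F x in at_right 0. \<forall>y\<in>W \<inter> S. \<bar>h (y, x)\<bar> \<le> C * \<bar>w x\<bar>))"

text \<open>The component matrix of \<open>x\<^sup>-\<^sup>2(dx\<^sup>2 + G)\<close>.\<close>
definition normal_form_matrix :: "real \<Rightarrow> real^'n^'n::finite \<Rightarrow> real^'n option^'n option"
  where "normal_form_matrix x G =
    (\<chi> i j. case (i, j) of
        (None, None) \<Rightarrow> 1 / x\<^sup>2
      | (Some k, Some l) \<Rightarrow> G $ k $ l / x\<^sup>2
      | _ \<Rightarrow> 0)"


section \<open>Poincare metrics and the quantities derived from them\<close>

text \<open>\<open>gp\<close> is the metric \<open>x\<^sup>-\<^sup>2(dx\<^sup>2 + gx x)\<close> on \<open>M \<times> (0,a)\<close>.\<close>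
definition poincare_metric ::
    "('m::topological_space, 'n::finite) chart set \<Rightarrow> nat \<Rightarrow> nat \<Rightarrow> ('m, 'n) tensor2 \<Rightarrow>
     real \<Rightarrow> (real \<Rightarrow> ('m, 'n) tensor2) \<Rightarrow> ('m \<times> real, 'n option) tensor2 \<Rightarrow> bool"
  where "poincare_metric A p q g a gx gp \<longleftrightarrow>
    a > 0 \<and>
    (\<forall>x\<in>{0..<a}. pseudo_metric A p q (gx x)) \<and>
    (\<forall>c\<in>A. \<forall>i j. smooth_on (chart_image (cyl_chart {0..<a} c))
       (\<lambda>z. case chart_inv (cyl_chart {0..<a} c) z of (y, x) \<Rightarrow> gx x c y $ i $ j)) \<and>
    (\<forall>c\<in>A. \<forall>y\<in>fst c. gx 0 c y = g c y) \<and>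
    pseudo_metric (cylinder {0<..<a} A) (p + 1) q gp \<and>
    (\<forall>c\<in>A. \<forall>y\<in>fst c. \<forall>x\<in>{0<..<a}.
       gp (cyl_chart {0<..<a} c) (y, x) = normal_form_matrix x (gx x c y)) \<and>
    (\<forall>c\<in>A. let d = cyl_chart {0<..<a} c;
               E = (\<lambda>r. ricci gp d r + real CARD('n) *\<^sub>R gp d r) in
       (\<forall>i j. locally_bigo (fst c) (\<lambda>r. E r $ i $ j) (\<lambda>x. x ^ (CARD('n) - 2))) \<and>
       locally_bigo (fst c) (\<lambda>r. trace (matrix_inv (gp d r) ** E r)) (\<lambda>x. x ^ (CARD('n) + 2)))"

text \<open>\<open>v (2 * k)\<close> is the coefficient of \<open>x\<^sup>2\<^sup>k\<close>; odd indices are not used.\<close>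
definition volume_coefficients ::
    "('m::topological_space, 'n::finite) chart set \<Rightarrow> ('m, 'n) tensor2 \<Rightarrow>
     (real \<Rightarrow> ('m, 'n) tensor2) \<Rightarrow> (nat \<Rightarrow> 'm \<Rightarrow> real) \<Rightarrow> bool"
  where "volume_coefficients A g gx v \<longleftrightarrow>
    (\<forall>k\<in>{0..CARD('n) div 2}. smooth_fun A (v (2 * k))) \<and>
    (\<forall>y\<in>carrier A. v 0 y = 1) \<and>
    (\<forall>c\<in>A. locally_bigo (fst c)
       (\<lambda>(y, x). sqrt (det (gx x c y) / det (g c y))
          - (\<Sum>k = 0..CARD('n) div 2. v (2 * k) y * x ^ (2 * k)))
       (\<lambda>x. x ^ (CARD('n) + 1)))"

text \<open>\<open>P (2 * k)\<close> is the operator whose value at \<open>f\<close> is the coefficient of \<open>x\<^sup>2\<^sup>k\<close> in the solution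
  with boundary value \<open>f\<close>.\<close>
definition harmonic_operators ::
    "('m::topological_space, 'n::finite) chart set \<Rightarrow> real \<Rightarrow> ('m \<times> real, 'n option) tensor2 \<Rightarrow>
     (nat \<Rightarrow> ('m \<Rightarrow> real) \<Rightarrow> 'm \<Rightarrow> real) \<Rightarrow> bool"
  where "harmonic_operators A a gp P \<longleftrightarrow>
    (\<forall>f. smooth_fun A f \<longrightarrow>
      (\<exists>u. smooth_fun (cylinder {0..<a} A) u \<and>
        (\<forall>y\<in>carrier A. u (y, 0) = f y) \<and>
        (\<forall>c\<in>A. locally_bigo (fst c) (laplacian gp (cyl_chart {0<..<a} c) u) (\<lambda>x. x ^ CARD('n))) \<and>
        locally_bigo (carrier A)
          (\<lambda>(y, x). u (y, x) - (f y + (\<Sum>k = 1..CARD('n) div 2 - 1. P (2 * k) f y * x ^ (2 * k))))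
          (\<lambda>x. x ^ CARD('n))))"

definition c_const :: "nat \<Rightarrow> real"
  where "c_const m = (-1) ^ m / (2 ^ (2 * m) * fact m * fact (m - 1))"

definition Q_curvature ::
    "('m::topological_space, 'n::finite) chart set \<Rightarrow> real \<Rightarrow> ('m \<times> real, 'n option) tensor2 \<Rightarrow>
     ('m \<Rightarrow> real) \<Rightarrow> bool"
  where "Q_curvature A a gp Q \<longleftrightarrow>
    (\<exists>U B H. smooth_fun (cylinder {0<..<a} A) U \<and>
      smooth_fun (cylinder {0..<a} A) B \<and> smooth_fun (cylinder {0..<a} A) H \<and>
      (\<forall>y\<in>carrier A. H (y, 0) = 0) \<and>
      locally_bigo (carrier A)
        (\<lambda>(y, x). U (y, x) - (ln x + H (y, x) + B (y, x) * x ^ CARD('n) * ln x))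
        (\<lambda>x. x ^ CARD('n)) \<and>
      (\<forall>c\<in>A. locally_bigo (fst c)
        (\<lambda>r. laplacian gp (cyl_chart {0<..<a} c) U r - real CARD('n))
        (\<lambda>x. x ^ (CARD('n) + 1) * ln x)) \<and>
      (\<forall>y\<in>carrier A. B (y, 0) = - 2 * c_const (CARD('n) div 2) * Q y))"

end

theory Submission
  imports Defs "HOL-Computational_Algebra.Formal_Power_Series"
begin

text \<open>Everything happens in one chart of \<open>M\<close>.  Let \<open>J = \<bar>det g\<^sub>x\<bar>\<^sup>1\<^sup>/\<^sup>2\<close> be the density of \<open>g\<^sub>x\<close> and write
  \<open>F\<^sub>k\<close> for the coefficient of \<open>x\<^sup>k\<close> in the Taylor expansion of \<open>F\<close> at \<open>x = 0\<close>; thus \<open>J\<^sub>k = J\<^sub>0 v\<^sup>(\<^sup>k\<^sup>)\<close> for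
  even \<open>k \<le> n\<close>, and \<open>J\<^sub>k = 0\<close> for odd \<open>k < n\<close>.  In divergence form the Laplacian of the Poincare
  metric satisfies
  \<open>- J \<Delta> u = L u = x\<^sup>2 \<partial>\<^sub>x (J \<partial>\<^sub>x u) + (1 - n) x J \<partial>\<^sub>x u + x\<^sup>2 \<partial>\<^sub>i (J g\<^sub>x\<^sup>i\<^sup>j \<partial>\<^sub>j u)\<close>
  (lemma \<open>laplacian_normal_form\<close>).  Lagrange's identity writes \<open>u L h - h L u\<close> as
  \<open>x\<^sup>2 \<partial>\<^sub>x Z + (1 - n) x Z + x\<^sup>2 \<partial>\<^sub>i V\<^sup>i\<close>, where \<open>Z\<close> and \<open>V\<close> are the normal and the tangential flux.
  The coefficient of \<open>x\<^sup>n\<close> is special: there \<open>Z\<close> enters with the factor \<open>(n - 1) + (1 - n) = 0\<close>, and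
  only the divergence of the coefficient \<open>V\<^sub>n\<^sub>-\<^sub>2\<close> remains.

  The function \<open>U = log x + h + B x\<^sup>n log x + R\<close> that defines \<open>Q\<close> satisfies \<open>L U = - n J\<close> up to
  \<open>O(x\<^sup>n\<^sup>+\<^sup>1 log x)\<close>.  Since \<open>L (log x) = x \<partial>\<^sub>x J - n J\<close> and \<open>L (B x\<^sup>n log x) = n J B x\<^sup>n\<close> up to the same
  error, the residual \<open>S = x \<partial>\<^sub>x J + L h + n J B x\<^sup>n\<close> equals \<open>- L R\<close> up to that error.  If \<open>R\<close> were \<open>x\<^sup>n\<close>
  times a smooth function, \<open>L R\<close> would be \<open>O(x\<^sup>n\<^sup>+\<^sup>1)\<close>, because \<open>n\<close> is an indicial root, and hence
  \<open>S\<^sub>k = 0\<close> for \<open>k \<le> n\<close>.  The definition only gives the bound \<open>R = O(x\<^sup>n)\<close>, without any control of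
  derivatives, so this conclusion is reached weakly: a first nonzero \<open>S\<^sub>k\<close> with \<open>k \<le> n\<close> would give \<open>L R\<close> a sign and a
  lower bound of order \<open>x\<^sup>n\<close>, and testing against cutoffs that live on long logarithmic scales
  excludes this (\<open>no_residual_of_one_sign\<close>, \<open>log_residual\<close>, \<open>residual_vanishes\<close>).

  Now let \<open>u\<close> have boundary value \<open>f\<close> and be harmonic up to \<open>O(x\<^sup>n)\<close>, so that \<open>u\<^sub>k = p\<^sub>k f\<close> for even \<open>k < n\<close>, the odd
  coefficients below order \<open>n\<close> vanish, and \<open>L u = O(x\<^sup>n)\<close>.  As \<open>h = O(x)\<close>, the product \<open>h L u\<close> does not
  reach the coefficient of \<open>x\<^sup>n\<close>, and \<open>(u S)\<^sub>n = 0\<close> becomes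
  \<open>\<Sum>\<^sub>k (n - k) u\<^sub>k J\<^sub>n\<^sub>-\<^sub>k + n f J\<^sub>0 B\<^sub>0 = - \<partial>\<^sub>i V\<^sup>i\<^sub>n\<^sub>-\<^sub>2\<close>
  (\<open>critical_identity\<close>, \<open>coefficient_identity\<close>).  The coefficients \<open>u\<^sub>k\<close> with \<open>k < n\<close> are local in \<open>f\<close>
  (\<open>coefficients_local\<close>).  So for a bump function \<open>f\<close> in the chart the flux has compact
  support, the divergence integrates to zero, and the formal adjoints move the operators from \<open>f\<close> to
  the volume coefficients (\<open>tested_formula\<close>):
  \<open>\<integral> f (n v\<^sup>(\<^sup>n\<^sup>) + \<Sum>\<^sub>k (n - 2k) p\<^sub>2\<^sub>k\<^sup>* v\<^sup>(\<^sup>n\<^sup>-\<^sup>2\<^sup>k\<^sup>) + n B\<^sub>0) dv\<^sub>g = 0\<close>.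
  Bump functions separate continuous functions (\<open>eq_0_if_tested\<close>), and \<open>B\<^sub>0 = - 2 c\<^sub>n\<^sub>/\<^sub>2 Q\<close>.\<close>

section \<open>Calculus of smooth functions\<close>

lemma partial_deriv_eq:
  assumes "(F has_derivative F') (at z)"
  shows "partial_deriv i F z = F' (axis i 1)"
  using frechet_derivative_at[OF assms] by (simp add: partial_deriv_def)

lemma has_derivative_frechet:
  assumes "F differentiable (at z)"
  shows "(F has_derivative frechet_derivative F (at z)) (at z)"
  using assms frechet_derivative_works by blast

lemma partial_deriv_cong:
  assumes "open W" "z \<in> W" "\<And>w. w \<in> W \<Longrightarrow> F w = G w"
  shows "partial_deriv i F z = partial_deriv i G z"
proof -
  have "(F has_derivative D) (at z) \<longleftrightarrow> (G has_derivative D) (at z)" for D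
  proof
    assume "(F has_derivative D) (at z)"
    from has_derivative_transform_within_open[OF this assms(1,2)] assms(3)
    show "(G has_derivative D) (at z)" by blast
  next
    assume "(G has_derivative D) (at z)"
    from has_derivative_transform_within_open[OF this assms(1,2)] assms(3)[symmetric]
    show "(F has_derivative D) (at z)" by blast
  qed
  then show ?thesis by (simp add: partial_deriv_def frechet_derivative_def)
qed

lemma differentiable_cong:
  assumes "open W" "z \<in> W" "\<And>w. w \<in> W \<Longrightarrow> F w = G w" "F differentiable (at z)"
  shows "G differentiable (at z)"
proof -
  obtain D where "(F has_derivative D) (at z)" using assms(4) by (auto simp: differentiable_def)
  from has_derivative_transform_within_open[OF this assms(1,2)] assms(3)
  have "(G has_derivative D) (at z)" by blast
  then show ?thesis by (auto simp: differentiable_def)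
qed

lemma partial_deriv_const [simp]: "partial_deriv i (\<lambda>w. c) z = 0"
  by (simp add: partial_deriv_def)

lemma partial_deriv_add:
  assumes "F differentiable (at z)" "G differentiable (at z)"
  shows "partial_deriv i (\<lambda>w. F w + G w) z = partial_deriv i F z + partial_deriv i G z"
  using partial_deriv_eq[OF has_derivative_add[OF assms[THEN has_derivative_frechet]]]
  by (simp add: partial_deriv_def)

lemma partial_deriv_diff:
  assumes "F differentiable (at z)" "G differentiable (at z)"
  shows "partial_deriv i (\<lambda>w. F w - G w) z = partial_deriv i F z - partial_deriv i G z"
  using partial_deriv_eq[OF has_derivative_diff[OF assms[THEN has_derivative_frechet]]]
  by (simp add: partial_deriv_def)

lemma partial_deriv_mult:
  assumes "F differentiable (at z)" "G differentiable (at z)"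
  shows "partial_deriv i (\<lambda>w. F w * G w) z = partial_deriv i F z * G z + F z * partial_deriv i G z"
  using partial_deriv_eq[OF has_derivative_mult[OF assms[THEN has_derivative_frechet]]]
  by (simp add: partial_deriv_def)

lemma partial_deriv_cmult:
  assumes "F differentiable (at z)"
  shows "partial_deriv i (\<lambda>w. c * F w) z = c * partial_deriv i F z"
  using partial_deriv_mult[OF differentiable_const assms, of i c] by simp

lemma partial_deriv_sum:
  assumes "\<And>s. s \<in> I \<Longrightarrow> F s differentiable (at z)"
  shows "partial_deriv i (\<lambda>w. \<Sum>s\<in>I. F s w) z = (\<Sum>s\<in>I. partial_deriv i (F s) z)"
proof -
  have "((\<lambda>w. \<Sum>s\<in>I. F s w) has_derivative (\<lambda>h. \<Sum>s\<in>I. frechet_derivative (F s) (at z) h)) (at z)"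
    by (intro has_derivative_sum has_derivative_frechet assms)
  from partial_deriv_eq[OF this] show ?thesis by (simp add: partial_deriv_def)
qed

lemma partial_deriv_compose:
  assumes "(\<phi> has_real_derivative d) (at (F z))" "F differentiable (at z)"
  shows "partial_deriv i (\<lambda>w. \<phi> (F w)) z = d * partial_deriv i F z"
    and "(\<lambda>w. \<phi> (F w)) differentiable (at z)"
proof -
  have 1: "((\<lambda>w. \<phi> (F w)) has_derivative (\<lambda>h. d * frechet_derivative F (at z) h)) (at z)"
    using has_derivative_compose[OF has_derivative_frechet[OF assms(2)]
        assms(1)[unfolded has_field_derivative_def]] .
  show "partial_deriv i (\<lambda>w. \<phi> (F w)) z = d * partial_deriv i F z"
    using partial_deriv_eq[OF 1] by (simp add: partial_deriv_def)
  show "(\<lambda>w. \<phi> (F w)) differentiable (at z)" using 1 by (auto simp: differentiable_def)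
qed

lemma coordinate_has_derivative: "((\<lambda>w. (w::real^'k::finite) $ j) has_derivative (\<lambda>w. w $ j)) (at z)"
  by (rule bounded_linear.has_derivative[OF bounded_linear_vec_nth has_derivative_ident])

lemma coordinate_differentiable [simp]: "(\<lambda>w. (w::real^'k::finite) $ j) differentiable (at z)"
  using coordinate_has_derivative unfolding differentiable_def by blast

lemma partial_deriv_coordinate [simp]:
  "partial_deriv i (\<lambda>w. w $ j) z = (if i = j then 1 else 0)"
  using partial_deriv_eq[OF coordinate_has_derivative, of i j z] by (auto simp: axis_def)

lemma has_real_derivative_along_axis:
  assumes "F differentiable (at (z + t *\<^sub>R axis i 1))"
  shows "((\<lambda>s. F (z + s *\<^sub>R axis i 1)) has_real_derivative partial_deriv i F (z + t *\<^sub>R axis i 1)) (at t)"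
proof -
  let ?D = "frechet_derivative F (at (z + t *\<^sub>R axis i 1))"
  have 1: "((\<lambda>s::real. z + s *\<^sub>R axis i 1) has_derivative (\<lambda>s. s *\<^sub>R axis i 1)) (at t)"
    by (auto intro!: derivative_eq_intros)
  have "((\<lambda>s. F (z + s *\<^sub>R axis i 1)) has_derivative (\<lambda>s. ?D (s *\<^sub>R axis i 1))) (at t)"
    by (rule has_derivative_compose[OF 1 has_derivative_frechet[OF assms]])
  moreover have "?D (s *\<^sub>R axis i 1) = partial_deriv i F (z + t *\<^sub>R axis i 1) * s" for s
    using linear_frechet_derivative[OF assms] by (simp add: partial_deriv_def linear_cmul)
  ultimately show ?thesis by (simp add: has_field_derivative_def)
qed

lemma Ck_on_SucD: "Ck_on (Suc r) W F \<Longrightarrow> Ck_on r W F"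
proof (induction r arbitrary: F)
  case 0
  then show ?case
    by (auto intro!: continuous_at_imp_continuous_on differentiable_imp_continuous_within)
qed auto

lemma Ck_on_subset: "Ck_on r W F \<Longrightarrow> V \<subseteq> W \<Longrightarrow> Ck_on r V F"
  by (induction r arbitrary: F) (auto intro: continuous_on_subset)

lemma Ck_on_SucI:
  assumes "\<And>z. z \<in> W \<Longrightarrow> F differentiable (at z)"
    and "\<And>i. Ck_on r W (partial_deriv i F)"
  shows "Ck_on (Suc r) W F"
  using assms by auto

lemma Ck_on_cong:
  assumes "open W" "\<And>w. w \<in> W \<Longrightarrow> F w = G w" "Ck_on r W F"
  shows "Ck_on r W G"
  using assms(2,3)
proof (induction r arbitrary: F G)
  case 0
  then show ?case using continuous_on_cong[of W W F G] by simp
next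
  case (Suc r)
  show ?case
  proof (rule Ck_on_SucI)
    show "G differentiable (at z)" if "z \<in> W" for z
      using differentiable_cong[OF assms(1) that] Suc.prems that by auto
    show "Ck_on r W (partial_deriv i G)" for i
    proof (rule Suc.IH)
      show "partial_deriv i F w = partial_deriv i G w" if "w \<in> W" for w
        by (rule partial_deriv_cong[OF assms(1) that]) (rule Suc.prems(1))
      show "Ck_on r W (partial_deriv i F)" using Suc.prems(2) by simp
    qed
  qed
qed

lemma Ck_on_const [simp]: "Ck_on r (W :: (real^'k::finite) set) (\<lambda>w. c)"
proof (induction r arbitrary: c)
  case (Suc r)
  have "partial_deriv i (\<lambda>w. c) = (\<lambda>w. 0)" for i :: 'k by auto
  then show ?case using Suc by simp
qed simp

lemma Ck_on_coordinate [simp]: "Ck_on r W (\<lambda>w. w $ j)"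
proof (cases r)
  case (Suc q)
  have "partial_deriv i (\<lambda>w. w $ j) = (\<lambda>w. if i = j then 1 else 0)" for i by auto
  then show ?thesis using Suc by simp
qed (auto intro!: continuous_intros)

lemma Ck_on_add:
  assumes "open W" "Ck_on r W F" "Ck_on r W G"
  shows "Ck_on r W (\<lambda>w. F w + G w)"
  using assms(2,3)
proof (induction r arbitrary: F G)
  case 0 then show ?case by (auto intro: continuous_intros)
next
  case (Suc r)
  show ?case
  proof (rule Ck_on_SucI)
    fix i show "Ck_on r W (partial_deriv i (\<lambda>w. F w + G w))"
      by (rule Ck_on_cong[OF assms(1) _ Suc.IH[of "partial_deriv i F" "partial_deriv i G"]])
        (use Suc.prems in \<open>auto simp: partial_deriv_add\<close>)
  qed (use Suc.prems in \<open>auto intro: differentiable_add\<close>)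
qed

lemma Ck_on_mult:
  assumes "open W" "Ck_on r W F" "Ck_on r W G"
  shows "Ck_on r W (\<lambda>w. F w * G w)"
  using assms(2,3)
proof (induction r arbitrary: F G)
  case 0 then show ?case by (auto intro: continuous_intros)
next
  case (Suc r)
  show ?case
  proof (rule Ck_on_SucI)
    fix i
    have "Ck_on r W (\<lambda>w. partial_deriv i F w * G w + F w * partial_deriv i G w)"
      using Suc.prems Ck_on_SucD[OF Suc.prems(1)] Ck_on_SucD[OF Suc.prems(2)]
      by (intro Ck_on_add[OF assms(1)] Suc.IH) auto
    then show "Ck_on r W (partial_deriv i (\<lambda>w. F w * G w))"
      by (rule Ck_on_cong[OF assms(1), rotated]) (use Suc.prems in \<open>auto simp: partial_deriv_mult\<close>)
  qed (use Suc.prems in \<open>auto intro: differentiable_mult\<close>)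
qed

text \<open>Induction on the order of differentiability, for all members of a family \<open>\<phi>\<close> at once, because the
  derivative of one member may involve others.  The hypothesis \<open>cl\<close> says that the derivatives are
  built from the family by operations that preserve differentiability.  A family with one member
  serves inverses, logarithms and exponentials; the bump function needs an infinite one.\<close>
lemma Ck_on_compose_family:
  assumes W: "open W" and F: "\<And>r. Ck_on r W F"
    and der: "\<And>m z. z \<in> W \<Longrightarrow> (\<phi> m has_real_derivative \<phi>' m (F z)) (at (F z))"
    and cl: "\<And>m r. (\<And>l. Ck_on r W (\<lambda>w. \<phi> l (F w))) \<Longrightarrow> Ck_on r W (\<lambda>w. \<phi>' m (F w))"
  shows "Ck_on r W (\<lambda>w. \<phi> m (F w))"
proof (induction r arbitrary: m)
  case 0
  have diff: "F differentiable (at z)" if "z \<in> W" for z using F[of 1] that by simp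
  have "(\<lambda>w. \<phi> m (F w)) differentiable (at z)" if "z \<in> W" for z
    by (rule partial_deriv_compose(2)[where \<phi>="\<phi> m" and F=F, OF der[OF that] diff[OF that]])
  then show ?case
    by (auto intro!: continuous_at_imp_continuous_on differentiable_imp_continuous_within)
next
  case (Suc r)
  have diff: "F differentiable (at z)" if "z \<in> W" for z using F[of 1] that by simp
  show ?case
  proof (rule Ck_on_SucI)
    fix i
    have "Ck_on r W (partial_deriv i F)" using F[of "Suc r"] by simp
    then have "Ck_on r W (\<lambda>w. \<phi>' m (F w) * partial_deriv i F w)"
      by (intro Ck_on_mult[OF W] cl Suc.IH)
    then show "Ck_on r W (partial_deriv i (\<lambda>w. \<phi> m (F w)))"
      by (rule Ck_on_cong[OF W, rotated]) (use partial_deriv_compose(1)[where \<phi>="\<phi> m" and F=F, OF der diff] in simp)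
  qed (use partial_deriv_compose(2)[where \<phi>="\<phi> m" and F=F, OF der diff] in auto)
qed

definition Cinf_on :: "(real^'k::finite) set \<Rightarrow> (real^'k \<Rightarrow> real) \<Rightarrow> bool"
  where "Cinf_on W F \<longleftrightarrow> (\<forall>r. Ck_on r W F)"

lemma Cinf_onD: "Cinf_on W F \<Longrightarrow> Ck_on r W F"
  by (simp add: Cinf_on_def)

lemma Cinf_on_partial_deriv: "Cinf_on W F \<Longrightarrow> Cinf_on W (partial_deriv i F)"
  using Cinf_onD[where r="Suc r" for r] by (fastforce simp: Cinf_on_def)

lemma Cinf_on_differentiable: "Cinf_on W F \<Longrightarrow> z \<in> W \<Longrightarrow> F differentiable (at z)"
  using Cinf_onD[where r="Suc 0"] by fastforce

lemma Cinf_on_continuous: "Cinf_on W F \<Longrightarrow> continuous_on W F"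
  using Cinf_onD[where r=0] by fastforce

lemma Cinf_on_isCont: "Cinf_on W F \<Longrightarrow> z \<in> W \<Longrightarrow> isCont F z"
  using Cinf_on_differentiable differentiable_imp_continuous_within by blast

lemma Cinf_on_subset: "Cinf_on W F \<Longrightarrow> V \<subseteq> W \<Longrightarrow> Cinf_on V F"
  unfolding Cinf_on_def by (blast intro: Ck_on_subset)

lemma Cinf_on_cong:
  "open W \<Longrightarrow> (\<And>w. w \<in> W \<Longrightarrow> F w = G w) \<Longrightarrow> Cinf_on W F \<Longrightarrow> Cinf_on W G"
  unfolding Cinf_on_def by (blast intro: Ck_on_cong)

lemma Cinf_on_const [simp]: "Cinf_on W (\<lambda>w. c)"
  and Cinf_on_coordinate [simp]: "Cinf_on W (\<lambda>w. w $ j)"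
  and Cinf_on_add: "open W \<Longrightarrow> Cinf_on W F \<Longrightarrow> Cinf_on W G \<Longrightarrow> Cinf_on W (\<lambda>w. F w + G w)"
  and Cinf_on_mult: "open W \<Longrightarrow> Cinf_on W F \<Longrightarrow> Cinf_on W G \<Longrightarrow> Cinf_on W (\<lambda>w. F w * G w)"
  by (simp_all add: Cinf_on_def Ck_on_add Ck_on_mult)

lemma Cinf_on_minus:
  assumes "open W" "Cinf_on W F"
  shows "Cinf_on W (\<lambda>w. - F w)"
  using Cinf_on_mult[OF assms(1) Cinf_on_const assms(2), of "-1"] by simp

lemma Cinf_on_diff:
  assumes "open W" "Cinf_on W F" "Cinf_on W G"
  shows "Cinf_on W (\<lambda>w. F w - G w)"
  using Cinf_on_add[OF assms(1,2) Cinf_on_minus[OF assms(1,3)]] by simp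

lemma Cinf_on_sum:
  assumes "open W" "\<And>s. s \<in> I \<Longrightarrow> Cinf_on W (F s)"
  shows "Cinf_on W (\<lambda>w. \<Sum>s\<in>I. F s w)"
  using assms(2) by (induction I rule: infinite_finite_induct) (auto intro: Cinf_on_add[OF assms(1)])

lemma Cinf_on_prod:
  assumes "open W" "\<And>s. s \<in> I \<Longrightarrow> Cinf_on W (F s)"
  shows "Cinf_on W (\<lambda>w. \<Prod>s\<in>I. F s w)"
  using assms(2) by (induction I rule: infinite_finite_induct) (auto intro: Cinf_on_mult[OF assms(1)])

lemma Cinf_on_power:
  assumes "open W" "Cinf_on W F"
  shows "Cinf_on W (\<lambda>w. F w ^ m)"
  by (induction m) (auto intro: Cinf_on_mult[OF assms(1)] assms)

lemma Cinf_on_inverse: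
  assumes W: "open W" and F: "Cinf_on W F" and nz: "\<And>w. w \<in> W \<Longrightarrow> F w \<noteq> 0"
  shows "Cinf_on W (\<lambda>w. inverse (F w))"
proof -
  have "Ck_on r W (\<lambda>w. inverse (F w))" for r
  proof (rule Ck_on_compose_family[OF W, where \<phi> = "\<lambda>_::unit. inverse"
        and \<phi>' = "\<lambda>_ t. (-1) * (inverse t * inverse t)" and m="()"])
    show "Ck_on r W F" for r using F by (simp add: Cinf_on_def)
    show "(inverse has_real_derivative - 1 * (inverse (F z) * inverse (F z))) (at (F z))"
      if "z \<in> W" for z using nz[OF that] by (auto intro!: derivative_eq_intros)
    show "Ck_on r W (\<lambda>w. (-1) * (inverse (F w) * inverse (F w)))"
      if "\<And>l::unit. Ck_on r W (\<lambda>w. inverse (F w))" for r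
      using that by (intro Ck_on_mult[OF W] Ck_on_const) auto
  qed
  then show ?thesis by (simp add: Cinf_on_def)
qed

lemma Cinf_on_divide:
  assumes "open W" "Cinf_on W F" "Cinf_on W G" "\<And>w. w \<in> W \<Longrightarrow> G w \<noteq> 0"
  shows "Cinf_on W (\<lambda>w. F w / G w)"
  using Cinf_on_mult[OF assms(1,2) Cinf_on_inverse[OF assms(1,3,4)]] by (simp add: divide_inverse)

lemma Cinf_on_ln:
  assumes W: "open W" and F: "Cinf_on W F" and pos: "\<And>w. w \<in> W \<Longrightarrow> F w > 0"
  shows "Cinf_on W (\<lambda>w. ln (F w))"
proof -
  have inv: "Ck_on r W (\<lambda>w. inverse (F w))" for r
    using Cinf_onD[OF Cinf_on_inverse[OF W F]] pos by fastforce
  have "Ck_on r W (\<lambda>w. ln (F w))" for r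
  proof (rule Ck_on_compose_family[OF W, where \<phi> = "\<lambda>_::unit. ln" and \<phi>' = "\<lambda>_ t. inverse t" and m="()"])
    show "Ck_on r W F" for r using F by (simp add: Cinf_on_def)
    show "(ln has_real_derivative inverse (F z)) (at (F z))" if "z \<in> W" for z
      using pos[OF that] by (auto intro!: derivative_eq_intros simp: divide_inverse)
  qed (rule inv)
  then show ?thesis by (simp add: Cinf_on_def)
qed

lemma Cinf_on_exp:
  assumes W: "open W" and F: "Cinf_on W F"
  shows "Cinf_on W (\<lambda>w. exp (F w))"
proof -
  have "Ck_on r W (\<lambda>w. exp (F w))" for r
  proof (rule Ck_on_compose_family[OF W, where \<phi> = "\<lambda>_::unit. exp" and \<phi>' = "\<lambda>_. exp" and m="()"])
    show "Ck_on r W F" for r using F by (simp add: Cinf_on_def)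
  qed (auto intro!: derivative_eq_intros)
  then show ?thesis by (simp add: Cinf_on_def)
qed

lemma Cinf_on_sqrt:
  assumes W: "open W" and F: "Cinf_on W F" and pos: "\<And>w. w \<in> W \<Longrightarrow> F w > 0"
  shows "Cinf_on W (\<lambda>w. sqrt (F w))"
proof (rule Cinf_on_cong[OF W])
  show "Cinf_on W (\<lambda>w. exp (ln (F w) / 2))"
    by (intro Cinf_on_exp[OF W] Cinf_on_divide[OF W] Cinf_on_ln[OF W] F pos Cinf_on_const) auto
  show "exp (ln (F w) / 2) = sqrt (F w)" if "w \<in> W" for w
    using pos[OF that] by (simp add: ln_sqrt[symmetric])
qed

text \<open>The family \<open>t\<^sup>-\<^sup>m e\<^sup>-\<^sup>1\<^sup>/\<^sup>t\<close>, extended by zero to \<open>t \<le> 0\<close>; its member \<open>m = 0\<close> is the standard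
  smooth function supported on a half line, and the derivative of each member is a combination of others.\<close>
definition flat :: "nat \<Rightarrow> real \<Rightarrow> real"
  where "flat m t = (if t > 0 then inverse t ^ m * exp (- inverse t) else 0)"

lemma flat_nonpos [simp]: "t \<le> 0 \<Longrightarrow> flat m t = 0"
  and flat_pos: "t > 0 \<Longrightarrow> flat m t > 0"
  and flat_nonneg: "flat m t \<ge> 0"
  by (auto simp: flat_def)

text \<open>One term of the exponential series of \<open>1/t\<close> beats the powers of \<open>1/t\<close>; two orders of vanishing are
  kept because differentiability at the origin needs more than one.\<close>
lemma flat_le_square: "\<bar>flat m t\<bar> \<le> fact (m + 2) * t\<^sup>2"
proof (cases "t > 0")
  case True
  have "inverse t ^ (m + 2) / fact (m + 2) \<le> exp (inverse t)"
    using sum_le_suminf[OF sums_summable[OF exp_converges[of "inverse t"]], of "{m + 2}"]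
      sums_unique[OF exp_converges[of "inverse t"]] True
    by (simp add: divide_inverse mult.commute del: fact_Suc)
  then have "inverse t ^ (m + 2) \<le> fact (m + 2) * exp (inverse t)"
    by (simp only: pos_divide_le_eq fact_gt_zero mult.commute)
  then have "inverse t ^ (m + 2) * exp (- inverse t) \<le> fact (m + 2) * exp (inverse t) * exp (- inverse t)"
    by (rule mult_right_mono) simp
  then have "inverse t ^ (m + 2) * exp (- inverse t) \<le> fact (m + 2)"
    by (simp add: mult.assoc exp_add[symmetric] del: fact_Suc)
  then have "inverse t ^ m * exp (- inverse t) * (inverse t)\<^sup>2 \<le> fact (m + 2)"
    by (simp add: power_add mult_ac power2_eq_square)
  then have "inverse t ^ m * exp (- inverse t) \<le> fact (m + 2) * t\<^sup>2"
    using True by (simp add: divide_simps power2_eq_square mult_ac)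
  then show ?thesis using True by (simp add: flat_def)
qed simp

lemma flat_has_derivative:
  "(flat m has_real_derivative flat (m + 2) t - real m * flat (m + 1) t) (at t)"
proof -
  consider "t > 0" | "t < 0" | "t = 0" by linarith
  then show ?thesis
  proof cases
    case 1
    have "((\<lambda>t. inverse t ^ m * exp (- inverse t)) has_real_derivative
        real m * inverse t ^ (m - 1) * (- (inverse t * inverse t)) * exp (- inverse t)
        + inverse t ^ m * (exp (- inverse t) * (inverse t * inverse t))) (at t)"
      using 1 by (auto intro!: derivative_eq_intros)
    moreover have "real m * inverse t ^ (m - 1) * (- (inverse t * inverse t)) * exp (- inverse t)
        + inverse t ^ m * (exp (- inverse t) * (inverse t * inverse t))
        = flat (m + 2) t - real m * flat (m + 1) t"
      using 1 by (cases m) (auto simp: flat_def algebra_simps)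
    ultimately have "((\<lambda>t. inverse t ^ m * exp (- inverse t)) has_real_derivative
        flat (m + 2) t - real m * flat (m + 1) t) (at t)" by simp
    then show ?thesis
      by (rule has_field_derivative_transform_within_open[where S="{0<..}"]) (use 1 in \<open>auto simp: flat_def\<close>)
  next
    case 2
    have "((\<lambda>t. 0) has_real_derivative 0) (at t)" by simp
    then have "(flat m has_real_derivative 0) (at t)"
      by (rule has_field_derivative_transform_within_open[where S="{..<0}"]) (use 2 in auto)
    then show ?thesis using 2 by simp
  next
    case 3
    have "((\<lambda>h. flat m h / h) \<longlongrightarrow> 0) (at 0)"
    proof (rule Lim_null_comparison)
      have "norm (flat m h / h) \<le> fact (m + 2) * \<bar>h\<bar>" if "h \<noteq> 0" for h
      proof -
        have "\<bar>flat m h\<bar> \<le> (fact (m + 2) * \<bar>h\<bar>) * \<bar>h\<bar>"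
          using flat_le_square[of m h] by (simp add: power2_eq_square abs_mult_self_eq mult.assoc del: fact_Suc)
        then show ?thesis using that by (simp add: pos_divide_le_eq del: fact_Suc)
      qed
      then show "\<forall>\<^sub>F h in at 0. norm (flat m h / h) \<le> fact (m + 2) * \<bar>h\<bar>"
        by (auto simp: eventually_at_filter simp del: fact_Suc)
      show "((\<lambda>h. fact (m + 2) * \<bar>h\<bar>) \<longlongrightarrow> (0::real)) (at 0)"
        by (auto intro!: tendsto_eq_intros)
    qed
    then show ?thesis using 3 by (simp add: DERIV_def)
  qed
qed

lemma Cinf_on_flat:
  assumes W: "open W" and F: "Cinf_on W F"
  shows "Cinf_on W (\<lambda>w. flat m (F w))"
proof -
  have "Ck_on r W (\<lambda>w. flat m (F w))" for r
  proof (rule Ck_on_compose_family[OF W, where \<phi> = flat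
        and \<phi>' = "\<lambda>m t. flat (m + 2) t + (- real m) * flat (m + 1) t"])
    show "Ck_on r W F" for r using F by (simp add: Cinf_on_def)
    show "(flat m has_real_derivative flat (m + 2) (F z) + - real m * flat (m + 1) (F z)) (at (F z))" for m z
      using flat_has_derivative[of m "F z"] by simp
  qed (intro Ck_on_add[OF W] Ck_on_mult[OF W] Ck_on_const)
  then show ?thesis by (simp add: Cinf_on_def)
qed

text \<open>Both mixed derivatives are limits of the second difference quotient over small squares, by
  the mean value theorem applied in either order.\<close>
lemma partial_deriv_commute:
  assumes W: "open W" and F: "Cinf_on W F" and p: "p \<in> W"
  shows "partial_deriv i (partial_deriv j F) p = partial_deriv j (partial_deriv i F) p"
proof -
  obtain r where r: "r > 0" "ball p r \<subseteq> W" using W p open_contains_ball by blast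
  have inW: "p + s *\<^sub>R axis k 1 + t *\<^sub>R axis l 1 \<in> W" 
    if "0 \<le> s" "s \<le> h" "0 \<le> t" "t \<le> h" "2 * h < r" for s t h and k l
  proof -
    have "norm (s *\<^sub>R axis k (1::real) + t *\<^sub>R axis l 1) \<le> \<bar>s\<bar> + \<bar>t\<bar>"
      by (rule order_trans[OF norm_triangle_ineq]) simp
    then have "norm (s *\<^sub>R axis k (1::real) + t *\<^sub>R axis l 1) < r" using that by simp
    moreover have "dist p (p + v) = norm v" for v by (simp add: dist_norm)
    ultimately have "p + (s *\<^sub>R axis k 1 + t *\<^sub>R axis l 1) \<in> ball p r" by (simp only: mem_ball)
    then have "p + s *\<^sub>R axis k 1 + t *\<^sub>R axis l 1 \<in> ball p r" by (simp only: add.assoc)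
    then show ?thesis using r by blast
  qed
  have key: "\<exists>s t. 0 \<le> s \<and> s \<le> h \<and> 0 \<le> t \<and> t \<le> h \<and>
      F (p + h *\<^sub>R axis k 1 + h *\<^sub>R axis l 1) - F (p + h *\<^sub>R axis k 1) - F (p + h *\<^sub>R axis l 1) + F p
      = h * h * partial_deriv l (partial_deriv k F) (p + s *\<^sub>R axis k 1 + t *\<^sub>R axis l 1)"
    if h: "0 < h" "2 * h < r" for h k l
  proof -
    let ?g = "\<lambda>s. F ((p + h *\<^sub>R axis l 1) + s *\<^sub>R axis k 1) - F (p + s *\<^sub>R axis k 1)"
    have d: "(?g has_real_derivative partial_deriv k F ((p + h *\<^sub>R axis l 1) + s *\<^sub>R axis k 1)
        - partial_deriv k F (p + s *\<^sub>R axis k 1)) (at s)" if "0 \<le> s" "s \<le> h" for s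
      using inW[of h h s l k] inW[of s h 0 k l] that h
      by (intro DERIV_diff has_real_derivative_along_axis Cinf_on_differentiable[OF F]) auto
    obtain s where s: "0 < s" "s < h" "?g h - ?g 0 = (h - 0) * (partial_deriv k F ((p + h *\<^sub>R axis l 1) + s *\<^sub>R axis k 1)
        - partial_deriv k F (p + s *\<^sub>R axis k 1))"
      using MVT2[OF h(1) d] by blast
    have d2: "((\<lambda>t. partial_deriv k F ((p + s *\<^sub>R axis k 1) + t *\<^sub>R axis l 1)) has_real_derivative
        partial_deriv l (partial_deriv k F) ((p + s *\<^sub>R axis k 1) + t *\<^sub>R axis l 1)) (at t)" if "0 \<le> t" "t \<le> h" for t
      using inW[of s h t k l] that h s
      by (intro has_real_derivative_along_axis Cinf_on_differentiable[OF Cinf_on_partial_deriv[OF F]]) auto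
    obtain t where t: "0 < t" "t < h" "partial_deriv k F ((p + s *\<^sub>R axis k 1) + h *\<^sub>R axis l 1)
        - partial_deriv k F ((p + s *\<^sub>R axis k 1) + 0 *\<^sub>R axis l 1)
        = (h - 0) * partial_deriv l (partial_deriv k F) ((p + s *\<^sub>R axis k 1) + t *\<^sub>R axis l 1)"
      using MVT2[OF h(1) d2] by blast
    show ?thesis
      apply (rule exI[of _ s], rule exI[of _ t])
      using s t by (simp add: algebra_simps)
  qed
  define m where "m = (\<lambda>N::nat. (r / 4) * inverse (real (Suc N)))"
  have m: "0 < m N" "2 * m N < r" for N using r(1) by (auto simp: m_def divide_simps)
  have m0: "m \<longlonglongrightarrow> 0" unfolding m_def using tendsto_mult_right_zero[OF LIMSEQ_inverse_real_of_nat] .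
  obtain s t where st: "0 \<le> s N" "s N \<le> m N" "0 \<le> t N" "t N \<le> m N"
      "F (p + m N *\<^sub>R axis i 1 + m N *\<^sub>R axis j 1) - F (p + m N *\<^sub>R axis i 1) - F (p + m N *\<^sub>R axis j 1) + F p
      = m N * m N * partial_deriv j (partial_deriv i F) (p + s N *\<^sub>R axis i 1 + t N *\<^sub>R axis j 1)" for N
    using key[OF m, of _ i j] by metis
  obtain s' t' where st': "0 \<le> s' N" "s' N \<le> m N" "0 \<le> t' N" "t' N \<le> m N"
      "F (p + m N *\<^sub>R axis j 1 + m N *\<^sub>R axis i 1) - F (p + m N *\<^sub>R axis j 1) - F (p + m N *\<^sub>R axis i 1) + F p
      = m N * m N * partial_deriv i (partial_deriv j F) (p + s' N *\<^sub>R axis j 1 + t' N *\<^sub>R axis i 1)" for N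
    using key[OF m, of _ j i] by metis
  have eq: "partial_deriv j (partial_deriv i F) (p + s N *\<^sub>R axis i 1 + t N *\<^sub>R axis j 1)
      = partial_deriv i (partial_deriv j F) (p + s' N *\<^sub>R axis j 1 + t' N *\<^sub>R axis i 1)" for N
  proof -
    have "m N * m N * partial_deriv j (partial_deriv i F) (p + s N *\<^sub>R axis i 1 + t N *\<^sub>R axis j 1)
      = m N * m N * partial_deriv i (partial_deriv j F) (p + s' N *\<^sub>R axis j 1 + t' N *\<^sub>R axis i 1)"
      unfolding st(5)[symmetric] st'(5)[symmetric] by (simp add: algebra_simps)
    then show ?thesis using m[of N] by simp
  qed
  have lim: "(\<lambda>N. p + a N *\<^sub>R axis k 1 + b N *\<^sub>R axis l 1) \<longlonglongrightarrow> p"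
    if "\<And>N. 0 \<le> a N" "\<And>N. a N \<le> m N" "\<And>N. 0 \<le> b N" "\<And>N. b N \<le> m N" for a b :: "nat \<Rightarrow> real" and k l
  proof -
    have "a \<longlonglongrightarrow> 0" "b \<longlonglongrightarrow> 0"
      using that by (auto intro!: tendsto_sandwich[OF _ _ tendsto_const m0] always_eventually)
    then show ?thesis by (auto intro!: tendsto_eq_intros)
  qed
  have "(\<lambda>N. partial_deriv j (partial_deriv i F) (p + s N *\<^sub>R axis i 1 + t N *\<^sub>R axis j 1))
      \<longlonglongrightarrow> partial_deriv j (partial_deriv i F) p"
    using Cinf_on_isCont[OF Cinf_on_partial_deriv[OF Cinf_on_partial_deriv[OF F]] p] lim[OF st(1-4)]
    by (rule isCont_tendsto_compose)
  moreover have "(\<lambda>N. partial_deriv i (partial_deriv j F) (p + s' N *\<^sub>R axis j 1 + t' N *\<^sub>R axis i 1))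
      \<longlonglongrightarrow> partial_deriv i (partial_deriv j F) p"
    using Cinf_on_isCont[OF Cinf_on_partial_deriv[OF Cinf_on_partial_deriv[OF F]] p] lim[OF st'(1-4)]
    by (rule isCont_tendsto_compose)
  ultimately show ?thesis unfolding eq using LIMSEQ_unique by blast
qed

section \<open>Functions smooth up to the boundary of a half space and their Taylor series\<close>

lemma eventually_at_right_0I:
  "e > 0 \<Longrightarrow> (\<And>x. 0 < x \<Longrightarrow> x < e \<Longrightarrow> P x) \<Longrightarrow> \<forall>\<^sub>F x in at_right (0::real). P x"
  unfolding eventually_at_right_field by blast

text \<open>Coordinates near the boundary are indexed by \<open>'n option\<close>, the index \<open>None\<close> belonging to \<open>x\<close>.  The
  cylinders extend to both sides of \<open>x = 0\<close>, so that they are open neighbourhoods of boundary points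
  and smooth extensions can live on them.\<close>
definition pt :: "real^'n::finite \<Rightarrow> real \<Rightarrow> real^'n option"
  where "pt z x = (\<chi> i. case i of None \<Rightarrow> x | Some j \<Rightarrow> z $ j)"

definition base :: "real^'n::finite option \<Rightarrow> real^'n"
  where "base w = (\<chi> j. w $ Some j)"

definition cyl :: "real^'n::finite \<Rightarrow> real \<Rightarrow> (real^'n option) set"
  where "cyl z e = {w. dist (base w) z < e \<and> \<bar>w $ None\<bar> < e}"

lemma pt_None [simp]: "pt z x $ None = x" and pt_Some [simp]: "pt z x $ Some j = z $ j"
  and base_pt [simp]: "base (pt z x) = z" and pt_base: "w $ None = x \<Longrightarrow> pt (base w) x = w"
  by (auto simp: pt_def base_def vec_eq_iff split: option.split)

lemma pt_in_cyl [simp]: "pt z x \<in> cyl z0 e \<longleftrightarrow> dist z z0 < e \<and> \<bar>x\<bar> < e"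
  by (simp add: cyl_def)

lemma pt_eq: "pt z x = pt z 0 + x *\<^sub>R axis None 1" "pt z x = pt 0 x + pt z 0"
  by (auto simp: vec_eq_iff pt_def axis_def split: option.split)

lemma linear_base: "linear base"
  by (rule linearI) (auto simp: base_def vec_eq_iff)

lemma linear_pt: "linear (\<lambda>z. pt z 0)"
  by (rule linearI) (auto simp: pt_def vec_eq_iff split: option.split)

lemma continuous_on_base [continuous_intros]:
  "continuous_on S f \<Longrightarrow> continuous_on S (\<lambda>w. base (f w))"
  using continuous_on_compose2[OF linear_continuous_on[OF linear_conv_bounded_linear[THEN iffD1, OF linear_base]]]
  by blast

lemma continuous_on_pt [continuous_intros]:
  assumes "continuous_on S f" "continuous_on S g"
  shows "continuous_on S (\<lambda>w. pt (f w) (g w))"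
proof -
  have "continuous_on S (\<lambda>w. case i of None \<Rightarrow> g w | Some j \<Rightarrow> f w $ j)" for i
    using assms by (cases i) (auto intro: continuous_intros)
  then show ?thesis unfolding pt_def by (intro continuous_on_vec_lambda)
qed

lemma open_cyl [simp]: "open (cyl z e)"
  unfolding cyl_def by (intro open_Collect_conj open_Collect_less continuous_intros)

lemma cyl_mono: "d \<le> e \<Longrightarrow> cyl z d \<subseteq> cyl z e"
  by (auto simp: cyl_def)

lemma cyl_shift: "dist z z0 + d \<le> e \<Longrightarrow> cyl z d \<subseteq> cyl z0 e"
proof
  fix w assume a: "dist z z0 + d \<le> e" "w \<in> cyl z d"
  then have "dist (base w) z < d" "\<bar>w $ None\<bar> < d" by (auto simp: cyl_def)
  moreover from this(2) have "\<bar>w $ None\<bar> < e" using a(1) zero_le_dist[of z z0] by linarith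
  ultimately show "w \<in> cyl z0 e"
    using a(1) dist_triangle[of "base w" z0 z] by (simp add: cyl_def)
qed

lemma cyl_subset_open:
  assumes "open W" "pt z0 0 \<in> W"
  obtains r where "r > 0" "cyl z0 r \<subseteq> W"
proof -
  obtain r where r: "r > 0" "ball (pt z0 0) r \<subseteq> W" using assms open_contains_ball by blast
  have "cyl z0 (r/2) \<subseteq> ball (pt z0 0) r"
  proof
    fix w assume w: "w \<in> cyl z0 (r/2)"
    have "w - pt z0 0 = pt (base w - z0) 0 + (w $ None) *\<^sub>R axis None 1"
      by (auto simp: vec_eq_iff pt_def base_def axis_def split: option.split)
    moreover have "norm (pt (base w - z0) 0) = norm (base w - z0)"
      by (simp add: norm_vec_def L2_set_def UNIV_option_conv sum.reindex)
    ultimately have "norm (w - pt z0 0) \<le> norm (base w - z0) + \<bar>w $ None\<bar>"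
      using norm_triangle_ineq[of "pt (base w - z0) 0" "(w $ None) *\<^sub>R axis None 1"] by simp
    then show "w \<in> ball (pt z0 0) r" using w by (simp add: cyl_def dist_norm norm_minus_commute)
  qed
  then show ?thesis using that[of "r/2"] r by auto
qed

lemma pt_has_derivative: "((\<lambda>z. pt z x) has_derivative (\<lambda>h. pt h 0)) (at z)"
proof -
  have "((\<lambda>z. pt 0 x + pt z 0) has_derivative (\<lambda>h. 0 + pt h 0)) (at z)"
    by (intro has_derivative_add has_derivative_const bounded_linear_imp_has_derivative
        linear_conv_bounded_linear[THEN iffD1, OF linear_pt])
  then show ?thesis unfolding pt_eq(2)[of _ x, symmetric] by simp
qed

lemma partial_deriv_slice:
  assumes "F differentiable (at (pt z x))"
  shows "partial_deriv j (\<lambda>z. F (pt z x)) z = partial_deriv (Some j) F (pt z x)"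
    and "(\<lambda>z. F (pt z x)) differentiable (at z)"
proof -
  have 1: "((\<lambda>z. F (pt z x)) has_derivative (\<lambda>h. frechet_derivative F (at (pt z x)) (pt h 0))) (at z)"
    by (rule has_derivative_compose[OF pt_has_derivative has_derivative_frechet[OF assms]])
  moreover have "pt (axis j 1) 0 = axis (Some j) 1"
    by (auto simp: vec_eq_iff pt_def axis_def split: option.split)
  ultimately show "partial_deriv j (\<lambda>z. F (pt z x)) z = partial_deriv (Some j) F (pt z x)"
    using partial_deriv_eq[OF 1] by (simp add: partial_deriv_def)
  show "(\<lambda>z. F (pt z x)) differentiable (at z)" using 1 by (auto simp: differentiable_def)
qed

lemma partial_deriv_vertical:
  assumes "F differentiable (at (pt z x))"
  shows "((\<lambda>x. F (pt z x)) has_real_derivative partial_deriv None F (pt z x)) (at x)"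
  using has_real_derivative_along_axis[of F "pt z 0" x None] assms by (simp add: pt_eq(1)[symmetric])

lemma Cinf_on_slice:
  assumes F: "Cinf_on W F" and W: "open W" and V: "open V" "\<And>z. z \<in> V \<Longrightarrow> pt z x \<in> W"
  shows "Cinf_on V (\<lambda>z. F (pt z x))"
proof -
  have "Ck_on r V (\<lambda>z. F (pt z x))" for r
    using F
  proof (induction r arbitrary: F)
    case 0
    then have "continuous_on W F" by (rule Cinf_on_continuous)
    then show ?case
      using V(2) by (auto intro!: continuous_on_compose2[of W F] continuous_intros)
  next
    case (Suc r)
    have d: "F differentiable (at (pt z x))" if "z \<in> V" for z
      using Cinf_on_differentiable[OF Suc.prems V(2)[OF that]] .
    show ?case
    proof (rule Ck_on_SucI)
      show "Ck_on r V (partial_deriv i (\<lambda>z. F (pt z x)))" for i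
        by (rule Ck_on_cong[OF V(1) _ Suc.IH[OF Cinf_on_partial_deriv[OF Suc.prems, of "Some i"]]])
          (simp add: partial_deriv_slice(1)[OF d])
    qed (rule partial_deriv_slice(2)[OF d])
  qed
  then show ?thesis by (simp add: Cinf_on_def)
qed

text \<open>Smoothness up to the boundary near the boundary point \<open>(z0, 0)\<close>, from the side \<open>x > 0\<close>.  Only the
  values for \<open>x > 0\<close> enter, so the notion applies directly to expressions such as inverses and roots
  of determinants whose values for \<open>x \<le> 0\<close> are arbitrary.\<close>
definition smooth_bd :: "real^'n::finite \<Rightarrow> (real^'n option \<Rightarrow> real) \<Rightarrow> bool"
  where "smooth_bd z0 f \<longleftrightarrow>
    (\<exists>e>0. \<exists>F. Cinf_on (cyl z0 e) F \<and> (\<forall>w\<in>cyl z0 e. w $ None > 0 \<longrightarrow> F w = f w))"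

abbreviation dx :: "nat \<Rightarrow> (real^'n::finite option \<Rightarrow> real) \<Rightarrow> real^'n option \<Rightarrow> real"
  where "dx k \<equiv> (partial_deriv None ^^ k)"

text \<open>The coefficient of \<open>x\<^sup>k\<close> in the Taylor expansion at \<open>(z, 0)\<close>, as a one-sided limit: like
  \<open>smooth_bd\<close> it depends on the values for \<open>x > 0\<close> alone.\<close>
definition tcoeff :: "nat \<Rightarrow> (real^'n::finite option \<Rightarrow> real) \<Rightarrow> real^'n \<Rightarrow> real"
  where "tcoeff k f z = Lim (at_right 0) (\<lambda>x. dx k f (pt z x)) / fact k"

lemma partial_deriv_cong_upper:
  assumes "\<forall>w\<in>cyl z0 e. w $ None > 0 \<longrightarrow> F w = f w" "w \<in> cyl z0 e" "w $ None > 0"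
  shows "partial_deriv i F w = partial_deriv i f w"
proof (rule partial_deriv_cong)
  show "open (cyl z0 e \<inter> {w. w $ None > 0})"
    by (intro open_Int open_cyl open_Collect_less continuous_intros)
qed (use assms in auto)

lemma dx_cong_upper:
  assumes "\<forall>w\<in>cyl z0 e. w $ None > 0 \<longrightarrow> F w = f w"
  shows "\<forall>w\<in>cyl z0 e. w $ None > 0 \<longrightarrow> dx k F w = dx k f w"
  by (induction k) (use assms partial_deriv_cong_upper[of z0 e] in auto)

lemma Cinf_on_dx: "Cinf_on W F \<Longrightarrow> Cinf_on W (dx k F)"
  by (induction k) (auto intro: Cinf_on_partial_deriv)

lemma dx_Suc_inner: "dx (Suc k) f = dx k (partial_deriv None f)"
  by (simp add: funpow_Suc_right del: funpow.simps)

lemma isCont_pt: "isCont (pt (z :: real^'n::finite)) x"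
proof -
  have "continuous_on UNIV (\<lambda>x. pt (z :: real^'n) x)" by (intro continuous_intros)
  then show ?thesis by (simp add: continuous_on_eq_continuous_at)
qed

lemma tcoeff_extension:
  assumes "Cinf_on (cyl z0 e) F" "\<forall>w\<in>cyl z0 e. w $ None > 0 \<longrightarrow> F w = f w" "dist z z0 < e"
  shows "tcoeff k f z = dx k F (pt z 0) / fact k"
    and "((\<lambda>x. dx k f (pt z x)) \<longlongrightarrow> dx k F (pt z 0)) (at_right 0)"
proof -
  have e: "e > 0" using assms(3) zero_le_dist[of z z0] by linarith
  have "isCont (dx k F) (pt z 0)"
    using Cinf_on_isCont[OF Cinf_on_dx[OF assms(1)]] assms(3) e by simp
  then have "((\<lambda>x. dx k F (pt z x)) \<longlongrightarrow> dx k F (pt z 0)) (at 0)"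
    by (rule isCont_tendsto_compose) (use isCont_pt[where z=z and x=0] in \<open>simp add: isCont_def\<close>)
  then have "((\<lambda>x. dx k F (pt z x)) \<longlongrightarrow> dx k F (pt z 0)) (at_right 0)"
    by (rule filterlim_mono) (auto simp: at_le)
  moreover have "\<forall>\<^sub>F x in at_right 0. dx k F (pt z x) = dx k f (pt z x)"
    by (rule eventually_at_right_0I[OF e]) (use dx_cong_upper[OF assms(2), of k] assms(3) in simp)
  ultimately show *: "((\<lambda>x. dx k f (pt z x)) \<longlongrightarrow> dx k F (pt z 0)) (at_right 0)"
    by (rule Lim_transform_eventually)
  show "tcoeff k f z = dx k F (pt z 0) / fact k"
    unfolding tcoeff_def by (subst tendsto_Lim[OF _ *]) auto
qed

lemma smooth_bdE:
  assumes "smooth_bd z0 f"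
  obtains e F where "e > 0" "Cinf_on (cyl z0 e) F" "\<forall>w\<in>cyl z0 e. w $ None > 0 \<longrightarrow> F w = f w"
    "\<And>k z. dist z z0 < e \<Longrightarrow> tcoeff k f z = dx k F (pt z 0) / fact k"
proof -
  obtain e F where eF: "e > 0" "Cinf_on (cyl z0 e) F" "\<forall>w\<in>cyl z0 e. w $ None > 0 \<longrightarrow> F w = f w"
    using assms unfolding smooth_bd_def by blast
  show ?thesis by (rule that[OF eF tcoeff_extension(1)[OF eF(2,3)]])
qed

lemma smooth_bd_near:
  assumes "smooth_bd z0 f"
  obtains d where "d > 0" "\<And>z. dist z z0 < d \<Longrightarrow> smooth_bd z f"
proof -
  obtain e F where eF: "e > 0" "Cinf_on (cyl z0 e) F" "\<forall>w\<in>cyl z0 e. w $ None > 0 \<longrightarrow> F w = f w"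
    using smooth_bdE[OF assms] by metis
  show ?thesis
  proof (rule that[of "e/2"])
    show "smooth_bd z f" if "dist z z0 < e / 2" for z
    proof -
      have "cyl z (e/2) \<subseteq> cyl z0 e" using cyl_shift[of z z0 "e/2" e] that by simp
      then show ?thesis
        unfolding smooth_bd_def using eF Cinf_on_subset[OF eF(2)]
        by (intro exI[of _ "e/2"] conjI exI[of _ F]) auto
    qed
  qed (use eF in simp)
qed

lemma smooth_bd_cong:
  assumes "smooth_bd z0 f" "d > 0" "\<And>w. w \<in> cyl z0 d \<Longrightarrow> w $ None > 0 \<Longrightarrow> f w = g w"
  shows "smooth_bd z0 g"
proof -
  obtain e F where eF: "e > 0" "Cinf_on (cyl z0 e) F" "\<forall>w\<in>cyl z0 e. w $ None > 0 \<longrightarrow> F w = f w"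
    using smooth_bdE[OF assms(1)] by metis
  show ?thesis unfolding smooth_bd_def
    using eF assms(2,3) Cinf_on_subset[OF eF(2) cyl_mono[of "min d e" e]]
      cyl_mono[of "min d e" e z0] cyl_mono[of "min d e" d z0]
    by (intro exI[of _ "min d e"] conjI exI[of _ F]) (auto simp: subset_iff)
qed

lemma tcoeff_cong:
  assumes "d > 0" "\<And>w. w \<in> cyl z0 d \<Longrightarrow> w $ None > 0 \<Longrightarrow> f w = g w" "dist z z0 < d"
  shows "tcoeff k f z = tcoeff k g z"
proof -
  have "\<forall>\<^sub>F x in at_right 0. dx k f (pt z x) = dx k g (pt z x)"
    by (rule eventually_at_right_0I[OF assms(1)]) (use dx_cong_upper[of z0 d f g k] assms(2,3) in simp)
  then have "Lim (at_right 0) (\<lambda>x. dx k f (pt z x)) = Lim (at_right 0) (\<lambda>x. dx k g (pt z x))"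
    by (rule Lim_cong) simp
  then show ?thesis by (simp add: tcoeff_def)
qed

lemma smooth_bd_Cinf:
  assumes "\<And>e. Cinf_on (cyl z0 e) F" shows "smooth_bd z0 F"
  unfolding smooth_bd_def using assms by (intro exI[of _ 1]) auto

lemma smooth_bd_const [simp]: "smooth_bd z0 (\<lambda>w. c)" and smooth_bd_coordinate [simp]: "smooth_bd z0 (\<lambda>w. w $ i)"
  by (rule smooth_bd_Cinf, simp)+

lemma smooth_bd_op2:
  assumes "smooth_bd z0 f" "smooth_bd z0 g"
    and "\<And>e F G. Cinf_on (cyl z0 e) F \<Longrightarrow> Cinf_on (cyl z0 e) G \<Longrightarrow> Cinf_on (cyl z0 e) (\<lambda>w. op (F w) (G w))"
  shows "smooth_bd z0 (\<lambda>w. op (f w) (g w))"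
proof -
  obtain e F where eF: "e > 0" "Cinf_on (cyl z0 e) F" "\<forall>w\<in>cyl z0 e. w $ None > 0 \<longrightarrow> F w = f w"
    using smooth_bdE[OF assms(1)] by metis
  obtain e' G where eG: "e' > 0" "Cinf_on (cyl z0 e') G" "\<forall>w\<in>cyl z0 e'. w $ None > 0 \<longrightarrow> G w = g w"
    using smooth_bdE[OF assms(2)] by metis
  let ?d = "min e e'"
  show ?thesis unfolding smooth_bd_def
    using eF eG assms(3)[OF Cinf_on_subset[OF eF(2) cyl_mono] Cinf_on_subset[OF eG(2) cyl_mono], of ?d]
      cyl_mono[of ?d e z0] cyl_mono[of ?d e' z0]
    by (intro exI[of _ ?d] conjI exI[of _ "\<lambda>w. op (F w) (G w)"]) (auto simp: subset_iff)
qed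

lemma smooth_bd_add: "smooth_bd z0 f \<Longrightarrow> smooth_bd z0 g \<Longrightarrow> smooth_bd z0 (\<lambda>w. f w + g w)"
  by (rule smooth_bd_op2) (auto intro: Cinf_on_add)

lemma smooth_bd_mult: "smooth_bd z0 f \<Longrightarrow> smooth_bd z0 g \<Longrightarrow> smooth_bd z0 (\<lambda>w. f w * g w)"
  by (rule smooth_bd_op2) (auto intro: Cinf_on_mult)

lemma smooth_bd_diff: "smooth_bd z0 f \<Longrightarrow> smooth_bd z0 g \<Longrightarrow> smooth_bd z0 (\<lambda>w. f w - g w)"
  by (rule smooth_bd_op2) (auto intro: Cinf_on_diff)

lemma smooth_bd_minus: "smooth_bd z0 f \<Longrightarrow> smooth_bd z0 (\<lambda>w. - f w)"
  using smooth_bd_diff[of z0 "\<lambda>w. 0" f] by simp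

lemma smooth_bd_power: "smooth_bd z0 f \<Longrightarrow> smooth_bd z0 (\<lambda>w. f w ^ m)"
  by (induction m) (auto intro: smooth_bd_mult)

lemma smooth_bd_sum: "(\<And>s. s \<in> I \<Longrightarrow> smooth_bd z0 (f s)) \<Longrightarrow> smooth_bd z0 (\<lambda>w. \<Sum>s\<in>I. f s w)"
  by (induction I rule: infinite_finite_induct) (auto intro: smooth_bd_add)

lemma smooth_bd_prod: "(\<And>s. s \<in> I \<Longrightarrow> smooth_bd z0 (f s)) \<Longrightarrow> smooth_bd z0 (\<lambda>w. \<Prod>s\<in>I. f s w)"
  by (induction I rule: infinite_finite_induct) (auto intro: smooth_bd_mult)

lemma smooth_bd_partial_deriv:
  assumes "smooth_bd z0 f" shows "smooth_bd z0 (partial_deriv i f)"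
proof -
  obtain e F where eF: "e > 0" "Cinf_on (cyl z0 e) F" "\<forall>w\<in>cyl z0 e. w $ None > 0 \<longrightarrow> F w = f w"
    using smooth_bdE[OF assms] by metis
  then show ?thesis unfolding smooth_bd_def
    using partial_deriv_cong_upper[OF eF(3)] Cinf_on_partial_deriv[OF eF(2)] by blast
qed

lemma smooth_bd_differentiable:
  assumes "smooth_bd z0 f"
  obtains e where "e > 0" "\<And>w. w \<in> cyl z0 e \<Longrightarrow> w $ None > 0 \<Longrightarrow> f differentiable (at w)"
proof -
  obtain e F where eF: "e > 0" "Cinf_on (cyl z0 e) F" "\<forall>w\<in>cyl z0 e. w $ None > 0 \<longrightarrow> F w = f w"
    using smooth_bdE[OF assms] by metis
  have "open (cyl z0 e \<inter> {w. w $ None > 0})"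
    by (intro open_Int open_cyl open_Collect_less continuous_intros)
  then have "f differentiable (at w)" if "w \<in> cyl z0 e" "w $ None > 0" for w
    using differentiable_cong[of "cyl z0 e \<inter> {w. w $ None > 0}" w F f] eF(3)
      Cinf_on_differentiable[OF eF(2)] that by auto
  then show ?thesis using that eF(1) by blast
qed

text \<open>By continuity of the extension.  The sign is recorded because absolute values, as in the volume
  density, are smooth only where the sign is constant.\<close>
lemma smooth_bd_nonzeroE:
  assumes "smooth_bd z0 f" "tcoeff 0 f z0 \<noteq> 0"
  obtains e F where "e > 0" "Cinf_on (cyl z0 e) F" "\<forall>w\<in>cyl z0 e. w $ None > 0 \<longrightarrow> F w = f w"
    "\<And>w. w \<in> cyl z0 e \<Longrightarrow> sgn (tcoeff 0 f z0) * F w > 0"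
proof -
  obtain e F where eF: "e > 0" "Cinf_on (cyl z0 e) F" "\<forall>w\<in>cyl z0 e. w $ None > 0 \<longrightarrow> F w = f w"
    and tcoeff: "\<And>k z. dist z z0 < e \<Longrightarrow> tcoeff k f z = dx k F (pt z 0) / fact k"
    using smooth_bdE[OF assms(1)] by metis
  let ?s = "sgn (tcoeff 0 f z0)"
  have F0: "tcoeff 0 f z0 = F (pt z0 0)" using tcoeff[of z0 0] eF(1) by simp
  have "continuous_on (cyl z0 e) (\<lambda>w. ?s * F w)"
    by (intro continuous_intros Cinf_on_continuous eF)
  then have "open (cyl z0 e \<inter> (\<lambda>w. ?s * F w) -` {0<..})"
    by (rule continuous_open_preimage) auto
  moreover have "cyl z0 e \<inter> (\<lambda>w. ?s * F w) -` {0<..} = {w \<in> cyl z0 e. ?s * F w > 0}" by auto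
  ultimately have op: "open {w \<in> cyl z0 e. ?s * F w > 0}" by simp
  have "?s * F (pt z0 0) > 0" using assms(2) F0 by (auto simp: sgn_if)
  then have in0: "pt z0 0 \<in> {w \<in> cyl z0 e. ?s * F w > 0}" using eF(1) by simp
  obtain r where r: "r > 0" and sub: "cyl z0 r \<subseteq> {w \<in> cyl z0 e. ?s * F w > 0}"
    using cyl_subset_open[OF op in0] by blast
  show ?thesis
  proof (rule that[of r F])
    show "Cinf_on (cyl z0 r) F" by (rule Cinf_on_subset[OF eF(2)]) (use sub in blast)
    show "\<forall>w\<in>cyl z0 r. 0 < w $ None \<longrightarrow> F w = f w" using sub eF(3) by blast
    show "?s * F w > 0" if "w \<in> cyl z0 r" for w using sub that by blast
  qed (rule r)
qed

lemma smooth_bd_inverse: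
  assumes "smooth_bd z0 f" "tcoeff 0 f z0 \<noteq> 0"
  shows "smooth_bd z0 (\<lambda>w. inverse (f w))"
proof -
  obtain e F where eF: "e > 0" "Cinf_on (cyl z0 e) F" "\<forall>w\<in>cyl z0 e. w $ None > 0 \<longrightarrow> F w = f w"
    "\<And>w. w \<in> cyl z0 e \<Longrightarrow> sgn (tcoeff 0 f z0) * F w > 0"
    using smooth_bd_nonzeroE[OF assms] by metis
  have "Cinf_on (cyl z0 e) (\<lambda>w. inverse (F w))"
    by (rule Cinf_on_inverse[OF open_cyl eF(2)]) (use eF(4) in fastforce)
  then show ?thesis unfolding smooth_bd_def using eF(1,3)
    by (intro exI[of _ e] conjI exI[of _ "\<lambda>w. inverse (F w)"]) auto
qed

lemma smooth_bd_sqrt_abs: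
  assumes "smooth_bd z0 f" "tcoeff 0 f z0 \<noteq> 0"
  shows "smooth_bd z0 (\<lambda>w. sqrt \<bar>f w\<bar>)"
proof -
  let ?s = "sgn (tcoeff 0 f z0)"
  obtain e F where eF: "e > 0" "Cinf_on (cyl z0 e) F" "\<forall>w\<in>cyl z0 e. w $ None > 0 \<longrightarrow> F w = f w"
    "\<And>w. w \<in> cyl z0 e \<Longrightarrow> ?s * F w > 0"
    using smooth_bd_nonzeroE[OF assms] by metis
  have "\<bar>F w\<bar> = ?s * F w" if "w \<in> cyl z0 e" for w
    using eF(4)[OF that] assms(2) by (auto simp: sgn_if split: if_splits)
  moreover have "Cinf_on (cyl z0 e) (\<lambda>w. sqrt (?s * F w))"
    by (intro Cinf_on_sqrt[OF open_cyl] Cinf_on_mult[OF open_cyl] Cinf_on_const eF)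
  ultimately have "Cinf_on (cyl z0 e) (\<lambda>w. sqrt \<bar>F w\<bar>)"
    using Cinf_on_cong[OF open_cyl, of z0 e "\<lambda>w. sqrt (?s * F w)"] by simp
  then show ?thesis unfolding smooth_bd_def using eF(1,3)
    by (intro exI[of _ e] conjI exI[of _ "\<lambda>w. sqrt \<bar>F w\<bar>"]) auto
qed

lemma tcoeff_0_limit:
  assumes "smooth_bd z0 f" "((\<lambda>x. f (pt z0 x)) \<longlongrightarrow> l) (at_right 0)"
  shows "tcoeff 0 f z0 = l"
  unfolding tcoeff_def using tendsto_Lim[OF _ assms(2)] by simp

lemma smooth_bd_tendsto:
  assumes "smooth_bd z0 f"
  shows "((\<lambda>x. f (pt z0 x)) \<longlongrightarrow> tcoeff 0 f z0) (at_right 0)"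
proof -
  obtain e F where eF: "e > 0" "Cinf_on (cyl z0 e) F" "\<forall>w\<in>cyl z0 e. w $ None > 0 \<longrightarrow> F w = f w"
    using smooth_bdE[OF assms] by metis
  show ?thesis using tcoeff_extension[OF eF(2,3), of z0 0] eF(1) by simp
qed

text \<open>Formal power series turn the Leibniz rule for Taylor coefficients into multiplication in a ring,
  and \<open>L\<close> into a formal differential operator.\<close>
definition jet :: "(real^'n::finite option \<Rightarrow> real) \<Rightarrow> real^'n \<Rightarrow> real fps"
  where "jet f z = Abs_fps (\<lambda>k. tcoeff k f z)"

lemma jet_nth [simp]: "fps_nth (jet f z) k = tcoeff k f z"
  by (simp add: jet_def)

lemma tcoeff_Suc: "real (Suc k) * tcoeff (Suc k) f z = tcoeff k (partial_deriv None f) z"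
  by (simp add: tcoeff_def dx_Suc_inner del: funpow.simps of_nat_Suc)

lemma jet_dx: "jet (partial_deriv None f) z = fps_deriv (jet f z)"
  by (rule fps_ext) (simp add: tcoeff_Suc[symmetric] del: of_nat_Suc)

lemma tcoeff_add:
  assumes "smooth_bd z0 f" "smooth_bd z0 g"
  shows "tcoeff k (\<lambda>w. f w + g w) z0 = tcoeff k f z0 + tcoeff k g z0"
  using assms
proof (induction k arbitrary: f g)
  case 0
  show ?case by (intro tcoeff_0_limit smooth_bd_add tendsto_add smooth_bd_tendsto 0)
next
  case (Suc k)
  obtain d where d: "d > 0" "\<And>w. w \<in> cyl z0 d \<Longrightarrow> w $ None > 0 \<Longrightarrow> f differentiable (at w)"
    using smooth_bd_differentiable[OF Suc.prems(1)] by metis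
  obtain e where e: "e > 0" "\<And>w. w \<in> cyl z0 e \<Longrightarrow> w $ None > 0 \<Longrightarrow> g differentiable (at w)"
    using smooth_bd_differentiable[OF Suc.prems(2)] by metis
  have "tcoeff k (partial_deriv None (\<lambda>w. f w + g w)) z0 =
      tcoeff k (\<lambda>w. partial_deriv None f w + partial_deriv None g w) z0"
    by (rule tcoeff_cong[of "min d e" z0]) 
      (use d e cyl_mono[of "min d e" d z0] cyl_mono[of "min d e" e z0] in \<open>auto intro!: partial_deriv_add\<close>)
  also have "\<dots> = tcoeff k (partial_deriv None f) z0 + tcoeff k (partial_deriv None g) z0"
    by (intro Suc.IH smooth_bd_partial_deriv Suc.prems)
  finally have "real (Suc k) * tcoeff (Suc k) (\<lambda>w. f w + g w) z0 = real (Suc k) * (tcoeff (Suc k) f z0 + tcoeff (Suc k) g z0)"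
    by (simp only: tcoeff_Suc distrib_left)
  then show ?case by (simp del: of_nat_Suc)
qed

lemma jet_add: "smooth_bd z0 f \<Longrightarrow> smooth_bd z0 g \<Longrightarrow> jet (\<lambda>w. f w + g w) z0 = jet f z0 + jet g z0"
  by (rule fps_ext) (simp add: tcoeff_add)

text \<open>Both sides have the same constant term, and by the Leibniz rule on either side their derivatives
  agree to one order less.\<close>
lemma jet_mult:
  assumes "smooth_bd z0 f" "smooth_bd z0 g"
  shows "jet (\<lambda>w. f w * g w) z0 = jet f z0 * jet g z0"
proof -
  have "tcoeff k (\<lambda>w. f w * g w) z0 = fps_nth (jet f z0 * jet g z0) k" for k
    using assms
  proof (induction k arbitrary: f g)
    case 0
    have "tcoeff 0 (\<lambda>w. f w * g w) z0 = tcoeff 0 f z0 * tcoeff 0 g z0"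
      by (intro tcoeff_0_limit smooth_bd_mult tendsto_mult smooth_bd_tendsto 0)
    then show ?case by simp
  next
    case (Suc k)
    obtain d where d: "d > 0" "\<And>w. w \<in> cyl z0 d \<Longrightarrow> w $ None > 0 \<Longrightarrow> f differentiable (at w)"
      using smooth_bd_differentiable[OF Suc.prems(1)] by metis
    obtain e where e: "e > 0" "\<And>w. w \<in> cyl z0 e \<Longrightarrow> w $ None > 0 \<Longrightarrow> g differentiable (at w)"
      using smooth_bd_differentiable[OF Suc.prems(2)] by metis
    let ?f = "partial_deriv None f" and ?g = "partial_deriv None g"
    have "tcoeff k (partial_deriv None (\<lambda>w. f w * g w)) z0 = tcoeff k (\<lambda>w. ?f w * g w + f w * ?g w) z0"
      by (rule tcoeff_cong[of "min d e" z0]) 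
        (use d e cyl_mono[of "min d e" d z0] cyl_mono[of "min d e" e z0] in \<open>auto intro!: partial_deriv_mult\<close>)
    also have "\<dots> = tcoeff k (\<lambda>w. ?f w * g w) z0 + tcoeff k (\<lambda>w. f w * ?g w) z0"
      by (intro tcoeff_add smooth_bd_mult smooth_bd_partial_deriv Suc.prems)
    also have "\<dots> = fps_nth (jet ?f z0 * jet g z0) k + fps_nth (jet f z0 * jet ?g z0) k"
      using Suc.prems by (simp only: Suc.IH smooth_bd_partial_deriv)
    also have "\<dots> = fps_nth (fps_deriv (jet f z0 * jet g z0)) k"
      by (simp add: jet_dx algebra_simps)
    finally have "real (Suc k) * tcoeff (Suc k) (\<lambda>w. f w * g w) z0 = real (Suc k) * fps_nth (jet f z0 * jet g z0) (Suc k)"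
      by (simp only: tcoeff_Suc fps_deriv_nth Suc_eq_plus1[symmetric])
    then show ?case by (simp del: of_nat_Suc)
  qed
  then show ?thesis by (intro fps_ext) simp
qed

lemma dx_const: "dx (Suc k) (\<lambda>w. c) = (\<lambda>w. 0)"
  by (induction k) auto

lemma jet_const [simp]: "jet (\<lambda>w. c) z0 = fps_const c"
proof (rule fps_ext)
  fix k show "fps_nth (jet (\<lambda>w. c) z0) k = fps_nth (fps_const c) k"
    by (cases k) (simp_all add: tcoeff_def dx_const del: funpow.simps(2), simp_all add: tendsto_Lim)
qed

lemma jet_x [simp]: "jet (\<lambda>w. w $ None) (z0 :: real^'n::finite) = fps_X"
proof (rule fps_ext)
  fix k
  have "tcoeff 0 (\<lambda>w. w $ None) z0 = 0"
    by (rule tcoeff_0_limit) (auto intro: tendsto_intros)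
  moreover have "partial_deriv None (\<lambda>w. (w :: real^'n option) $ None) = (\<lambda>w. 1)" by auto
  then have "real (Suc l) * tcoeff (Suc l) (\<lambda>w. w $ None) z0 = fps_nth (jet (\<lambda>w. 1) z0) l" for l
    by (simp only: tcoeff_Suc jet_nth)
  then have "real (Suc l) * tcoeff (Suc l) (\<lambda>w. w $ None) z0 = (if l = 0 then 1 else 0)" for l
    by (simp only: jet_const) simp
  ultimately show "fps_nth (jet (\<lambda>w. w $ None) z0) k = fps_nth fps_X k"
  proof (cases k)
    case (Suc l)
    then have "real (Suc l) * tcoeff k (\<lambda>w. w $ None) z0 = (if l = 0 then 1 else 0)"
      using \<open>\<And>l. real (Suc l) * tcoeff (Suc l) (\<lambda>w. w $ None) z0 = (if l = 0 then 1 else 0)\<close> by simp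
    then show ?thesis using Suc by (simp add: fps_X_def split: if_splits)
  qed (simp add: fps_X_def)
qed

lemma jet_power: "smooth_bd z0 f \<Longrightarrow> jet (\<lambda>w. f w ^ m) z0 = jet f z0 ^ m"
  by (induction m) (simp_all add: jet_mult smooth_bd_power)

lemma jet_cmult: "smooth_bd z0 f \<Longrightarrow> jet (\<lambda>w. c * f w) z0 = fps_const c * jet f z0"
  by (simp add: jet_mult)

lemma jet_minus: "smooth_bd z0 f \<Longrightarrow> jet (\<lambda>w. - f w) z0 = - jet f z0"
  using jet_cmult[of z0 f "-1"] by (simp add: fps_const_neg[symmetric] del: fps_const_neg)

lemma jet_diff: "smooth_bd z0 f \<Longrightarrow> smooth_bd z0 g \<Longrightarrow> jet (\<lambda>w. f w - g w) z0 = jet f z0 - jet g z0"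
  using jet_add[of z0 f "\<lambda>w. - g w"] by (simp add: jet_minus smooth_bd_minus)

lemma tcoeff_diff:
  assumes "smooth_bd z f" "smooth_bd z g" shows "tcoeff k (\<lambda>w. f w - g w) z = tcoeff k f z - tcoeff k g z"
proof -
  have "fps_nth (jet (\<lambda>w. f w - g w) z) k = fps_nth (jet f z - jet g z) k"
    by (simp only: jet_diff[OF assms])
  then show ?thesis by simp
qed

lemma jet_sum: "(\<And>s. s \<in> I \<Longrightarrow> smooth_bd z0 (f s)) \<Longrightarrow> jet (\<lambda>w. \<Sum>s\<in>I. f s w) z0 = (\<Sum>s\<in>I. jet (f s) z0)"
  by (induction I rule: infinite_finite_induct) (simp_all add: jet_add smooth_bd_sum)

lemma jet_cong:
  assumes "d > 0" "\<And>w. w \<in> cyl z0 d \<Longrightarrow> w $ None > 0 \<Longrightarrow> f w = g w"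
  shows "jet f z0 = jet g z0"
  by (rule fps_ext) (use tcoeff_cong[OF assms, of z0] assms(1) in simp)

lemma dx_partial_deriv_commute:
  assumes W: "open W" and F: "Cinf_on W F" and w: "w \<in> W"
  shows "dx k (partial_deriv i F) w = partial_deriv i (dx k F) w"
  using w
proof (induction k arbitrary: w)
  case (Suc k)
  have "partial_deriv None (dx k (partial_deriv i F)) w = partial_deriv None (partial_deriv i (dx k F)) w"
    by (rule partial_deriv_cong[OF W Suc.prems Suc.IH])
  also have "\<dots> = partial_deriv i (partial_deriv None (dx k F)) w"
    by (rule partial_deriv_commute[OF W Cinf_on_dx[OF F] Suc.prems])
  finally show ?case by simp
qed simp

lemma tcoeff_Cinf_on:
  assumes "smooth_bd z0 f"
  obtains e where "e > 0" "Cinf_on (ball z0 e) (tcoeff k f)"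
proof -
  obtain e F where eF: "e > 0" "Cinf_on (cyl z0 e) F"
    and tcoeff: "\<And>k z. dist z z0 < e \<Longrightarrow> tcoeff k f z = dx k F (pt z 0) / fact k"
    using smooth_bdE[OF assms] by metis
  have "Cinf_on (ball z0 e) (\<lambda>z. dx k F (pt z 0) / fact k)"
    by (intro Cinf_on_divide Cinf_on_const Cinf_on_slice[OF Cinf_on_dx[OF eF(2)]])
      (use eF(1) in \<open>auto simp: dist_commute\<close>)
  then have "Cinf_on (ball z0 e) (tcoeff k f)"
    by (rule Cinf_on_cong[OF open_ball, rotated]) (simp add: tcoeff dist_commute)
  then show ?thesis using that eF(1) by blast
qed

text \<open>Tangential derivatives commute with those in \<open>x\<close>, up to the boundary, because they do so for the
  extension.\<close>
lemma tcoeff_partial_deriv: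
  assumes "smooth_bd z0 f"
  shows "tcoeff k (partial_deriv (Some i) f) z0 = partial_deriv i (tcoeff k f) z0"
proof -
  obtain e F where eF: "e > 0" "Cinf_on (cyl z0 e) F" "\<forall>w\<in>cyl z0 e. w $ None > 0 \<longrightarrow> F w = f w"
    and tcoeff: "\<And>k z. dist z z0 < e \<Longrightarrow> tcoeff k f z = dx k F (pt z 0) / fact k"
    using smooth_bdE[OF assms] by metis
  have in0: "pt z0 0 \<in> cyl z0 e" using eF(1) by simp
  have d: "dx k F differentiable (at (pt z0 0))"
    by (rule Cinf_on_differentiable[OF Cinf_on_dx[OF eF(2)] in0])
  have "tcoeff k (partial_deriv (Some i) f) z0 = dx k (partial_deriv (Some i) F) (pt z0 0) / fact k"
    by (rule tcoeff_extension(1)[OF Cinf_on_partial_deriv[OF eF(2)]])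
      (use partial_deriv_cong_upper[OF eF(3)] eF(1) in auto)
  also have "\<dots> = partial_deriv i (\<lambda>z. dx k F (pt z 0)) z0 / fact k"
    by (simp add: dx_partial_deriv_commute[OF open_cyl eF(2) in0] partial_deriv_slice(1)[OF d])
  also have "\<dots> = partial_deriv i (\<lambda>z. (1 / fact k) * dx k F (pt z 0)) z0"
    using partial_deriv_cmult[OF partial_deriv_slice(2)[OF d], where i=i and c="1 / fact k"] by simp
  also have "\<dots> = partial_deriv i (tcoeff k f) z0"
    by (rule partial_deriv_cong[of "ball z0 e"]) (use eF(1) in \<open>auto simp: tcoeff dist_commute\<close>)
  finally show ?thesis .
qed

text \<open>The lower coefficients are taken at the moving base point \<open>z\<close>, the top one at the fixed point \<open>z0\<close>:
  by continuity this costs only an arbitrarily small multiple of \<open>x\<^sup>m\<close>.  Where the lower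
  coefficients vanish, the top one then controls size and sign on a whole half cylinder.\<close>
lemma smooth_bd_taylor:
  assumes "smooth_bd z0 f" "\<eta> > 0"
  obtains e where "e > 0"
    "\<And>z x. dist z z0 < e \<Longrightarrow> 0 < x \<Longrightarrow> x < e \<Longrightarrow>
       \<bar>f (pt z x) - (\<Sum>j<m. tcoeff j f z * x ^ j) - tcoeff m f z0 * x ^ m\<bar> \<le> \<eta> * x ^ m"
proof -
  obtain e F where eF: "e > 0" "Cinf_on (cyl z0 e) F" "\<forall>w\<in>cyl z0 e. w $ None > 0 \<longrightarrow> F w = f w"
    and tcoeff: "\<And>k z. dist z z0 < e \<Longrightarrow> tcoeff k f z = dx k F (pt z 0) / fact k"
    using smooth_bdE[OF assms(1)] by metis
  let ?G = "\<lambda>w. dx m F w / fact m"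
  have "isCont ?G (pt z0 0)"
    using Cinf_on_isCont[OF Cinf_on_dx[OF eF(2)]] eF(1) by (intro continuous_intros) auto
  then obtain r where r: "r > 0" "\<And>w. dist w (pt z0 0) < r \<Longrightarrow> dist (?G w) (?G (pt z0 0)) < \<eta>"
    using assms(2) by (auto simp: continuous_at_eps_delta)
  let ?d = "min e (r / 2)"
  show ?thesis
  proof (rule that[of ?d])
    fix z x assume z: "dist z z0 < ?d" and x: "0 < x" "x < ?d"
    have "\<exists>t. 0 < t \<and> t \<le> x \<and> F (pt z x) = (\<Sum>j<m. dx j F (pt z 0) / fact j * x ^ j) + dx m F (pt z t) / fact m * x ^ m"
    proof (rule Maclaurin2[where diff="\<lambda>k x. dx k F (pt z x)"])
      show "\<forall>k t. k < m \<and> 0 \<le> t \<and> t \<le> x \<longrightarrow> DERIV (\<lambda>x. dx k F (pt z x)) t :> dx (Suc k) F (pt z t)"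
        using partial_deriv_vertical[OF Cinf_on_differentiable[OF Cinf_on_dx[OF eF(2)]]] z x by auto
    qed (use x in auto)
    then obtain t where t: "0 < t" "t \<le> x"
      "F (pt z x) = (\<Sum>j<m. dx j F (pt z 0) / fact j * x ^ j) + ?G (pt z t) * x ^ m" by blast
    have "dist (pt z t) (pt z0 0) \<le> norm (pt (z - z0) 0) + norm (t *\<^sub>R axis None (1::real) :: real^'a option)"
    proof -
      have "pt z t - pt z0 0 = pt (z - z0) 0 + t *\<^sub>R axis None 1"
        by (auto simp: vec_eq_iff pt_def axis_def split: option.split)
      then show ?thesis using norm_triangle_ineq[of "pt (z - z0) 0" "t *\<^sub>R axis None 1"] by (simp add: dist_norm)
    qed
    also have "norm (pt (z - z0) 0) = norm (z - z0)"
      by (simp add: norm_vec_def L2_set_def UNIV_option_conv sum.reindex)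
    finally have "dist (pt z t) (pt z0 0) < r" using z x t by (simp add: dist_norm)
    then have "\<bar>?G (pt z t) - tcoeff m f z0\<bar> \<le> \<eta>"
      using r(2) tcoeff[of z0 m] eF(1) by (fastforce simp: dist_real_def)
    then have le: "\<bar>?G (pt z t) - tcoeff m f z0\<bar> * x ^ m \<le> \<eta> * x ^ m"
      using x by (intro mult_right_mono) auto
    have "F (pt z x) = f (pt z x)" using eF(3) z x by simp
    moreover have "(\<Sum>j<m. dx j F (pt z 0) / fact j * x ^ j) = (\<Sum>j<m. tcoeff j f z * x ^ j)"
      using tcoeff z by simp
    ultimately have "f (pt z x) - (\<Sum>j<m. tcoeff j f z * x ^ j) - tcoeff m f z0 * x ^ m = (?G (pt z t) - tcoeff m f z0) * x ^ m"
      using t(3) by (simp only: left_diff_distrib)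
    moreover have "\<bar>(?G (pt z t) - tcoeff m f z0) * x ^ m\<bar> = \<bar>?G (pt z t) - tcoeff m f z0\<bar> * x ^ m"
      using x by (simp add: abs_mult)
    ultimately show "\<bar>f (pt z x) - (\<Sum>j<m. tcoeff j f z * x ^ j) - tcoeff m f z0 * x ^ m\<bar> \<le> \<eta> * x ^ m"
      using le by simp
  qed (use eF(1) r(1) in auto)
qed

text \<open>If all earlier coefficients vanish, Taylor's formula bounds \<open>\<bar>f\<^sub>k\<bar>\<close> by \<open>\<bar>f\<bar> / x\<^sup>k\<close> up to a small error, and
  this tends to zero for \<open>k < m\<close>.\<close>
lemma tcoeff_eq_0_if_bigo:
  assumes "smooth_bd z0 f" "\<forall>\<^sub>F x in at_right 0. \<bar>f (pt z0 x)\<bar> \<le> C * x ^ m" "k < m"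
  shows "tcoeff k f z0 = 0"
  using assms(3)
proof (induction k rule: less_induct)
  case (less k)
  have "\<bar>tcoeff k f z0\<bar> \<le> \<eta>" if \<eta>: "\<eta> > 0" for \<eta> :: real
  proof -
    obtain e where e: "e > 0" "\<And>z x. dist z z0 < e \<Longrightarrow> 0 < x \<Longrightarrow> x < e \<Longrightarrow>
       \<bar>f (pt z x) - (\<Sum>j<k. tcoeff j f z * x ^ j) - tcoeff k f z0 * x ^ k\<bar> \<le> (\<eta>/2) * x ^ k"
      by (rule smooth_bd_taylor[OF assms(1) half_gt_zero[OF \<eta>], where m=k]) blast
    obtain b where b: "b > 0" "\<And>x. 0 < x \<Longrightarrow> x < b \<Longrightarrow> \<bar>f (pt z0 x)\<bar> \<le> C * x ^ m"
      using assms(2) by (auto simp: eventually_at_right_field)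
    define x where "x = min (min (e/2) (b/2)) (min 1 (\<eta> / (2 * (\<bar>C\<bar> + 1))))"
    have x: "0 < x" "x < e" "x < b" "x \<le> 1" "x \<le> \<eta> / (2 * (\<bar>C\<bar> + 1))" 
      using e(1) b(1) \<eta> by (auto simp: x_def)
    have "\<bar>f (pt z0 x) - tcoeff k f z0 * x ^ k\<bar> \<le> (\<eta>/2) * x ^ k"
      using e(2)[of z0 x] x e(1) less by simp
    moreover have "\<bar>f (pt z0 x)\<bar> \<le> (\<eta>/2) * x ^ k"
    proof -
      have "x ^ m \<le> x ^ (Suc k)" using x less.prems by (intro power_decreasing) auto
      have "\<bar>f (pt z0 x)\<bar> \<le> C * x ^ m" using b(2) x by simp
      also have "\<dots> \<le> (\<bar>C\<bar> + 1) * x ^ m" using x by (intro mult_right_mono) auto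
      also have "\<dots> \<le> (\<bar>C\<bar> + 1) * x ^ Suc k" using \<open>x ^ m \<le> x ^ Suc k\<close> by (intro mult_left_mono) auto
      also have "\<dots> = ((\<bar>C\<bar> + 1) * x) * x ^ k" by simp
      also have "\<dots> \<le> (\<eta>/2) * x ^ k"
        using x by (intro mult_right_mono) (auto simp: field_simps)
      finally show ?thesis .
    qed
    ultimately have "\<bar>tcoeff k f z0 * x ^ k\<bar> \<le> \<eta> * x ^ k" by linarith
    then show ?thesis using x by (simp add: abs_mult)
  qed
  then show ?case using field_le_epsilon[of "\<bar>tcoeff k f z0\<bar>" 0] by simp
qed

text \<open>In contrast to \<open>tcoeff_eq_0_if_bigo\<close>, the vanishing is required, and the bound obtained, uniformly
  near the point.\<close>
lemma tcoeff_bigo: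
  assumes "smooth_bd z0 f" "\<And>z k. dist z z0 < d \<Longrightarrow> k < m \<Longrightarrow> tcoeff k f z = 0" "d > 0"
  obtains e C where "e > 0" "\<And>z x. dist z z0 < e \<Longrightarrow> 0 < x \<Longrightarrow> x < e \<Longrightarrow> \<bar>f (pt z x)\<bar> \<le> C * x ^ m"
proof -
  obtain e where e: "e > 0" "\<And>z x. dist z z0 < e \<Longrightarrow> 0 < x \<Longrightarrow> x < e \<Longrightarrow>
       \<bar>f (pt z x) - (\<Sum>j<m. tcoeff j f z * x ^ j) - tcoeff m f z0 * x ^ m\<bar> \<le> 1 * x ^ m"
    by (rule smooth_bd_taylor[OF assms(1) zero_less_one, where m=m]) blast
  show ?thesis
  proof (rule that[of "min d e" "1 + \<bar>tcoeff m f z0\<bar>"])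
    fix z x assume "dist z z0 < min d e" "0 < x" "x < min d e"
    then have "\<bar>f (pt z x) - tcoeff m f z0 * x ^ m\<bar> \<le> x ^ m" using e(2)[of z x] assms(2) by simp
    moreover have "\<bar>tcoeff m f z0 * x ^ m\<bar> = \<bar>tcoeff m f z0\<bar> * x ^ m" using \<open>0 < x\<close> by (simp add: abs_mult)
    ultimately show "\<bar>f (pt z x)\<bar> \<le> (1 + \<bar>tcoeff m f z0\<bar>) * x ^ m" by (simp only: distrib_right)
  qed (use assms(3) e(1) in auto)
qed

section \<open>Matrix-valued functions\<close>

lemma matrix_inv_unique:
  fixes A B :: "real^'k^'k::finite"
  assumes "A ** B = mat 1"
  shows "matrix_inv A = B"
proof -
  have "B ** A = mat 1" using assms matrix_left_right_inverse by blast
  then have "A ** matrix_inv A = mat 1"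
    using someI[of "\<lambda>X. A ** X = mat 1 \<and> X ** A = mat 1" B] assms by (simp add: matrix_inv_def)
  then have "B ** (A ** matrix_inv A) = B" by simp
  then show ?thesis by (simp add: matrix_mul_assoc \<open>B ** A = mat 1\<close>)
qed

lemma matrix_inv_mult:
  fixes A :: "real^'k^'k::finite"
  assumes "invertible A"
  shows "A ** matrix_inv A = mat 1" "matrix_inv A ** A = mat 1"
proof -
  obtain B where B: "A ** B = mat 1" "B ** A = mat 1" using assms unfolding invertible_def by blast
  then show "A ** matrix_inv A = mat 1" "matrix_inv A ** A = mat 1"
    using matrix_inv_unique[OF B(1)] by auto
qed

text \<open>Cramer's rule makes the entries of the inverse rational functions of those of the matrix; their
  smoothness is read off from this formula.\<close>
lemma matrix_inv_cramer:
  fixes A :: "real^'k^'k::finite"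
  assumes "invertible A"
  shows "matrix_inv A $ i $ j = det (\<chi> k l. if l = i then axis j 1 $ k else A $ k $ l) * inverse (det A)"
proof -
  have "det A \<noteq> 0" using assms invertible_det_nz by blast
  moreover have "A *v (matrix_inv A *v axis j 1) = axis j 1"
    by (simp add: matrix_vector_mul_assoc matrix_inv_mult[OF assms])
  ultimately have "matrix_inv A *v axis j 1 = (\<chi> i. det (\<chi> k l. if l = i then axis j 1 $ k else A $ k $ l) / det A)"
    using cramer by blast
  then have "(matrix_inv A *v axis j 1) $ i = det (\<chi> k l. if l = i then axis j 1 $ k else A $ k $ l) / det A"
    by simp
  then show ?thesis by (simp add: matrix_vector_mult_basis column_def divide_inverse)
qed

lemma Cinf_on_det:
  assumes "open W" "\<And>i j. Cinf_on W (\<lambda>w. M w $ i $ j)"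
  shows "Cinf_on W (\<lambda>w. det (M w))"
  unfolding det_def
  by (intro Cinf_on_sum[OF assms(1)] Cinf_on_mult[OF assms(1)] Cinf_on_const Cinf_on_prod[OF assms(1)] assms(2))

lemma smooth_bd_det:
  assumes "\<And>i j. smooth_bd z (\<lambda>w. M w $ i $ j)"
  shows "smooth_bd z (\<lambda>w. det (M w))"
  unfolding det_def by (intro smooth_bd_sum smooth_bd_mult smooth_bd_const smooth_bd_prod assms)

lemma Cinf_on_matrix_inv:
  fixes M :: "real^'j::finite \<Rightarrow> real^'k^'k::finite"
  assumes W: "open W" and M: "\<And>i j. Cinf_on W (\<lambda>w. M w $ i $ j)" and inv: "\<And>w. w \<in> W \<Longrightarrow> invertible (M w)"
  shows "Cinf_on W (\<lambda>w. matrix_inv (M w) $ i $ j)"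
proof (rule Cinf_on_cong[OF W])
  have "Cinf_on W (\<lambda>w. if l = i then axis j 1 $ k else M w $ k $ l)" for k l
    by (cases "l = i") (simp_all add: M)
  then show "Cinf_on W (\<lambda>w. det (\<chi> k l. if l = i then axis j 1 $ k else M w $ k $ l) * inverse (det (M w)))"
    by (intro Cinf_on_mult[OF W] Cinf_on_det[OF W] Cinf_on_inverse[OF W] M)
      (use inv invertible_det_nz in auto)
qed (use matrix_inv_cramer[OF inv] in simp)

lemma smooth_bd_matrix_inv:
  fixes M :: "real^'j::finite option \<Rightarrow> real^'k^'k::finite"
  assumes M: "\<And>i j. smooth_bd z (\<lambda>w. M w $ i $ j)" and nz: "tcoeff 0 (\<lambda>w. det (M w)) z \<noteq> 0"
    and inv: "e > 0" "\<And>w. w \<in> cyl z e \<Longrightarrow> w $ None > 0 \<Longrightarrow> invertible (M w)"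
  shows "smooth_bd z (\<lambda>w. matrix_inv (M w) $ i $ j)"
proof (rule smooth_bd_cong[OF _ inv(1)])
  have "smooth_bd z (\<lambda>w. if l = i then axis j 1 $ k else M w $ k $ l)" for k l
    by (cases "l = i") (simp_all add: M)
  then show "smooth_bd z (\<lambda>w. det (\<chi> k l. if l = i then axis j 1 $ k else M w $ k $ l) * inverse (det (M w)))"
    by (intro smooth_bd_mult smooth_bd_det smooth_bd_inverse M nz) simp
qed (use matrix_inv_cramer[OF inv(2)] in simp)

text \<open>In the Leibniz expansion of the determinant, a permutation other than the identity picks at
  least two off-diagonal entries, so it does not contribute to first order at the unit matrix.\<close>
lemma det_derivative_at_unit:
  fixes M :: "real \<Rightarrow> real^'k^'k::finite"
  assumes "M 0 = mat 1" "\<And>i j. ((\<lambda>t. M t $ i $ j) has_real_derivative D i j) (at 0)"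
  shows "((\<lambda>t. det (M t)) has_real_derivative (\<Sum>i\<in>UNIV. D i i)) (at 0)"
proof -
  let ?P = "{p. p permutes (UNIV :: 'k set)}"
  have "((\<lambda>t. det (M t)) has_real_derivative
      (\<Sum>p\<in>?P. of_int (sign p) * (\<Sum>i\<in>UNIV. D i (p i) * (\<Prod>j\<in>UNIV-{i}. M 0 $ j $ p j)))) (at 0)"
    unfolding det_def by (intro DERIV_sum DERIV_cmult has_field_derivative_prod assms(2))
  moreover have "(\<Sum>i\<in>UNIV. D i (p i) * (\<Prod>j\<in>UNIV-{i}. M 0 $ j $ p j)) = (if p = id then (\<Sum>i\<in>UNIV. D i i) else 0)"
    if p: "p permutes UNIV" for p
  proof (cases "p = id")
    case False
    have pz: "(\<Prod>j\<in>UNIV-{i}. M 0 $ j $ p j) = 0" for i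
    proof -
      obtain j where "p j \<noteq> j" using False by (auto simp: fun_eq_iff)
      then have "p (p j) \<noteq> p j" using permutes_inj[OF p] by (auto dest: injD)
      then obtain l where "l \<noteq> i" "p l \<noteq> l" using \<open>p j \<noteq> j\<close> by metis
      then show ?thesis unfolding assms(1) by (intro prod_zero bexI[of _ l]) (auto simp: mat_def)
    qed
    show ?thesis using False by (simp only: pz mult_zero_right sum.neutral_const if_False)
  qed (simp add: assms(1) mat_def)
  then have "(\<Sum>p\<in>?P. of_int (sign p) * (\<Sum>i\<in>UNIV. D i (p i) * (\<Prod>j\<in>UNIV-{i}. M 0 $ j $ p j)))
      = (\<Sum>p\<in>?P. of_int (sign p) * (if p = id then (\<Sum>i\<in>UNIV. D i i) else 0))"
    by (intro sum.cong refl arg_cong2[where f="(*)"]) simp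
  moreover have "(\<Sum>p\<in>?P. of_int (sign p) * (if p = id then (\<Sum>i\<in>UNIV. D i i) else 0))
      = (\<Sum>p\<in>?P. if p = id then (\<Sum>i\<in>UNIV. D i i) else 0)"
    by (rule sum.cong) (auto simp: sign_id)
  ultimately show ?thesis by (simp add: sum.delta permutes_id)
qed

text \<open>Jacobi's formula.  Multiplication by the inverse of \<open>M z\<close> moves the base point to the unit matrix.\<close>
lemma partial_deriv_det:
  fixes M :: "real^'j::finite \<Rightarrow> real^'k^'k::finite"
  assumes W: "open W" "z \<in> W" and M: "\<And>i j. Cinf_on W (\<lambda>w. M w $ i $ j)" and inv: "invertible (M z)"
  shows "partial_deriv k (\<lambda>w. det (M w)) z =
    det (M z) * (\<Sum>a\<in>UNIV. \<Sum>b\<in>UNIV. matrix_inv (M z) $ a $ b * partial_deriv k (\<lambda>w. M w $ b $ a) z)"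
proof -
  let ?l = "\<lambda>t. z + t *\<^sub>R axis k 1"
  let ?N = "\<lambda>t. matrix_inv (M z) ** M (?l t)"
  have "((\<lambda>t. det (M (?l t))) has_real_derivative partial_deriv k (\<lambda>w. det (M w)) (?l 0)) (at 0)"
    by (rule has_real_derivative_along_axis) (use Cinf_on_differentiable[OF Cinf_on_det[OF W(1) M] W(2)] in simp)
  moreover have "((\<lambda>t. det (M z) * det (?N t)) has_real_derivative
      det (M z) * (\<Sum>a\<in>UNIV. \<Sum>b\<in>UNIV. matrix_inv (M z) $ a $ b * partial_deriv k (\<lambda>w. M w $ b $ a) (?l 0))) (at 0)"
  proof (rule DERIV_cmult, rule det_derivative_at_unit[where
        D="\<lambda>i j. \<Sum>b\<in>UNIV. matrix_inv (M z) $ i $ b * partial_deriv k (\<lambda>w. M w $ b $ j) (?l 0)"])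
    show "?N 0 = mat 1" by (simp add: matrix_inv_mult[OF inv])
    have "((\<lambda>t. \<Sum>b\<in>UNIV. matrix_inv (M z) $ i $ b * M (?l t) $ b $ j) has_real_derivative
        (\<Sum>b\<in>UNIV. matrix_inv (M z) $ i $ b * partial_deriv k (\<lambda>w. M w $ b $ j) (?l 0))) (at 0)" for i j
      by (intro DERIV_sum DERIV_cmult has_real_derivative_along_axis) 
        (use Cinf_on_differentiable[OF M W(2)] in simp)
    then show "((\<lambda>t. ?N t $ i $ j) has_real_derivative
        (\<Sum>b\<in>UNIV. matrix_inv (M z) $ i $ b * partial_deriv k (\<lambda>w. M w $ b $ j) (?l 0))) (at 0)" for i j
      by (simp add: matrix_matrix_mult_def)
  qed
  moreover have "det (M z) * det (?N t) = det (M (?l t))" for t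
    by (simp add: det_mul[symmetric] matrix_mul_assoc matrix_inv_mult[OF inv])
  ultimately show ?thesis using DERIV_unique by fastforce
qed

text \<open>By differentiating \<open>M M\<^sup>-\<^sup>1 = 1\<close>.\<close>
lemma partial_deriv_matrix_inv:
  fixes M :: "real^'j::finite \<Rightarrow> real^'k^'k::finite"
  assumes W: "open W" "z \<in> W" and M: "\<And>i j. Cinf_on W (\<lambda>w. M w $ i $ j)"
    and inv: "\<And>w. w \<in> W \<Longrightarrow> invertible (M w)"
  shows "partial_deriv k (\<lambda>w. matrix_inv (M w) $ i $ j) z =
    - (\<Sum>a\<in>UNIV. \<Sum>b\<in>UNIV. matrix_inv (M z) $ i $ a * partial_deriv k (\<lambda>w. M w $ a $ b) z * matrix_inv (M z) $ b $ j)"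
proof -
  let ?I = "matrix_inv (M z)"
  let ?dM = "\<lambda>a b. partial_deriv k (\<lambda>w. M w $ a $ b) z"
  let ?dI = "\<lambda>a b. partial_deriv k (\<lambda>w. matrix_inv (M w) $ a $ b) z"
  have dM: "(\<lambda>w. M w $ a $ b) differentiable (at z)" for a b
    by (rule Cinf_on_differentiable[OF M W(2)])
  have dI: "(\<lambda>w. matrix_inv (M w) $ a $ b) differentiable (at z)" for a b
    by (rule Cinf_on_differentiable[OF Cinf_on_matrix_inv[OF W(1) M inv] W(2)])
  have zero: "(\<Sum>b\<in>UNIV. ?dM a b * ?I $ b $ j) + (\<Sum>b\<in>UNIV. M z $ a $ b * ?dI b j) = 0" for a
  proof -
    have "partial_deriv k (\<lambda>w. \<Sum>b\<in>UNIV. M w $ a $ b * matrix_inv (M w) $ b $ j) z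
        = partial_deriv k (\<lambda>w. mat 1 $ a $ j) z"
    proof (rule partial_deriv_cong[OF W])
      fix w assume "w \<in> W"
      then have "(M w ** matrix_inv (M w)) $ a $ j = mat 1 $ a $ j" by (simp add: matrix_inv_mult inv)
      then show "(\<Sum>b\<in>UNIV. M w $ a $ b * matrix_inv (M w) $ b $ j) = mat 1 $ a $ j"
        by (simp add: matrix_matrix_mult_def)
    qed
    then show ?thesis
      by (simp add: partial_deriv_sum differentiable_mult dM dI partial_deriv_mult sum.distrib)
  qed
  have "?dI i j = (\<Sum>b\<in>UNIV. (?I ** M z) $ i $ b * ?dI b j)"
    by (simp add: matrix_inv_mult[OF inv[OF W(2)]] mat_def if_distrib[of "\<lambda>t. t * _"] cong: if_cong)
  also have "\<dots> = (\<Sum>b\<in>UNIV. \<Sum>a\<in>UNIV. ?I $ i $ a * M z $ a $ b * ?dI b j)"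
    by (simp add: matrix_matrix_mult_def sum_distrib_right)
  also have "\<dots> = (\<Sum>a\<in>UNIV. ?I $ i $ a * (\<Sum>b\<in>UNIV. M z $ a $ b * ?dI b j))"
    by (subst sum.swap) (simp add: sum_distrib_left mult.assoc)
  also have "\<dots> = (\<Sum>a\<in>UNIV. ?I $ i $ a * - (\<Sum>b\<in>UNIV. ?dM a b * ?I $ b $ j))"
  proof -
    have "(\<Sum>b\<in>UNIV. M z $ a $ b * ?dI b j) = - (\<Sum>b\<in>UNIV. ?dM a b * ?I $ b $ j)" for a
      using zero[of a] by linarith
    then show ?thesis by simp
  qed
  also have "\<dots> = - (\<Sum>a\<in>UNIV. \<Sum>b\<in>UNIV. ?I $ i $ a * ?dM a b * ?I $ b $ j)"
    by (simp add: sum_negf sum_distrib_left mult.assoc)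
  finally show ?thesis .
qed

section \<open>The Laplacian in divergence form\<close>

text \<open>By Jacobi's formula this is the logarithmic derivative \<open>\<partial>\<^sub>i log \<bar>det G\<bar>\<^sup>1\<^sup>/\<^sup>2\<close> of the volume density.\<close>
definition half_trace :: "(real^'k::finite \<Rightarrow> real^'l^'l::finite) \<Rightarrow> 'k \<Rightarrow> real^'k \<Rightarrow> real"
  where "half_trace G i z =
    (\<Sum>a\<in>UNIV. \<Sum>b\<in>UNIV. matrix_inv (G z) $ a $ b * partial_deriv i (\<lambda>w. G w $ b $ a) z) / 2"

lemma transpose_eq_entry: "transpose A = A \<Longrightarrow> A $ i $ j = A $ j $ i"
proof -
  assume "transpose A = A"
  moreover have "transpose A $ i $ j = A $ j $ i" by (simp add: transpose_def)
  ultimately show ?thesis by simp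
qed

lemma transpose_matrix_inv:
  fixes A :: "real^'k^'k::finite"
  assumes "invertible A" "transpose A = A"
  shows "matrix_inv A $ i $ j = matrix_inv A $ j $ i"
proof -
  have "A ** transpose (matrix_inv A) = transpose (matrix_inv A ** A)"
    by (simp add: matrix_transpose_mul assms(2))
  then have "A ** transpose (matrix_inv A) = mat 1"
    by (simp add: matrix_inv_mult[OF assms(1)] transpose_mat)
  from matrix_inv_unique[OF this] have "transpose (matrix_inv A) = matrix_inv A" by simp
  then show ?thesis by (rule transpose_eq_entry)
qed

text \<open>Contracted with the inverse metric, the first two of the three derivatives in the Christoffel
  symbol coincide and combine to the derivative of the inverse metric, and the third gives the half
  trace.\<close>
lemma christoffel_contraction:
  fixes G :: "real^'k::finite \<Rightarrow> real^'k^'k"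
  assumes W: "open W" "z \<in> W" and G: "\<And>i j. Cinf_on W (\<lambda>w. G w $ i $ j)"
    and inv: "\<And>w. w \<in> W \<Longrightarrow> invertible (G w)" and sym: "\<And>w. w \<in> W \<Longrightarrow> transpose (G w) = G w"
  shows "(\<Sum>i\<in>UNIV. \<Sum>j\<in>UNIV. matrix_inv (G z) $ i $ j * christoffel G k i j z) =
    - (\<Sum>i\<in>UNIV. partial_deriv i (\<lambda>w. matrix_inv (G w) $ i $ k) z + half_trace G i z * matrix_inv (G z) $ i $ k)"
proof -
  define I where "I = (\<lambda>i j. matrix_inv (G z) $ i $ j)"
  define D where "D = (\<lambda>k i j. partial_deriv k (\<lambda>w. G w $ i $ j) z)"
  have Isym: "I i j = I j i" for i j
    unfolding I_def by (rule transpose_matrix_inv[OF inv[OF W(2)] sym[OF W(2)]])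
  have Dsym: "D k i j = D k j i" for k i j
    unfolding D_def by (rule partial_deriv_cong[OF W]) (rule transpose_eq_entry[OF sym])
  have "(\<Sum>i\<in>UNIV. \<Sum>j\<in>UNIV. matrix_inv (G z) $ i $ j * christoffel G k i j z)
    = (\<Sum>i\<in>UNIV. \<Sum>j\<in>UNIV. \<Sum>l\<in>UNIV. I i j * I k l * D i j l) / 2
    + (\<Sum>i\<in>UNIV. \<Sum>j\<in>UNIV. \<Sum>l\<in>UNIV. I i j * I k l * D j i l) / 2
    - (\<Sum>i\<in>UNIV. \<Sum>j\<in>UNIV. \<Sum>l\<in>UNIV. I i j * I k l * D l i j) / 2"
    unfolding christoffel_def I_def D_def
    by (simp add: sum_distrib_left sum.distrib sum_subtractf ring_distribs sum_divide_distrib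
        add_divide_distrib diff_divide_distrib mult.assoc)
  also have "(\<Sum>i\<in>UNIV. \<Sum>j\<in>UNIV. \<Sum>l\<in>UNIV. I i j * I k l * D j i l)
      = (\<Sum>i\<in>UNIV. \<Sum>j\<in>UNIV. \<Sum>l\<in>UNIV. I i j * I k l * D i j l)"
    by (subst sum.swap) (simp add: Isym)
  also have "(\<Sum>i\<in>UNIV. \<Sum>j\<in>UNIV. \<Sum>l\<in>UNIV. I i j * I k l * D i j l) / 2
     + (\<Sum>i\<in>UNIV. \<Sum>j\<in>UNIV. \<Sum>l\<in>UNIV. I i j * I k l * D i j l) / 2
     = - (\<Sum>i\<in>UNIV. partial_deriv i (\<lambda>w. matrix_inv (G w) $ i $ k) z)"
  proof -
    have "partial_deriv i (\<lambda>w. matrix_inv (G w) $ i $ k) z = - (\<Sum>a\<in>UNIV. \<Sum>b\<in>UNIV. I i a * D i a b * I b k)" for i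
      unfolding I_def D_def by (rule partial_deriv_matrix_inv[OF W G inv])
    moreover have "I i a * D i a b * I b k = I i a * I k b * D i a b" for i a b
      using Isym[of b k] by simp
    ultimately show ?thesis by (simp add: sum_negf)
  qed
  also have "(\<Sum>i\<in>UNIV. \<Sum>j\<in>UNIV. \<Sum>l\<in>UNIV. I i j * I k l * D l i j) / 2
     = (\<Sum>l\<in>UNIV. half_trace G l z * matrix_inv (G z) $ l $ k)"
  proof -
    have "(\<Sum>i\<in>UNIV. \<Sum>j\<in>UNIV. \<Sum>l\<in>UNIV. I i j * I k l * D l i j)
      = (\<Sum>i\<in>UNIV. \<Sum>l\<in>UNIV. \<Sum>j\<in>UNIV. I i j * I k l * D l i j)"
      by (intro sum.cong refl sum.swap)
    also have "\<dots> = (\<Sum>l\<in>UNIV. \<Sum>i\<in>UNIV. \<Sum>j\<in>UNIV. I i j * I k l * D l i j)"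
      by (rule sum.swap)
    also have "\<dots> = (\<Sum>l\<in>UNIV. 2 * half_trace G l z * I k l)"
    proof -
      have "2 * half_trace G l z = (\<Sum>i\<in>UNIV. \<Sum>j\<in>UNIV. I i j * D l i j)" for l
        using Dsym by (simp add: half_trace_def I_def D_def)
      then show ?thesis by (simp add: sum_distrib_right sum_distrib_left mult_ac)
    qed
    finally show ?thesis using Isym by (simp add: I_def sum_divide_distrib)
  qed
  finally show ?thesis by (simp add: sum.distrib)
qed

text \<open>The Laplacian as \<open>(\<partial>\<^sub>i + \<lambda>\<^sub>i) (G\<^sup>i\<^sup>j \<partial>\<^sub>j F)\<close> with the half trace \<open>\<lambda>\<close>.  In this form the
  density enters through its logarithmic derivative only.\<close>
lemma laplacian_divergence:
  fixes G :: "real^'k::finite \<Rightarrow> real^'k^'k"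
  assumes W: "open W" "z \<in> W" and G: "\<And>i j. Cinf_on W (\<lambda>w. G w $ i $ j)"
    and inv: "\<And>w. w \<in> W \<Longrightarrow> invertible (G w)" and sym: "\<And>w. w \<in> W \<Longrightarrow> transpose (G w) = G w"
    and F: "Cinf_on W F"
  shows "(\<Sum>i\<in>UNIV. \<Sum>j\<in>UNIV. matrix_inv (G z) $ i $ j *
         (partial_deriv i (partial_deriv j F) z
          - (\<Sum>k\<in>UNIV. christoffel G k i j z * partial_deriv k F z)))
    = (\<Sum>i\<in>UNIV. \<Sum>j\<in>UNIV. partial_deriv i (\<lambda>w. matrix_inv (G w) $ i $ j * partial_deriv j F w) z
        + half_trace G i z * (matrix_inv (G z) $ i $ j * partial_deriv j F z))"
proof -
  let ?I = "matrix_inv (G z)"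
  have "(\<Sum>i\<in>UNIV. \<Sum>j\<in>UNIV. ?I $ i $ j * (\<Sum>k\<in>UNIV. christoffel G k i j z * partial_deriv k F z))
     = (\<Sum>i\<in>UNIV. \<Sum>k\<in>UNIV. \<Sum>j\<in>UNIV. ?I $ i $ j * christoffel G k i j z * partial_deriv k F z)"
    by (simp add: sum_distrib_left mult.assoc) (intro sum.cong refl sum.swap)
  also have "\<dots> = (\<Sum>k\<in>UNIV. \<Sum>i\<in>UNIV. \<Sum>j\<in>UNIV. ?I $ i $ j * christoffel G k i j z * partial_deriv k F z)"
    by (rule sum.swap)
  also have "\<dots> = (\<Sum>k\<in>UNIV. (\<Sum>i\<in>UNIV. \<Sum>j\<in>UNIV. ?I $ i $ j * christoffel G k i j z) * partial_deriv k F z)"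
    by (simp add: sum_distrib_right)
  also have "\<dots> = - (\<Sum>k\<in>UNIV. \<Sum>i\<in>UNIV. (partial_deriv i (\<lambda>w. matrix_inv (G w) $ i $ k) z + half_trace G i z * ?I $ i $ k) * partial_deriv k F z)"
    by (simp only: christoffel_contraction[OF W G inv sym] minus_mult_left[symmetric] sum_negf sum_distrib_right)
  also have "(\<Sum>k\<in>UNIV. \<Sum>i\<in>UNIV. (partial_deriv i (\<lambda>w. matrix_inv (G w) $ i $ k) z + half_trace G i z * ?I $ i $ k) * partial_deriv k F z)
     = (\<Sum>i\<in>UNIV. \<Sum>k\<in>UNIV. (partial_deriv i (\<lambda>w. matrix_inv (G w) $ i $ k) z + half_trace G i z * ?I $ i $ k) * partial_deriv k F z)"
    by (rule sum.swap)
  finally have contr: "(\<Sum>i\<in>UNIV. \<Sum>j\<in>UNIV. ?I $ i $ j * (\<Sum>k\<in>UNIV. christoffel G k i j z * partial_deriv k F z))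
     = - (\<Sum>i\<in>UNIV. \<Sum>k\<in>UNIV. (partial_deriv i (\<lambda>w. matrix_inv (G w) $ i $ k) z + half_trace G i z * ?I $ i $ k) * partial_deriv k F z)" .
  have prod: "partial_deriv i (\<lambda>w. matrix_inv (G w) $ i $ j * partial_deriv j F w) z
      = partial_deriv i (\<lambda>w. matrix_inv (G w) $ i $ j) z * partial_deriv j F z + ?I $ i $ j * partial_deriv i (partial_deriv j F) z" for i j
    by (intro partial_deriv_mult Cinf_on_differentiable[OF _ W(2)] Cinf_on_matrix_inv[OF W(1) G inv] Cinf_on_partial_deriv F)
  show ?thesis
    unfolding prod right_diff_distrib sum_subtractf contr
    by (simp add: sum.distrib algebra_simps)
qed

lemma partial_deriv_sqrt_det:
  fixes g :: "real^'j::finite \<Rightarrow> real^'l^'l::finite"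
  assumes W: "open W" "z \<in> W" and g: "\<And>i j. Cinf_on W (\<lambda>w. g w $ i $ j)"
    and inv: "invertible (g z)"
  shows "partial_deriv i (\<lambda>w. sqrt \<bar>det (g w)\<bar>) z = half_trace g i z * sqrt \<bar>det (g z)\<bar>"
proof -
  let ?d = "det (g z)"
  have nz: "?d \<noteq> 0" using inv invertible_det_nz by blast
  have d: "((\<lambda>t. sqrt \<bar>t\<bar>) has_real_derivative (inverse (sqrt \<bar>?d\<bar>) / 2) * sgn ?d) (at ?d)"
  proof (rule has_field_derivative_transform_within_open)
    show "((\<lambda>t. sqrt (sgn ?d * t)) has_real_derivative (inverse (sqrt \<bar>?d\<bar>) / 2) * sgn ?d) (at ?d)"
      by (rule DERIV_chain2[where f=sqrt and g="\<lambda>t. sgn ?d * t"])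
        (use nz DERIV_real_sqrt[of "\<bar>?d\<bar>"] in \<open>auto intro!: derivative_eq_intros simp: sgn_if\<close>)
    show "open {t. sgn ?d * t > 0}" by (intro open_Collect_less continuous_intros)
    show "sqrt (sgn ?d * t) = sqrt \<bar>t\<bar>" if "t \<in> {t. sgn ?d * t > 0}" for t
      using that by (auto simp: sgn_if split: if_splits)
    show "?d \<in> {t. sgn ?d * t > 0}" using nz by (auto simp: sgn_if)
  qed
  have sq: "inverse (sqrt \<bar>?d\<bar>) * (sgn ?d * ?d) = sqrt \<bar>?d\<bar>"
  proof -
    have "sgn ?d * ?d = sqrt \<bar>?d\<bar> * sqrt \<bar>?d\<bar>" by (simp add: sgn_if)
    moreover have "inverse t * (t * t) = t" if "t \<noteq> 0" for t :: real using that by simp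
    ultimately show ?thesis using nz by (metis abs_eq_0 real_sqrt_eq_zero_cancel_iff)
  qed
  have "partial_deriv i (\<lambda>w. sqrt \<bar>det (g w)\<bar>) z = (inverse (sqrt \<bar>?d\<bar>) / 2) * sgn ?d * partial_deriv i (\<lambda>w. det (g w)) z"
    by (rule partial_deriv_compose(1)[where F="\<lambda>w. det (g w)", OF d Cinf_on_differentiable[OF Cinf_on_det[OF W(1) g] W(2)]])
  also have "\<dots> = inverse (sqrt \<bar>?d\<bar>) * (sgn ?d * ?d) * half_trace g i z"
    unfolding partial_deriv_det[OF W g inv] half_trace_def by simp
  also have "\<dots> = half_trace g i z * sqrt \<bar>?d\<bar>" unfolding sq by simp
  finally show ?thesis .
qed

lemma sum_option: "(\<Sum>i\<in>UNIV. f i) = f None + (\<Sum>j\<in>UNIV. f (Some (j :: 'n::finite)))"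
  by (simp add: UNIV_option_conv sum.reindex)

text \<open>The operator \<open>-\<Delta>\<close> of the metric \<open>x\<^sup>-\<^sup>2(dx\<^sup>2 + g\<^sub>x)\<close>, multiplied by the density \<open>J\<close> of
  \<open>g\<^sub>x\<close>; \<open>H\<close> stands for the inverse of \<open>g\<^sub>x\<close>.\<close>
definition cyl_op :: "(real^'n::finite option \<Rightarrow> real) \<Rightarrow> (real^'n option \<Rightarrow> real^'n^'n) \<Rightarrow>
    (real^'n option \<Rightarrow> real) \<Rightarrow> real^'n option \<Rightarrow> real"
  where "cyl_op J H u w =
    (w $ None)\<^sup>2 * partial_deriv None (\<lambda>w. J w * partial_deriv None u w) w
    + (1 - real CARD('n)) * (w $ None * (J w * partial_deriv None u w))
    + (w $ None)\<^sup>2 * (\<Sum>i\<in>UNIV. partial_deriv (Some i) (\<lambda>w. \<Sum>j\<in>UNIV. J w * H w $ i $ j * partial_deriv (Some j) u w) w)"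

lemma normal_form_matrix_nth [simp]:
  "normal_form_matrix x G $ None $ None = 1 / x\<^sup>2"
  "normal_form_matrix x G $ Some k $ Some l = G $ k $ l / x\<^sup>2"
  "normal_form_matrix x G $ None $ Some l = 0"
  "normal_form_matrix x G $ Some k $ None = 0"
  by (simp_all add: normal_form_matrix_def)

lemma matrix_inv_normal_form:
  assumes "invertible G" "x \<noteq> 0"
  shows "normal_form_matrix x G ** normal_form_matrix (1 / x) (matrix_inv G) = mat 1"
    and "matrix_inv (normal_form_matrix x G) = normal_form_matrix (1 / x) (matrix_inv G)"
proof -
  have "(\<Sum>l\<in>UNIV. G $ i $ l * matrix_inv G $ l $ j) = mat 1 $ i $ j" for i j
  proof -
    have "(\<Sum>l\<in>UNIV. G $ i $ l * matrix_inv G $ l $ j) = (G ** matrix_inv G) $ i $ j"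
      by (simp add: matrix_matrix_mult_def)
    then show ?thesis by (simp add: matrix_inv_mult(1)[OF assms(1)])
  qed
  then have "(normal_form_matrix x G ** normal_form_matrix (1 / x) (matrix_inv G)) $ i $ j = mat 1 $ i $ j" for i j
    using assms(2) by (cases i; cases j) (simp_all add: matrix_matrix_mult_def sum_option mat_def power2_eq_square)
  then show 1: "normal_form_matrix x G ** normal_form_matrix (1 / x) (matrix_inv G) = mat 1"
    by (simp add: vec_eq_iff)
  show "matrix_inv (normal_form_matrix x G) = normal_form_matrix (1 / x) (matrix_inv G)"
    by (rule matrix_inv_unique[OF 1])
qed

text \<open>The \<open>n + 1\<close> dimensional metric is scaled by \<open>x\<^sup>-\<^sup>2\<close>, which contributes \<open>- (n + 1) log x\<close> to the
  logarithm of the density.\<close>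
lemma half_trace_normal_form:
  fixes g :: "real^'n::finite option \<Rightarrow> real^'n^'n"
  assumes W: "open W" "z \<in> W" and g: "\<And>i j. Cinf_on W (\<lambda>w. g w $ i $ j)"
    and inv: "invertible (g z)" and pos: "\<And>w. w \<in> W \<Longrightarrow> w $ None > 0"
  shows "half_trace (\<lambda>w. normal_form_matrix (w $ None) (g w)) i z =
    half_trace g i z - (if i = None then (real CARD('n) + 1) / z $ None else 0)"
proof -
  let ?x = "z $ None"
  have x: "?x > 0" using pos W by blast
  have gd: "(\<lambda>w. g w $ a $ b) differentiable (at z)" for a b
    by (rule Cinf_on_differentiable[OF g W(2)])
  have di: "((\<lambda>t. 1 / t\<^sup>2) has_real_derivative - 2 / ?x ^ 3) (at ?x)"
    using x by (auto intro!: derivative_eq_intros simp: power2_eq_square power3_eq_cube field_simps)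
  have d1: "partial_deriv i (\<lambda>w. 1 / (w $ None)\<^sup>2) z = (if i = None then - 2 / ?x ^ 3 else 0)"
    and d2: "(\<lambda>w. 1 / (w $ None)\<^sup>2) differentiable (at z)"
    using partial_deriv_compose[where F="\<lambda>w. w $ None", OF di] by auto
  have d3: "partial_deriv i (\<lambda>w. g w $ a $ b / (w $ None)\<^sup>2) z
      = partial_deriv i (\<lambda>w. g w $ a $ b) z / ?x\<^sup>2 - (if i = None then 2 * g z $ a $ b / ?x ^ 3 else 0)" for a b
    using partial_deriv_mult[OF gd d2, of i] by (simp add: d1)
  have tr: "(\<Sum>a\<in>UNIV. \<Sum>b\<in>UNIV. matrix_inv (g z) $ a $ b * g z $ b $ a) = real CARD('n)"
  proof -
    have "(\<Sum>b\<in>UNIV. matrix_inv (g z) $ a $ b * g z $ b $ a) = 1" for a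
    proof -
      have "(matrix_inv (g z) ** g z) $ a $ a = 1" by (simp add: matrix_inv_mult[OF inv] mat_def)
      then show ?thesis by (simp add: matrix_matrix_mult_def)
    qed
    then show ?thesis by simp
  qed
  have "2 * half_trace (\<lambda>w. normal_form_matrix (w $ None) (g w)) i z
    = ?x\<^sup>2 * (if i = None then - 2 / ?x ^ 3 else 0) + (\<Sum>a\<in>UNIV. \<Sum>b\<in>UNIV. ?x\<^sup>2 * matrix_inv (g z) $ a $ b *
      (partial_deriv i (\<lambda>w. g w $ b $ a) z / ?x\<^sup>2 - (if i = None then 2 * g z $ b $ a / ?x ^ 3 else 0)))"
    unfolding half_trace_def matrix_inv_normal_form(2)[OF inv less_imp_neq[OF x, symmetric]]
    by (simp add: sum_option d1 d3 power_divide mult_ac)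
  also have "(\<Sum>a\<in>UNIV. \<Sum>b\<in>UNIV. ?x\<^sup>2 * matrix_inv (g z) $ a $ b *
      (partial_deriv i (\<lambda>w. g w $ b $ a) z / ?x\<^sup>2 - (if i = None then 2 * g z $ b $ a / ?x ^ 3 else 0)))
    = (\<Sum>a\<in>UNIV. \<Sum>b\<in>UNIV. matrix_inv (g z) $ a $ b * partial_deriv i (\<lambda>w. g w $ b $ a) z
        - (if i = None then 2 / ?x else 0) * (matrix_inv (g z) $ a $ b * g z $ b $ a))"
    using x by (intro sum.cong refl) (simp add: field_simps power2_eq_square power3_eq_cube)
  also have "\<dots> = 2 * half_trace g i z - (if i = None then 2 / ?x else 0) * real CARD('n)"
    unfolding sum_subtractf sum_distrib_left[symmetric] tr half_trace_def by simp
  finally have "2 * half_trace (\<lambda>w. normal_form_matrix (w $ None) (g w)) i z =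
      ?x\<^sup>2 * (if i = None then - 2 / ?x ^ 3 else 0)
      + (2 * half_trace g i z - (if i = None then 2 / ?x else 0) * real CARD('n))" .
  moreover have "?x\<^sup>2 * (- 2 / ?x ^ 3) = - 2 / ?x"
    using x by (simp add: field_simps power2_eq_square power3_eq_cube)
  moreover have "2 / ?x * real CARD('n) = 2 * (real CARD('n) / ?x)" "- 2 / ?x = - (2 * (1 / ?x))"
    "(real CARD('n) + 1) / ?x = real CARD('n) / ?x + 1 / ?x"
    by (simp_all add: add_divide_distrib)
  note facts = calculation this
  show ?thesis
  proof (cases "i = None")
    case True
    from facts show ?thesis unfolding True by (simp only: if_True refl)
  next
    case False
    from facts False show ?thesis by (simp only: if_False)
  qed
qed

text \<open>The first order term of \<open>cyl_op\<close> collects \<open>- (n + 1) x\<close> from the half trace and \<open>2 x\<close> from the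
  derivative of the factor \<open>x\<^sup>2\<close> of the inverse metric.\<close>
lemma laplacian_normal_form:
  fixes g :: "real^'n::finite option \<Rightarrow> real^'n^'n"
  assumes W: "open W" "z \<in> W" and g: "\<And>i j. Cinf_on W (\<lambda>w. g w $ i $ j)"
    and inv: "\<And>w. w \<in> W \<Longrightarrow> invertible (g w)" and sym: "\<And>w. w \<in> W \<Longrightarrow> transpose (g w) = g w"
    and pos: "\<And>w. w \<in> W \<Longrightarrow> w $ None > 0"
    and G: "\<And>w. w \<in> W \<Longrightarrow> G w = normal_form_matrix (w $ None) (g w)"
    and F: "Cinf_on W F"
  defines "J \<equiv> \<lambda>w. sqrt \<bar>det (g w)\<bar>"
  shows "J z * (\<Sum>i\<in>UNIV. \<Sum>j\<in>UNIV. matrix_inv (G z) $ i $ j *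
         (partial_deriv i (partial_deriv j F) z
          - (\<Sum>k\<in>UNIV. christoffel G k i j z * partial_deriv k F z)))
    = cyl_op J (\<lambda>w. matrix_inv (g w)) F z"
proof -
  let ?N = "\<lambda>w. normal_form_matrix (w $ None) (g w)" and ?x = "z $ None"
  let ?I = "\<lambda>w. matrix_inv (g w)"
  have x: "?x > 0" using pos W by blast
  have N: "Cinf_on W (\<lambda>w. ?N w $ i $ j)" for i j
    by (cases i; cases j) (auto intro!: Cinf_on_divide[OF W(1)] Cinf_on_power[OF W(1)] g dest: pos)
  have Ninv: "invertible (?N w)" if "w \<in> W" for w
    using matrix_inv_normal_form(1)[OF inv[OF that], of "w $ None"] pos[OF that] invertible_right_inverse by auto
  have Nsym: "transpose (?N w) = ?N w" if "w \<in> W" for w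
  proof -
    have "g w $ k $ l = g w $ l $ k" for k l by (rule transpose_eq_entry[OF sym[OF that]])
    then have "?N w $ j $ i = ?N w $ i $ j" for i j by (cases i; cases j) auto
    then show ?thesis by (simp add: transpose_def vec_eq_iff)
  qed
  have chr: "christoffel G k i j z = christoffel ?N k i j z" for k i j
  proof -
    have "partial_deriv a (\<lambda>w. G w $ b $ c) z = partial_deriv a (\<lambda>w. ?N w $ b $ c) z" for a b c
      by (rule partial_deriv_cong[OF W]) (simp add: G)
    then show ?thesis unfolding christoffel_def by (simp add: G W(2))
  qed
  have Ninv_eq: "matrix_inv (?N w) = normal_form_matrix (1 / (w $ None)) (?I w)" if "w \<in> W" for w
    using matrix_inv_normal_form(2)[OF inv[OF that]] pos[OF that] by simp
  have nz: "det (g w) \<noteq> 0" if "w \<in> W" for w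
    using inv[OF that] invertible_det_nz by blast
  have pos_sq: "0 < det (g w) * det (g w)" if "w \<in> W" for w
    using nz[OF that] not_real_square_gt_zero by blast
  have J: "Cinf_on W J" unfolding J_def
  proof (rule Cinf_on_cong[OF W(1)])
    show "Cinf_on W (\<lambda>w. sqrt (sqrt (det (g w) * det (g w))))"
      by (intro Cinf_on_sqrt[OF W(1)] Cinf_on_mult[OF W(1)] Cinf_on_det[OF W(1)] g)
        (erule pos_sq, rule real_sqrt_gt_zero, erule pos_sq)
  qed simp
  note dif = Cinf_on_differentiable[OF _ W(2)]
  have I: "Cinf_on W (\<lambda>w. ?I w $ i $ j)" for i j by (rule Cinf_on_matrix_inv[OF W(1) g inv])
  have JI: "partial_deriv i J z = half_trace g i z * J z" for i
    unfolding J_def by (rule partial_deriv_sqrt_det[OF W g inv[OF W(2)]])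
  have pN: "partial_deriv None (\<lambda>w. matrix_inv (?N w) $ None $ None * partial_deriv None F w) z
     = 2 * ?x * partial_deriv None F z + ?x\<^sup>2 * partial_deriv None (partial_deriv None F) z"
  proof -
    have "partial_deriv None (\<lambda>w. matrix_inv (?N w) $ None $ None * partial_deriv None F w) z
      = partial_deriv None (\<lambda>w. (w $ None * w $ None) * partial_deriv None F w) z"
      by (rule partial_deriv_cong[OF W]) (simp add: Ninv_eq power_divide power2_eq_square)
    also have "\<dots> = 2 * ?x * partial_deriv None F z + ?x\<^sup>2 * partial_deriv None (partial_deriv None F) z"
      by (simp add: partial_deriv_mult differentiable_mult dif[OF Cinf_on_partial_deriv[OF F]] power2_eq_square)
    finally show ?thesis .
  qed
  have pS: "partial_deriv (Some i) (\<lambda>w. matrix_inv (?N w) $ Some i $ Some j * partial_deriv (Some j) F w) z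
     = ?x\<^sup>2 * partial_deriv (Some i) (\<lambda>w. ?I w $ i $ j * partial_deriv (Some j) F w) z" for i j
  proof -
    have "partial_deriv (Some i) (\<lambda>w. matrix_inv (?N w) $ Some i $ Some j * partial_deriv (Some j) F w) z
      = partial_deriv (Some i) (\<lambda>w. (w $ None * w $ None) * (?I w $ i $ j * partial_deriv (Some j) F w)) z"
      by (rule partial_deriv_cong[OF W]) (simp add: Ninv_eq power_divide power2_eq_square)
    also have "\<dots> = ?x\<^sup>2 * partial_deriv (Some i) (\<lambda>w. ?I w $ i $ j * partial_deriv (Some j) F w) z"
      by (subst partial_deriv_mult) (simp_all add: partial_deriv_mult differentiable_mult
          dif[OF Cinf_on_partial_deriv[OF F]] dif[OF I] power2_eq_square)
    finally show ?thesis .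
  qed
  have pM: "partial_deriv (Some i) (\<lambda>w. matrix_inv (?N w) $ Some i $ None * partial_deriv None F w) z = 0"
    "partial_deriv None (\<lambda>w. matrix_inv (?N w) $ None $ Some i * partial_deriv (Some i) F w) z = 0" for i
    using partial_deriv_cong[OF W, of "\<lambda>w. matrix_inv (?N w) $ Some i $ None * partial_deriv None F w" "\<lambda>w. 0"]
      partial_deriv_cong[OF W, of "\<lambda>w. matrix_inv (?N w) $ None $ Some i * partial_deriv (Some i) F w" "\<lambda>w. 0"]
    by (simp_all add: Ninv_eq)
  have ht: "half_trace ?N i z = half_trace g i z - (if i = None then (real CARD('n) + 1) / ?x else 0)" for i
    by (rule half_trace_normal_form[OF W g inv[OF W(2)] pos])
  have q1: "partial_deriv None (\<lambda>w. J w * partial_deriv None F w) z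
     = half_trace g None z * J z * partial_deriv None F z + J z * partial_deriv None (partial_deriv None F) z"
    by (simp add: partial_deriv_mult dif[OF J] dif[OF Cinf_on_partial_deriv[OF F]] JI)
  have q2: "partial_deriv (Some i) (\<lambda>w. \<Sum>j\<in>UNIV. J w * ?I w $ i $ j * partial_deriv (Some j) F w) z
     = (\<Sum>j\<in>UNIV. half_trace g (Some i) z * J z * (?I z $ i $ j * partial_deriv (Some j) F z)
         + J z * partial_deriv (Some i) (\<lambda>w. ?I w $ i $ j * partial_deriv (Some j) F w) z)" for i
    by (simp add: partial_deriv_sum partial_deriv_mult differentiable_mult dif[OF J] dif[OF I]
        dif[OF Cinf_on_partial_deriv[OF F]] JI mult.assoc)
  have zN: "matrix_inv (?N z) $ None $ None = ?x\<^sup>2" "matrix_inv (?N z) $ Some i $ Some j = ?x\<^sup>2 * ?I z $ i $ j"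
     "matrix_inv (?N z) $ None $ Some i = 0" "matrix_inv (?N z) $ Some i $ None = 0" for i j
    using W(2) by (simp_all add: Ninv_eq power_divide)
  have "J z * (\<Sum>i\<in>UNIV. \<Sum>j\<in>UNIV. matrix_inv (G z) $ i $ j *
         (partial_deriv i (partial_deriv j F) z
          - (\<Sum>k\<in>UNIV. christoffel G k i j z * partial_deriv k F z)))
    = J z * (\<Sum>i\<in>UNIV. \<Sum>j\<in>UNIV. partial_deriv i (\<lambda>w. matrix_inv (?N w) $ i $ j * partial_deriv j F w) z
        + half_trace ?N i z * (matrix_inv (?N z) $ i $ j * partial_deriv j F z))"
    unfolding chr G[OF W(2)] by (subst laplacian_divergence[OF W N Ninv Nsym F]) auto
  also have "\<dots> = J z * (2 * ?x * partial_deriv None F z + ?x\<^sup>2 * partial_deriv None (partial_deriv None F) z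
       + (half_trace g None z - (real CARD('n) + 1) / ?x) * (?x\<^sup>2 * partial_deriv None F z)
       + (\<Sum>i\<in>UNIV. \<Sum>j\<in>UNIV. ?x\<^sup>2 * partial_deriv (Some i) (\<lambda>w. ?I w $ i $ j * partial_deriv (Some j) F w) z
          + half_trace g (Some i) z * (?x\<^sup>2 * ?I z $ i $ j * partial_deriv (Some j) F z)))"
    unfolding sum_option pN pS pM zN ht by simp
  also have "\<dots> = cyl_op J ?I F z"
  proof -
    have e: "(h - (real CARD('n) + 1) / ?x) * (?x\<^sup>2 * y) = h * (?x\<^sup>2 * y) - (real CARD('n) + 1) * (?x * y)" for h y
      using x by (simp add: field_simps power2_eq_square)
    show ?thesis unfolding cyl_op_def q1 q2 e
      by (simp add: sum_distrib_left algebra_simps power2_eq_square sum.distrib)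
  qed
  finally show ?thesis .
qed

section \<open>Integrals of derivatives of compactly supported functions\<close>

lemma Ck_on_local:
  assumes "\<And>w. w \<in> U \<Longrightarrow> \<exists>W. open W \<and> w \<in> W \<and> Ck_on r W F"
  shows "Ck_on r U F"
  using assms
proof (induction r arbitrary: F)
  case 0
  have "isCont F w" if "w \<in> U" for w
    using 0[OF that] by (auto simp: continuous_on_eq_continuous_at)
  then show ?case by (auto intro: continuous_at_imp_continuous_on)
next
  case (Suc r)
  show ?case
  proof (rule Ck_on_SucI)
    show "F differentiable (at z)" if "z \<in> U" for z using Suc.prems[OF that] by auto
    show "Ck_on r U (partial_deriv i F)" for i
    proof (rule Suc.IH)
      fix w assume "w \<in> U"
      from Suc.prems[OF this] show "\<exists>W. open W \<and> w \<in> W \<and> Ck_on r W (partial_deriv i F)" by auto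
    qed
  qed
qed

lemma Cinf_on_Un:
  assumes "open A" "open B" "Cinf_on A F" "Cinf_on B F"
  shows "Cinf_on (A \<union> B) F"
  unfolding Cinf_on_def
proof (intro allI Ck_on_local)
  fix r w assume "w \<in> A \<union> B"
  then show "\<exists>W. open W \<and> w \<in> W \<and> Ck_on r W F"
    using assms Cinf_onD[OF assms(3), of r] Cinf_onD[OF assms(4), of r] by blast
qed

lemma Cinf_on_extend_zero:
  assumes U: "open U" and F: "Cinf_on U F" and K: "closed K" "K \<subseteq> U"
    and zero: "\<And>w. w \<in> U \<Longrightarrow> w \<notin> K \<Longrightarrow> F w = 0"
  shows "Cinf_on UNIV (\<lambda>w. if w \<in> U then F w else 0)"
proof -
  have oK: "open (- K)" using K(1) by blast
  have "Cinf_on U (\<lambda>w. if w \<in> U then F w else 0)"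
    by (rule Cinf_on_cong[OF U _ F]) simp
  moreover have "Cinf_on (- K) (\<lambda>w. if w \<in> U then F w else 0)"
    by (rule Cinf_on_cong[OF oK _ Cinf_on_const[of _ 0]]) (use zero in auto)
  ultimately have "Cinf_on (U \<union> - K) (\<lambda>w. if w \<in> U then F w else 0)"
    by (rule Cinf_on_Un[OF U oK])
  moreover have "U \<union> - K = UNIV" using K(2) by blast
  ultimately show ?thesis by simp
qed

text \<open>Translation invariance: the difference quotients in the direction \<open>v\<close> have integral zero,
  and by the mean value theorem they are dominated by a multiple of the indicator of a ball.\<close>
lemma integral_directional_derivative_eq_0:
  fixes f D :: "'a::euclidean_space \<Rightarrow> real"
  assumes der: "\<And>z. ((\<lambda>t. f (z + t *\<^sub>R v)) has_real_derivative D z) (at 0)"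
    and cf: "continuous_on UNIV f" and cD: "continuous_on UNIV D"
    and K: "compact K" "\<And>z. z \<notin> K \<Longrightarrow> f z = 0"
  shows "integral\<^sup>L lborel D = 0"
proof -
  have oK: "open (- K)" using compact_imp_closed[OF K(1)] by blast
  have D0: "D z = 0" if "z \<notin> K" for z
  proof -
    have "((\<lambda>t::real. 0) has_real_derivative D z) (at 0)"
    proof (rule has_field_derivative_transform_within_open[OF der])
      have "continuous_on UNIV (\<lambda>t::real. z + t *\<^sub>R v)" by (intro continuous_intros)
      from open_vimage[OF oK this] show "open ((\<lambda>t::real. z + t *\<^sub>R v) -` (- K))" .
    qed (use that K(2) in auto)
    then show ?thesis by (rule DERIV_unique) simp
  qed
  have "bounded (D ` K)"
    by (intro compact_imp_bounded compact_continuous_image K(1) continuous_on_subset[OF cD]) auto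
  then obtain b where b: "\<And>z. z \<in> K \<Longrightarrow> \<bar>D z\<bar> \<le> b" by (auto simp: bounded_iff)
  define B where "B = max b 0"
  have B: "\<bar>D z\<bar> \<le> B" for z using b[of z] D0[of z] by (cases "z \<in> K") (auto simp: B_def)
  obtain r where r: "\<And>z. z \<in> K \<Longrightarrow> norm z \<le> r"
    using compact_imp_bounded[OF K(1)] by (auto simp: bounded_iff)
  define h where "h = (\<lambda>m. inverse (real (Suc m)))"
  have h: "0 < h m" "h m \<le> 1" for m by (auto simp: h_def divide_simps)
  have h0: "h \<longlonglongrightarrow> 0" unfolding h_def by (rule LIMSEQ_inverse_real_of_nat)
  define q where "q = (\<lambda>m z. (f (z + h m *\<^sub>R v) - f z) / h m)"
  have "(\<lambda>m. integral\<^sup>L lborel (q m)) \<longlonglongrightarrow> integral\<^sup>L lborel D"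
  proof (rule integral_dominated_convergence[where w="\<lambda>z. B * indicator (cball (0::'a) (r + norm v)) z"])
    show "D \<in> borel_measurable lborel"
      using borel_measurable_continuous_onI[OF cD] by simp
    have qc: "continuous_on UNIV (q m)" for m
      unfolding q_def using h(1)[of m]
      by (intro continuous_intros continuous_on_compose2[OF cf]) auto
    show "q m \<in> borel_measurable lborel" for m
      using borel_measurable_continuous_onI[OF qc[of m]] by simp
    show "integrable lborel (\<lambda>z. B * indicator (cball (0::'a) (r + norm v)) z :: real)"
      using emeasure_bounded_finite[OF bounded_cball, of "0::'a" "r + norm v"]
      by (intro integrable_mult_right integrable_real_indicator) auto
    show "AE z in lborel. (\<lambda>m. q m z) \<longlonglongrightarrow> D z"
    proof (rule AE_I2)
      fix z
      have "((\<lambda>t. (f (z + t *\<^sub>R v) - f z) / t) \<longlongrightarrow> D z) (at 0)"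
        using der[of z] by (simp add: DERIV_def)
      then show "(\<lambda>m. q m z) \<longlonglongrightarrow> D z"
        unfolding q_def
        by (rule filterlim_compose) (use h h0 in \<open>auto simp: filterlim_at less_imp_neq[symmetric]\<close>)
    qed
    show "AE z in lborel. norm (q m z) \<le> B * indicator (cball (0::'a) (r + norm v)) z" for m
    proof (rule AE_I2)
      fix z
      show "norm (q m z) \<le> B * indicator (cball (0::'a) (r + norm v)) z"
      proof (cases "z \<in> cball (0::'a) (r + norm v)")
        case True
        have d: "((\<lambda>s. f (z + s *\<^sub>R v)) has_real_derivative D (z + s *\<^sub>R v)) (at s)" for s
          using der[of "z + s *\<^sub>R v"] DERIV_shift[of "\<lambda>s. f (z + s *\<^sub>R v)" "D (z + s *\<^sub>R v)" 0 s]
          by (simp add: algebra_simps)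
        obtain s where "f (z + h m *\<^sub>R v) - f (z + 0 *\<^sub>R v) = (h m - 0) * D (z + s *\<^sub>R v)"
          using MVT2[OF h(1)[of m] d] by blast
        then have "q m z = D (z + s *\<^sub>R v)" using h(1)[of m] by (simp add: q_def)
        then show ?thesis using True B by simp
      next
        case False
        have "norm z \<le> norm (z + h m *\<^sub>R v) + norm (h m *\<^sub>R v)"
          using norm_triangle_ineq4[of "z + h m *\<^sub>R v" "h m *\<^sub>R v"] by simp
        moreover have "norm (h m *\<^sub>R v) \<le> norm v" using h[of m] by (simp add: mult_left_le_one_le)
        moreover have "norm z > r + norm v" using False by simp
        ultimately have "z + h m *\<^sub>R v \<notin> K" "z \<notin> K" using r norm_ge_zero[of v] by fastforce+
        then show ?thesis using K(2) False by (simp add: q_def)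
      qed
    qed
  qed
  moreover have "integral\<^sup>L lborel (q m) = 0" for m
  proof -
    have fi: "integrable lborel f"
    proof -
      have "integrable lborel (\<lambda>z. indicator K z *\<^sub>R f z)"
        by (rule borel_integrable_compact[OF K(1)]) (rule continuous_on_subset[OF cf], simp)
      moreover have "(\<lambda>z. indicator K z *\<^sub>R f z) = f" using K(2) by (auto simp: indicator_def fun_eq_iff)
      ultimately show ?thesis by simp
    qed
    have fm: "f \<in> borel_measurable borel" using borel_measurable_continuous_onI[OF cf] .
    have tr: "integral\<^sup>L lborel (\<lambda>z. f (z + h m *\<^sub>R v)) = integral\<^sup>L lborel f"
      using integral_distr[of "(+) (h m *\<^sub>R v)" lborel borel f] fm
      by (simp add: lborel_distr_plus add.commute)
    have ti: "integrable lborel (\<lambda>z. f (z + h m *\<^sub>R v))"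
      using integrable_distr_eq[of "(+) (h m *\<^sub>R v)" lborel borel f] fm fi
      by (simp add: lborel_distr_plus add.commute)
    show ?thesis unfolding q_def by (simp add: tr ti fi)
  qed
  ultimately show ?thesis using LIMSEQ_unique[OF _ tendsto_const[of 0]] by simp
qed

lemma integral_partial_deriv_eq_0:
  fixes f :: "real^'k::finite \<Rightarrow> real"
  assumes V: "open V" and f: "Cinf_on V f" and K: "compact K" "K \<subseteq> V"
    and zero: "\<And>z. z \<in> V \<Longrightarrow> z \<notin> K \<Longrightarrow> f z = 0"
  shows "(\<integral>z. indicator K z * partial_deriv i f z \<partial>lborel) = 0"
proof -
  let ?g = "\<lambda>z. if z \<in> V then f z else 0"
  have g: "Cinf_on UNIV ?g" by (rule Cinf_on_extend_zero[OF V f compact_imp_closed[OF K(1)] K(2) zero])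
  have oK: "open (- K)" using compact_imp_closed[OF K(1)] by blast
  have eq: "partial_deriv i ?g z = indicator K z * partial_deriv i f z" for z
  proof (cases "z \<in> K")
    case True
    then show ?thesis using partial_deriv_cong[OF V, of z ?g f i] K(2) by auto
  next
    case False
    then have "partial_deriv i ?g z = partial_deriv i (\<lambda>z. 0) z"
      by (intro partial_deriv_cong[OF oK]) (use zero in auto)
    then show ?thesis using False by simp
  qed
  have "integral\<^sup>L lborel (partial_deriv i ?g) = 0"
  proof (rule integral_directional_derivative_eq_0)
    show "((\<lambda>t. ?g (z + t *\<^sub>R axis i 1)) has_real_derivative partial_deriv i ?g z) (at 0)" for z
      using has_real_derivative_along_axis[of ?g z 0 i] Cinf_on_differentiable[OF g] by simp
  qed (use g K zero in \<open>auto intro: Cinf_on_continuous Cinf_on_partial_deriv\<close>)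
  then show ?thesis by (simp only: eq[abs_def])
qed

text \<open>Boxes with respect to the scale invariant measure \<open>dz dx/x\<close>.\<close>
lemma integral_box_inverse:
  fixes B :: "'a::euclidean_space set"
  assumes "compact B" "0 < a" "a \<le> b"
  shows "integrable lborel (\<lambda>p. indicator (B \<times> {a..b}) p * (1 / snd p))"
    and "(\<integral>p. indicator (B \<times> {a..b}) p * (1 / snd p) \<partial>lborel) = measure lborel B * (ln b - ln a)"
proof -
  have "integrable lborel (\<lambda>p::'a \<times> real. indicator (B \<times> {a..b}) p *\<^sub>R (1 / snd p))"
    by (intro borel_integrable_compact compact_Times assms(1) compact_Icc continuous_intros)
      (use assms(2) in auto)
  then show i: "integrable lborel (\<lambda>p. indicator (B \<times> {a..b}) p * (1 / snd p))" by simp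
  have *: "(\<integral>x. indicator (B \<times> {a..b}) (z, x) * (1 / snd (z, x)) \<partial>lborel) = indicator B z * (ln b - ln a)" for z
  proof -
    have "(\<integral>x. indicator {a..b} x *\<^sub>R (1 / x) \<partial>lborel) = ln b - ln a"
    proof (rule integral_FTC_atLeastAtMost[OF assms(3)])
      show "(ln has_vector_derivative 1 / x) (at x within {a..b})" if "a \<le> x" "x \<le> b" for x
        using that assms(2) DERIV_ln_divide[of x]
        by (auto simp: has_real_derivative_iff_has_vector_derivative[symmetric] intro: has_field_derivative_at_within)
      show "continuous_on {a..b} (\<lambda>x. 1 / x)" using assms(2) by (intro continuous_intros) auto
    qed
    moreover have "(\<lambda>x. indicator (B \<times> {a..b}) (z, x) * (1 / snd (z, x)))
        = (\<lambda>x. indicator B z * (indicator {a..b} x *\<^sub>R (1 / x)))"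
      by (auto simp: indicator_def)
    ultimately show ?thesis by (simp only: integral_mult_right_zero)
  qed
  have "(\<integral>p. indicator (B \<times> {a..b}) p * (1 / snd p) \<partial>lborel)
     = (\<integral>z. (\<integral>x. indicator (B \<times> {a..b}) (z, x) * (1 / snd (z, x)) \<partial>lborel) \<partial>lborel)"
    using lborel_pair.integral_fst'[of "\<lambda>p::'a \<times> real. indicator (B \<times> {a..b}) p * (1 / snd p)"] i
    by (simp only: lborel_prod)
  also have "\<dots> = measure lborel B * (ln b - ln a)"
    unfolding * by simp
  finally show "(\<integral>p. indicator (B \<times> {a..b}) p * (1 / snd p) \<partial>lborel) = measure lborel B * (ln b - ln a)" .
qed

lemma integral_pair_eq_0:
  fixes k :: "'a::euclidean_space \<times> 'b::euclidean_space \<Rightarrow> real"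
  assumes "integrable lborel k"
  shows "(\<And>z. (\<integral>x. k (z, x) \<partial>lborel) = 0) \<Longrightarrow> integral\<^sup>L lborel k = 0"
    and "(\<And>x. (\<integral>z. k (z, x) \<partial>lborel) = 0) \<Longrightarrow> integral\<^sup>L lborel k = 0"
proof -
  have i: "integrable (lborel \<Otimes>\<^sub>M lborel) k" using assms by (simp add: lborel_prod)
  show "integral\<^sup>L lborel k = 0" if "\<And>z. (\<integral>x. k (z, x) \<partial>lborel) = 0"
    using lborel_pair.integral_fst'[OF i] that by (simp add: lborel_prod)
  show "integral\<^sup>L lborel k = 0" if "\<And>x. (\<integral>z. k (z, x) \<partial>lborel) = 0"
    using lborel_pair.integral_snd[of "\<lambda>z x. k (z, x)"] i that by (simp add: lborel_prod)
qed

section \<open>Algebra of the operator on the cylinder\<close>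

lemma cyl_op_cong:
  assumes "open W" "w \<in> W" "\<And>w. w \<in> W \<Longrightarrow> u w = v w"
  shows "cyl_op J H u w = cyl_op J H v w"
proof -
  have pd: "partial_deriv i u w = partial_deriv i v w" if "w \<in> W" for i w
    by (rule partial_deriv_cong[OF assms(1) that assms(3)])
  have 1: "partial_deriv None (\<lambda>w. J w * partial_deriv None u w) w = partial_deriv None (\<lambda>w. J w * partial_deriv None v w) w"
    by (rule partial_deriv_cong[OF assms(1,2)]) (simp add: pd)
  have 2: "partial_deriv (Some i) (\<lambda>w. \<Sum>j\<in>UNIV. J w * H w $ i $ j * partial_deriv (Some j) u w) w
    = partial_deriv (Some i) (\<lambda>w. \<Sum>j\<in>UNIV. J w * H w $ i $ j * partial_deriv (Some j) v w) w" for i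
    by (rule partial_deriv_cong[OF assms(1,2)]) (simp add: pd)
  show ?thesis unfolding cyl_op_def 1 2 pd[OF assms(2)] ..
qed

lemma smooth_bd_cyl_op:
  assumes J: "smooth_bd z J" and H: "\<And>i j. smooth_bd z (\<lambda>w. H w $ i $ j)" and u: "smooth_bd z u"
  shows "smooth_bd z (cyl_op J H u)"
  unfolding cyl_op_def
  by (intro smooth_bd_add smooth_bd_mult smooth_bd_power smooth_bd_sum smooth_bd_const smooth_bd_coordinate smooth_bd_partial_deriv J H u)

locale cyl_coeffs =
  fixes W :: "(real^'n::finite option) set" and J :: "real^'n option \<Rightarrow> real" and H :: "real^'n option \<Rightarrow> real^'n^'n"
  assumes W: "open W" and J: "Cinf_on W J" and H: "\<And>i j. Cinf_on W (\<lambda>w. H w $ i $ j)"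
begin

lemma J_dif: "w \<in> W \<Longrightarrow> J differentiable (at w)"
  and H_dif: "w \<in> W \<Longrightarrow> (\<lambda>w. H w $ i $ j) differentiable (at w)"
  using Cinf_on_differentiable J H by blast+

lemma flux_dif:
  assumes "Cinf_on W u" "w \<in> W"
  shows "(\<lambda>w. J w * partial_deriv None u w) differentiable (at w)"
    and "(\<lambda>w. \<Sum>j\<in>UNIV. J w * H w $ i $ j * partial_deriv (Some j) u w) differentiable (at w)"
  by (intro Cinf_on_differentiable[OF _ assms(2)] Cinf_on_mult[OF W] Cinf_on_sum[OF W] Cinf_on_partial_deriv J H assms(1))+

lemma cyl_op_add:
  assumes u: "Cinf_on W u" and v: "Cinf_on W v" and w: "w \<in> W"
  shows "cyl_op J H (\<lambda>w. u w + v w) w = cyl_op J H u w + cyl_op J H v w"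
proof -
  have pd: "partial_deriv i (\<lambda>w. u w + v w) w = partial_deriv i u w + partial_deriv i v w" if "w \<in> W" for i w
    by (intro partial_deriv_add Cinf_on_differentiable[OF _ that] u v)
  have 1: "partial_deriv None (\<lambda>w. J w * partial_deriv None (\<lambda>w. u w + v w) w) w
    = partial_deriv None (\<lambda>w. J w * partial_deriv None u w) w + partial_deriv None (\<lambda>w. J w * partial_deriv None v w) w"
  proof -
    have "partial_deriv None (\<lambda>w. J w * partial_deriv None (\<lambda>w. u w + v w) w) w
      = partial_deriv None (\<lambda>w. J w * partial_deriv None u w + J w * partial_deriv None v w) w"
      by (rule partial_deriv_cong[OF W w]) (simp add: pd distrib_left)
    then show ?thesis by (simp add: partial_deriv_add flux_dif u v w)
  qed
  have 2: "partial_deriv (Some i) (\<lambda>w. \<Sum>j\<in>UNIV. J w * H w $ i $ j * partial_deriv (Some j) (\<lambda>w. u w + v w) w) w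
    = partial_deriv (Some i) (\<lambda>w. \<Sum>j\<in>UNIV. J w * H w $ i $ j * partial_deriv (Some j) u w) w
      + partial_deriv (Some i) (\<lambda>w. \<Sum>j\<in>UNIV. J w * H w $ i $ j * partial_deriv (Some j) v w) w" for i
  proof -
    have "partial_deriv (Some i) (\<lambda>w. \<Sum>j\<in>UNIV. J w * H w $ i $ j * partial_deriv (Some j) (\<lambda>w. u w + v w) w) w
      = partial_deriv (Some i) (\<lambda>w. (\<Sum>j\<in>UNIV. J w * H w $ i $ j * partial_deriv (Some j) u w)
        + (\<Sum>j\<in>UNIV. J w * H w $ i $ j * partial_deriv (Some j) v w)) w"
      by (rule partial_deriv_cong[OF W w]) (simp add: pd distrib_left sum.distrib)
    then show ?thesis by (simp add: partial_deriv_add flux_dif(2)[OF u w] flux_dif(2)[OF v w])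
  qed
  show ?thesis unfolding cyl_op_def 1 2 pd[OF w] by (simp add: sum.distrib algebra_simps)
qed

text \<open>A factor that depends on \<open>x\<close> alone passes through the tangential part.  On it acts the ordinary
  differential operator \<open>x\<^sup>2 \<partial>\<^sub>x\<^sup>2 + (1 - n) x \<partial>\<^sub>x\<close>, whose indicial roots are \<open>0\<close> and \<open>n\<close>.\<close>
lemma cyl_op_mult_vertical:
  assumes B: "Cinf_on W B" and w: "w \<in> W"
    and L: "\<And>w. w \<in> W \<Longrightarrow> (L has_real_derivative L1 (w $ None)) (at (w $ None))"
    and L1: "(L1 has_real_derivative L2) (at (w $ None))"
  shows "cyl_op J H (\<lambda>w. B w * L (w $ None)) w = L (w $ None) * cyl_op J H B w
    + (w $ None)\<^sup>2 * (J w * partial_deriv None B w + partial_deriv None (\<lambda>w. J w * B w) w) * L1 (w $ None)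
    + J w * B w * ((w $ None)\<^sup>2 * L2 + (1 - real CARD('n)) * (w $ None * L1 (w $ None)))"
proof -
  note dB = Cinf_on_differentiable[OF B]
  have dL: "(\<lambda>w. L (w $ None)) differentiable (at w)"
    "partial_deriv i (\<lambda>w. L (w $ None)) w = (if i = None then L1 (w $ None) else 0)" if "w \<in> W" for i w
    using partial_deriv_compose[where F="\<lambda>w. w $ None", OF L[OF that]] by auto
  have dL1: "(\<lambda>w. L1 (w $ None)) differentiable (at w)"
    "partial_deriv i (\<lambda>w. L1 (w $ None)) w = (if i = None then L2 else 0)" for i
    using partial_deriv_compose[where F="\<lambda>w. w $ None", OF L1] by auto
  have pd: "partial_deriv i (\<lambda>w. B w * L (w $ None)) w
      = partial_deriv i B w * L (w $ None) + (if i = None then B w * L1 (w $ None) else 0)" if "w \<in> W" for i w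
    by (simp add: partial_deriv_mult dB dL that)
  have 1: "partial_deriv None (\<lambda>w. J w * partial_deriv None (\<lambda>w. B w * L (w $ None)) w) w
    = partial_deriv None (\<lambda>w. J w * partial_deriv None B w) w * L (w $ None) + J w * partial_deriv None B w * L1 (w $ None)
      + (partial_deriv None (\<lambda>w. J w * B w) w * L1 (w $ None) + J w * B w * L2)"
  proof -
    have "partial_deriv None (\<lambda>w. J w * partial_deriv None (\<lambda>w. B w * L (w $ None)) w) w
      = partial_deriv None (\<lambda>w. (J w * partial_deriv None B w) * L (w $ None) + (J w * B w) * L1 (w $ None)) w"
      by (rule partial_deriv_cong[OF W w]) (simp add: pd algebra_simps)
    also have "\<dots> = partial_deriv None (\<lambda>w. (J w * partial_deriv None B w) * L (w $ None)) w + partial_deriv None (\<lambda>w. (J w * B w) * L1 (w $ None)) w"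
      by (intro partial_deriv_add differentiable_mult flux_dif(1)[OF B w] dL(1)[OF w] dL1(1) J_dif w dB)
    also have "partial_deriv None (\<lambda>w. (J w * partial_deriv None B w) * L (w $ None)) w
      = partial_deriv None (\<lambda>w. J w * partial_deriv None B w) w * L (w $ None) + J w * partial_deriv None B w * L1 (w $ None)"
      by (simp add: partial_deriv_mult[OF flux_dif(1)[OF B w] dL(1)[OF w]] dL(2)[OF w])
    also have "partial_deriv None (\<lambda>w. (J w * B w) * L1 (w $ None)) w = partial_deriv None (\<lambda>w. J w * B w) w * L1 (w $ None) + J w * B w * L2"
      by (simp add: partial_deriv_mult[OF differentiable_mult[OF J_dif[OF w] dB[OF w]] dL1(1)] dL1(2))
    finally show ?thesis .
  qed
  have 2: "partial_deriv (Some i) (\<lambda>w. \<Sum>j\<in>UNIV. J w * H w $ i $ j * partial_deriv (Some j) (\<lambda>w. B w * L (w $ None)) w) w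
    = L (w $ None) * partial_deriv (Some i) (\<lambda>w. \<Sum>j\<in>UNIV. J w * H w $ i $ j * partial_deriv (Some j) B w) w" for i
  proof -
    have "partial_deriv (Some i) (\<lambda>w. \<Sum>j\<in>UNIV. J w * H w $ i $ j * partial_deriv (Some j) (\<lambda>w. B w * L (w $ None)) w) w
      = partial_deriv (Some i) (\<lambda>w. L (w $ None) * (\<Sum>j\<in>UNIV. J w * H w $ i $ j * partial_deriv (Some j) B w)) w"
      by (rule partial_deriv_cong[OF W w]) (simp add: pd sum_distrib_left mult_ac)
    then show ?thesis by (simp add: partial_deriv_mult[OF dL(1)[OF w] flux_dif(2)[OF B w]] dL(2)[OF w])
  qed
  show ?thesis unfolding cyl_op_def 1 2 pd[OF w]
    by (simp add: sum_distrib_left algebra_simps)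
qed

text \<open>Lagrange's identity: the terms without derivatives of the fluxes cancel by the symmetry of \<open>H\<close>.\<close>
lemma green_identity:
  assumes u: "Cinf_on W u" and v: "Cinf_on W v" and w: "w \<in> W" and sym: "\<And>i j. H w $ i $ j = H w $ j $ i"
  shows "u w * cyl_op J H v w - v w * cyl_op J H u w =
    (w $ None)\<^sup>2 * partial_deriv None (\<lambda>w. J w * (u w * partial_deriv None v w - v w * partial_deriv None u w)) w
    + (1 - real CARD('n)) * (w $ None * (J w * (u w * partial_deriv None v w - v w * partial_deriv None u w)))
    + (w $ None)\<^sup>2 * (\<Sum>i\<in>UNIV. partial_deriv (Some i)
        (\<lambda>w. \<Sum>j\<in>UNIV. J w * H w $ i $ j * (u w * partial_deriv (Some j) v w - v w * partial_deriv (Some j) u w)) w)"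
proof -
  note du = Cinf_on_differentiable[OF u w] and dv = Cinf_on_differentiable[OF v w]
  have 1: "partial_deriv None (\<lambda>w. J w * (u w * partial_deriv None v w - v w * partial_deriv None u w)) w
    = u w * partial_deriv None (\<lambda>w. J w * partial_deriv None v w) w - v w * partial_deriv None (\<lambda>w. J w * partial_deriv None u w) w"
  proof -
    have "(\<lambda>w. J w * (u w * partial_deriv None v w - v w * partial_deriv None u w))
      = (\<lambda>w. u w * (J w * partial_deriv None v w) - v w * (J w * partial_deriv None u w))"
      by (simp add: algebra_simps)
    then show ?thesis
      by (simp add: partial_deriv_diff partial_deriv_mult differentiable_mult du dv flux_dif(1)[OF u w] flux_dif(1)[OF v w])
  qed
  let ?Vu = "\<lambda>i w. \<Sum>j\<in>UNIV. J w * H w $ i $ j * partial_deriv (Some j) u w"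
  let ?Vv = "\<lambda>i w. \<Sum>j\<in>UNIV. J w * H w $ i $ j * partial_deriv (Some j) v w"
  have 2: "partial_deriv (Some i)
        (\<lambda>w. \<Sum>j\<in>UNIV. J w * H w $ i $ j * (u w * partial_deriv (Some j) v w - v w * partial_deriv (Some j) u w)) w
    = partial_deriv (Some i) u w * ?Vv i w - partial_deriv (Some i) v w * ?Vu i w
      + (u w * partial_deriv (Some i) (?Vv i) w - v w * partial_deriv (Some i) (?Vu i) w)" for i
  proof -
    have "(\<lambda>w. \<Sum>j\<in>UNIV. J w * H w $ i $ j * (u w * partial_deriv (Some j) v w - v w * partial_deriv (Some j) u w))
      = (\<lambda>w. u w * ?Vv i w - v w * ?Vu i w)"
      by (simp add: sum_distrib_left sum_subtractf right_diff_distrib mult_ac)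
    moreover have "partial_deriv (Some i) (\<lambda>w. u w * ?Vv i w - v w * ?Vu i w) w
       = partial_deriv (Some i) (\<lambda>w. u w * ?Vv i w) w - partial_deriv (Some i) (\<lambda>w. v w * ?Vu i w) w"
      by (intro partial_deriv_diff differentiable_mult du dv flux_dif u v w)
    moreover have "partial_deriv (Some i) (\<lambda>w. u w * ?Vv i w) w = partial_deriv (Some i) u w * ?Vv i w + u w * partial_deriv (Some i) (?Vv i) w"
      by (intro partial_deriv_mult du flux_dif v w)
    moreover have "partial_deriv (Some i) (\<lambda>w. v w * ?Vu i w) w = partial_deriv (Some i) v w * ?Vu i w + v w * partial_deriv (Some i) (?Vu i) w"
      by (intro partial_deriv_mult dv flux_dif u w)
    ultimately show ?thesis by simp
  qed
  have 3: "(\<Sum>i\<in>UNIV. partial_deriv (Some i) u w * ?Vv i w) = (\<Sum>i\<in>UNIV. partial_deriv (Some i) v w * ?Vu i w)"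
  proof -
    have "(\<Sum>i\<in>UNIV. partial_deriv (Some i) u w * ?Vv i w)
      = (\<Sum>i\<in>UNIV. \<Sum>j\<in>UNIV. J w * H w $ i $ j * partial_deriv (Some i) u w * partial_deriv (Some j) v w)"
      by (simp add: sum_distrib_left mult_ac)
    also have "\<dots> = (\<Sum>j\<in>UNIV. \<Sum>i\<in>UNIV. J w * H w $ i $ j * partial_deriv (Some i) u w * partial_deriv (Some j) v w)"
      by (rule sum.swap)
    also have "\<dots> = (\<Sum>i\<in>UNIV. partial_deriv (Some i) v w * ?Vu i w)"
      using sym by (simp add: sum_distrib_left mult_ac)
    finally show ?thesis .
  qed
  have 4: "(\<Sum>i\<in>UNIV. partial_deriv (Some i) u w * ?Vv i w - partial_deriv (Some i) v w * ?Vu i w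
      + (u w * partial_deriv (Some i) (?Vv i) w - v w * partial_deriv (Some i) (?Vu i) w))
    = u w * (\<Sum>i\<in>UNIV. partial_deriv (Some i) (?Vv i) w) - v w * (\<Sum>i\<in>UNIV. partial_deriv (Some i) (?Vu i) w)"
    unfolding sum.distrib sum_subtractf 3 sum_distrib_left[symmetric] by simp
  show ?thesis unfolding cyl_op_def 1 2 4 by (simp add: algebra_simps)
qed

end

section \<open>A weak solution argument\<close>

text \<open>A smooth function supported on the interval from \<open>-2\<close> to \<open>-1\<close>, and its first two derivatives.
  Cutoffs in the normal direction are \<open>profile (log x / N)\<close>.\<close>
definition profile :: "real \<Rightarrow> real" where "profile t = flat 0 ((t + 2) * (- 1 - t))"
definition profile1 :: "real \<Rightarrow> real" where "profile1 t = flat 2 ((t + 2) * (- 1 - t)) * (- 2 * t - 3)"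
definition profile2 :: "real \<Rightarrow> real"
  where "profile2 t = (flat 4 ((t + 2) * (- 1 - t)) - 2 * flat 3 ((t + 2) * (- 1 - t))) * (- 2 * t - 3)\<^sup>2
    - 2 * flat 2 ((t + 2) * (- 1 - t))"

lemma profile_deriv: "(profile has_real_derivative profile1 t) (at t)"
  and profile1_deriv: "(profile1 has_real_derivative profile2 t) (at t)"
proof -
  have q: "((\<lambda>t. (t + 2) * (- 1 - t)) has_real_derivative - 2 * t - 3) (at t)" for t :: real
    by (auto intro!: derivative_eq_intros)
  have f: "((\<lambda>t. flat m ((t + 2) * (- 1 - t))) has_real_derivative
      (flat (m + 2) ((t + 2) * (- 1 - t)) - real m * flat (m + 1) ((t + 2) * (- 1 - t))) * (- 2 * t - 3)) (at t)" for m t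
    by (rule DERIV_chain2[OF flat_has_derivative q])
  show "(profile has_real_derivative profile1 t) (at t)"
    using f[of 0 t] unfolding profile_def[abs_def] profile1_def by (simp add: numeral_2_eq_2)
  show "(profile1 has_real_derivative profile2 t) (at t)"
    unfolding profile1_def[abs_def] profile2_def
    by (rule derivative_eq_intros f refl)+ (simp add: algebra_simps power2_eq_square numeral_eq_Suc)
qed

lemma isCont_flat: "isCont (flat m) t"
  using flat_has_derivative DERIV_isCont by blast

lemma profile_bounded:
  obtains B where "B > 0" "\<And>t. t \<in> {-2..-1} \<Longrightarrow> \<bar>profile t\<bar> \<le> B \<and> \<bar>profile1 t\<bar> \<le> B \<and> \<bar>profile2 t\<bar> \<le> B"
proof -
  have fl: "continuous_on {-2..-1} (\<lambda>t. flat m ((t + 2) * (- 1 - t)))" for m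
    by (rule continuous_on_compose2[of UNIV "flat m"])
      (auto intro!: continuous_intros continuous_at_imp_continuous_on isCont_flat)
  have c: "continuous_on {-2..-1} (\<lambda>t. \<bar>profile t\<bar> + \<bar>profile1 t\<bar> + \<bar>profile2 t\<bar>)"
    unfolding profile_def profile1_def profile2_def by (intro continuous_intros fl)
  have "bounded ((\<lambda>t. \<bar>profile t\<bar> + \<bar>profile1 t\<bar> + \<bar>profile2 t\<bar>) ` {-2..-1})"
    by (intro compact_imp_bounded compact_continuous_image c) simp
  then obtain B where B': "\<forall>y\<in>(\<lambda>t. \<bar>profile t\<bar> + \<bar>profile1 t\<bar> + \<bar>profile2 t\<bar>) ` {-2..-1}. norm y \<le> B"
    unfolding bounded_iff by blast
  have B: "\<bar>\<bar>profile t\<bar> + \<bar>profile1 t\<bar> + \<bar>profile2 t\<bar>\<bar> \<le> B" if "t \<in> {-2..-1}" for t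
    using B' that by (auto simp del: abs_of_nonneg)
  show ?thesis
  proof (rule that[of "\<bar>B\<bar> + 1"])
    fix t :: real assume "t \<in> {-2..-1}"
    from B[OF this] show "\<bar>profile t\<bar> \<le> \<bar>B\<bar> + 1 \<and> \<bar>profile1 t\<bar> \<le> \<bar>B\<bar> + 1 \<and> \<bar>profile2 t\<bar> \<le> \<bar>B\<bar> + 1"
      by linarith
  qed simp
qed

lemma profile_zero: "profile (-2) = 0" "profile (-1) = 0" "profile1 (-2) = 0" "profile1 (-1) = 0"
  by (simp_all add: profile_def profile1_def)

lemma profile_nonneg: "profile t \<ge> 0"
  by (simp add: profile_def flat_nonneg)

lemma ln_le_of_le_exp: "0 < x \<Longrightarrow> x \<le> exp t \<Longrightarrow> ln x \<le> t" for x t :: real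
  using ln_mono[of x "exp t"] by simp

lemma flat_0_mono: "s \<le> t \<Longrightarrow> flat 0 s \<le> flat 0 t"
  by (auto simp: flat_def le_imp_inverse_le)

lemma flat_0_le_1: "flat 0 t \<le> 1"
  by (auto simp: flat_def)

lemma profile_lower:
  assumes "t \<in> {- 7 / 4 .. - 5 / 4}"
  shows "profile t \<ge> flat 0 (3 / 16)"
  unfolding profile_def
proof (rule flat_0_mono)
  have "(t + 7 / 4) * (t + 5 / 4) \<le> 0" using assms by (intro mult_nonneg_nonpos) auto
  then show "3 / 16 \<le> (t + 2) * (- 1 - t)" by (simp add: algebra_simps)
qed

text \<open>A function of the square of the distance, hence smooth also at the centre.\<close>
definition bump :: "real^'n::finite \<Rightarrow> real \<Rightarrow> real^'n \<Rightarrow> real"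
  where "bump z0 r z = flat 0 (r\<^sup>2 - (dist z z0)\<^sup>2)"

lemma dist_square_sum: "(dist z z0)\<^sup>2 = (\<Sum>j\<in>UNIV. (z $ j - z0 $ j)\<^sup>2)" for z z0 :: "real^'n::finite"
  by (simp add: dist_vec_def L2_set_def sum_nonneg dist_real_def)

lemma bump_pos_iff: "r > 0 \<Longrightarrow> bump z0 r z > 0 \<longleftrightarrow> dist z z0 < r"
proof -
  assume r: "r > 0"
  have "bump z0 r z > 0 \<longleftrightarrow> r\<^sup>2 - (dist z z0)\<^sup>2 > 0" by (simp add: bump_def flat_def)
  also have "\<dots> \<longleftrightarrow> dist z z0 < r" using r
    using power_strict_mono[of "dist z z0" r 2] power2_less_imp_less[of "dist z z0" r] by auto
  finally show ?thesis .
qed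

lemma bump_zero_iff: "r > 0 \<Longrightarrow> bump z0 r z = 0 \<longleftrightarrow> r \<le> dist z z0"
  using bump_pos_iff[of r z0 z] flat_nonneg[of 0 "r\<^sup>2 - (dist z z0)\<^sup>2"] by (auto simp: bump_def)

lemma abs_sum_le_card:
  fixes f :: "'n::finite \<Rightarrow> real"
  assumes "\<And>i. \<bar>f i\<bar> \<le> K"
  shows "\<bar>\<Sum>i\<in>UNIV. f i\<bar> \<le> real CARD('n) * K"
proof -
  have "\<bar>\<Sum>i\<in>UNIV. f i\<bar> \<le> (\<Sum>i\<in>UNIV. \<bar>f i\<bar>)" by (rule sum_abs)
  also have "\<dots> \<le> real CARD('n) * K" by (rule sum_bounded_above) (rule assms)
  finally show ?thesis .
qed

text \<open>The inequality \<open>\<sigma> x\<^sup>n \<le> - s L R\<close> is tested against cutoffs \<open>\<Phi>\<close> supported in the long logarithmic range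
  \<open>e\<^sup>-\<^sup>2\<^sup>N \<le> x \<le> e\<^sup>-\<^sup>N\<close>, with respect to the measure \<open>x\<^sup>-\<^sup>n\<^sup>-\<^sup>1 dx dz\<close>, for which \<open>L\<close> is symmetric.  The left side
  is an integral against \<open>dx/x\<close> and grows like \<open>N\<close>.  On the right \<open>L\<close> is moved to the cutoff: a
  function of \<open>log x / N\<close> loses a factor \<open>1/N\<close> under \<open>x \<partial>\<^sub>x\<close>, and the tangential
  part of \<open>L\<close> carries the factor \<open>x\<^sup>2 \<le> 1/N\<close>; so \<open>L \<Phi> = O(1/N)\<close>, and with
  \<open>R = O(x\<^sup>n)\<close> the right side stays bounded.  No derivative of \<open>R\<close> is estimated.\<close>
lemma no_residual_of_one_sign:
  fixes J R :: "real^'n::finite option \<Rightarrow> real" and H :: "real^'n option \<Rightarrow> real^'n^'n" and z0 :: "real^'n"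
  assumes e: "0 < e" "e \<le> 1"
  defines "U \<equiv> cyl z0 e \<inter> {w. w $ None > 0}"
  assumes J: "Cinf_on U J" and H: "\<And>i j. Cinf_on U (\<lambda>w. H w $ i $ j)"
    and Hsym: "\<And>w i j. w \<in> U \<Longrightarrow> H w $ i $ j = H w $ j $ i"
    and R: "Cinf_on U R" and Rb: "\<And>w. w \<in> U \<Longrightarrow> \<bar>R w\<bar> \<le> C * (w $ None) ^ CARD('n)"
    and lower: "\<And>w. w \<in> U \<Longrightarrow> \<sigma> * (w $ None) ^ CARD('n) \<le> - s * cyl_op J H R w"
    and \<sigma>: "\<sigma> > 0" and s: "\<bar>s\<bar> = 1"
    and M: "\<And>w. w \<in> U \<Longrightarrow> \<bar>J w\<bar> \<le> M" "\<And>w. w \<in> U \<Longrightarrow> \<bar>partial_deriv None J w\<bar> \<le> M"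
      "\<And>w i j. w \<in> U \<Longrightarrow> \<bar>J w * H w $ i $ j\<bar> \<le> M"
      "\<And>w i j. w \<in> U \<Longrightarrow> \<bar>partial_deriv (Some i) (\<lambda>w. J w * H w $ i $ j) w\<bar> \<le> M"
  shows False
proof -
  define n where "n = CARD('n)"
  have n: "n \<ge> 1" by (simp add: n_def Suc_leI)
  have U: "open U" unfolding U_def by (intro open_Int open_cyl open_Collect_less continuous_intros)
  interpret cyl_coeffs U J H by unfold_locales (fact U J H)+
  have inU: "pt z x \<in> U" if "dist z z0 < e" "0 < x" "x < e" for z x using that by (simp add: U_def)
  define r where "r = e / 2"
  have r: "0 < r" "r < e" using e by (auto simp: r_def)
  have M0: "M \<ge> 0" using M(1)[OF inU[of z0 "e/2"]] e by simp
  have C0: "C \<ge> 0"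
  proof -
    have "0 \<le> C * (e / 2) ^ CARD('n)" using Rb[OF inU[of z0 "e/2"]] e by simp
    moreover have "(e / 2) ^ CARD('n) > 0" using e by simp
    ultimately show ?thesis by (simp only: zero_le_mult_iff) linarith
  qed

  \<comment> \<open>The spatial cutoff and bounds for its derivatives.\<close>
  define q where "q = (\<lambda>w :: real^'n option. r\<^sup>2 - (\<Sum>j\<in>UNIV. (w $ Some j - z0 $ j)\<^sup>2))"
  define F where "F = (\<lambda>w. flat 0 (q w))"
  have q_eq: "q w = r\<^sup>2 - (dist (base w) z0)\<^sup>2" for w
    unfolding q_def by (simp add: dist_square_sum base_def)
  have q: "Cinf_on UNIV q" unfolding q_def power2_eq_square
    by (intro Cinf_on_diff Cinf_on_mult Cinf_on_sum Cinf_on_const Cinf_on_coordinate open_UNIV)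
  have F: "Cinf_on UNIV F" unfolding F_def by (rule Cinf_on_flat[OF open_UNIV q])
  have FU: "Cinf_on U F" by (rule Cinf_on_subset[OF F]) simp
  have F01: "0 \<le> F w" "F w \<le> 1" for w by (simp_all add: F_def flat_nonneg flat_0_le_1)
  have dF: "partial_deriv i F w = flat 2 (q w) * partial_deriv i q w" for i w
    unfolding F_def
    using partial_deriv_compose(1)[where F=q and i=i, OF flat_has_derivative[of 0 "q w"] Cinf_on_differentiable[OF q UNIV_I]]
    by (simp add: numeral_2_eq_2)
  have Foff: "F w = 0" "partial_deriv i F w = 0" if "r \<le> dist (base w) z0" for i w
  proof -
    have "r\<^sup>2 \<le> (dist (base w) z0)\<^sup>2" using that r by (intro power_mono) auto
    then have "q w \<le> 0" by (simp add: q_eq)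
    then show "F w = 0" "partial_deriv i F w = 0" by (simp_all add: dF) (simp add: F_def)
  qed
  have FNone: "partial_deriv None F w = 0" for w
  proof -
    have "((\<lambda>x. F (pt (base w) x)) has_real_derivative partial_deriv None F (pt (base w) (w $ None))) (at (w $ None))"
      by (rule partial_deriv_vertical[OF Cinf_on_differentiable[OF F UNIV_I]])
    moreover have "(\<lambda>x. F (pt (base w) x)) = (\<lambda>x. F w)" by (simp add: F_def q_eq)
    ultimately show ?thesis by (simp add: pt_base) (metis DERIV_const DERIV_unique)
  qed
  define g where "g = (\<lambda>w. (\<Sum>j\<in>UNIV. \<bar>partial_deriv (Some j) F w\<bar>)
      + (\<Sum>i\<in>UNIV. \<Sum>j\<in>UNIV. \<bar>partial_deriv (Some i) (partial_deriv (Some j) F) w\<bar>))"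
  obtain M1 where M1: "M1 \<ge> 0" "\<And>z x. dist z z0 \<le> r \<Longrightarrow> 0 \<le> x \<Longrightarrow> x \<le> 1 \<Longrightarrow> g (pt z x) \<le> M1"
  proof -
    have "continuous_on UNIV g" unfolding g_def
      by (intro continuous_intros Cinf_on_continuous Cinf_on_partial_deriv F)
    then have "continuous_on (cball z0 r \<times> {0..1}) (\<lambda>p. g (pt (fst p) (snd p)))"
      by (rule continuous_on_compose2) (auto intro!: continuous_intros)
    then have "bounded ((\<lambda>p. g (pt (fst p) (snd p))) ` (cball z0 r \<times> {0..1}))"
      by (intro compact_imp_bounded compact_continuous_image compact_Times) auto
    then obtain B where B': "\<forall>y\<in>(\<lambda>p. g (pt (fst p) (snd p))) ` (cball z0 r \<times> {0..1}). norm y \<le> B"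
      unfolding bounded_iff by blast
    have B: "\<bar>g (pt (fst p) (snd p))\<bar> \<le> B" if "p \<in> cball z0 r \<times> {0..1}" for p
      using B'[rule_format, OF imageI[OF that]] by simp
    show ?thesis
    proof (rule that[of "\<bar>B\<bar>"])
      fix z x assume "dist z z0 \<le> r" "0 \<le> x" "x \<le> (1::real)"
      then show "g (pt z x) \<le> \<bar>B\<bar>" using B[of "(z, x)"] by (simp add: dist_commute)
    qed simp
  qed
  have gj: "\<bar>partial_deriv (Some j) F w\<bar> \<le> g w" and gij: "\<bar>partial_deriv (Some i) (partial_deriv (Some j) F) w\<bar> \<le> g w" for i j w
  proof -
    have "\<bar>partial_deriv (Some j) F w\<bar> \<le> (\<Sum>j\<in>UNIV. \<bar>partial_deriv (Some j) F w\<bar>)"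
      by (rule member_le_sum) auto
    moreover have "\<bar>partial_deriv (Some i) (partial_deriv (Some j) F) w\<bar> \<le> (\<Sum>j\<in>UNIV. \<bar>partial_deriv (Some i) (partial_deriv (Some j) F) w\<bar>)"
      by (rule member_le_sum) auto
    moreover have "\<dots> \<le> (\<Sum>i\<in>UNIV. \<Sum>j\<in>UNIV. \<bar>partial_deriv (Some i) (partial_deriv (Some j) F) w\<bar>)"
      by (rule member_le_sum[where f="\<lambda>i. \<Sum>j\<in>UNIV. \<bar>partial_deriv (Some i) (partial_deriv (Some j) F) w\<bar>"]) (auto intro: sum_nonneg)
    moreover have "0 \<le> (\<Sum>i\<in>UNIV. \<Sum>j\<in>UNIV. \<bar>partial_deriv (Some i) (partial_deriv (Some j) F) w\<bar>)"
      "0 \<le> (\<Sum>j\<in>UNIV. \<bar>partial_deriv (Some j) F w\<bar>)"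
      by (auto intro!: sum_nonneg)
    ultimately show "\<bar>partial_deriv (Some j) F w\<bar> \<le> g w"
      "\<bar>partial_deriv (Some i) (partial_deriv (Some j) F) w\<bar> \<le> g w" unfolding g_def by linarith+
  qed
  have LF: "\<bar>cyl_op J H F (pt z x)\<bar> \<le> x\<^sup>2 * (real n * (real n * (2 * M * M1)))"
    if z: "dist z z0 \<le> r" and x: "0 < x" "x < e" for z x
  proof -
    let ?w = "pt z x"
    have w: "?w \<in> U" using z x r by (intro inU) auto
    have g: "g ?w \<le> M1" using M1(2)[OF z] x e by simp
    have eq: "cyl_op J H F ?w = x\<^sup>2 * (\<Sum>i\<in>UNIV. \<Sum>j\<in>UNIV. partial_deriv (Some i) (\<lambda>w. J w * H w $ i $ j) ?w * partial_deriv (Some j) F ?w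
        + (J ?w * H ?w $ i $ j) * partial_deriv (Some i) (partial_deriv (Some j) F) ?w)"
    proof -
      have "partial_deriv (Some i) (\<lambda>w. \<Sum>j\<in>UNIV. J w * H w $ i $ j * partial_deriv (Some j) F w) ?w
        = (\<Sum>j\<in>UNIV. partial_deriv (Some i) (\<lambda>w. J w * H w $ i $ j * partial_deriv (Some j) F w) ?w)" for i
        by (intro partial_deriv_sum Cinf_on_differentiable[OF _ w] Cinf_on_mult[OF U] Cinf_on_partial_deriv FU J H)
      moreover have "partial_deriv (Some i) (\<lambda>w. J w * H w $ i $ j * partial_deriv (Some j) F w) ?w
        = partial_deriv (Some i) (\<lambda>w. J w * H w $ i $ j) ?w * partial_deriv (Some j) F ?w
        + (J ?w * H ?w $ i $ j) * partial_deriv (Some i) (partial_deriv (Some j) F) ?w" for i j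
        by (intro partial_deriv_mult Cinf_on_differentiable[OF _ w] Cinf_on_mult[OF U] Cinf_on_partial_deriv FU J H)
      ultimately show ?thesis unfolding cyl_op_def by (simp add: FNone)
    qed
    have "\<bar>\<Sum>i\<in>UNIV. \<Sum>j\<in>UNIV. partial_deriv (Some i) (\<lambda>w. J w * H w $ i $ j) ?w * partial_deriv (Some j) F ?w
        + (J ?w * H ?w $ i $ j) * partial_deriv (Some i) (partial_deriv (Some j) F) ?w\<bar> \<le> real n * (real n * (2 * M * M1))"
      unfolding n_def
    proof (rule abs_sum_le_card, rule abs_sum_le_card)
      fix i j
      have "\<bar>partial_deriv (Some i) (\<lambda>w. J w * H w $ i $ j) ?w * partial_deriv (Some j) F ?w\<bar> \<le> M * M1"
        unfolding abs_mult using M(4)[OF w] gj[of j ?w] g M0 by (intro mult_mono) auto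
      moreover have "\<bar>(J ?w * H ?w $ i $ j) * partial_deriv (Some i) (partial_deriv (Some j) F) ?w\<bar> \<le> M * M1"
        unfolding abs_mult[of "J ?w * H ?w $ i $ j"] using M(3)[OF w] gij[of i j ?w] g M0 by (intro mult_mono) auto
      ultimately show "\<bar>partial_deriv (Some i) (\<lambda>w. J w * H w $ i $ j) ?w * partial_deriv (Some j) F ?w
        + (J ?w * H ?w $ i $ j) * partial_deriv (Some i) (partial_deriv (Some j) F) ?w\<bar> \<le> 2 * M * M1" by linarith
    qed
    then show ?thesis unfolding eq abs_mult[of "x\<^sup>2"] abs_power2 by (intro mult_left_mono) auto
  qed

  obtain B where B: "B > 0" "\<And>t. t \<in> {-2..-1} \<Longrightarrow> \<bar>profile t\<bar> \<le> B \<and> \<bar>profile1 t\<bar> \<le> B \<and> \<bar>profile2 t\<bar> \<le> B"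
    using profile_bounded by blast
  define C3 where "C3 = B * (real n * (real n * (2 * M * M1))) + M * B + (M * (B + real n * B))"
  have C3: "C3 \<ge> 0" unfolding C3_def using B(1) M0 M1(1) by simp
  define c where "c = \<sigma> * (flat 0 (3 / 4 * r\<^sup>2) * flat 0 (3 / 16))"
  have c: "c > 0" unfolding c_def using \<sigma> r by (intro mult_pos_pos flat_pos) auto
  define vol where "vol = measure lborel (cball z0 r)"
  define vol' where "vol' = measure lborel (cball z0 (r / 2))"
  have vol': "vol' > 0" unfolding vol'_def using r by (intro content_cball_pos) simp

  have main: "c * (vol' * (N / 2)) \<le> C * C3 * vol" if N: "N \<ge> 1" "exp (- N) < e" for N
  proof -
    \<comment> \<open>Between \<open>a\<close> and \<open>b\<close> the variable \<open>log x / N\<close> runs through the support of the profile.\<close>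
    define a where "a = exp (- 2 * N)"
    define b where "b = exp (- N)"
    have ab: "0 < a" "a < b" "b < e" using N by (auto simp: a_def b_def)
    have bN: "b \<le> 1 / N"
    proof -
      have "N \<le> exp N" using exp_ge_add_one_self[of N] by linarith
      then show ?thesis using N by (simp add: b_def exp_minus field_simps)
    qed
    define L where "L = (\<lambda>x. profile (ln x / N))"
    define L1 where "L1 = (\<lambda>x. profile1 (ln x / N) / (N * x))"
    have lnN: "((\<lambda>x. ln x / N) has_real_derivative 1 / (N * x)) (at x)" if "x > 0" for x
      using that N by (auto intro!: derivative_eq_intros)
    have dL: "(L has_real_derivative L1 x) (at x)" if "x > 0" for x
      unfolding L_def L1_def using DERIV_chain2[OF profile_deriv lnN[OF that]] by simp
    have dL1: "(L1 has_real_derivative (profile2 (ln x / N) / N\<^sup>2 - profile1 (ln x / N) / N) / x\<^sup>2) (at x)" if "x > 0" for x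
    proof -
      have "((\<lambda>x. profile1 (ln x / N) / (N * x)) has_real_derivative
        (profile2 (ln x / N) * (1 / (N * x)) * (N * x) - profile1 (ln x / N) * N) / ((N * x) * (N * x))) (at x)"
        using that N by (intro DERIV_divide DERIV_chain2[OF profile1_deriv lnN[OF that]]) (auto intro!: derivative_eq_intros)
      moreover have "(profile2 (ln x / N) * (1 / (N * x)) * (N * x) - profile1 (ln x / N) * N) / ((N * x) * (N * x))
        = (profile2 (ln x / N) / N\<^sup>2 - profile1 (ln x / N) / N) / x\<^sup>2"
        using that N by (simp add: field_simps power2_eq_square)
      ultimately show ?thesis unfolding L1_def by simp
    qed
    define \<Phi> where "\<Phi> = (\<lambda>w. F w * L (w $ None))"
    have LC: "Cinf_on U (\<lambda>w. L (w $ None))" unfolding L_def profile_def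
      by (intro Cinf_on_flat[OF U] Cinf_on_mult[OF U] Cinf_on_add[OF U] Cinf_on_diff[OF U] Cinf_on_divide[OF U]
          Cinf_on_ln[OF U] Cinf_on_const Cinf_on_coordinate) (use N in \<open>auto simp: U_def\<close>)
    have \<Phi>: "Cinf_on U \<Phi>" unfolding \<Phi>_def by (rule Cinf_on_mult[OF U FU LC])
    have d\<Phi>: "partial_deriv i \<Phi> w = partial_deriv i F w * L (w $ None) + (if i = None then F w * L1 (w $ None) else 0)"
      if "w \<in> U" for i w
    proof -
      have "w $ None > 0" using that by (simp add: U_def)
      from partial_deriv_compose[where F="\<lambda>w. w $ None", OF dL[OF this]]
      have "(\<lambda>w. L (w $ None)) differentiable (at w)"
        "partial_deriv i (\<lambda>w. L (w $ None)) w = (if i = None then L1 (w $ None) else 0)" by auto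
      then show ?thesis unfolding \<Phi>_def using partial_deriv_mult[OF Cinf_on_differentiable[OF FU that]] by simp
    qed
    have \<Phi>0: "\<Phi> w \<ge> 0" for w unfolding \<Phi>_def L_def by (intro mult_nonneg_nonneg F01 profile_nonneg)
    have ln_range: "ln x / N \<in> {-2..-1}" if "a \<le> x" "x \<le> b" for x
    proof -
      have "x > 0" using that ab by linarith
      then have "- 2 * N \<le> ln x" "ln x \<le> - N"
        using that ln_ge_iff[of x "- 2 * N"] ln_le_of_le_exp[of x "- N"] by (simp_all add: a_def b_def)
      then show ?thesis using N by (simp add: field_simps)
    qed
    have L\<Phi>: "\<bar>cyl_op J H \<Phi> (pt z x)\<bar> \<le> C3 / N" if z: "dist z z0 \<le> r" and x: "a \<le> x" "x \<le> b" for z x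
    proof -
      let ?w = "pt z x" and ?t = "ln x / N"
      have x0: "0 < x" "x < e" "x \<le> 1" using x ab e by linarith+
      have w: "?w \<in> U" using z x0 r by (intro inU) auto
      have t: "\<bar>profile ?t\<bar> \<le> B" "\<bar>profile1 ?t\<bar> \<le> B" "\<bar>profile2 ?t\<bar> \<le> B" using B(2)[OF ln_range[OF x]] by auto
      have xN: "x \<le> 1 / N" using x bN by linarith
      have x2N: "x\<^sup>2 \<le> 1 / N"
      proof -
        have "x * x \<le> x * 1" using x0 by (intro mult_left_mono) auto
        then show ?thesis using xN by (simp only: power2_eq_square mult_1_right)
      qed
      have "cyl_op J H \<Phi> ?w = L x * cyl_op J H F ?w
        + x\<^sup>2 * (J ?w * partial_deriv None F ?w + partial_deriv None (\<lambda>w. J w * F w) ?w) * L1 x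
        + J ?w * F ?w * (x\<^sup>2 * ((profile2 ?t / N\<^sup>2 - profile1 ?t / N) / x\<^sup>2) + (1 - real CARD('n)) * (x * L1 x))"
        unfolding \<Phi>_def using cyl_op_mult_vertical[OF FU w, of L L1] dL dL1[OF x0(1)] by (simp add: U_def)
      also have "partial_deriv None (\<lambda>w. J w * F w) ?w = partial_deriv None J ?w * F ?w"
        by (simp add: partial_deriv_mult J_dif[OF w] Cinf_on_differentiable[OF FU w] FNone)
      also have "x\<^sup>2 * ((profile2 ?t / N\<^sup>2 - profile1 ?t / N) / x\<^sup>2) = profile2 ?t / N\<^sup>2 - profile1 ?t / N"
        using x0 by simp
      also have "x * L1 x = profile1 ?t / N" unfolding L1_def using x0 by simp
      also have "x\<^sup>2 * (J ?w * partial_deriv None F ?w + partial_deriv None J ?w * F ?w) * L1 x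
         = x * (partial_deriv None J ?w * F ?w) * (profile1 ?t / N)"
        unfolding L1_def FNone using x0 by (simp add: power2_eq_square)
      finally have eq: "cyl_op J H \<Phi> ?w = profile ?t * cyl_op J H F ?w
         + x * (partial_deriv None J ?w * F ?w) * (profile1 ?t / N)
         + J ?w * F ?w * (profile2 ?t / N\<^sup>2 - real n * profile1 ?t / N)"
        unfolding L_def n_def by (simp add: algebra_simps diff_divide_distrib)
      have 1: "\<bar>profile ?t * cyl_op J H F ?w\<bar> \<le> B * (real n * (real n * (2 * M * M1))) / N"
      proof -
        have "\<bar>cyl_op J H F ?w\<bar> \<le> x\<^sup>2 * (real n * (real n * (2 * M * M1)))" by (rule LF[OF z x0(1,2)])
        also have "\<dots> \<le> 1 / N * (real n * (real n * (2 * M * M1)))"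
          using x2N M0 M1(1) by (intro mult_right_mono) auto
        finally have "\<bar>profile ?t\<bar> * \<bar>cyl_op J H F ?w\<bar> \<le> B * (1 / N * (real n * (real n * (2 * M * M1))))"
          using t(1) B(1) by (intro mult_mono) auto
        then show ?thesis by (simp add: abs_mult mult_ac)
      qed
      have 2: "\<bar>x * (partial_deriv None J ?w * F ?w) * (profile1 ?t / N)\<bar> \<le> M * B / N"
      proof -
        have "\<bar>partial_deriv None J ?w * F ?w\<bar> \<le> M * 1"
          unfolding abs_mult using M(2)[OF w] F01[of ?w] M0 by (intro mult_mono) auto
        then have "\<bar>x\<bar> * \<bar>partial_deriv None J ?w * F ?w\<bar> \<le> 1 * (M * 1)" using x0 by (intro mult_mono) auto
        moreover have "\<bar>profile1 ?t / N\<bar> \<le> B / N" using t(2) N by (simp add: divide_right_mono)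
        ultimately have "(\<bar>x\<bar> * \<bar>partial_deriv None J ?w * F ?w\<bar>) * \<bar>profile1 ?t / N\<bar> \<le> (1 * (M * 1)) * (B / N)"
          by (rule mult_mono) (use M0 in auto)
        then show ?thesis by (simp add: abs_mult)
      qed
      have 3: "\<bar>J ?w * F ?w * (profile2 ?t / N\<^sup>2 - real n * profile1 ?t / N)\<bar> \<le> M * (B + real n * B) / N"
      proof -
        have "\<bar>J ?w * F ?w\<bar> \<le> M * 1"
          unfolding abs_mult using M(1)[OF w] F01[of ?w] M0 by (intro mult_mono) auto
        moreover have "\<bar>profile2 ?t / N\<^sup>2 - real n * profile1 ?t / N\<bar> \<le> (B + real n * B) / N"
        proof -
          have "\<bar>profile2 ?t / N\<^sup>2\<bar> \<le> B / N"
          proof -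
            have "N \<le> N\<^sup>2" using N by (simp add: power2_eq_square)
            then have "\<bar>profile2 ?t\<bar> / N\<^sup>2 \<le> B / N" using t(3) B(1) N by (intro frac_le) auto
            then show ?thesis by simp
          qed
          moreover have "\<bar>real n * profile1 ?t / N\<bar> \<le> real n * B / N"
            using t(2) N by (simp add: abs_mult divide_right_mono mult_left_mono)
          ultimately show ?thesis unfolding add_divide_distrib by linarith
        qed
        ultimately have "\<bar>J ?w * F ?w\<bar> * \<bar>profile2 ?t / N\<^sup>2 - real n * profile1 ?t / N\<bar> \<le> (M * 1) * ((B + real n * B) / N)"
          using M0 by (intro mult_mono) auto
        then show ?thesis by (simp only: abs_mult[of "J ?w * F ?w"] mult_1_right times_divide_eq_right)
      qed
      have "\<bar>cyl_op J H \<Phi> ?w\<bar> \<le> B * (real n * (real n * (2 * M * M1))) / N + M * B / N + M * (B + real n * B) / N"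
        unfolding eq using 1 2 3 by linarith
      then show ?thesis by (simp add: C3_def add_divide_distrib)
    qed

    \<comment> \<open>After multiplication by \<open>x\<^sup>-\<^sup>n\<^sup>-\<^sup>1\<close> Green's identity is in divergence form: the first order term of
      \<open>L\<close> is absorbed in the derivative of \<open>x\<^sup>1\<^sup>-\<^sup>n Z\<close>.\<close>
    define Z where "Z = (\<lambda>w. J w * (R w * partial_deriv None \<Phi> w - \<Phi> w * partial_deriv None R w))"
    define Y where "Y = (\<lambda>w. inverse (w $ None) ^ (n - 1) * Z w)"
    define V where "V = (\<lambda>i w. \<Sum>j\<in>UNIV. J w * H w $ i $ j * (R w * partial_deriv (Some j) \<Phi> w - \<Phi> w * partial_deriv (Some j) R w))"
    define K1 where "K1 = (\<lambda>w. partial_deriv None Y w)"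
    define K2 where "K2 = (\<lambda>i x w. inverse x ^ (n - 1) * partial_deriv (Some i) (V i) w)"
    have ZC: "Cinf_on U Z" unfolding Z_def
      by (intro Cinf_on_mult[OF U] Cinf_on_diff[OF U] Cinf_on_partial_deriv J R \<Phi>)
    have iC: "Cinf_on U (\<lambda>w. inverse (w $ None) ^ m)" for m
      by (intro Cinf_on_power[OF U] Cinf_on_inverse[OF U] Cinf_on_coordinate) (auto simp: U_def)
    have YC: "Cinf_on U Y" unfolding Y_def by (rule Cinf_on_mult[OF U iC ZC])
    have VC: "Cinf_on U (V i)" for i unfolding V_def
      by (intro Cinf_on_mult[OF U] Cinf_on_sum[OF U] Cinf_on_diff[OF U] Cinf_on_partial_deriv J H R \<Phi>)
    have K_eq: "K1 w + (\<Sum>i\<in>UNIV. K2 i (w $ None) w) = inverse (w $ None) ^ (n + 1) * (R w * cyl_op J H \<Phi> w - \<Phi> w * cyl_op J H R w)"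
      if w: "w \<in> U" for w
    proof -
      let ?x = "w $ None"
      have x: "?x > 0" using w by (simp add: U_def)
      have "((\<lambda>t. inverse t ^ (n - 1)) has_real_derivative - (real (n - 1) * inverse ?x ^ n)) (at ?x)"
      proof -
        have A: "((\<lambda>t. inverse t ^ (n - 1)) has_real_derivative real (n - 1) * inverse ?x ^ (n - 1 - 1) * (- (inverse ?x * inverse ?x))) (at ?x)"
          using x by (auto intro!: derivative_eq_intros)
        have E: "real (n - 1) * inverse ?x ^ (n - 1 - 1) * (- (inverse ?x * inverse ?x)) = - (real (n - 1) * inverse ?x ^ n)"
        proof (cases "n = 1")
          case False
          then obtain m where "n = Suc (Suc m)" using n by (metis One_nat_def Suc_le_D le_antisym not_less_eq_eq)
          then show ?thesis by simp
        qed simp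
        show ?thesis using A unfolding E .
      qed
      from partial_deriv_compose[where F="\<lambda>w. w $ None", OF this]
      have di: "(\<lambda>w. inverse (w $ None) ^ (n - 1)) differentiable (at w)"
        "partial_deriv None (\<lambda>w. inverse (w $ None) ^ (n - 1)) w = - (real (n - 1) * inverse ?x ^ n)" by auto
      have "K1 w = - (real (n - 1) * inverse ?x ^ n) * Z w + inverse ?x ^ (n - 1) * partial_deriv None Z w"
        unfolding K1_def Y_def partial_deriv_mult[OF di(1) Cinf_on_differentiable[OF ZC w]] di(2) ..
      also have "\<dots> = inverse ?x ^ (n + 1) * (?x\<^sup>2 * partial_deriv None Z w + (1 - real n) * (?x * Z w))"
      proof -
        obtain m where m: "n = Suc m" using n by (cases n) auto
        show ?thesis using x by (simp add: m field_simps power2_eq_square)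
      qed
      finally have k1: "K1 w = inverse ?x ^ (n + 1) * (?x\<^sup>2 * partial_deriv None Z w + (1 - real n) * (?x * Z w))" .
      have "(\<Sum>i\<in>UNIV. K2 i ?x w) = inverse ?x ^ (n + 1) * (?x\<^sup>2 * (\<Sum>i\<in>UNIV. partial_deriv (Some i) (V i) w))"
      proof -
        obtain m where m: "n = Suc m" using n by (cases n) auto
        show ?thesis unfolding K2_def sum_distrib_left[symmetric] using x by (simp add: m field_simps power2_eq_square)
      qed
      then show ?thesis unfolding k1 green_identity[OF R \<Phi> w Hsym[OF w]]
        unfolding Z_def V_def n_def by (simp add: distrib_left)
    qed
    \<comment> \<open>The support of the cutoff, and a smaller box on which the cutoff is bounded below by a positive constant.\<close>
    define S where "S = cball z0 r \<times> {a..b}"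
    define S' where "S' = cball z0 (r / 2) \<times> {exp (- 7 / 4 * N) .. exp (- 5 / 4 * N)}"
    have cS: "compact S" unfolding S_def by (intro compact_Times compact_cball compact_Icc)
    have SU: "pt (fst p) (snd p) \<in> U" if "p \<in> S" for p
      using that r ab by (intro inU) (auto simp: S_def dist_commute)
    have intg: "integrable lborel (\<lambda>p. indicator S p * f (pt (fst p) (snd p)))" if "Cinf_on U f" for f
    proof -
      have "continuous_on S (\<lambda>p. f (pt (fst p) (snd p)))"
        by (rule continuous_on_compose2[OF Cinf_on_continuous[OF that]]) (use SU in \<open>auto intro!: continuous_intros\<close>)
      from borel_integrable_compact[OF cS this] show ?thesis by simp
    qed
    define k1 where "k1 = (\<lambda>p. indicator S p * K1 (pt (fst p) (snd p)))"
    define k2 where "k2 = (\<lambda>i p. indicator S p * K2 i (snd p) (pt (fst p) (snd p)))"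
    have ik1: "integrable lborel k1" unfolding k1_def K1_def by (rule intg[OF Cinf_on_partial_deriv[OF YC]])
    have ik2: "integrable lborel (k2 i)" for i
      using intg[OF Cinf_on_mult[OF U iC Cinf_on_partial_deriv[OF VC[of i], of "Some i"]], of "n - 1"]
      unfolding k2_def K2_def by simp
    have Y0: "Y (pt z x) = 0" if "x \<in> {a, b}" "dist z z0 \<le> r" for z x
    proof -
      have x: "0 < x" "x < e" using that ab by auto
      have w: "pt z x \<in> U" using that(2) x r by (intro inU) auto
      have t: "ln x / N \<in> {-2, -1}" using that(1) N by (auto simp: a_def b_def)
      have "L x = 0" "L1 x = 0" using t by (auto simp: L_def L1_def profile_zero)
      then show ?thesis using d\<Phi>[OF w, of None] FNone by (simp add: Y_def Z_def \<Phi>_def)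
    qed
    have "integral\<^sup>L lborel k1 = 0"
    proof (rule integral_pair_eq_0(1)[OF ik1])
      fix z
      show "(\<integral>x. k1 (z, x) \<partial>lborel) = 0"
      proof (cases "z \<in> cball z0 r")
        case True
        then have z: "dist z z0 \<le> r" by (simp add: dist_commute)
        have w: "pt z x \<in> U" if "a \<le> x" "x \<le> b" for x using that z r ab by (intro inU) auto
        have "(\<integral>x. indicator {a..b} x *\<^sub>R partial_deriv None Y (pt z x) \<partial>lborel) = Y (pt z b) - Y (pt z a)"
        proof (rule integral_FTC_atLeastAtMost)
          show "((\<lambda>x. Y (pt z x)) has_vector_derivative partial_deriv None Y (pt z x)) (at x within {a..b})"
            if "a \<le> x" "x \<le> b" for x
            using partial_deriv_vertical[OF Cinf_on_differentiable[OF YC w[OF that]]]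
            by (auto simp: has_real_derivative_iff_has_vector_derivative[symmetric] intro: has_field_derivative_at_within)
          show "continuous_on {a..b} (\<lambda>x. partial_deriv None Y (pt z x))"
            by (rule continuous_on_compose2[OF Cinf_on_continuous[OF Cinf_on_partial_deriv[OF YC]]])
              (use w in \<open>auto intro!: continuous_intros\<close>)
        qed (use ab in simp)
        moreover have "k1 (z, x) = indicator {a..b} x *\<^sub>R partial_deriv None Y (pt z x)" for x
          using True by (simp add: k1_def K1_def S_def indicator_def)
        ultimately show ?thesis using Y0[of _ z] z by simp
      qed (simp add: k1_def S_def)
    qed
    moreover have "integral\<^sup>L lborel (k2 i) = 0" for i
    proof (rule integral_pair_eq_0(2)[OF ik2])
      fix x
      show "(\<integral>z. k2 i (z, x) \<partial>lborel) = 0"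
      proof (cases "x \<in> {a..b}")
        case True
        then have x: "0 < x" "x < e" using ab by auto
        have w: "pt z x \<in> U" if "z \<in> ball z0 e" for z using that x by (intro inU) (auto simp: dist_commute)
        have "(\<integral>z. indicator (cball z0 r) z * partial_deriv i (\<lambda>z. V i (pt z x)) z \<partial>lborel) = 0"
        proof (rule integral_partial_deriv_eq_0)
          show "Cinf_on (ball z0 e) (\<lambda>z. V i (pt z x))" by (rule Cinf_on_slice[OF VC U _ w]) auto
          fix z assume z: "z \<in> ball z0 e" "z \<notin> cball z0 r"
          then have "r \<le> dist (base (pt z x)) z0" by (simp add: dist_commute)
          from Foff[OF this] show "V i (pt z x) = 0"
            using d\<Phi>[OF w[OF z(1)]] by (simp add: V_def \<Phi>_def)
        qed (use r in auto)
        moreover have "k2 i (z, x) = inverse x ^ (n - 1) * (indicator (cball z0 r) z * partial_deriv i (\<lambda>z. V i (pt z x)) z)" for z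
        proof (cases "z \<in> cball z0 r")
          case z: True
          then have "pt z x \<in> U" using r by (intro w) auto
          from partial_deriv_slice(1)[OF Cinf_on_differentiable[OF VC this]]
          show ?thesis using z True by (simp add: k2_def K2_def S_def)
        qed (simp add: k2_def S_def)
        ultimately show ?thesis by simp
      qed (simp add: k2_def S_def)
    qed
    ultimately have zero: "(\<integral>p. s * (k1 p + (\<Sum>i\<in>UNIV. k2 i p)) \<partial>lborel) = 0"
      using ik1 ik2 by simp
    have ineq: "c * (indicator S' p * (1 / snd p)) - C * C3 / N * (indicator S p * (1 / snd p)) \<le> s * (k1 p + (\<Sum>i\<in>UNIV. k2 i p))" for p
    proof (cases "p \<in> S")
      case True
      obtain z x where p: "p = (z, x)" by (cases p)
      let ?w = "pt z x"
      have zx: "dist z z0 \<le> r" "a \<le> x" "x \<le> b" using True by (auto simp: S_def p dist_commute)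
      have x0: "0 < x" using zx ab by linarith
      have w: "?w \<in> U" using SU[OF True] by (simp add: p)
      have k: "k1 p + (\<Sum>i\<in>UNIV. k2 i p) = inverse x ^ (n + 1) * (R ?w * cyl_op J H \<Phi> ?w - \<Phi> ?w * cyl_op J H R ?w)"
        using K_eq[OF w] True by (simp add: k1_def k2_def p)
      have "\<bar>R ?w * cyl_op J H \<Phi> ?w\<bar> \<le> (C * x ^ n) * (C3 / N)"
        unfolding abs_mult using Rb[OF w] L\<Phi>[OF zx] C0 x0 by (intro mult_mono) (auto simp: n_def)
      then have 1: "\<bar>s * (R ?w * cyl_op J H \<Phi> ?w)\<bar> \<le> (C * x ^ n) * (C3 / N)"
        by (simp add: abs_mult[of s] s)
      have 2: "\<Phi> ?w * (\<sigma> * x ^ n) \<le> \<Phi> ?w * (- s * cyl_op J H R ?w)"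
        using lower[OF w] \<Phi>0 by (intro mult_left_mono) (auto simp: n_def)
      have 3: "flat 0 (3 / 4 * r\<^sup>2) * flat 0 (3 / 16) * indicator S' p \<le> \<Phi> ?w"
      proof (cases "p \<in> S'")
        case S': True
        have "dist z z0 \<le> r / 2" using S' by (simp add: S'_def p dist_commute)
        then have "(dist z z0)\<^sup>2 \<le> (r / 2)\<^sup>2" by (intro power_mono) auto
        then have "3 / 4 * r\<^sup>2 \<le> q ?w" by (simp add: q_eq power_divide)
        then have "flat 0 (3 / 4 * r\<^sup>2) \<le> F ?w" unfolding F_def by (rule flat_0_mono)
        moreover have "ln x / N \<in> {- 7 / 4 .. - 5 / 4}"
        proof -
          have "exp (- 7 / 4 * N) \<le> x" "x \<le> exp (- 5 / 4 * N)" using S' by (auto simp: S'_def p)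
          then have "- 7 / 4 * N \<le> ln x" "ln x \<le> - 5 / 4 * N"
            using x0 ln_ge_iff[of x "- 7 / 4 * N"] ln_le_of_le_exp[of x "- 5 / 4 * N"] by simp_all
          then show ?thesis using N by (simp add: field_simps)
        qed
        then have "flat 0 (3 / 16) \<le> L x" unfolding L_def by (rule profile_lower)
        ultimately show ?thesis using S' F01[of ?w] by (simp add: \<Phi>_def mult_mono flat_nonneg)
      qed (use \<Phi>0 in simp)
      have "(\<sigma> * \<Phi> ?w - C * C3 / N) * x ^ n \<le> s * (R ?w * cyl_op J H \<Phi> ?w - \<Phi> ?w * cyl_op J H R ?w)"
        using 1 2 by (simp add: algebra_simps abs_le_iff)
      then have "inverse x ^ (n + 1) * ((\<sigma> * \<Phi> ?w - C * C3 / N) * x ^ n)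
          \<le> inverse x ^ (n + 1) * (s * (R ?w * cyl_op J H \<Phi> ?w - \<Phi> ?w * cyl_op J H R ?w))"
        using x0 by (intro mult_left_mono) auto
      moreover have "inverse x ^ (n + 1) * ((\<sigma> * \<Phi> ?w - C * C3 / N) * x ^ n) = (\<sigma> * \<Phi> ?w - C * C3 / N) * (1 / x)"
        using x0 by (simp add: field_simps)
      moreover have "(c * indicator S' p - C * C3 / N) * (1 / x) \<le> (\<sigma> * \<Phi> ?w - C * C3 / N) * (1 / x)"
        using 3 \<sigma> x0 by (intro mult_right_mono) (auto simp: c_def mult.assoc intro!: mult_left_mono)
      ultimately show ?thesis using True unfolding k by (simp add: p algebra_simps)
    next
      case False
      have "p \<notin> S'"
      proof
        assume "p \<in> S'"
        moreover have "a \<le> exp (- 7 / 4 * N)" "exp (- 5 / 4 * N) \<le> b" using N by (simp_all add: a_def b_def)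
        ultimately have "p \<in> S" using r by (auto simp: S'_def S_def)
        then show False using False by blast
      qed
      then show ?thesis using False by (simp add: k1_def k2_def)
    qed
    have iS: "integrable lborel (\<lambda>p. indicator S p * (1 / snd p))"
      "(\<integral>p. indicator S p * (1 / snd p) \<partial>lborel) = vol * N"
      using integral_box_inverse[of "cball z0 r" a b] ab by (auto simp: S_def vol_def a_def b_def)
    have iS': "integrable lborel (\<lambda>p. indicator S' p * (1 / snd p))"
      "(\<integral>p. indicator S' p * (1 / snd p) \<partial>lborel) = vol' * (N / 2)"
      using integral_box_inverse[of "cball z0 (r / 2)" "exp (- 7 / 4 * N)" "exp (- 5 / 4 * N)"] N
      by (auto simp: S'_def vol'_def)
    have "(\<integral>p. c * (indicator S' p * (1 / snd p)) - C * C3 / N * (indicator S p * (1 / snd p)) \<partial>lborel)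
      \<le> (\<integral>p. s * (k1 p + (\<Sum>i\<in>UNIV. k2 i p)) \<partial>lborel)"
      by (intro integral_mono ineq Bochner_Integration.integrable_diff integrable_mult_right Bochner_Integration.integrable_add
          Bochner_Integration.integrable_sum iS iS' ik1 ik2)
    also have "(\<integral>p. c * (indicator S' p * (1 / snd p)) - C * C3 / N * (indicator S p * (1 / snd p)) \<partial>lborel)
      = c * (vol' * (N / 2)) - C * C3 / N * (vol * N)"
      by (simp only: Bochner_Integration.integral_diff[OF integrable_mult_right[OF iS'(1)] integrable_mult_right[OF iS(1)]]
          integral_mult_right_zero iS(2) iS'(2))
    finally show ?thesis unfolding zero using N by simp
  qed
  \<comment> \<open>The last entry makes the left side of \<open>main\<close> at least \<open>C * C3 * vol + 1\<close>.\<close>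
  define N where "N = max (max 1 (1 - ln e)) (2 * (C * C3 * vol + 1) / (c * vol'))"
  have "N \<ge> 1" by (simp add: N_def)
  moreover have "exp (- N) < e"
  proof -
    have "- N < ln e" by (simp add: N_def)
    then have "exp (- N) < exp (ln e)" by (simp only: exp_less_cancel_iff)
    then show ?thesis using e by simp
  qed
  ultimately have "c * (vol' * (N / 2)) \<le> C * C3 * vol" by (rule main)
  moreover have "2 * (C * C3 * vol + 1) / (c * vol') \<le> N" by (simp add: N_def)
  then have "2 * (C * C3 * vol + 1) \<le> N * (c * vol')" using c vol' by (simp add: pos_divide_le_eq)
  ultimately show False by (simp add: algebra_simps)
qed

section \<open>Asymptotics at the boundary\<close>

text \<open>The filter of points with \<open>x > 0\<close> tending to \<open>(z0, 0)\<close>.  The base point is free to move, so bounds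
  along this filter are uniform near \<open>z0\<close>.\<close>
definition bdry :: "real^'n::finite \<Rightarrow> (real^'n option) filter"
  where "bdry z0 = (INF e\<in>{0<..}. principal (cyl z0 e \<inter> {w. w $ None > 0}))"

lemma eventually_bdry:
  "eventually P (bdry z0) \<longleftrightarrow> (\<exists>e>0. \<forall>w\<in>cyl z0 e. w $ None > 0 \<longrightarrow> P w)"
proof -
  have "eventually P (bdry z0) \<longleftrightarrow> (\<exists>e\<in>{0<..}. eventually P (principal (cyl z0 e \<inter> {w. w $ None > 0})))"
    unfolding bdry_def
  proof (rule eventually_INF_base)
    fix a b :: real assume "a \<in> {0<..}" "b \<in> {0<..}"
    then show "\<exists>x\<in>{0<..}. principal (cyl z0 x \<inter> {w. w $ None > 0})
        \<le> inf (principal (cyl z0 a \<inter> {w. w $ None > 0})) (principal (cyl z0 b \<inter> {w. w $ None > 0}))"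
      using cyl_mono[of "min a b" a z0] cyl_mono[of "min a b" b z0]
      by (intro bexI[of _ "min a b"]) auto
  qed auto
  then show ?thesis by (auto simp: eventually_principal)
qed

lemma bdry_small: "d > 0 \<Longrightarrow> \<forall>\<^sub>F w in bdry z0. 0 < w $ None \<and> w $ None < d \<and> dist (base w) z0 < d"
  unfolding eventually_bdry by (auto simp: cyl_def)

definition Cinf_at :: "(real^'k::finite \<Rightarrow> real) \<Rightarrow> real^'k \<Rightarrow> bool"
  where "Cinf_at f w \<longleftrightarrow> (\<exists>W. open W \<and> w \<in> W \<and> Cinf_on W f)"

lemma Cinf_on_if_at: "(\<And>w. w \<in> U \<Longrightarrow> Cinf_at f w) \<Longrightarrow> Cinf_on U f"
  unfolding Cinf_on_def by (intro allI Ck_on_local) (auto simp: Cinf_at_def Cinf_on_def)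

lemma smooth_bd_eventually_Cinf_at:
  assumes "smooth_bd z0 f" shows "\<forall>\<^sub>F w in bdry z0. Cinf_at f w"
proof -
  obtain e F where eF: "e > 0" "Cinf_on (cyl z0 e) F" "\<forall>w\<in>cyl z0 e. w $ None > 0 \<longrightarrow> F w = f w"
    using smooth_bdE[OF assms] by metis
  let ?U = "cyl z0 e \<inter> {w. w $ None > 0}"
  have U: "open ?U" by (intro open_Int open_cyl open_Collect_less continuous_intros)
  have "Cinf_on ?U f"
    by (rule Cinf_on_cong[OF U _ Cinf_on_subset[OF eF(2)]]) (use eF(3) in auto)
  then show ?thesis unfolding eventually_bdry Cinf_at_def using U eF(1) by blast
qed

lemma smooth_bd_eventually_bounded:
  assumes "smooth_bd z0 f" obtains C where "\<forall>\<^sub>F w in bdry z0. \<bar>f w\<bar> \<le> C"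
proof -
  obtain e C where e: "e > 0" "\<And>z x. dist z z0 < e \<Longrightarrow> 0 < x \<Longrightarrow> x < e \<Longrightarrow> \<bar>f (pt z x)\<bar> \<le> C * x ^ 0"
    using tcoeff_bigo[OF assms, of 1 0] by (metis less_nat_zero_code zero_less_one)
  have "\<bar>f w\<bar> \<le> C" if "w \<in> cyl z0 e" "w $ None > 0" for w
    using e(2)[of "base w" "w $ None"] that by (simp add: cyl_def pt_base)
  then show ?thesis using that e(1) unfolding eventually_bdry by blast
qed

lemma x_ln_x_small:
  assumes "C \<ge> 0" "\<epsilon> > 0"
  shows "\<forall>\<^sub>F w in bdry z0. C * (w $ None * \<bar>ln (w $ None)\<bar>) \<le> \<epsilon>"
proof -
  have key: "x * \<bar>ln x\<bar> \<le> 2 * sqrt x" if "0 < x" "x \<le> 1" for x :: real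
  proof -
    have "ln (inverse (sqrt x)) \<le> inverse (sqrt x)"
      using ln_le_minus_one[of "inverse (sqrt x)"] that by simp
    moreover have "ln (inverse (sqrt x)) = - (ln x / 2)" using that by (simp add: ln_inverse ln_sqrt)
    moreover have "\<bar>ln x\<bar> = - ln x" using that by simp
    ultimately have "\<bar>ln x\<bar> \<le> 2 * inverse (sqrt x)" by linarith
    then have "x * \<bar>ln x\<bar> \<le> x * (2 * inverse (sqrt x))" using that by (intro mult_left_mono) auto
    also have "\<dots> = 2 * (x / sqrt x)" by (simp add: divide_inverse)
    also have "\<dots> = 2 * sqrt x" using that by (simp add: real_div_sqrt)
    finally show ?thesis .
  qed
  define d where "d = min 1 ((\<epsilon> / (2 * (C + 1)))\<^sup>2)"
  have "d > 0" using assms by (simp add: d_def)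
  from bdry_small[OF this, of z0] show ?thesis
  proof eventually_elim
    case (elim w)
    let ?x = "w $ None"
    have x: "0 < ?x" "?x \<le> 1" "?x \<le> (\<epsilon> / (2 * (C + 1)))\<^sup>2" using elim by (auto simp: d_def)
    have "sqrt ?x \<le> \<epsilon> / (2 * (C + 1))" by (rule real_le_lsqrt) (use x assms in auto)
    then have "(C + 1) * (2 * sqrt ?x) \<le> \<epsilon>" using assms by (simp add: pos_le_divide_eq algebra_simps)
    moreover have "C * (?x * \<bar>ln ?x\<bar>) \<le> (C + 1) * (2 * sqrt ?x)"
      by (rule mult_mono[OF _ key[OF x(1,2)]]) (use assms x(1) in \<open>simp_all add: mult_nonneg_nonneg\<close>)
    ultimately show ?case by linarith
  qed
qed

section \<open>The expansion of the equations in a boundary chart\<close>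

lemma jet_add3:
  "smooth_bd z f \<Longrightarrow> smooth_bd z g \<Longrightarrow> smooth_bd z h \<Longrightarrow> jet (\<lambda>w. f w + g w + h w) z = jet f z + jet g z + jet h z"
  by (simp add: jet_add smooth_bd_add)

text \<open>For \<open>c = 1 - n\<close> the factor \<open>m + c\<close> vanishes exactly at the coefficient of \<open>x\<^sup>n\<close>.\<close>
lemma fps_nth_second_order:
  fixes P D :: "real fps"
  shows "fps_nth (fps_X\<^sup>2 * fps_deriv P + fps_const c * (fps_X * P) + fps_X\<^sup>2 * D) (Suc m)
    = (real m + c) * fps_nth P m + (if m = 0 then 0 else fps_nth D (m - 1))"
  by (cases m) (simp_all add: fps_X_power_mult_nth ring_distribs)

text \<open>A smooth family of pseudo-Riemannian metrics in coordinates, given by a matrix whose germs from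
  \<open>x > 0\<close> at the boundary points over \<open>\<Omega>\<close> are prescribed.\<close>
locale boundary_chart =
  fixes \<Omega> :: "(real^'n::finite) set" and gm :: "real^'n option \<Rightarrow> real^'n^'n"
  assumes open_\<Omega>: "open \<Omega>" and n2: "CARD('n) \<ge> 2"
    and gm: "\<And>z i j. z \<in> \<Omega> \<Longrightarrow> smooth_bd z (\<lambda>w. gm w $ i $ j)"
    and gm_nz: "\<And>z. z \<in> \<Omega> \<Longrightarrow> tcoeff 0 (\<lambda>w. det (gm w)) z \<noteq> 0"
    and gm_inv: "\<And>z. z \<in> \<Omega> \<Longrightarrow> \<forall>\<^sub>F w in bdry z. invertible (gm w)"
    and gm_sym: "\<And>z. z \<in> \<Omega> \<Longrightarrow> \<forall>\<^sub>F w in bdry z. transpose (gm w) = gm w"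
begin

definition J :: "real^'n option \<Rightarrow> real" where "J w = sqrt \<bar>det (gm w)\<bar>"
definition H :: "real^'n option \<Rightarrow> real^'n^'n" where "H w = matrix_inv (gm w)"
abbreviation "L \<equiv> cyl_op J H"

lemma J_smooth_bd: "z \<in> \<Omega> \<Longrightarrow> smooth_bd z J"
  unfolding J_def[abs_def] by (rule smooth_bd_sqrt_abs[OF smooth_bd_det[OF gm] gm_nz])

lemma H_smooth_bd: assumes "z \<in> \<Omega>" shows "smooth_bd z (\<lambda>w. H w $ i $ j)"
proof -
  obtain e where "e > 0" "\<forall>w\<in>cyl z e. w $ None > 0 \<longrightarrow> invertible (gm w)"
    using gm_inv[OF assms] unfolding eventually_bdry by blast
  then show ?thesis unfolding H_def by (intro smooth_bd_matrix_inv[OF gm gm_nz]) (use assms in auto)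
qed

lemma tcoeff_J_0: assumes "z \<in> \<Omega>" shows "tcoeff 0 J z = sqrt \<bar>tcoeff 0 (\<lambda>w. det (gm w)) z\<bar>" and "tcoeff 0 J z > 0"
proof -
  show *: "tcoeff 0 J z = sqrt \<bar>tcoeff 0 (\<lambda>w. det (gm w)) z\<bar>"
    by (rule tcoeff_0_limit[OF J_smooth_bd[OF assms]], unfold J_def)
      (intro tendsto_real_sqrt tendsto_rabs smooth_bd_tendsto smooth_bd_det gm assms)
  show "tcoeff 0 J z > 0" unfolding * using gm_nz[OF assms] by simp
qed

lemma H_sym: assumes "z \<in> \<Omega>" shows "\<forall>\<^sub>F w in bdry z. \<forall>i j. H w $ i $ j = H w $ j $ i"
  using gm_inv[OF assms] gm_sym[OF assms]
  by eventually_elim (auto simp: H_def intro: transpose_matrix_inv)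

lemma L_smooth_bd: "z \<in> \<Omega> \<Longrightarrow> smooth_bd z u \<Longrightarrow> smooth_bd z (L u)"
  by (intro smooth_bd_cyl_op J_smooth_bd H_smooth_bd)

text \<open>Passage from properties that hold eventually at a boundary point to an open half cylinder on which
  the identities for \<open>cyl_op\<close> can be differentiated.\<close>
lemma half_cyl:
  assumes z: "z \<in> \<Omega>" and P: "\<forall>\<^sub>F w in bdry z. P w"
  obtains e where "0 < e" "e \<le> 1" "cyl_coeffs (cyl z e \<inter> {w. w $ None > 0}) J H"
    "\<And>w. w \<in> cyl z e \<inter> {w. w $ None > 0} \<Longrightarrow> P w \<and> (\<forall>i j. H w $ i $ j = H w $ j $ i)
        \<and> invertible (gm w) \<and> transpose (gm w) = gm w \<and> (\<forall>i j. Cinf_at (\<lambda>w. gm w $ i $ j) w)"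
proof -
  have "\<forall>\<^sub>F w in bdry z. Cinf_at J w \<and> (\<forall>i j. Cinf_at (\<lambda>w. H w $ i $ j) w) \<and> P w
      \<and> (\<forall>i j. H w $ i $ j = H w $ j $ i) \<and> invertible (gm w) \<and> transpose (gm w) = gm w \<and> (\<forall>i j. Cinf_at (\<lambda>w. gm w $ i $ j) w)"
    by (intro eventually_conj eventually_all_finite smooth_bd_eventually_Cinf_at J_smooth_bd H_smooth_bd H_sym gm_inv gm_sym gm P z)
  then obtain e where e: "e > 0" "\<forall>w\<in>cyl z e. w $ None > 0 \<longrightarrow> Cinf_at J w \<and> (\<forall>i j. Cinf_at (\<lambda>w. H w $ i $ j) w) \<and> P w
      \<and> (\<forall>i j. H w $ i $ j = H w $ j $ i) \<and> invertible (gm w) \<and> transpose (gm w) = gm w \<and> (\<forall>i j. Cinf_at (\<lambda>w. gm w $ i $ j) w)"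
    unfolding eventually_bdry by blast
  let ?U = "cyl z (min e 1) \<inter> {w. w $ None > 0}"
  have sub: "w \<in> cyl z e" "w $ None > 0" if "w \<in> ?U" for w using that cyl_mono[of "min e 1" e z] by auto
  have "open ?U" by (intro open_Int open_cyl open_Collect_less continuous_intros)
  moreover have "Cinf_on ?U J" "\<And>i j. Cinf_on ?U (\<lambda>w. H w $ i $ j)"
    by (rule Cinf_on_if_at, use e(2) sub in blast)+
  ultimately have "cyl_coeffs ?U J H" by unfold_locales
  then show ?thesis
  proof (rule that[rotated 2])
    fix w assume "w \<in> ?U"
    from e(2)[rule_format, OF sub[OF this]]
    show "P w \<and> (\<forall>i j. H w $ i $ j = H w $ j $ i) \<and> invertible (gm w) \<and> transpose (gm w) = gm w
      \<and> (\<forall>i j. Cinf_at (\<lambda>w. gm w $ i $ j) w)" by blast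
  qed (use e(1) in simp_all)
qed

text \<open>If \<open>S\<^sub>k\<close> is the first coefficient that is not identically zero, then near a point where it does not
  vanish \<open>S\<close> is close to \<open>S\<^sub>k x\<^sup>k\<close>.  As \<open>k \<le> n\<close>, this gives \<open>L R\<close> a sign and a lower bound of order \<open>x\<^sup>n\<close> on a
  half cylinder.\<close>
lemma residual_vanishes:
  assumes R: "\<And>z. z \<in> \<Omega> \<Longrightarrow> \<forall>\<^sub>F w in bdry z. Cinf_at R w"
    and Rb: "\<And>z. z \<in> \<Omega> \<Longrightarrow> \<exists>C. \<forall>\<^sub>F w in bdry z. \<bar>R w\<bar> \<le> C * (w $ None) ^ CARD('n)"
    and S: "\<And>z. z \<in> \<Omega> \<Longrightarrow> smooth_bd z S"
    and res: "\<And>z. z \<in> \<Omega> \<Longrightarrow> \<exists>C. \<forall>\<^sub>F w in bdry z. \<bar>L R w + S w\<bar> \<le> C * ((w $ None) ^ (CARD('n) + 1) * \<bar>ln (w $ None)\<bar>)"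
    and k: "k \<le> CARD('n)" and z0: "z0 \<in> \<Omega>"
  shows "tcoeff k S z0 = 0"
  using k z0
proof (induction k arbitrary: z0 rule: less_induct)
  case (less k)
  show ?case
  proof (rule ccontr)
    define \<tau> where "\<tau> = tcoeff k S z0"
    assume "tcoeff k S z0 \<noteq> 0"
    then have \<tau>: "\<tau> \<noteq> 0" by (simp add: \<tau>_def)
    obtain d where d: "d > 0" "ball z0 d \<subseteq> \<Omega>" using open_\<Omega> less.prems(2) open_contains_ball by blast
    have "\<forall>\<^sub>F w in bdry z0. \<bar>S w - \<tau> * (w $ None) ^ k\<bar> \<le> \<bar>\<tau>\<bar> / 2 * (w $ None) ^ k"
    proof -
      have h: "\<bar>\<tau>\<bar> / 2 > 0" using \<tau> by simp
      obtain e where e: "e > 0" "\<And>z x. dist z z0 < e \<Longrightarrow> 0 < x \<Longrightarrow> x < e \<Longrightarrow>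
       \<bar>S (pt z x) - (\<Sum>j<k. tcoeff j S z * x ^ j) - tcoeff k S z0 * x ^ k\<bar> \<le> \<bar>\<tau>\<bar> / 2 * x ^ k"
        by (rule smooth_bd_taylor[OF S[OF less.prems(2)] h, where m=k]) blast
      have "min d e > 0" using d e by simp
      from bdry_small[OF this, of z0] show ?thesis
      proof eventually_elim
        case (elim w)
        then have "base w \<in> \<Omega>" using d(2) by (auto simp: dist_commute)
        then have "tcoeff j S (base w) = 0" if "j < k" for j using less.IH[OF that] that less.prems(1) by simp
        then show ?case using e(2)[of "base w" "w $ None"] elim by (simp add: pt_base \<tau>_def)
      qed
    qed
    moreover obtain C1 where C1: "\<forall>\<^sub>F w in bdry z0. \<bar>L R w + S w\<bar> \<le> C1 * ((w $ None) ^ (CARD('n) + 1) * \<bar>ln (w $ None)\<bar>)"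
      using res[OF less.prems(2)] by blast
    moreover have "\<forall>\<^sub>F w in bdry z0. \<bar>C1\<bar> * (w $ None * \<bar>ln (w $ None)\<bar>) \<le> \<bar>\<tau>\<bar> / 4"
      by (rule x_ln_x_small) (use \<tau> in auto)
    moreover have "\<forall>\<^sub>F w in bdry z0. 0 < w $ None \<and> w $ None < 1 \<and> dist (base w) z0 < 1" by (rule bdry_small) simp
    ultimately have lower: "\<forall>\<^sub>F w in bdry z0. (\<bar>\<tau>\<bar> / 4) * (w $ None) ^ CARD('n) \<le> - sgn \<tau> * L R w"
    proof eventually_elim
      case (elim w)
      let ?x = "w $ None"
      have x: "0 < ?x" "?x < 1" using elim by auto
      have xk: "?x ^ CARD('n) \<le> ?x ^ k" using x less.prems(1) by (intro power_decreasing) auto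
      have "C1 * (?x ^ (CARD('n) + 1) * \<bar>ln ?x\<bar>) \<le> \<bar>C1\<bar> * (?x ^ (CARD('n) + 1) * \<bar>ln ?x\<bar>)"
        by (intro mult_right_mono mult_nonneg_nonneg) (use x in simp_all)
      also have "\<dots> = ?x ^ CARD('n) * (\<bar>C1\<bar> * (?x * \<bar>ln ?x\<bar>))" by simp
      also have "\<dots> \<le> ?x ^ CARD('n) * (\<bar>\<tau>\<bar> / 4)" using elim x by (intro mult_left_mono) auto
      finally have 1: "\<bar>L R w + S w\<bar> \<le> ?x ^ CARD('n) * (\<bar>\<tau>\<bar> / 4)" using elim by linarith
      have sg: "\<bar>sgn \<tau> * t\<bar> = \<bar>t\<bar>" for t using \<tau> by (simp add: abs_mult sgn_if)
      have "\<bar>sgn \<tau> * (S w - \<tau> * ?x ^ k)\<bar> \<le> \<bar>\<tau>\<bar> / 2 * ?x ^ k" unfolding sg using elim by simp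
      also have "sgn \<tau> * (S w - \<tau> * ?x ^ k) = sgn \<tau> * S w - \<bar>\<tau>\<bar> * ?x ^ k"
        by (simp add: sgn_if algebra_simps)
      finally have 2: "sgn \<tau> * S w \<ge> \<bar>\<tau>\<bar> / 2 * ?x ^ k" by linarith
      have "\<bar>sgn \<tau> * (L R w + S w)\<bar> \<le> ?x ^ CARD('n) * (\<bar>\<tau>\<bar> / 4)" unfolding sg by (rule 1)
      then have "\<bar>sgn \<tau> * L R w + sgn \<tau> * S w\<bar> \<le> ?x ^ CARD('n) * (\<bar>\<tau>\<bar> / 4)" by (simp only: distrib_left)
      then have "- sgn \<tau> * L R w \<ge> sgn \<tau> * S w - ?x ^ CARD('n) * (\<bar>\<tau>\<bar> / 4)"
        by (simp only: mult_minus_left)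
      moreover have "\<bar>\<tau>\<bar> / 2 * ?x ^ k \<ge> \<bar>\<tau>\<bar> / 2 * ?x ^ CARD('n)" using xk by (intro mult_left_mono) auto
      ultimately show ?case using 2 by (simp add: algebra_simps)
    qed
    obtain C2 where Rb': "\<forall>\<^sub>F w in bdry z0. \<bar>R w\<bar> \<le> C2 * (w $ None) ^ CARD('n)" using Rb[OF less.prems(2)] by blast
    note bd = smooth_bd_eventually_bounded
    have JH: "smooth_bd z0 (\<lambda>w. J w * H w $ i $ j)" for i j by (intro smooth_bd_mult J_smooth_bd H_smooth_bd less.prems)
    obtain m1 where m1: "\<forall>\<^sub>F w in bdry z0. \<bar>J w\<bar> \<le> m1" using bd[OF J_smooth_bd[OF less.prems(2)]] by blast
    obtain m2 where m2: "\<forall>\<^sub>F w in bdry z0. \<bar>partial_deriv None J w\<bar> \<le> m2"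
      using bd[OF smooth_bd_partial_deriv[OF J_smooth_bd[OF less.prems(2)]]] by blast
    define m3 where "m3 = (\<lambda>i j. SOME m. \<forall>\<^sub>F w in bdry z0. \<bar>J w * H w $ i $ j\<bar> \<le> m)"
    define m4 where "m4 = (\<lambda>i j. SOME m. \<forall>\<^sub>F w in bdry z0. \<bar>partial_deriv (Some i) (\<lambda>w. J w * H w $ i $ j) w\<bar> \<le> m)"
    have m3: "\<forall>\<^sub>F w in bdry z0. \<bar>J w * H w $ i $ j\<bar> \<le> m3 i j" for i j
      unfolding m3_def by (rule someI_ex) (rule bd[OF JH], rule exI)
    have m4: "\<forall>\<^sub>F w in bdry z0. \<bar>partial_deriv (Some i) (\<lambda>w. J w * H w $ i $ j) w\<bar> \<le> m4 i j" for i j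
      unfolding m4_def by (rule someI_ex) (rule bd[OF smooth_bd_partial_deriv[OF JH]], rule exI)
    define M where "M = \<bar>m1\<bar> + \<bar>m2\<bar> + (\<Sum>i\<in>UNIV. \<Sum>j\<in>UNIV. \<bar>m3 i j\<bar> + \<bar>m4 i j\<bar>)"
    have mij: "\<bar>m3 i j\<bar> + \<bar>m4 i j\<bar> \<le> M" for i j
    proof -
      have "\<bar>m3 i j\<bar> + \<bar>m4 i j\<bar> \<le> (\<Sum>j\<in>UNIV. \<bar>m3 i j\<bar> + \<bar>m4 i j\<bar>)" by (rule member_le_sum) auto
      also have "\<dots> \<le> (\<Sum>i\<in>UNIV. \<Sum>j\<in>UNIV. \<bar>m3 i j\<bar> + \<bar>m4 i j\<bar>)"
        by (rule member_le_sum[where f="\<lambda>i. \<Sum>j\<in>UNIV. \<bar>m3 i j\<bar> + \<bar>m4 i j\<bar>"]) (auto intro!: sum_nonneg)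
      finally show ?thesis by (simp add: M_def)
    qed
    have M12: "m1 \<le> M" "m2 \<le> M"
    proof -
      have "0 \<le> (\<Sum>i\<in>UNIV. \<Sum>j\<in>UNIV. \<bar>m3 i j\<bar> + \<bar>m4 i j\<bar>)" by (auto intro!: sum_nonneg)
      then show "m1 \<le> M" "m2 \<le> M" by (simp_all add: M_def)
    qed
    have M3: "\<forall>\<^sub>F w in bdry z0. \<bar>J w * H w $ i $ j\<bar> \<le> M" for i j
      using m3[of i j] by eventually_elim (use mij[of i j] in linarith)
    have M4: "\<forall>\<^sub>F w in bdry z0. \<bar>partial_deriv (Some i) (\<lambda>w. J w * H w $ i $ j) w\<bar> \<le> M" for i j
      using m4[of i j] by eventually_elim (use mij[of i j] in linarith)
    have "\<forall>\<^sub>F w in bdry z0. Cinf_at R w \<and> \<bar>R w\<bar> \<le> C2 * (w $ None) ^ CARD('n) \<and> (\<bar>\<tau>\<bar> / 4) * (w $ None) ^ CARD('n) \<le> - sgn \<tau> * L R w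
      \<and> \<bar>J w\<bar> \<le> m1 \<and> \<bar>partial_deriv None J w\<bar> \<le> m2 \<and> (\<forall>i j. \<bar>J w * H w $ i $ j\<bar> \<le> M)
      \<and> (\<forall>i j. \<bar>partial_deriv (Some i) (\<lambda>w. J w * H w $ i $ j) w\<bar> \<le> M)"
      by (intro eventually_conj eventually_all_finite R Rb' lower m1 m2 M3 M4 less.prems)
    then show False
    proof (rule half_cyl[OF less.prems(2)])
     fix e assume e: "0 < e" "e \<le> 1"
      and cc: "cyl_coeffs (cyl z0 e \<inter> {w. w $ None > 0}) J H"
      and all: "\<And>w. w \<in> cyl z0 e \<inter> {w. w $ None > 0} \<Longrightarrow>
        (Cinf_at R w \<and> \<bar>R w\<bar> \<le> C2 * (w $ None) ^ CARD('n) \<and> (\<bar>\<tau>\<bar> / 4) * (w $ None) ^ CARD('n) \<le> - sgn \<tau> * L R w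
      \<and> \<bar>J w\<bar> \<le> m1 \<and> \<bar>partial_deriv None J w\<bar> \<le> m2 \<and> (\<forall>i j. \<bar>J w * H w $ i $ j\<bar> \<le> M)
      \<and> (\<forall>i j. \<bar>partial_deriv (Some i) (\<lambda>w. J w * H w $ i $ j) w\<bar> \<le> M)) \<and> (\<forall>i j. H w $ i $ j = H w $ j $ i)
        \<and> invertible (gm w) \<and> transpose (gm w) = gm w \<and> (\<forall>i j. Cinf_at (\<lambda>w. gm w $ i $ j) w)"
     show False
     proof (rule no_residual_of_one_sign[OF e, of z0 J H R C2 "\<bar>\<tau>\<bar> / 4" "sgn \<tau>" M])
      show "Cinf_on (cyl z0 e \<inter> {w. w $ None > 0}) R" by (rule Cinf_on_if_at) (use all in blast)
      show "\<bar>J w\<bar> \<le> M" "\<bar>partial_deriv None J w\<bar> \<le> M" if "w \<in> cyl z0 e \<inter> {w. w $ None > 0}" for w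
        using all[OF that] M12 by linarith+
      show "Cinf_on (cyl z0 e \<inter> {w. w $ None > 0}) J" by (rule cyl_coeffs.J[OF cc])
      show "Cinf_on (cyl z0 e \<inter> {w. w $ None > 0}) (\<lambda>w. H w $ i $ j)" for i j by (rule cyl_coeffs.H[OF cc])
      show "\<bar>\<tau>\<bar> / 4 > 0" "\<bar>sgn \<tau>\<bar> = 1" using \<tau> by (simp_all add: sgn_if)
      fix w i j assume "w \<in> cyl z0 e \<inter> {w. w $ None > 0}"
      note a = all[OF this]
      show "H w $ i $ j = H w $ j $ i" "\<bar>R w\<bar> \<le> C2 * w $ None ^ CARD('n)"
        "\<bar>\<tau>\<bar> / 4 * w $ None ^ CARD('n) \<le> - sgn \<tau> * L R w"
        "\<bar>J w * H w $ i $ j\<bar> \<le> M" "\<bar>partial_deriv (Some i) (\<lambda>w. J w * H w $ i $ j) w\<bar> \<le> M"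
        using a by blast+
     qed
    qed
  qed
qed

lemma jet_L:
  assumes "z \<in> \<Omega>" "smooth_bd z u"
  shows "jet (L u) z = fps_X\<^sup>2 * fps_deriv (jet J z * fps_deriv (jet u z))
    + fps_const (1 - real CARD('n)) * (fps_X * (jet J z * fps_deriv (jet u z)))
    + fps_X\<^sup>2 * (\<Sum>i\<in>UNIV. jet (partial_deriv (Some i) (\<lambda>w. \<Sum>j\<in>UNIV. J w * H w $ i $ j * partial_deriv (Some j) u w)) z)"
proof -
  note b = smooth_bd_add smooth_bd_mult smooth_bd_power smooth_bd_sum smooth_bd_const smooth_bd_coordinate smooth_bd_partial_deriv J_smooth_bd[OF assms(1)] H_smooth_bd[OF assms(1)] assms(2)
  have P: "smooth_bd z (\<lambda>w. J w * partial_deriv None u w)" by (intro b)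
  have V: "smooth_bd z (\<lambda>w. \<Sum>j\<in>UNIV. J w * H w $ i $ j * partial_deriv (Some j) u w)" for i by (intro b)
  have jP: "jet (\<lambda>w. J w * partial_deriv None u w) z = jet J z * fps_deriv (jet u z)"
    by (simp add: jet_mult b jet_dx)
  have 1: "jet (\<lambda>w. (w $ None)\<^sup>2 * partial_deriv None (\<lambda>w. J w * partial_deriv None u w) w) z
    = fps_X\<^sup>2 * fps_deriv (jet J z * fps_deriv (jet u z))"
    by (subst jet_mult) (intro b, intro b P, simp add: jet_power jet_dx jP)
  have 2: "jet (\<lambda>w. (1 - real CARD('n)) * (w $ None * (J w * partial_deriv None u w))) z
    = fps_const (1 - real CARD('n)) * (fps_X * (jet J z * fps_deriv (jet u z)))"
    by (simp add: jet_mult smooth_bd_mult P jP del: fps_const_sub)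
  have 3: "jet (\<lambda>w. (w $ None)\<^sup>2 * (\<Sum>i\<in>UNIV. partial_deriv (Some i) (\<lambda>w. \<Sum>j\<in>UNIV. J w * H w $ i $ j * partial_deriv (Some j) u w) w)) z
    = fps_X\<^sup>2 * (\<Sum>i\<in>UNIV. jet (partial_deriv (Some i) (\<lambda>w. \<Sum>j\<in>UNIV. J w * H w $ i $ j * partial_deriv (Some j) u w)) z)"
    by (subst jet_mult) (intro b, intro b V, simp add: jet_power jet_sum smooth_bd_partial_deriv V)
  show ?thesis unfolding cyl_op_def[abs_def] 1[symmetric] 2[symmetric] 3[symmetric]
    by (rule jet_add3) (intro b V P)+
qed

lemma tcoeff_L_0:
  assumes "z \<in> \<Omega>" "smooth_bd z u" shows "tcoeff 0 (L u) z = 0"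
proof -
  have "tcoeff 0 (L u) z = fps_nth (jet (L u) z) 0" by simp
  also have "\<dots> = 0" unfolding jet_L[OF assms] by (simp add: power2_eq_square mult.assoc)
  finally show ?thesis .
qed

text \<open>If the coefficients below order \<open>k\<close> vanish on \<open>V\<close>, so do their tangential derivatives, and the
  coefficient of \<open>x\<^sup>k\<close> in \<open>L u\<close> is \<open>k (k - n) J\<^sub>0 u\<^sub>k\<close>; for \<open>0 < k < n\<close> the factor is not zero.\<close>
lemma coefficients_local:
  assumes V: "open V" "V \<subseteq> \<Omega>" and u: "\<And>z. z \<in> V \<Longrightarrow> smooth_bd z u"
    and Lu: "\<And>z j. z \<in> V \<Longrightarrow> j < CARD('n) \<Longrightarrow> tcoeff j (L u) z = 0"
    and u0: "\<And>z. z \<in> V \<Longrightarrow> tcoeff 0 u z = 0" and k: "k < CARD('n)" and z: "z \<in> V"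
  shows "tcoeff k u z = 0"
  using k z
proof (induction k arbitrary: z rule: less_induct)
  case (less k)
  show ?case
  proof (cases "k = 0")
    case False
    then obtain m where m: "k = Suc m" by (cases k) auto
    have z\<Omega>: "z \<in> \<Omega>" using less.prems V by blast
    let ?P = "jet J z * fps_deriv (jet u z)"
    have P: "fps_nth ?P m = tcoeff 0 J z * (real k * tcoeff k u z)"
    proof -
      have "fps_nth ?P m = (\<Sum>i=0..m. tcoeff i J z * (real (Suc (m - i)) * tcoeff (Suc (m - i)) u z))"
        by (simp add: fps_mult_nth del: of_nat_Suc)
      also have "\<dots> = (\<Sum>i=0..m. if i = 0 then tcoeff 0 J z * (real k * tcoeff k u z) else 0)"
        using less.IH less.prems by (intro sum.cong refl) (auto simp: m)
      finally show ?thesis by simp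
    qed
    have div: "tcoeff j (partial_deriv (Some i) (\<lambda>w. \<Sum>j\<in>UNIV. J w * H w $ i $ j * partial_deriv (Some j) u w)) z = 0"
      if "j < k" for i j
    proof -
      have zero: "tcoeff j (\<lambda>w. \<Sum>l\<in>UNIV. J w * H w $ i $ l * partial_deriv (Some l) u w) z' = 0" if z': "z' \<in> V" for z'
      proof -
        have z'\<Omega>: "z' \<in> \<Omega>" using z' V by blast
        note b = smooth_bd_mult smooth_bd_partial_deriv J_smooth_bd[OF z'\<Omega>] H_smooth_bd[OF z'\<Omega>] u[OF z']
        have du: "tcoeff q (partial_deriv (Some l) u) z' = 0" if "q < k" for q l
        proof -
          have "tcoeff q (partial_deriv (Some l) u) z' = partial_deriv l (tcoeff q u) z'" by (rule tcoeff_partial_deriv[OF u[OF z']])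
          also have "\<dots> = partial_deriv l (\<lambda>z. 0) z'"
            by (rule partial_deriv_cong[OF V(1) z']) (use less.IH[OF that] less.prems(1) that in auto)
          finally show ?thesis by simp
        qed
        have "fps_nth (jet (\<lambda>w. \<Sum>l\<in>UNIV. J w * H w $ i $ l * partial_deriv (Some l) u w) z') j
          = (\<Sum>l\<in>UNIV. fps_nth (jet (\<lambda>w. J w * H w $ i $ l) z' * jet (partial_deriv (Some l) u) z') j)"
        proof (subst jet_sum)
          show "smooth_bd z' (\<lambda>w. J w * H w $ i $ l * partial_deriv (Some l) u w)" for l by (intro b)
          have "jet (\<lambda>w. J w * H w $ i $ l * partial_deriv (Some l) u w) z' = jet (\<lambda>w. J w * H w $ i $ l) z' * jet (partial_deriv (Some l) u) z'" for l
            by (intro jet_mult b)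
          then show "fps_nth (\<Sum>l\<in>UNIV. jet (\<lambda>w. J w * H w $ i $ l * partial_deriv (Some l) u w) z') j
            = (\<Sum>l\<in>UNIV. fps_nth (jet (\<lambda>w. J w * H w $ i $ l) z' * jet (partial_deriv (Some l) u) z') j)"
            by (simp add: fps_sum_nth)
        qed
        also have "\<dots> = 0"
          using du \<open>j < k\<close> by (auto simp: fps_mult_nth intro!: sum.neutral)
        finally show ?thesis by simp
      qed
      have "smooth_bd z (\<lambda>w. \<Sum>l\<in>UNIV. J w * H w $ i $ l * partial_deriv (Some l) u w)"
        by (intro smooth_bd_sum smooth_bd_mult smooth_bd_partial_deriv J_smooth_bd H_smooth_bd u less.prems z\<Omega>)
      from tcoeff_partial_deriv[OF this, of j i]
      have "tcoeff j (partial_deriv (Some i) (\<lambda>w. \<Sum>j\<in>UNIV. J w * H w $ i $ j * partial_deriv (Some j) u w)) z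
        = partial_deriv i (tcoeff j (\<lambda>w. \<Sum>l\<in>UNIV. J w * H w $ i $ l * partial_deriv (Some l) u w)) z" .
      also have "\<dots> = partial_deriv i (\<lambda>z. 0) z"
        by (rule partial_deriv_cong[OF V(1) less.prems(2)]) (rule zero)
      finally show ?thesis by simp
    qed
    have "0 = fps_nth (jet (L u) z) k" using Lu[OF less.prems(2,1)] by simp
    also have "\<dots> = real m * fps_nth ?P m + (1 - real CARD('n)) * fps_nth ?P m"
      unfolding jet_L[OF z\<Omega> u[OF less.prems(2)]]
      unfolding m fps_nth_second_order using div by (simp add: m fps_sum_nth distrib_right)
    also have "\<dots> = (real k - real CARD('n)) * (tcoeff 0 J z * (real k * tcoeff k u z))" unfolding P by (simp add: m algebra_simps)
    finally show ?thesis using tcoeff_J_0(2)[OF z\<Omega>] less.prems(1) False by simp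
  qed (use u0 less.prems in simp)
qed

text \<open>The coefficient of \<open>x\<^sup>n\<close> in Green's identity for \<open>u\<close> and \<open>h\<close> is a pure divergence, since the
  normal part of \<open>L\<close> contributes \<open>(n - 1) + (1 - n) = 0\<close> at this order.\<close>
lemma critical_identity:
  assumes z: "z \<in> \<Omega>" and u: "smooth_bd z u" and h: "smooth_bd z h" and B: "smooth_bd z B"
    and S: "\<And>k. k \<le> CARD('n) \<Longrightarrow> tcoeff k (\<lambda>w. w $ None * partial_deriv None J w + L h w + real CARD('n) * (J w * B w * (w $ None) ^ CARD('n))) z = 0"
    and Lu: "\<And>j. j < CARD('n) \<Longrightarrow> tcoeff j (L u) z = 0" and h0: "tcoeff 0 h z = 0"
  shows "(\<Sum>k\<le>CARD('n). real (CARD('n) - k) * tcoeff k u z * tcoeff (CARD('n) - k) J z) + real CARD('n) * tcoeff 0 u z * tcoeff 0 J z * tcoeff 0 B z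
    = - (\<Sum>i\<in>UNIV. partial_deriv i (tcoeff (CARD('n) - 2)
        (\<lambda>w. \<Sum>j\<in>UNIV. J w * H w $ i $ j * (u w * partial_deriv (Some j) h w - h w * partial_deriv (Some j) u w))) z)"
proof -
  note b = smooth_bd_add smooth_bd_mult smooth_bd_power smooth_bd_sum smooth_bd_const smooth_bd_coordinate smooth_bd_partial_deriv smooth_bd_diff J_smooth_bd[OF z] H_smooth_bd[OF z] u h B L_smooth_bd[OF z]
  let ?Z = "\<lambda>w. J w * (u w * partial_deriv None h w - h w * partial_deriv None u w)"
  let ?V = "\<lambda>i w. \<Sum>j\<in>UNIV. J w * H w $ i $ j * (u w * partial_deriv (Some j) h w - h w * partial_deriv (Some j) u w)"
  have Zb: "smooth_bd z ?Z" and Vb: "smooth_bd z (?V i)" for i by (intro b)+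
  have "\<forall>\<^sub>F w in bdry z. Cinf_at u w \<and> Cinf_at h w"
    by (intro eventually_conj smooth_bd_eventually_Cinf_at u h)
  then obtain e where e: "0 < e" "e \<le> 1"
    and cc: "cyl_coeffs (cyl z e \<inter> {w. w $ None > 0}) J H"
    and all: "\<And>w. w \<in> cyl z e \<inter> {w. w $ None > 0} \<Longrightarrow> (Cinf_at u w \<and> Cinf_at h w) \<and> (\<forall>i j. H w $ i $ j = H w $ j $ i)
      \<and> invertible (gm w) \<and> transpose (gm w) = gm w \<and> (\<forall>i j. Cinf_at (\<lambda>w. gm w $ i $ j) w)"
    by (rule half_cyl[OF z]) blast
  let ?U = "cyl z e \<inter> {w. w $ None > 0}"
  have uU: "Cinf_on ?U u" and hU: "Cinf_on ?U h" using all by (auto intro!: Cinf_on_if_at)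
  have green: "jet (\<lambda>w. u w * L h w - h w * L u w) z = jet (\<lambda>w. (w $ None)\<^sup>2 * partial_deriv None ?Z w
      + (1 - real CARD('n)) * (w $ None * ?Z w) + (w $ None)\<^sup>2 * (\<Sum>i\<in>UNIV. partial_deriv (Some i) (?V i) w)) z"
    by (rule jet_cong[OF e(1)], rule cyl_coeffs.green_identity[OF cc uU hU]) (use all in auto)
  obtain m where m: "CARD('n) = Suc (Suc m)" using n2 by (metis Suc_le_D numeral_2_eq_2 Suc_le_mono)
  have rhs: "fps_nth (jet (\<lambda>w. (w $ None)\<^sup>2 * partial_deriv None ?Z w
      + (1 - real CARD('n)) * (w $ None * ?Z w) + (w $ None)\<^sup>2 * (\<Sum>i\<in>UNIV. partial_deriv (Some i) (?V i) w)) z) CARD('n)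
      = (\<Sum>i\<in>UNIV. partial_deriv i (tcoeff (CARD('n) - 2) (?V i)) z)"
  proof -
    have "jet (\<lambda>w. (w $ None)\<^sup>2 * partial_deriv None ?Z w
      + (1 - real CARD('n)) * (w $ None * ?Z w) + (w $ None)\<^sup>2 * (\<Sum>i\<in>UNIV. partial_deriv (Some i) (?V i) w)) z
      = jet (\<lambda>w. (w $ None)\<^sup>2 * partial_deriv None ?Z w) z + jet (\<lambda>w. (1 - real CARD('n)) * (w $ None * ?Z w)) z
        + jet (\<lambda>w. (w $ None)\<^sup>2 * (\<Sum>i\<in>UNIV. partial_deriv (Some i) (?V i) w)) z"
      by (rule jet_add3) (intro b Zb Vb)+
    also have "jet (\<lambda>w. (w $ None)\<^sup>2 * partial_deriv None ?Z w) z = fps_X\<^sup>2 * fps_deriv (jet ?Z z)"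
      by (subst jet_mult) (intro b, intro b Zb, simp add: jet_power jet_dx)
    also have "jet (\<lambda>w. (1 - real CARD('n)) * (w $ None * ?Z w)) z = fps_const (1 - real CARD('n)) * (fps_X * jet ?Z z)"
    proof -
      have "jet (\<lambda>w. (1 - real CARD('n)) * (w $ None * ?Z w)) z = jet (\<lambda>w. 1 - real CARD('n)) z * jet (\<lambda>w. w $ None * ?Z w) z"
        by (intro jet_mult smooth_bd_mult[OF _ Zb] b)
      also have "jet (\<lambda>w. w $ None * ?Z w) z = jet (\<lambda>w. w $ None) z * jet ?Z z" by (intro jet_mult Zb b)
      finally show ?thesis by (simp only: jet_const jet_x)
    qed
    also have "jet (\<lambda>w. (w $ None)\<^sup>2 * (\<Sum>i\<in>UNIV. partial_deriv (Some i) (?V i) w)) z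
      = fps_X\<^sup>2 * (\<Sum>i\<in>UNIV. jet (partial_deriv (Some i) (?V i)) z)"
      by (subst jet_mult) (intro b, intro b Vb, simp add: jet_power jet_sum smooth_bd_partial_deriv Vb)
    finally have "fps_nth (jet (\<lambda>w. (w $ None)\<^sup>2 * partial_deriv None ?Z w
      + (1 - real CARD('n)) * (w $ None * ?Z w) + (w $ None)\<^sup>2 * (\<Sum>i\<in>UNIV. partial_deriv (Some i) (?V i) w)) z) CARD('n)
      = fps_nth (fps_X\<^sup>2 * fps_deriv (jet ?Z z) + fps_const (1 - real CARD('n)) * (fps_X * jet ?Z z)
        + fps_X\<^sup>2 * (\<Sum>i\<in>UNIV. jet (partial_deriv (Some i) (?V i)) z)) CARD('n)" by (simp only:)
    also have "\<dots> = (\<Sum>i\<in>UNIV. tcoeff m (partial_deriv (Some i) (?V i)) z)"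
      unfolding m fps_nth_second_order by (simp add: fps_sum_nth)
    also have "\<dots> = (\<Sum>i\<in>UNIV. partial_deriv i (tcoeff (CARD('n) - 2) (?V i)) z)"
      by (intro sum.cong refl) (simp add: tcoeff_partial_deriv[OF Vb] m)
    finally show ?thesis .
  qed
  let ?S = "\<lambda>w. w $ None * partial_deriv None J w + L h w + real CARD('n) * (J w * B w * (w $ None) ^ CARD('n))"
  have Sb: "smooth_bd z ?S" by (intro b)
  have jL: "jet (L h) z = jet ?S z - fps_X * fps_deriv (jet J z) - fps_const (real CARD('n)) * (jet J z * jet B z * fps_X ^ CARD('n))"
  proof -
    have "jet ?S z = jet (\<lambda>w. w $ None * partial_deriv None J w) z + jet (L h) z + jet (\<lambda>w. real CARD('n) * (J w * B w * (w $ None) ^ CARD('n))) z"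
      by (rule jet_add3) (intro b)+
    moreover have "jet (\<lambda>w. w $ None * partial_deriv None J w) z = fps_X * fps_deriv (jet J z)"
      by (subst jet_mult) (intro b, intro b, simp add: jet_dx)
    moreover have "jet (\<lambda>w. real CARD('n) * (J w * B w * (w $ None) ^ CARD('n))) z = fps_const (real CARD('n)) * (jet J z * jet B z * fps_X ^ CARD('n))"
      by (simp add: jet_mult smooth_bd_mult smooth_bd_power b(9) B jet_power)
    ultimately show ?thesis by simp
  qed
  have lhs: "fps_nth (jet (\<lambda>w. u w * L h w - h w * L u w) z) CARD('n)
    = - ((\<Sum>k\<le>CARD('n). real (CARD('n) - k) * tcoeff k u z * tcoeff (CARD('n) - k) J z) + real CARD('n) * tcoeff 0 u z * tcoeff 0 J z * tcoeff 0 B z)"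
  proof -
    have split: "jet (\<lambda>w. u w * L h w - h w * L u w) z = jet u z * jet (L h) z - jet h z * jet (L u) z"
      by (subst jet_diff) (intro b, intro b, simp add: jet_mult b)
    have "fps_nth (jet (\<lambda>w. u w * L h w - h w * L u w) z) CARD('n)
      = fps_nth (jet u z * jet ?S z) CARD('n) - fps_nth (jet u z * (fps_X * fps_deriv (jet J z))) CARD('n)
        - real CARD('n) * fps_nth ((jet u z * (jet J z * jet B z)) * fps_X ^ CARD('n)) CARD('n) - fps_nth (jet h z * jet (L u) z) CARD('n)"
    proof -
      have "U * (S - D - fps_const c * (JB * XN)) - W = U * S - U * D - fps_const c * (U * JB * XN) - W"
        for U S D JB XN W :: "real fps" and c by (simp add: algebra_simps)
      then have "jet (\<lambda>w. u w * L h w - h w * L u w) z = jet u z * jet ?S z - jet u z * (fps_X * fps_deriv (jet J z))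
        - fps_const (real CARD('n)) * ((jet u z * (jet J z * jet B z)) * fps_X ^ CARD('n)) - jet h z * jet (L u) z"
        unfolding split jL by (simp only:)
      then show ?thesis by (simp only: fps_sub_nth fps_mult_left_const_nth)
    qed
    moreover have "fps_nth (jet u z * jet ?S z) CARD('n) = 0"
      unfolding fps_mult_nth using S by (intro sum.neutral) auto
    moreover have "fps_nth (jet h z * jet (L u) z) CARD('n) = 0"
      unfolding fps_mult_nth
    proof (intro sum.neutral ballI)
      fix i assume "i \<in> {0..CARD('n)}"
      then show "fps_nth (jet h z) i * fps_nth (jet (L u) z) (CARD('n) - i) = 0"
        using h0 Lu[of "CARD('n) - i"] by (cases "i = 0") auto
    qed
    moreover have "fps_nth ((jet u z * (jet J z * jet B z)) * fps_X ^ CARD('n)) CARD('n) = tcoeff 0 u z * tcoeff 0 J z * tcoeff 0 B z"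
      by (simp add: fps_X_power_mult_right_nth)
    moreover have "fps_nth (jet u z * (fps_X * fps_deriv (jet J z))) CARD('n) = (\<Sum>k\<le>CARD('n). real (CARD('n) - k) * tcoeff k u z * tcoeff (CARD('n) - k) J z)"
    proof -
      have nth: "fps_nth (fps_X * fps_deriv (jet J z)) k = real k * tcoeff k J z" for k
        by (cases k) (simp_all del: of_nat_Suc)
      show ?thesis
        unfolding fps_mult_nth[of "jet u z" "fps_X * fps_deriv (jet J z)"] nth jet_nth atMost_atLeast0
        by (intro sum.cong refl) simp
    qed
    ultimately show ?thesis by simp
  qed
  show ?thesis using lhs rhs green by simp
qed

text \<open>In the splitting \<open>U = log x + h + B x\<^sup>n log x + R\<close> the operator is computed exactly on the explicit
  terms.  The term \<open>x\<^sup>n log x\<close> drops out of \<open>L (B x\<^sup>n log x)\<close> to leading order, \<open>n\<close> being an indicial root,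
  and leaves \<open>n J B x\<^sup>n\<close>.\<close>
lemma log_residual:
  assumes z: "z \<in> \<Omega>" and U: "\<forall>\<^sub>F w in bdry z. Cinf_at U w" and h: "smooth_bd z h" and B: "smooth_bd z B"
    and eq: "\<forall>\<^sub>F w in bdry z. \<bar>L U w + real CARD('n) * J w\<bar> \<le> C * ((w $ None) ^ (CARD('n) + 1) * \<bar>ln (w $ None)\<bar>)"
  defines "R \<equiv> \<lambda>w. U w - (ln (w $ None) + h w + B w * ((w $ None) ^ CARD('n) * ln (w $ None)))"
  shows "\<forall>\<^sub>F w in bdry z. Cinf_at R w"
    and "\<exists>C. \<forall>\<^sub>F w in bdry z. \<bar>L R w + (w $ None * partial_deriv None J w + L h w
        + real CARD('n) * (J w * B w * (w $ None) ^ CARD('n)))\<bar> \<le> C * ((w $ None) ^ (CARD('n) + 1) * \<bar>ln (w $ None)\<bar>)"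
proof -
  let ?n = "real CARD('n)"
  let ?T = "\<lambda>w. J w * partial_deriv None B w + partial_deriv None (\<lambda>w. J w * B w) w"
  have Tb: "smooth_bd z ?T" by (intro smooth_bd_add smooth_bd_mult smooth_bd_partial_deriv J_smooth_bd B z)
  obtain CT where CT: "\<forall>\<^sub>F w in bdry z. \<bar>?T w\<bar> \<le> CT" using smooth_bd_eventually_bounded[OF Tb] by blast
  obtain CB where CB: "\<forall>\<^sub>F w in bdry z. \<bar>L B w\<bar> \<le> CB * w $ None"
  proof -
    obtain d1 where d1: "d1 > 0" "\<And>z'. dist z' z < d1 \<Longrightarrow> smooth_bd z' B" using smooth_bd_near[OF B] by blast
    obtain d2 where d2: "d2 > 0" "ball z d2 \<subseteq> \<Omega>" using open_\<Omega> z open_contains_ball by blast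
    have 0: "tcoeff k (L B) z' = 0" if "dist z' z < min d1 d2" "k < 1" for z' k
      using tcoeff_L_0[of z' B] that d1(2)[of z'] d2(2) by (auto simp: dist_commute)
    have m: "min d1 d2 > 0" using d1 d2 by simp
    obtain e C where e: "e > 0" "\<And>z' x. dist z' z < e \<Longrightarrow> 0 < x \<Longrightarrow> x < e \<Longrightarrow> \<bar>L B (pt z' x)\<bar> \<le> C * x ^ 1"
      by (rule tcoeff_bigo[where m=1 and d="min d1 d2", OF L_smooth_bd[OF z B] 0 m]) blast+
    have "\<bar>L B w\<bar> \<le> C * w $ None" if "w \<in> cyl z e" "w $ None > 0" for w
      using e(2)[of "base w" "w $ None"] that by (simp add: cyl_def pt_base)
    then have "\<forall>\<^sub>F w in bdry z. \<bar>L B w\<bar> \<le> C * w $ None" unfolding eventually_bdry using e(1) by blast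
    then show ?thesis using that by blast
  qed
  let ?x = "\<lambda>w :: real^'n option. w $ None"
  have small: "\<forall>\<^sub>F w in bdry z. 0 < ?x w \<and> ?x w < exp (- 1) \<and> dist (base w) z < exp (- 1)"
    by (rule bdry_small) simp
  have "\<forall>\<^sub>F w in bdry z. Cinf_at U w \<and> Cinf_at h w \<and> Cinf_at B w"
    by (intro eventually_conj smooth_bd_eventually_Cinf_at h B U)
  then obtain e where e: "0 < e" "e \<le> 1" and cc: "cyl_coeffs (cyl z e \<inter> {w. w $ None > 0}) J H"
    and all: "\<And>w. w \<in> cyl z e \<inter> {w. w $ None > 0} \<Longrightarrow> (Cinf_at U w \<and> Cinf_at h w \<and> Cinf_at B w) \<and> (\<forall>i j. H w $ i $ j = H w $ j $ i)
      \<and> invertible (gm w) \<and> transpose (gm w) = gm w \<and> (\<forall>i j. Cinf_at (\<lambda>w. gm w $ i $ j) w)"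
    by (rule half_cyl[OF z]) blast
  define W where "W = cyl z e \<inter> {w. w $ None > 0}"
  have W: "open W" unfolding W_def by (intro open_Int open_cyl open_Collect_less continuous_intros)
  have pos: "?x w > 0" if "w \<in> W" for w using that by (simp add: W_def)
  interpret cc: cyl_coeffs W J H using cc by (simp add: W_def)
  have UW: "Cinf_on W U" and hW: "Cinf_on W h" and BW: "Cinf_on W B"
    using all by (auto intro!: Cinf_on_if_at simp: W_def)
  have lnW: "Cinf_on W (\<lambda>w. ln (?x w))" by (rule Cinf_on_ln[OF W Cinf_on_coordinate pos])
  have lW: "Cinf_on W (\<lambda>w. ?x w ^ CARD('n) * ln (?x w))"
    by (intro Cinf_on_mult[OF W] Cinf_on_power[OF W] Cinf_on_coordinate lnW)
  have BlW: "Cinf_on W (\<lambda>w. B w * (?x w ^ CARD('n) * ln (?x w)))" by (intro Cinf_on_mult[OF W] BW lW)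
  have RW: "Cinf_on W R" unfolding R_def by (intro Cinf_on_diff[OF W] Cinf_on_add[OF W] UW lnW hW BlW)
  have evW: "\<forall>\<^sub>F w in bdry z. w \<in> W" unfolding eventually_bdry W_def using e(1) by blast
  show "\<forall>\<^sub>F w in bdry z. Cinf_at R w" using evW
    by eventually_elim (use RW W in \<open>auto simp: Cinf_at_def\<close>)
  obtain m where m: "CARD('n) = Suc (Suc m)" using n2 by (metis Suc_le_D numeral_2_eq_2 Suc_le_mono)

  have Lln: "L (\<lambda>w. ln (?x w)) w = ?x w * partial_deriv None J w - ?n * J w" if w: "w \<in> W" for w
  proof -
    have x: "?x w > 0" by (rule pos[OF w])
    have "L (\<lambda>w. 1 * ln (?x w)) w = ln (?x w) * L (\<lambda>w. 1) w
      + (?x w)\<^sup>2 * (J w * partial_deriv None (\<lambda>w. 1) w + partial_deriv None (\<lambda>w. J w * 1) w) * inverse (?x w)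
      + J w * 1 * ((?x w)\<^sup>2 * (- (inverse (?x w) * inverse (?x w))) + (1 - ?n) * (?x w * inverse (?x w)))"
    proof (rule cc.cyl_op_mult_vertical[OF Cinf_on_const w])
      show "(ln has_real_derivative inverse (w $ None)) (at (w $ None))" if "w \<in> W" for w
        using pos[OF that] by (auto intro!: derivative_eq_intros simp: divide_inverse)
      show "(inverse has_real_derivative - (inverse (?x w) * inverse (?x w))) (at (?x w))"
        using x by (auto intro!: derivative_eq_intros)
    qed
    moreover have "L (\<lambda>w. 1) w = 0" by (simp add: cyl_op_def)
    ultimately show ?thesis using x by (simp add: power2_eq_square algebra_simps)
  qed
  have LBl: "L (\<lambda>w. B w * (?x w ^ CARD('n) * ln (?x w))) w = ?x w ^ CARD('n) * ln (?x w) * L B w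
      + ?x w ^ (CARD('n) + 1) * (?n * ln (?x w) + 1) * ?T w + ?n * (J w * B w * ?x w ^ CARD('n))" if w: "w \<in> W" for w
  proof -
    have x: "?x w > 0" by (rule pos[OF w])
    have pow: "((\<lambda>t. t ^ Suc k) has_real_derivative real (Suc k) * t ^ k) (at t)" for k and t :: real
      using DERIV_pow[of "Suc k" t UNIV] by simp
    let ?l1 = "\<lambda>t. ?n * t ^ Suc m * ln t + t ^ Suc m"
    let ?l2 = "?n * (real (Suc m) * ?x w ^ m * ln (?x w) + ?x w ^ m) + real (Suc m) * ?x w ^ m"
    have "L (\<lambda>w. B w * (?x w ^ CARD('n) * ln (?x w))) w = ?x w ^ CARD('n) * ln (?x w) * L B w
      + (?x w)\<^sup>2 * ?T w * ?l1 (?x w)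
      + J w * B w * ((?x w)\<^sup>2 * ?l2 + (1 - ?n) * (?x w * ?l1 (?x w)))"
    proof (rule cc.cyl_op_mult_vertical[OF BW w])
      show "((\<lambda>t. t ^ CARD('n) * ln t) has_real_derivative ?l1 (w $ None)) (at (w $ None))" if "w \<in> W" for w
        unfolding m
        by (rule DERIV_cong[OF DERIV_mult[OF pow DERIV_ln[OF pos[OF that]]]]) (use pos[OF that] in \<open>simp add: m algebra_simps\<close>)
      show "(?l1 has_real_derivative ?l2) (at (?x w))"
        unfolding mult.assoc[of ?n]
        by (rule DERIV_cong[OF DERIV_add[OF DERIV_cmult[OF DERIV_mult[OF pow DERIV_ln[OF x]]] pow]])
          (use x in \<open>simp add: algebra_simps\<close>)
    qed
    also have "\<dots> = ?x w ^ CARD('n) * ln (?x w) * L B w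
      + ?x w ^ (CARD('n) + 1) * (?n * ln (?x w) + 1) * ?T w + ?n * (J w * B w * ?x w ^ CARD('n))"
      unfolding m by (simp add: algebra_simps power2_eq_square)
    finally show ?thesis .
  qed
  have LR: "L R w + (?x w * partial_deriv None J w + L h w + ?n * (J w * B w * ?x w ^ CARD('n)))
      = (L U w + ?n * J w) - ?x w ^ CARD('n) * ln (?x w) * L B w - ?x w ^ (CARD('n) + 1) * (?n * ln (?x w) + 1) * ?T w"
    if w: "w \<in> W" for w
  proof -
    have "L U w = L (\<lambda>w. (ln (?x w) + h w + B w * (?x w ^ CARD('n) * ln (?x w))) + R w) w"
      by (rule cyl_op_cong[OF W w]) (simp add: R_def)
    also have "\<dots> = L (\<lambda>w. ln (?x w) + h w + B w * (?x w ^ CARD('n) * ln (?x w))) w + L R w"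
      by (intro cc.cyl_op_add Cinf_on_add[OF W] lnW hW BlW RW w)
    also have "L (\<lambda>w. ln (?x w) + h w + B w * (?x w ^ CARD('n) * ln (?x w))) w
      = L (\<lambda>w. ln (?x w) + h w) w + L (\<lambda>w. B w * (?x w ^ CARD('n) * ln (?x w))) w"
      by (intro cc.cyl_op_add Cinf_on_add[OF W] lnW hW BlW w)
    also have "L (\<lambda>w. ln (?x w) + h w) w = L (\<lambda>w. ln (?x w)) w + L h w"
      by (intro cc.cyl_op_add lnW hW w)
    finally show ?thesis unfolding Lln[OF w] LBl[OF w] by simp
  qed
  let ?K = "\<bar>C\<bar> + \<bar>CB\<bar> + (?n + 1) * \<bar>CT\<bar>"
  show "\<exists>C. \<forall>\<^sub>F w in bdry z. \<bar>L R w + (w $ None * partial_deriv None J w + L h w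
        + real CARD('n) * (J w * B w * (w $ None) ^ CARD('n)))\<bar> \<le> C * ((w $ None) ^ (CARD('n) + 1) * \<bar>ln (w $ None)\<bar>)"
  proof (rule exI[of _ ?K])
    show "\<forall>\<^sub>F w in bdry z. \<bar>L R w + (w $ None * partial_deriv None J w + L h w
        + real CARD('n) * (J w * B w * (w $ None) ^ CARD('n)))\<bar> \<le> ?K * ((w $ None) ^ (CARD('n) + 1) * \<bar>ln (w $ None)\<bar>)"
      using evW eq CB CT small
    proof eventually_elim
      case (elim w)
      define x where "x = ?x w"
      define q where "q = x ^ (CARD('n) + 1) * \<bar>ln x\<bar>"
      have x: "0 < x" "x < exp (- 1)" using elim by (simp_all add: x_def)
      have "ln x < -1" using x by (metis exp_gt_zero ln_exp ln_less_cancel_iff)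
      then have l1: "\<bar>ln x\<bar> \<ge> 1" by linarith
      have q0: "q \<ge> 0" unfolding q_def using x by simp
      have 1: "\<bar>L U w + ?n * J w\<bar> \<le> \<bar>C\<bar> * q"
      proof -
        have "C * q \<le> \<bar>C\<bar> * q" using q0 by (intro mult_right_mono) auto
        then show ?thesis using elim(2) by (simp only: q_def x_def)
      qed
      have 2: "\<bar>x ^ CARD('n) * ln x * L B w\<bar> \<le> \<bar>CB\<bar> * q"
      proof -
        have "CB * x \<le> \<bar>CB\<bar> * x" using x by (intro mult_right_mono) auto
        then have "\<bar>L B w\<bar> \<le> \<bar>CB\<bar> * x" using elim(3) by (simp add: x_def)
        then have "x ^ CARD('n) * \<bar>ln x\<bar> * \<bar>L B w\<bar> \<le> x ^ CARD('n) * \<bar>ln x\<bar> * (\<bar>CB\<bar> * x)"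
          by (rule mult_left_mono) (use x in simp)
        moreover have "x ^ CARD('n) * \<bar>ln x\<bar> * (\<bar>CB\<bar> * x) = \<bar>CB\<bar> * q" by (simp add: q_def)
        moreover have "\<bar>x ^ CARD('n) * ln x * L B w\<bar> = x ^ CARD('n) * \<bar>ln x\<bar> * \<bar>L B w\<bar>" using x by (simp add: abs_mult)
        ultimately show ?thesis by linarith
      qed
      have 3: "\<bar>x ^ (CARD('n) + 1) * (?n * ln x + 1) * ?T w\<bar> \<le> (?n + 1) * \<bar>CT\<bar> * q"
      proof -
        have "\<bar>?n * ln x + 1\<bar> \<le> ?n * \<bar>ln x\<bar> + 1"
          using abs_triangle_ineq[of "?n * ln x" 1] by (simp add: abs_mult)
        also have "\<dots> \<le> (?n + 1) * \<bar>ln x\<bar>" using l1 by (simp add: algebra_simps)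
        finally have a: "\<bar>?n * ln x + 1\<bar> \<le> (?n + 1) * \<bar>ln x\<bar>" .
        have b: "\<bar>?T w\<bar> \<le> \<bar>CT\<bar>" using elim(4) by linarith
        have "x ^ (CARD('n) + 1) * \<bar>?n * ln x + 1\<bar> * \<bar>?T w\<bar> \<le> x ^ (CARD('n) + 1) * ((?n + 1) * \<bar>ln x\<bar>) * \<bar>CT\<bar>"
          by (rule mult_mono[OF mult_left_mono[OF a] b]) (use x in simp_all)
        moreover have "x ^ (CARD('n) + 1) * ((?n + 1) * \<bar>ln x\<bar>) * \<bar>CT\<bar> = (?n + 1) * \<bar>CT\<bar> * q" by (simp add: q_def)
        moreover have "\<bar>x ^ (CARD('n) + 1) * (?n * ln x + 1) * ?T w\<bar> = x ^ (CARD('n) + 1) * \<bar>?n * ln x + 1\<bar> * \<bar>?T w\<bar>"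
          using x by (simp only: abs_mult abs_of_pos zero_less_power)
        ultimately show ?thesis by linarith
      qed
      have "\<bar>(L U w + ?n * J w) - x ^ CARD('n) * ln x * L B w - x ^ (CARD('n) + 1) * (?n * ln x + 1) * ?T w\<bar>
        \<le> \<bar>C\<bar> * q + \<bar>CB\<bar> * q + (?n + 1) * \<bar>CT\<bar> * q" using 1 2 3 by linarith
      also have "\<dots> = ?K * q" by (simp add: algebra_simps)
      finally show ?case unfolding LR[OF elim(1)] by (simp only: x_def q_def)
    qed
  qed
qed

end

section \<open>Charts of the cylinder\<close>

definition lift :: "('m, 'n::finite) chart \<Rightarrow> ('m \<times> real \<Rightarrow> real) \<Rightarrow> real^'n option \<Rightarrow> real"
  where "lift c u w = u (chart_inv c (base w), w $ None)"

lemma chartD: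
  assumes "is_chart c"
  shows "open (fst c)" "open (chart_image c)" "continuous_on (fst c) (snd c)"
    "continuous_on (chart_image c) (chart_inv c)"
    "y \<in> fst c \<Longrightarrow> chart_inv c (snd c y) = y" "z \<in> chart_image c \<Longrightarrow> snd c (chart_inv c z) = z"
    "z \<in> chart_image c \<Longrightarrow> chart_inv c z \<in> fst c" "y \<in> fst c \<Longrightarrow> snd c y \<in> chart_image c"
  using assms by (auto simp: is_chart_def homeomorphism_def)

lemma snd_cyl_chart: "snd (cyl_chart I c) (y, x) = pt (snd c y) x"
  and fst_cyl_chart: "fst (cyl_chart I c) = fst c \<times> I"
  by (simp_all add: cyl_chart_def pt_def)

lemma chart_image_cyl:
  assumes "is_chart c"
  shows "chart_image (cyl_chart I c) = {w. w $ None \<in> I \<and> base w \<in> chart_image c}"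
proof (intro set_eqI iffI)
  fix w assume "w \<in> chart_image (cyl_chart I c)"
  then obtain y x where "y \<in> fst c" "x \<in> I" "w = pt (snd c y) x"
    unfolding chart_image_def fst_cyl_chart using snd_cyl_chart[of I c] by fastforce
  then show "w \<in> {w. w $ None \<in> I \<and> base w \<in> chart_image c}" using chartD(8)[OF assms] by simp
next
  fix w assume w: "w \<in> {w. w $ None \<in> I \<and> base w \<in> chart_image c}"
  have "snd (cyl_chart I c) (chart_inv c (base w), w $ None) = w"
    using w chartD(6)[OF assms] by (simp add: snd_cyl_chart pt_base)
  moreover have "(chart_inv c (base w), w $ None) \<in> fst (cyl_chart I c)"
    using w chartD(7)[OF assms] by (simp add: fst_cyl_chart)
  ultimately show "w \<in> chart_image (cyl_chart I c)" unfolding chart_image_def by (metis imageI)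
qed

lemma chart_inv_cyl:
  assumes c: "is_chart c" and w: "w $ None \<in> I" "base w \<in> chart_image c"
  shows "chart_inv (cyl_chart I c) w = (chart_inv c (base w), w $ None)"
proof -
  have inj: "inj_on (snd (cyl_chart I c)) (fst (cyl_chart I c))"
  proof (rule inj_onI)
    fix p q assume p: "p \<in> fst (cyl_chart I c)" and q: "q \<in> fst (cyl_chart I c)" and eq: "snd (cyl_chart I c) p = snd (cyl_chart I c) q"
    have "pt (snd c (fst p)) (snd p) = pt (snd c (fst q)) (snd q)"
      using eq snd_cyl_chart[of I c "fst p" "snd p"] snd_cyl_chart[of I c "fst q" "snd q"] by simp
    then have "snd c (fst p) = snd c (fst q)" "snd p = snd q" by (metis base_pt, metis pt_None)
    then show "p = q" using p q chartD(5)[OF c] by (metis fst_cyl_chart mem_Times_iff prod_eqI)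
  qed
  have "snd (cyl_chart I c) (chart_inv c (base w), w $ None) = w"
    using w chartD(6)[OF c] by (simp add: snd_cyl_chart pt_base)
  moreover have "(chart_inv c (base w), w $ None) \<in> fst (cyl_chart I c)"
    using w chartD(7)[OF c] by (simp add: fst_cyl_chart)
  ultimately show ?thesis unfolding chart_inv_def[of "cyl_chart I c"] using inv_into_f_f[OF inj] by metis
qed

lemma smooth_on_open_imp:
  assumes "open S" "smooth_on S f" shows "Cinf_on S f"
proof (rule Cinf_on_if_at)
  fix z assume "z \<in> S"
  from bspec[OF assms(2)[unfolded smooth_on_def] this]
  obtain W F where W: "open W" "z \<in> W" "\<forall>r. Ck_on r W F" "\<forall>y\<in>S \<inter> W. F y = f y"
    by (elim exE conjE)
  have "Cinf_on W F" using W(3) by (simp add: Cinf_on_def)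
  then have F: "Cinf_on (S \<inter> W) F" by (rule Cinf_on_subset) simp
  have "Cinf_on (S \<inter> W) f" by (rule Cinf_on_cong[OF open_Int[OF assms(1) W(1)] _ F]) (use W(4) in blast)
  then show "Cinf_at f z" unfolding Cinf_at_def using assms(1) W(1,2) \<open>z \<in> S\<close> by blast
qed

lemma Cinf_on_imp_smooth_on: "open S \<Longrightarrow> Cinf_on S f \<Longrightarrow> smooth_on S f"
  unfolding smooth_on_def Cinf_on_def by blast

text \<open>The local extension provided by smoothness at the points with \<open>x = 0\<close> agrees with \<open>u\<close> also at these
  points, so the limit from \<open>x > 0\<close> is the boundary value.\<close>
lemma smooth_bd_lift:
  assumes c: "is_chart c" and a: "a > 0"
    and s: "smooth_on (chart_image (cyl_chart {0..<a} c)) (\<lambda>w. u (chart_inv (cyl_chart {0..<a} c) w))"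
    and z: "z \<in> chart_image c"
  shows "smooth_bd z (lift c u)" and "tcoeff 0 (lift c u) z = u (chart_inv c z, 0)"
proof -
  let ?S = "chart_image (cyl_chart {0..<a} c)"
  note img = chart_image_cyl[OF c, of "{0..<a}"]
  have "pt z 0 \<in> ?S" unfolding img using z a by simp
  from bspec[OF s[unfolded smooth_on_def] this]
  obtain W F where W: "open W" "pt z 0 \<in> W" "\<forall>r. Ck_on r W F"
    "\<forall>w\<in>?S \<inter> W. F w = u (chart_inv (cyl_chart {0..<a} c) w)"
    by (elim exE conjE)
  have lift: "u (chart_inv (cyl_chart {0..<a} c) w) = lift c u w" if "w \<in> ?S" for w
    using chart_inv_cyl[OF c, of w "{0..<a}"] that by (simp add: img lift_def)
  have "open (base -` chart_image c)"
    using open_vimage[OF chartD(2)[OF c] continuous_on_base[OF continuous_on_id]] by simp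
  moreover have "open {w :: real^'b option. w $ None < a}" by (intro open_Collect_less continuous_intros)
  ultimately have "open (W \<inter> (base -` chart_image c \<inter> {w. w $ None < a}))"
    using W(1) by (intro open_Int)
  then obtain e where e: "e > 0" "cyl z e \<subseteq> W \<inter> (base -` chart_image c \<inter> {w. w $ None < a})"
    by (rule cyl_subset_open) (use W(2) z a in auto)
  have "Cinf_on W F" using W(3) by (simp add: Cinf_on_def)
  then have F: "Cinf_on (cyl z e) F" by (rule Cinf_on_subset) (use e(2) in blast)
  have eq: "F w = lift c u w" if "w \<in> cyl z e" "w $ None \<ge> 0" for w
  proof -
    have "w \<in> ?S \<inter> W" using that e(2) by (auto simp: img)
    then show ?thesis using W(4) lift by auto
  qed
  show b: "smooth_bd z (lift c u)" unfolding smooth_bd_def using e(1) F eq by (intro exI[of _ e] conjI exI[of _ F]) auto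
  have "tcoeff 0 (lift c u) z = F (pt z 0)"
    using tcoeff_extension(1)[OF F, of "lift c u" z 0] eq e(1) by simp
  also have "\<dots> = u (chart_inv c z, 0)" using eq[of "pt z 0"] e(1) by (simp add: lift_def)
  finally show "tcoeff 0 (lift c u) z = u (chart_inv c z, 0)" .
qed

lemma half_chart_near:
  assumes c: "is_chart c" and a: "a > 0" and z: "z \<in> chart_image c"
  shows "\<forall>\<^sub>F w in bdry z. 0 < w $ None \<and> w $ None < a \<and> base w \<in> chart_image c"
proof -
  obtain d where d: "d > 0" "ball z d \<subseteq> chart_image c" using chartD(2)[OF c] z open_contains_ball by blast
  then have "min a d > 0" using a by simp
  from bdry_small[OF this, of z] show ?thesis
    by eventually_elim (use d(2) in \<open>auto simp: dist_commute\<close>)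
qed

lemma open_half_chart: "is_chart c \<Longrightarrow> open (chart_image (cyl_chart {0<..<a} c))"
proof -
  assume c: "is_chart c"
  have "open (base -` chart_image c)"
    using open_vimage[OF chartD(2)[OF c] continuous_on_base[OF continuous_on_id]] by simp
  moreover have "open {w :: real^'b option. 0 < w $ None}" "open {w :: real^'b option. w $ None < a}"
    by (intro open_Collect_less continuous_intros)+
  ultimately have "open ({w. 0 < w $ None} \<inter> {w. w $ None < a} \<inter> base -` chart_image c)" by (intro open_Int)
  moreover have "{w. 0 < w $ None} \<inter> {w. w $ None < a} \<inter> base -` chart_image c = chart_image (cyl_chart {0<..<a} c)"
    by (auto simp: chart_image_cyl[OF c])
  ultimately show ?thesis by simp
qed

lemma Cinf_at_lift:
  assumes c: "is_chart c" and a: "a > 0" and z: "z \<in> chart_image c"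
    and s: "smooth_on (chart_image (cyl_chart {0<..<a} c)) (\<lambda>w. u (chart_inv (cyl_chart {0<..<a} c) w))"
  shows "\<forall>\<^sub>F w in bdry z. Cinf_at (lift c u) w"
  using half_chart_near[OF c a z]
proof eventually_elim
  case (elim w)
  let ?S = "chart_image (cyl_chart {0<..<a} c)"
  have "Cinf_on ?S (lift c u)"
    by (rule Cinf_on_cong[OF open_half_chart[OF c] _ smooth_on_open_imp[OF open_half_chart[OF c] s]])
      (simp add: chart_image_cyl[OF c] chart_inv_cyl[OF c] lift_def)
  moreover have "w \<in> ?S" using elim by (simp add: chart_image_cyl[OF c])
  ultimately show ?case unfolding Cinf_at_def using open_half_chart[OF c] by blast
qed

lemma locally_bigo_lift:
  assumes c: "is_chart c" and z: "z \<in> chart_image c" and S: "fst c \<subseteq> S" and o: "locally_bigo S h k"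
  shows "\<exists>C. \<forall>\<^sub>F w in bdry z. \<bar>lift c h w\<bar> \<le> C * \<bar>k (w $ None)\<bar>"
proof -
  have "chart_inv c z \<in> S" using chartD(7)[OF c z] S by blast
  then obtain W C where W: "open W" "chart_inv c z \<in> W"
    "\<forall>\<^sub>F x in at_right 0. \<forall>y\<in>W \<inter> S. \<bar>h (y, x)\<bar> \<le> C * \<bar>k x\<bar>"
    using o unfolding locally_bigo_def by blast
  from W(3) obtain b where b: "b > 0" "\<And>x y. 0 < x \<Longrightarrow> x < b \<Longrightarrow> y \<in> W \<inter> S \<Longrightarrow> \<bar>h (y, x)\<bar> \<le> C * \<bar>k x\<bar>"
    unfolding eventually_at_right_field by blast
  have "open (chart_image c \<inter> chart_inv c -` W)"
    by (rule continuous_open_preimage[OF chartD(4)[OF c] chartD(2)[OF c] W(1)])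
  then obtain d where d: "d > 0" "ball z d \<subseteq> chart_image c \<inter> chart_inv c -` W"
    using z W(2) open_contains_ball by blast
  have "min b d > 0" using b d by simp
  from bdry_small[OF this, of z] have "\<forall>\<^sub>F w in bdry z. \<bar>lift c h w\<bar> \<le> C * \<bar>k (w $ None)\<bar>"
  proof eventually_elim
    case (elim w)
    then have "base w \<in> chart_image c \<inter> chart_inv c -` W" using d(2) by (auto simp: dist_commute)
    then show ?case using b(2)[of "w $ None" "chart_inv c (base w)"] elim chartD(7)[OF c] S
      by (auto simp: lift_def)
  qed
  then show ?thesis by blast
qed

lemma bdry_at_right: "\<forall>\<^sub>F w in bdry z. P w \<Longrightarrow> \<forall>\<^sub>F x in at_right 0. P (pt z x)"
proof -
  assume "\<forall>\<^sub>F w in bdry z. P w"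
  then obtain e where "e > 0" "\<forall>w\<in>cyl z e. w $ None > 0 \<longrightarrow> P w" unfolding eventually_bdry by blast
  then show ?thesis by (intro eventually_at_right_0I[of e]) auto
qed

lemma has_signature_det:
  assumes "has_signature p q G" shows "det G \<noteq> 0" "transpose G = G"
proof -
  show "transpose G = G" using assms by (simp add: has_signature_def)
  obtain B :: "real^'a^'a" and \<epsilon> where B: "invertible B" "transpose B ** G ** B = (\<chi> i j. if i = j then \<epsilon> i else 0)" "range \<epsilon> \<subseteq> {1, -1}"
    using assms unfolding has_signature_def by blast
  have "\<epsilon> i \<noteq> 0" for i using B(3) by (metis insertE rangeI singletonD subsetD zero_neq_neg_one zero_neq_one)
  then have "det (transpose B ** G ** B) \<noteq> 0" unfolding B(2) by (subst det_diagonal) auto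
  then show "det G \<noteq> 0" by (auto simp: det_mul)
qed

lemma tcoeff_Cinf_on_open:
  assumes "open \<Omega>" "\<And>z. z \<in> \<Omega> \<Longrightarrow> smooth_bd z f" shows "Cinf_on \<Omega> (tcoeff k f)"
proof (rule Cinf_on_if_at)
  fix z assume "z \<in> \<Omega>"
  obtain e where e: "e > 0" "Cinf_on (ball z e) (tcoeff k f)" using tcoeff_Cinf_on[OF assms(2)[OF \<open>z \<in> \<Omega>\<close>]] by metis
  then show "Cinf_at (tcoeff k f) z" unfolding Cinf_at_def by (intro exI[of _ "ball z e"]) auto
qed

text \<open>The coordinate map carries the restriction of the volume measure to the domain of the chart to
  Lebesgue measure with density \<open>\<bar>det g\<bar>\<^sup>1\<^sup>/\<^sup>2\<close>.\<close>
lemma integral_in_chart: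
  fixes A :: "('m::topological_space, 'n::finite) chart set"
  assumes vm: "volume_measure A g \<mu>" and cA: "c \<in> A" and c: "is_chart c"
    and dens: "continuous_on (chart_image c) (\<lambda>z. sqrt \<bar>det (g c (chart_inv c z))\<bar>)"
    and F: "continuous_on (chart_image c) (\<lambda>z. F (chart_inv c z))"
    and K: "K \<subseteq> chart_image c" "\<And>p. p \<in> carrier A \<Longrightarrow> p \<notin> chart_inv c ` K \<Longrightarrow> F p = (0::real)"
  shows "(\<integral>p. F p \<partial>\<mu>) = (\<integral>z. indicator K z * (F (chart_inv c z) * sqrt \<bar>det (g c (chart_inv c z))\<bar>) \<partial>lborel)"
proof -
  let ?D = "fst c" and ?\<Omega> = "chart_image c"
  let ?\<rho> = "\<lambda>z. sqrt \<bar>det (g c (chart_inv c z))\<bar>"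
  define \<rho> where "\<rho> = (\<lambda>z. indicator ?\<Omega> z *\<^sub>R ?\<rho> z)"
  define F' where "F' = (\<lambda>z. indicator ?\<Omega> z *\<^sub>R F (chart_inv c z))"
  have sp: "space \<mu> = carrier A" and st: "sets \<mu> = sets (restrict_space borel (carrier A))"
    and em: "\<And>E. E \<in> sets borel \<Longrightarrow> E \<subseteq> ?D \<Longrightarrow> emeasure \<mu> E = (\<integral>\<^sup>+z. ennreal (?\<rho> z) * indicator (snd c ` E) z \<partial>lborel)"
    using vm cA unfolding volume_measure_def by blast+
  have DA: "?D \<subseteq> carrier A" using cA by (auto simp: carrier_def)
  have oD: "open ?D" and o\<Omega>: "open ?\<Omega>" using chartD[OF c] by auto
  have \<rho>m: "\<rho> \<in> borel_measurable borel" unfolding \<rho>_def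
    by (rule borel_measurable_continuous_on_indicator[OF _ dens]) (use o\<Omega> in simp)
  have F'm: "F' \<in> borel_measurable borel" unfolding F'_def
    by (rule borel_measurable_continuous_on_indicator[OF _ F]) (use o\<Omega> in simp)
  have setsR: "sets (restrict_space \<mu> ?D) = sets (restrict_space borel ?D)"
  proof -
    have "(\<inter>) ?D ` ((\<inter>) (carrier A) ` sets borel) = (\<inter>) ?D ` sets borel"
      using DA by (auto simp: image_image Int_absorb2 Int_assoc[symmetric] inf.absorb1 intro!: image_cong)
    then show ?thesis by (simp add: sets_restrict_space st)
  qed
  have Dm: "?D \<inter> space \<mu> \<in> sets \<mu>"
  proof -
    have "?D \<inter> space \<mu> = carrier A \<inter> ?D" using sp by blast
    then show ?thesis using oD by (auto simp: st sets_restrict_space)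
  qed
  have phim: "snd c \<in> borel_measurable (restrict_space \<mu> ?D)"
  proof -
    have "snd c \<in> borel_measurable (restrict_space borel ?D)"
      by (rule borel_measurable_continuous_on_restrict[OF chartD(3)[OF c]])
    moreover have "measurable (restrict_space \<mu> ?D) (borel :: (real^'n) measure) = measurable (restrict_space borel ?D) borel"
      by (rule measurable_cong_sets[OF setsR refl])
    ultimately show ?thesis by simp
  qed
  have spR: "space (restrict_space \<mu> ?D) = ?D" using DA by (auto simp: space_restrict_space sp)
  have distr: "distr (restrict_space \<mu> ?D) borel (snd c) = density lborel (\<lambda>z. ennreal (\<rho> z))"
  proof (rule measure_eqI)
    fix B :: "(real^'n) set" assume "B \<in> sets (distr (restrict_space \<mu> ?D) borel (snd c))"
    then have B: "B \<in> sets borel" by simp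
    let ?E = "snd c -` B \<inter> ?D"
    have "?E \<in> sets (restrict_space \<mu> ?D)" using measurable_sets[OF phim B] by (simp add: spR)
    then have Eb: "?E \<in> sets borel" unfolding setsR using oD by (auto simp: sets_restrict_space)
    have im: "snd c ` ?E = B \<inter> ?\<Omega>" by (auto simp: chart_image_def)
    have "emeasure (distr (restrict_space \<mu> ?D) borel (snd c)) B = emeasure (restrict_space \<mu> ?D) ?E"
      by (simp add: emeasure_distr[OF phim B] spR)
    also have "\<dots> = emeasure \<mu> ?E" by (rule emeasure_restrict_space[OF Dm]) auto
    also have "\<dots> = (\<integral>\<^sup>+z. ennreal (?\<rho> z) * indicator (B \<inter> ?\<Omega>) z \<partial>lborel)"
      unfolding em[OF Eb Int_lower2] im ..
    also have "\<dots> = (\<integral>\<^sup>+z. ennreal (\<rho> z) * indicator B z \<partial>lborel)"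
      by (intro nn_integral_cong) (auto simp: \<rho>_def indicator_def)
    also have "\<dots> = emeasure (density lborel (\<lambda>z. ennreal (\<rho> z))) B"
      by (rule emeasure_density[symmetric]) (use \<rho>m B in auto)
    finally show "emeasure (distr (restrict_space \<mu> ?D) borel (snd c)) B = emeasure (density lborel (\<lambda>z. ennreal (\<rho> z))) B" .
  qed simp
  have "(\<integral>p. F p \<partial>\<mu>) = (\<integral>p. indicator ?D p *\<^sub>R F p \<partial>\<mu>)"
  proof (rule Bochner_Integration.integral_cong)
    fix p assume "p \<in> space \<mu>"
    then have p: "p \<in> carrier A" using sp by simp
    show "F p = indicator ?D p *\<^sub>R F p"
      using K(2)[OF p] K(1) chartD(7)[OF c] by (cases "p \<in> ?D") auto
  qed simp
  also have "\<dots> = (\<integral>p. F p \<partial>restrict_space \<mu> ?D)" by (rule integral_restrict_space[OF Dm, symmetric])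
  also have "\<dots> = (\<integral>p. F' (snd c p) \<partial>restrict_space \<mu> ?D)"
    by (rule Bochner_Integration.integral_cong) (simp_all add: spR F'_def chartD[OF c])
  also have "\<dots> = (\<integral>z. F' z \<partial>distr (restrict_space \<mu> ?D) borel (snd c))"
    by (rule integral_distr[OF phim F'm, symmetric])
  also have "\<dots> = (\<integral>z. \<rho> z *\<^sub>R F' z \<partial>lborel)"
    unfolding distr by (rule integral_density) (use \<rho>m F'm in \<open>auto simp: \<rho>_def\<close>)
  also have "\<dots> = (\<integral>z. indicator K z * (F (chart_inv c z) * ?\<rho> z) \<partial>lborel)"
  proof (rule Bochner_Integration.integral_cong[OF refl])
    fix z
    show "\<rho> z *\<^sub>R F' z = indicator K z * (F (chart_inv c z) * ?\<rho> z)"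
    proof (cases "z \<in> ?\<Omega>")
      case True
      have "F (chart_inv c z) = 0" if "z \<notin> K"
      proof (rule K(2))
        show "chart_inv c z \<in> carrier A" using chartD(7)[OF c True] DA by blast
        show "chart_inv c z \<notin> chart_inv c ` K"
        proof
          assume "chart_inv c z \<in> chart_inv c ` K"
          then obtain z' where "z' \<in> K" "chart_inv c z = chart_inv c z'" by blast
          then have "z = z'" using chartD(6)[OF c] True K(1) by (metis subsetD)
          then show False using that \<open>z' \<in> K\<close> by simp
        qed
      qed
      then show ?thesis using True by (cases "z \<in> K") (simp_all add: \<rho>_def F'_def)
    qed (use K(1) in \<open>auto simp: \<rho>_def indicator_def\<close>)
  qed
  finally show ?thesis .
qed

section \<open>Poincare metrics in charts\<close>

locale poincare_setup =
  fixes A :: "('m::{t2_space, second_countable_topology}, 'n::finite) chart set"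
    and p q :: nat and g :: "('m, 'n) tensor2" and a :: real
    and gx :: "real \<Rightarrow> ('m, 'n) tensor2" and gp :: "('m \<times> real, 'n option) tensor2"
  assumes n_even: "even CARD('n)" and n2: "CARD('n) \<ge> 2" and atlas: "smooth_atlas A"
    and g: "pseudo_metric A p q g" and pm: "poincare_metric A p q g a gx gp"
begin

definition gmat :: "('m, 'n) chart \<Rightarrow> real^'n option \<Rightarrow> real^'n^'n"
  where "gmat c w = gx (w $ None) c (chart_inv c (base w))"

abbreviation dens :: "('m, 'n) chart \<Rightarrow> real^'n option \<Rightarrow> real" where "dens c \<equiv> boundary_chart.J (gmat c)"
abbreviation Lap :: "('m, 'n) chart \<Rightarrow> (real^'n option \<Rightarrow> real) \<Rightarrow> real^'n option \<Rightarrow> real"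
  where "Lap c \<equiv> cyl_op (boundary_chart.J (gmat c)) (boundary_chart.H (gmat c))"

lemma chart: "c \<in> A \<Longrightarrow> is_chart c"
  using atlas by (simp add: smooth_atlas_def)

lemma a_pos: "a > 0"
  and gx_metric: "x \<in> {0..<a} \<Longrightarrow> pseudo_metric A p q (gx x)"
  and gx_smooth: "c \<in> A \<Longrightarrow> smooth_on (chart_image (cyl_chart {0..<a} c))
       (\<lambda>z. case chart_inv (cyl_chart {0..<a} c) z of (y, x) \<Rightarrow> gx x c y $ i $ j)"
  and gx_0: "c \<in> A \<Longrightarrow> y \<in> fst c \<Longrightarrow> gx 0 c y = g c y"
  and gp_normal_form: "c \<in> A \<Longrightarrow> y \<in> fst c \<Longrightarrow> x \<in> {0<..<a} \<Longrightarrow>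
       gp (cyl_chart {0<..<a} c) (y, x) = normal_form_matrix x (gx x c y)"
  using pm unfolding poincare_metric_def by blast+

lemma gmat_entry:
  assumes c: "c \<in> A" and z: "z \<in> chart_image c"
  shows "smooth_bd z (\<lambda>w. gmat c w $ i $ j)" and "tcoeff 0 (\<lambda>w. gmat c w $ i $ j) z = g c (chart_inv c z) $ i $ j"
proof -
  have l: "lift c (\<lambda>(y, x). gx x c y $ i $ j) = (\<lambda>w. gmat c w $ i $ j)"
    by (simp add: lift_def gmat_def fun_eq_iff)
  have s: "smooth_on (chart_image (cyl_chart {0..<a} c))
      (\<lambda>w. (\<lambda>(y, x). gx x c y $ i $ j) (chart_inv (cyl_chart {0..<a} c) w))"
    using gx_smooth[OF c] by simp
  show "smooth_bd z (\<lambda>w. gmat c w $ i $ j)" using smooth_bd_lift(1)[OF chart[OF c] a_pos s z] by (simp only: l)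
  have "chart_inv c z \<in> fst c" by (rule chartD(7)[OF chart[OF c] z])
  then show "tcoeff 0 (\<lambda>w. gmat c w $ i $ j) z = g c (chart_inv c z) $ i $ j"
    using smooth_bd_lift(2)[OF chart[OF c] a_pos s z] gx_0[OF c] by (simp only: l) simp
qed

lemma tcoeff_0_det_gmat:
  assumes c: "c \<in> A" and z: "z \<in> chart_image c"
  shows "tcoeff 0 (\<lambda>w. det (gmat c w)) z = det (g c (chart_inv c z))"
proof (rule tcoeff_0_limit)
  show "smooth_bd z (\<lambda>w. det (gmat c w))" by (intro smooth_bd_det gmat_entry[OF c z])
  show "((\<lambda>x. det (gmat c (pt z x))) \<longlongrightarrow> det (g c (chart_inv c z))) (at_right 0)"
    unfolding det_def
    by (intro tendsto_sum tendsto_mult tendsto_const tendsto_prod)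
      (rule smooth_bd_tendsto[OF gmat_entry(1)[OF c z], unfolded gmat_entry(2)[OF c z]])
qed

lemma boundary_chart: assumes c: "c \<in> A" shows "boundary_chart (chart_image c) (gmat c)"
proof
  show "open (chart_image c)" by (rule chartD(2)[OF chart[OF c]])
  show "2 \<le> CARD('n)" by (rule n2)
  fix z assume z: "z \<in> chart_image c"
  show "smooth_bd z (\<lambda>w. gmat c w $ i $ j)" for i j by (rule gmat_entry(1)[OF c z])
  have "has_signature p q (g c (chart_inv c z))"
    using g c chartD(7)[OF chart[OF c] z] unfolding pseudo_metric_def by blast
  then show "tcoeff 0 (\<lambda>w. det (gmat c w)) z \<noteq> 0"
    unfolding tcoeff_0_det_gmat[OF c z] by (rule has_signature_det)
  have sig: "\<forall>\<^sub>F w in bdry z. has_signature p q (gmat c w)"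
    using half_chart_near[OF chart[OF c] a_pos z]
  proof eventually_elim
    case (elim w)
    then have "pseudo_metric A p q (gx (w $ None))" by (intro gx_metric) simp
    then show ?case using c chartD(7)[OF chart[OF c]] elim unfolding pseudo_metric_def gmat_def by blast
  qed
  show "\<forall>\<^sub>F w in bdry z. invertible (gmat c w)"
    using sig by eventually_elim (use has_signature_det invertible_det_nz in blast)
  show "\<forall>\<^sub>F w in bdry z. transpose (gmat c w) = gmat c w"
    using sig by eventually_elim (use has_signature_det in blast)
qed

lemma tcoeff_0_dens:
  assumes c: "c \<in> A" and z: "z \<in> chart_image c"
  shows "tcoeff 0 (dens c) z = sqrt \<bar>det (g c (chart_inv c z))\<bar>" and "tcoeff 0 (dens c) z > 0"
  using boundary_chart.tcoeff_J_0[OF boundary_chart[OF c] z] tcoeff_0_det_gmat[OF c z] by simp_all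

lemma laplacian_lift:
  assumes c: "c \<in> A" and z: "z \<in> chart_image c" and u: "\<forall>\<^sub>F w in bdry z. Cinf_at (lift c u) w"
  shows "\<forall>\<^sub>F w in bdry z. dens c w * lift c (laplacian gp (cyl_chart {0<..<a} c) u) w = - Lap c (lift c u) w"
proof -
  let ?d = "cyl_chart {0<..<a} c"
  note ch = chart[OF c]
  have P: "\<forall>\<^sub>F w in bdry z. Cinf_at (lift c u) w \<and> (0 < w $ None \<and> w $ None < a \<and> base w \<in> chart_image c)"
    by (intro eventually_conj u half_chart_near[OF ch a_pos z])
  show ?thesis
  proof (rule boundary_chart.half_cyl[OF boundary_chart[OF c] z P])
    fix e assume e: "0 < e" "e \<le> 1" and all: "\<And>w. w \<in> cyl z e \<inter> {w. w $ None > 0} \<Longrightarrow>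
      (Cinf_at (lift c u) w \<and> (0 < w $ None \<and> w $ None < a \<and> base w \<in> chart_image c))
      \<and> (\<forall>i j. boundary_chart.H (gmat c) w $ i $ j = boundary_chart.H (gmat c) w $ j $ i)
      \<and> invertible (gmat c w) \<and> transpose (gmat c w) = gmat c w \<and> (\<forall>i j. Cinf_at (\<lambda>w. gmat c w $ i $ j) w)"
    define W where "W = cyl z e \<inter> {w. w $ None > 0}"
    have W: "open W" unfolding W_def by (intro open_Int open_cyl open_Collect_less continuous_intros)
    let ?G = "\<lambda>w. gp ?d (chart_inv ?d w)" and ?F = "\<lambda>w. u (chart_inv ?d w)"
    have dom: "w $ None \<in> {0<..<a}" "base w \<in> chart_image c" and pos: "w $ None > 0"
      and uat: "Cinf_at (lift c u) w" and ginv: "invertible (gmat c w)" and gsym: "transpose (gmat c w) = gmat c w"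
      if "w \<in> W" for w
      using all[OF that[unfolded W_def]] by simp_all
    have gat: "Cinf_at (\<lambda>w. gmat c w $ i $ j) w" if "w \<in> W" for w i j
      using all[OF that[unfolded W_def]] by blast
    have inv: "chart_inv ?d w = (chart_inv c (base w), w $ None)" if "w \<in> W" for w
      by (rule chart_inv_cyl[OF ch dom[OF that]])
    have G: "?G w = normal_form_matrix (w $ None) (gmat c w)" if "w \<in> W" for w
      unfolding inv[OF that] gmat_def
      by (rule gp_normal_form[OF c chartD(7)[OF ch dom(2)[OF that]] dom(1)[OF that]])
    have Fl: "?F w = lift c u w" if "w \<in> W" for w using inv[OF that] by (simp add: lift_def)
    have lW: "Cinf_on W (lift c u)" by (rule Cinf_on_if_at[OF uat])
    have FW: "Cinf_on W ?F" by (rule Cinf_on_cong[OF W _ lW]) (simp add: Fl)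
    have gW: "Cinf_on W (\<lambda>w. gmat c w $ i $ j)" for i j by (rule Cinf_on_if_at[OF gat])
    have "dens c w * lift c (laplacian gp ?d u) w = - Lap c (lift c u) w" if w: "w \<in> W" for w
    proof -
      have "snd ?d (chart_inv c (base w), w $ None) = w"
        using chartD(6)[OF ch dom(2)[OF w]] by (simp add: snd_cyl_chart pt_base)
      then have "lift c (laplacian gp ?d u) w = - (\<Sum>i\<in>UNIV. \<Sum>j\<in>UNIV. matrix_inv (?G w) $ i $ j *
         (partial_deriv i (partial_deriv j ?F) w - (\<Sum>k\<in>UNIV. christoffel ?G k i j w * partial_deriv k ?F w)))"
        by (simp add: lift_def laplacian_def Let_def)
      moreover have "sqrt \<bar>det (gmat c w)\<bar> * (\<Sum>i\<in>UNIV. \<Sum>j\<in>UNIV. matrix_inv (?G w) $ i $ j *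
         (partial_deriv i (partial_deriv j ?F) w - (\<Sum>k\<in>UNIV. christoffel ?G k i j w * partial_deriv k ?F w)))
         = cyl_op (\<lambda>w. sqrt \<bar>det (gmat c w)\<bar>) (\<lambda>w. matrix_inv (gmat c w)) ?F w"
        by (rule laplacian_normal_form[OF W w gW ginv gsym pos G FW])
      moreover have "cyl_op (\<lambda>w. sqrt \<bar>det (gmat c w)\<bar>) (\<lambda>w. matrix_inv (gmat c w)) ?F w = Lap c ?F w"
      proof -
        have "dens c = (\<lambda>w. sqrt \<bar>det (gmat c w)\<bar>)" "boundary_chart.H (gmat c) = (\<lambda>w. matrix_inv (gmat c w))"
          by (rule ext, rule boundary_chart.J_def[OF boundary_chart[OF c]], rule ext, rule boundary_chart.H_def[OF boundary_chart[OF c]])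
        then show ?thesis by (simp only:)
      qed
      moreover have "Lap c ?F w = Lap c (lift c u) w" by (rule cyl_op_cong[OF W w]) (simp add: Fl)
      ultimately show ?thesis using boundary_chart.J_def[OF boundary_chart[OF c], of w] by simp
    qed
    then show ?thesis unfolding eventually_bdry W_def using e(1) by blast
  qed
qed

lemma tcoeff_even_poly:
  "tcoeff k (\<lambda>w. \<Sum>l\<in>I. b l * (w $ None) ^ (2 * l)) (z :: real^'n) = (\<Sum>l\<in>I. if k = 2 * l then b l else 0)"
proof -
  have "tcoeff k (\<lambda>w. \<Sum>l\<in>I. b l * (w $ None) ^ (2 * l)) z = fps_nth (jet (\<lambda>w. \<Sum>l\<in>I. b l * (w $ None) ^ (2 * l)) z) k"
    by simp
  also have "jet (\<lambda>w. \<Sum>l\<in>I. b l * (w $ None) ^ (2 * l)) z = (\<Sum>l\<in>I. fps_const (b l) * fps_X ^ (2 * l))"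
    by (subst jet_sum) (auto intro!: smooth_bd_mult smooth_bd_power sum.cong simp: jet_mult smooth_bd_power jet_power)
  finally show ?thesis by (auto simp: fps_sum_nth intro!: sum.cong)
qed

text \<open>The ratio of the determinants tends to \<open>1\<close>, hence is positive near the boundary, whatever the
  signature; so its root splits into \<open>J / J\<^sub>0\<close>, and the expansion of the density follows.\<close>
lemma tcoeff_dens:
  assumes v: "volume_coefficients A g gx v" and c: "c \<in> A" and z: "z \<in> chart_image c" and k: "k \<le> CARD('n)"
  shows "tcoeff k (dens c) z = (if even k then tcoeff 0 (dens c) z * v k (chart_inv c z) else 0)"
proof -
  let ?y = "chart_inv c z" and ?D = "tcoeff 0 (dens c) z"
  let ?I = "{0..CARD('n) div 2}"
  let ?p = "\<lambda>w :: real^'n option. \<Sum>l\<in>?I. (?D * v (2 * l) ?y) * (w $ None) ^ (2 * l)"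
  have y: "?y \<in> fst c" by (rule chartD(7)[OF chart[OF c] z])
  have db: "smooth_bd z (\<lambda>w. det (gmat c w))" by (intro smooth_bd_det gmat_entry[OF c z])
  have Jb: "smooth_bd z (dens c)" by (rule boundary_chart.J_smooth_bd[OF boundary_chart[OF c] z])
  have pb: "smooth_bd z ?p" by (intro smooth_bd_sum smooth_bd_mult smooth_bd_const smooth_bd_power smooth_bd_coordinate)
  have gnz: "det (g c ?y) \<noteq> 0" using boundary_chart.gm_nz[OF boundary_chart[OF c] z] tcoeff_0_det_gmat[OF c z] by simp
  have sg: "\<forall>\<^sub>F x in at_right 0. det (gmat c (pt z x)) / det (g c ?y) > 0"
  proof -
    have "((\<lambda>x. det (gmat c (pt z x)) / det (g c ?y)) \<longlongrightarrow> 1) (at_right 0)"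
      using tendsto_divide[OF smooth_bd_tendsto[OF db] tendsto_const gnz] gnz by (simp add: tcoeff_0_det_gmat[OF c z])
    then show ?thesis by (rule order_tendstoD(1)) simp
  qed
  obtain C where C: "\<forall>\<^sub>F w in bdry z. \<bar>lift c (\<lambda>(y, x). sqrt (det (gx x c y) / det (g c y))
          - (\<Sum>k = 0..CARD('n) div 2. v (2 * k) y * x ^ (2 * k))) w\<bar> \<le> C * \<bar>(w $ None) ^ (CARD('n) + 1)\<bar>"
    using locally_bigo_lift[OF chart[OF c] z order_refl] v c unfolding volume_coefficients_def by blast
  have "\<forall>\<^sub>F x in at_right 0. \<bar>dens c (pt z x) - ?p (pt z x)\<bar> \<le> (?D * C) * x ^ (CARD('n) + 1)"
    using sg bdry_at_right[OF C] eventually_at_right_less[of 0]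
  proof eventually_elim
    case (elim x)
    have r: "sqrt (det (gmat c (pt z x)) / det (g c ?y)) = sqrt \<bar>det (gmat c (pt z x))\<bar> / sqrt \<bar>det (g c ?y)\<bar>"
      using elim(1) by (metis abs_divide abs_of_pos real_sqrt_divide)
    have d: "dens c (pt z x) = ?D * sqrt (det (gmat c (pt z x)) / det (g c ?y))"
      unfolding r boundary_chart.J_def[OF boundary_chart[OF c]] tcoeff_0_dens(1)[OF c z] using gnz by simp
    have "dens c (pt z x) - ?p (pt z x) = ?D * (sqrt (det (gmat c (pt z x)) / det (g c ?y)) - (\<Sum>l\<in>?I. v (2 * l) ?y * x ^ (2 * l)))"
      unfolding d by (simp add: right_diff_distrib sum_distrib_left mult.assoc)
    moreover have "\<bar>sqrt (det (gmat c (pt z x)) / det (g c ?y)) - (\<Sum>l\<in>?I. v (2 * l) ?y * x ^ (2 * l))\<bar> \<le> C * x ^ (CARD('n) + 1)"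
      using elim(2,3) by (simp add: lift_def gmat_def)
    ultimately show ?case using tcoeff_0_dens(2)[OF c z] by (simp add: abs_mult mult.assoc)
  qed
  then have "tcoeff k (\<lambda>w. dens c w - ?p w) z = 0"
    by (rule tcoeff_eq_0_if_bigo[OF smooth_bd_diff[OF Jb pb]]) (use k in simp)
  moreover have "tcoeff k (\<lambda>w. dens c w - ?p w) z = tcoeff k (dens c) z - tcoeff k ?p z"
    by (rule tcoeff_diff[OF Jb pb])
  ultimately have "tcoeff k (dens c) z = (\<Sum>l\<in>?I. if k = 2 * l then ?D * v (2 * l) ?y else 0)"
    by (simp only: tcoeff_even_poly)
  also have "\<dots> = (if even k then ?D * v k ?y else 0)"
  proof (cases "even k")
    case True
    then obtain m where m: "k = 2 * m" by (auto elim: evenE)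
    then show ?thesis using k by (simp add: sum.delta')
  qed (auto intro!: sum.neutral)
  finally show ?thesis .
qed

text \<open>Both error terms \<open>O(x\<^sup>n)\<close> turn into statements about the Taylor coefficients below order \<open>n\<close>.\<close>
lemma harmonicE:
  assumes P: "harmonic_operators A a gp P" and f: "smooth_fun A f"
  obtains u where "\<And>c z. c \<in> A \<Longrightarrow> z \<in> chart_image c \<Longrightarrow> smooth_bd z (lift c u)"
    "\<And>c z j. c \<in> A \<Longrightarrow> z \<in> chart_image c \<Longrightarrow> j < CARD('n) \<Longrightarrow> tcoeff j (Lap c (lift c u)) z = 0"
    "\<And>c z j. c \<in> A \<Longrightarrow> z \<in> chart_image c \<Longrightarrow> j < CARD('n) \<Longrightarrow>
      tcoeff j (lift c u) z = (if j = 0 then f (chart_inv c z) else if even j then P j f (chart_inv c z) else 0)"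
proof -
  obtain u where us: "smooth_fun (cylinder {0..<a} A) u" and u0: "\<forall>y\<in>carrier A. u (y, 0) = f y"
    and ul: "\<forall>c\<in>A. locally_bigo (fst c) (laplacian gp (cyl_chart {0<..<a} c) u) (\<lambda>x. x ^ CARD('n))"
    and ue: "locally_bigo (carrier A)
          (\<lambda>(y, x). u (y, x) - (f y + (\<Sum>k = 1..CARD('n) div 2 - 1. P (2 * k) f y * x ^ (2 * k)))) (\<lambda>x. x ^ CARD('n))"
    using P f unfolding harmonic_operators_def by blast
  have s: "smooth_on (chart_image (cyl_chart {0..<a} c)) (\<lambda>w. u (chart_inv (cyl_chart {0..<a} c) w))" if "c \<in> A" for c
    using us that unfolding smooth_fun_def cylinder_def by blast
  have ub: "smooth_bd z (lift c u)" if "c \<in> A" "z \<in> chart_image c" for c z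
    by (rule smooth_bd_lift(1)[OF chart[OF that(1)] a_pos s[OF that(1)] that(2)])
  show ?thesis
  proof (rule that[of u])
    fix c z and j :: nat assume c: "c \<in> A" and z: "z \<in> chart_image c"
    show "smooth_bd z (lift c u)" by (rule ub[OF c z])
    assume j: "j < CARD('n)"
    note bc = boundary_chart[OF c]
    obtain C where C: "\<forall>\<^sub>F w in bdry z. \<bar>lift c (laplacian gp (cyl_chart {0<..<a} c) u) w\<bar> \<le> C * \<bar>(w $ None) ^ CARD('n)\<bar>"
      using locally_bigo_lift[OF chart[OF c] z order_refl] ul c by blast
    obtain M where M: "\<forall>\<^sub>F w in bdry z. \<bar>dens c w\<bar> \<le> M" using smooth_bd_eventually_bounded[OF boundary_chart.J_smooth_bd[OF bc z]] by blast
    have "\<forall>\<^sub>F w in bdry z. \<bar>Lap c (lift c u) w\<bar> \<le> (\<bar>M\<bar> * \<bar>C\<bar>) * \<bar>(w $ None) ^ CARD('n)\<bar>"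
      using C M laplacian_lift[OF c z smooth_bd_eventually_Cinf_at[OF ub[OF c z]]]
    proof eventually_elim
      case (elim w)
      have "\<bar>Lap c (lift c u) w\<bar> = \<bar>dens c w\<bar> * \<bar>lift c (laplacian gp (cyl_chart {0<..<a} c) u) w\<bar>"
        using elim(3) by (metis abs_minus abs_mult)
      also have "\<dots> \<le> \<bar>M\<bar> * (\<bar>C\<bar> * \<bar>(w $ None) ^ CARD('n)\<bar>)"
      proof (rule mult_mono)
        show "\<bar>dens c w\<bar> \<le> \<bar>M\<bar>" using elim(2) by linarith
        have "C * \<bar>(w $ None) ^ CARD('n)\<bar> \<le> \<bar>C\<bar> * \<bar>(w $ None) ^ CARD('n)\<bar>" by (rule mult_right_mono) auto
        then show "\<bar>lift c (laplacian gp (cyl_chart {0<..<a} c) u) w\<bar> \<le> \<bar>C\<bar> * \<bar>(w $ None) ^ CARD('n)\<bar>" using elim(1) by linarith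
      qed auto
      finally show ?case by (simp only: mult.assoc)
    qed
    from bdry_at_right[OF this]
    have "\<forall>\<^sub>F x in at_right 0. \<bar>Lap c (lift c u) (pt z x)\<bar> \<le> (\<bar>M\<bar> * \<bar>C\<bar>) * x ^ CARD('n)"
      using eventually_at_right_less[of 0] by eventually_elim simp
    then show "tcoeff j (Lap c (lift c u)) z = 0"
      by (rule tcoeff_eq_0_if_bigo[OF boundary_chart.L_smooth_bd[OF bc z ub[OF c z]] _ j])
    let ?y = "chart_inv c z" and ?I = "{0..CARD('n) div 2 - 1}"
    let ?b = "\<lambda>l. if l = 0 then f ?y else P (2 * l) f ?y"
    let ?p = "\<lambda>w :: real^'n option. \<Sum>l\<in>?I. ?b l * (w $ None) ^ (2 * l)"
    have pb: "smooth_bd z ?p" by (intro smooth_bd_sum smooth_bd_mult smooth_bd_const smooth_bd_power smooth_bd_coordinate)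
    have cA: "fst c \<subseteq> carrier A" using c by (auto simp: carrier_def)
    obtain C' where C': "\<forall>\<^sub>F w in bdry z. \<bar>lift c (\<lambda>(y, x). u (y, x) - (f y + (\<Sum>k = 1..CARD('n) div 2 - 1. P (2 * k) f y * x ^ (2 * k)))) w\<bar>
        \<le> C' * \<bar>(w $ None) ^ CARD('n)\<bar>"
      using locally_bigo_lift[OF chart[OF c] z cA ue] by blast
    have "\<forall>\<^sub>F x in at_right 0. \<bar>lift c u (pt z x) - ?p (pt z x)\<bar> \<le> C' * x ^ CARD('n)"
      using bdry_at_right[OF C'] eventually_at_right_less[of 0]
    proof eventually_elim
      case (elim x)
      have "?p (pt z x) = f ?y + (\<Sum>k = 1..CARD('n) div 2 - 1. P (2 * k) f ?y * x ^ (2 * k))"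
        by (simp add: sum.atLeast_Suc_atMost[of 0])
      then show ?case using elim by (simp add: lift_def)
    qed
    then have "tcoeff j (\<lambda>w. lift c u w - ?p w) z = 0"
      by (rule tcoeff_eq_0_if_bigo[OF smooth_bd_diff[OF ub[OF c z] pb] _ j])
    moreover have "tcoeff j (\<lambda>w. lift c u w - ?p w) z = tcoeff j (lift c u) z - tcoeff j ?p z"
      by (rule tcoeff_diff[OF ub[OF c z] pb])
    ultimately have "tcoeff j (lift c u) z = (\<Sum>l\<in>?I. if j = 2 * l then ?b l else 0)"
      by (simp only: tcoeff_even_poly)
    also have "\<dots> = (if j = 0 then f ?y else if even j then P j f ?y else 0)"
    proof (cases "even j")
      case True
      then obtain m where m: "j = 2 * m" by (auto elim: evenE)
      then have "m \<in> ?I" using j n_even by auto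
      then show ?thesis by (simp add: m sum.delta')
    qed (auto intro!: sum.neutral)
    finally show "tcoeff j (lift c u) z = (if j = 0 then f ?y else if even j then P j f ?y else 0)" .
  qed
qed

text \<open>The extension \<open>u\<close> is not local in \<open>f\<close>, but its Taylor coefficients below order \<open>n\<close> are.\<close>
lemma harmonic_local:
  assumes P: "harmonic_operators A a gp P" and f: "smooth_fun A f"
    and X: "open X" "\<And>y. y \<in> X \<Longrightarrow> y \<in> carrier A \<Longrightarrow> f y = 0"
    and y: "y \<in> X" "y \<in> carrier A" and k: "k \<in> {1..CARD('n) div 2 - 1}"
  shows "P (2 * k) f y = 0"
proof (rule harmonicE[OF P f])
  fix u assume ub: "\<And>c z. c \<in> A \<Longrightarrow> z \<in> chart_image c \<Longrightarrow> smooth_bd z (lift c u)"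
    and Lu: "\<And>c z j. c \<in> A \<Longrightarrow> z \<in> chart_image c \<Longrightarrow> j < CARD('n) \<Longrightarrow> tcoeff j (Lap c (lift c u)) z = 0"
    and tu: "\<And>c z j. c \<in> A \<Longrightarrow> z \<in> chart_image c \<Longrightarrow> j < CARD('n) \<Longrightarrow>
      tcoeff j (lift c u) z = (if j = 0 then f (chart_inv c z) else if even j then P j f (chart_inv c z) else 0)"
  obtain c where c: "c \<in> A" "y \<in> fst c" using y by (auto simp: carrier_def)
  note ch = chart[OF c(1)]
  let ?V = "chart_image c \<inter> chart_inv c -` X"
  have k2: "2 * k < CARD('n)" "2 * k \<noteq> 0" using k n_even by auto
  have z: "snd c y \<in> ?V" using chartD(5,8)[OF ch c(2)] y by simp
  have "tcoeff (2 * k) (lift c u) (snd c y) = 0"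
  proof (rule boundary_chart.coefficients_local[OF boundary_chart[OF c(1)], of ?V])
    show "open ?V" by (rule continuous_open_preimage[OF chartD(4)[OF ch] chartD(2)[OF ch] X(1)])
    show "tcoeff 0 (lift c u) z = 0" if "z \<in> ?V" for z
    proof -
      have "chart_inv c z \<in> carrier A" using chartD(7)[OF ch] that c(1) by (auto simp: carrier_def)
      then show ?thesis using tu[OF c(1), of z 0] X(2) that n2 by simp
    qed
  qed (use ub[OF c(1)] Lu[OF c(1)] k2 z in auto)
  then show ?thesis using tu[OF c(1) _ k2(1), of "snd c y"] k2 z chartD(5)[OF ch c(2)] by simp
qed

text \<open>The function \<open>U\<close> and its remainder are eliminated here: what is kept of them is that the Taylor
  coefficients of the residual vanish up to order \<open>n\<close>.\<close>
lemma Q_curvatureE: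
  assumes Q: "Q_curvature A a gp Q"
  obtains h B where "\<And>c z. c \<in> A \<Longrightarrow> z \<in> chart_image c \<Longrightarrow> smooth_bd z (lift c h) \<and> smooth_bd z (lift c B)"
    "\<And>c z. c \<in> A \<Longrightarrow> z \<in> chart_image c \<Longrightarrow> tcoeff 0 (lift c h) z = 0"
    "\<And>c z. c \<in> A \<Longrightarrow> z \<in> chart_image c \<Longrightarrow> tcoeff 0 (lift c B) z = - 2 * c_const (CARD('n) div 2) * Q (chart_inv c z)"
    "\<And>c z k. c \<in> A \<Longrightarrow> z \<in> chart_image c \<Longrightarrow> k \<le> CARD('n) \<Longrightarrow>
      tcoeff k (\<lambda>w. w $ None * partial_deriv None (dens c) w + Lap c (lift c h) w
        + real CARD('n) * (dens c w * lift c B w * (w $ None) ^ CARD('n))) z = 0"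
proof -
  obtain U B h where Us: "smooth_fun (cylinder {0<..<a} A) U"
    and Bs: "smooth_fun (cylinder {0..<a} A) B" and hs: "smooth_fun (cylinder {0..<a} A) h"
    and h0: "\<forall>y\<in>carrier A. h (y, 0) = 0"
    and Ue: "locally_bigo (carrier A)
        (\<lambda>(y, x). U (y, x) - (ln x + h (y, x) + B (y, x) * x ^ CARD('n) * ln x)) (\<lambda>x. x ^ CARD('n))"
    and Ul: "\<forall>c\<in>A. locally_bigo (fst c)
        (\<lambda>r. laplacian gp (cyl_chart {0<..<a} c) U r - real CARD('n)) (\<lambda>x. x ^ (CARD('n) + 1) * ln x)"
    and B0: "\<forall>y\<in>carrier A. B (y, 0) = - 2 * c_const (CARD('n) div 2) * Q y"
    using Q unfolding Q_curvature_def by (elim exE conjE)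
  have s: "smooth_on (chart_image (cyl_chart {0..<a} c)) (\<lambda>w. u (chart_inv (cyl_chart {0..<a} c) w))"
    if "c \<in> A" "smooth_fun (cylinder {0..<a} A) u" for c u
    using that unfolding smooth_fun_def cylinder_def by blast
  have Us': "smooth_on (chart_image (cyl_chart {0<..<a} c)) (\<lambda>w. U (chart_inv (cyl_chart {0<..<a} c) w))" if "c \<in> A" for c
    using that Us unfolding smooth_fun_def cylinder_def by blast
  have car: "chart_inv c z \<in> carrier A" if "c \<in> A" "z \<in> chart_image c" for c z
    using chartD(7)[OF chart[OF that(1)] that(2)] that(1) by (auto simp: carrier_def)
  have hb: "smooth_bd z (lift c h)" and Bb: "smooth_bd z (lift c B)" if "c \<in> A" "z \<in> chart_image c" for c z
    by (rule smooth_bd_lift(1)[OF chart[OF that(1)] a_pos s[OF that(1)] that(2)], rule hs Bs)+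
  show ?thesis
  proof (rule that[of h B])
    fix c z assume c: "c \<in> A" and z: "z \<in> chart_image c"
    show "smooth_bd z (lift c h) \<and> smooth_bd z (lift c B)" using hb[OF c z] Bb[OF c z] by blast
    show "tcoeff 0 (lift c h) z = 0"
      using smooth_bd_lift(2)[OF chart[OF c] a_pos s[OF c hs] z] h0 car[OF c z] by simp
    show "tcoeff 0 (lift c B) z = - 2 * c_const (CARD('n) div 2) * Q (chart_inv c z)"
      using smooth_bd_lift(2)[OF chart[OF c] a_pos s[OF c Bs] z] B0 car[OF c z] by simp
  next
    fix c z k assume c: "c \<in> A" and z: "z \<in> chart_image c" and k: "k \<le> CARD('n)"
    note bc = boundary_chart[OF c] and ch = chart[OF c]
    let ?\<Omega> = "chart_image c"
    let ?R = "\<lambda>w. lift c U w - (ln (w $ None) + lift c h w + lift c B w * ((w $ None) ^ CARD('n) * ln (w $ None)))"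
    have cA: "fst c \<subseteq> carrier A" using c by (auto simp: carrier_def)
    have UC: "\<forall>\<^sub>F w in bdry z. Cinf_at (lift c U) w" if "z \<in> ?\<Omega>" for z
      by (rule Cinf_at_lift[OF ch a_pos that Us'[OF c]])
    have eq: "\<exists>C. \<forall>\<^sub>F w in bdry z. \<bar>Lap c (lift c U) w + real CARD('n) * dens c w\<bar>
        \<le> C * ((w $ None) ^ (CARD('n) + 1) * \<bar>ln (w $ None)\<bar>)" if z: "z \<in> ?\<Omega>" for z
    proof -
      obtain C where C: "\<forall>\<^sub>F w in bdry z. \<bar>lift c (\<lambda>r. laplacian gp (cyl_chart {0<..<a} c) U r - real CARD('n)) w\<bar>
          \<le> C * \<bar>(w $ None) ^ (CARD('n) + 1) * ln (w $ None)\<bar>"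
        using locally_bigo_lift[OF ch z order_refl] Ul c by blast
      obtain M where M: "\<forall>\<^sub>F w in bdry z. \<bar>dens c w\<bar> \<le> M" using smooth_bd_eventually_bounded[OF boundary_chart.J_smooth_bd[OF bc z]] by blast
      have "\<forall>\<^sub>F w in bdry z. \<bar>Lap c (lift c U) w + real CARD('n) * dens c w\<bar>
        \<le> (\<bar>M\<bar> * \<bar>C\<bar>) * ((w $ None) ^ (CARD('n) + 1) * \<bar>ln (w $ None)\<bar>)"
        using C M laplacian_lift[OF c z UC[OF z]] half_chart_near[OF ch a_pos z]
      proof eventually_elim
        case (elim w)
        define t where "t = (w $ None) ^ (CARD('n) + 1) * \<bar>ln (w $ None)\<bar>"
        define l where "l = lift c (laplacian gp (cyl_chart {0<..<a} c) U) w"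
        have t: "\<bar>(w $ None) ^ (CARD('n) + 1) * ln (w $ None)\<bar> = t" "t \<ge> 0"
          using elim(4) by (simp_all add: t_def abs_mult)
        have "Lap c (lift c U) w + real CARD('n) * dens c w = - (dens c w * (l - real CARD('n)))"
          using elim(3) by (simp add: l_def right_diff_distrib)
        then have "\<bar>Lap c (lift c U) w + real CARD('n) * dens c w\<bar> = \<bar>dens c w\<bar> * \<bar>l - real CARD('n)\<bar>"
          by (simp only: abs_minus abs_mult)
        also have "\<dots> \<le> \<bar>M\<bar> * (\<bar>C\<bar> * t)"
        proof (rule mult_mono)
          show "\<bar>dens c w\<bar> \<le> \<bar>M\<bar>" using elim(2) by linarith
          have "C * t \<le> \<bar>C\<bar> * t" using t(2) by (intro mult_right_mono) auto
          moreover have "lift c (\<lambda>r. laplacian gp (cyl_chart {0<..<a} c) U r - real CARD('n)) w = l - real CARD('n)"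
            by (simp add: lift_def l_def)
          ultimately show "\<bar>l - real CARD('n)\<bar> \<le> \<bar>C\<bar> * t" using elim(1) unfolding t(1) by linarith
        qed auto
        finally show ?case by (simp only: mult.assoc t_def)
      qed
      then show ?thesis by blast
    qed
    have lr: "(\<forall>\<^sub>F w in bdry z. Cinf_at ?R w) \<and>
      (\<exists>C. \<forall>\<^sub>F w in bdry z. \<bar>Lap c ?R w + (w $ None * partial_deriv None (dens c) w + Lap c (lift c h) w
        + real CARD('n) * (dens c w * lift c B w * (w $ None) ^ CARD('n)))\<bar> \<le> C * ((w $ None) ^ (CARD('n) + 1) * \<bar>ln (w $ None)\<bar>))"
      if z: "z \<in> ?\<Omega>" for z
    proof -
      obtain C where C: "\<forall>\<^sub>F w in bdry z. \<bar>Lap c (lift c U) w + real CARD('n) * dens c w\<bar>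
        \<le> C * ((w $ None) ^ (CARD('n) + 1) * \<bar>ln (w $ None)\<bar>)" using eq[OF z] by blast
      show ?thesis using boundary_chart.log_residual[OF bc z UC[OF z] hb[OF c z] Bb[OF c z] C] by (rule conjI)
    qed
    show "tcoeff k (\<lambda>w. w $ None * partial_deriv None (dens c) w + Lap c (lift c h) w
        + real CARD('n) * (dens c w * lift c B w * (w $ None) ^ CARD('n))) z = 0"
    proof (rule boundary_chart.residual_vanishes[OF bc, of ?R])
      fix z assume z: "z \<in> ?\<Omega>"
      show "\<forall>\<^sub>F w in bdry z. Cinf_at ?R w" using lr[OF z] by (rule conjunct1)
      show "\<exists>C. \<forall>\<^sub>F w in bdry z. \<bar>Lap c ?R w + (w $ None * partial_deriv None (dens c) w + Lap c (lift c h) w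
        + real CARD('n) * (dens c w * lift c B w * (w $ None) ^ CARD('n)))\<bar> \<le> C * ((w $ None) ^ (CARD('n) + 1) * \<bar>ln (w $ None)\<bar>)"
        using lr[OF z] by (rule conjunct2)
      show "smooth_bd z (\<lambda>w. w $ None * partial_deriv None (dens c) w + Lap c (lift c h) w
        + real CARD('n) * (dens c w * lift c B w * (w $ None) ^ CARD('n)))"
        by (intro smooth_bd_add smooth_bd_mult smooth_bd_power smooth_bd_const smooth_bd_coordinate smooth_bd_partial_deriv boundary_chart.J_smooth_bd[OF bc z]
            boundary_chart.L_smooth_bd[OF bc z] hb[OF c z] Bb[OF c z])
      obtain C where C: "\<forall>\<^sub>F w in bdry z. \<bar>lift c (\<lambda>(y, x). U (y, x) - (ln x + h (y, x) + B (y, x) * x ^ CARD('n) * ln x)) w\<bar>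
          \<le> C * \<bar>(w $ None) ^ CARD('n)\<bar>"
        using locally_bigo_lift[OF ch z cA Ue] by blast
      have "\<forall>\<^sub>F w in bdry z. \<bar>?R w\<bar> \<le> C * (w $ None) ^ CARD('n)"
        using C half_chart_near[OF ch a_pos z] by eventually_elim (simp add: lift_def mult.assoc)
      then show "\<exists>C. \<forall>\<^sub>F w in bdry z. \<bar>?R w\<bar> \<le> C * (w $ None) ^ CARD('n)" by blast
    qed (use k z in auto)
  qed
qed

end

section \<open>The formula for the curvature\<close>
lemma sum_atMost_even:
  fixes a :: "nat \<Rightarrow> real"
  assumes "\<And>k. k \<le> 2 * m \<Longrightarrow> odd k \<Longrightarrow> a k = 0"
  shows "(\<Sum>k\<le>2 * m. a k) = (\<Sum>l\<le>m. a (2 * l))"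
  using assms by (induction m) auto

text \<open>If \<open>E z0\<close> were not zero, a bump function concentrated where \<open>E\<close> has constant sign would give a
  nonzero integral: on the ball of half the radius the integrand is bounded away from zero.\<close>
lemma eq_0_if_tested:
  fixes E D :: "real^'n::finite \<Rightarrow> real"
  assumes \<Omega>: "open \<Omega>" and E: "continuous_on \<Omega> E" and D: "continuous_on \<Omega> D" "\<And>z. z \<in> \<Omega> \<Longrightarrow> D z > 0"
    and t: "\<And>z0 r. r > 0 \<Longrightarrow> cball z0 r \<subseteq> \<Omega> \<Longrightarrow>
      (\<integral>z. indicator (cball z0 r) z * (D z * (bump z0 r z * E z)) \<partial>lborel) = 0"
    and z0: "z0 \<in> \<Omega>"
  shows "E z0 = 0"
proof (rule ccontr)
  define s where "s = sgn (E z0)"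
  assume "E z0 \<noteq> 0"
  then have s: "s * E z0 > 0" by (auto simp: s_def sgn_if)
  have "open (\<Omega> \<inter> (\<lambda>z. s * E z) -` {0<..})"
    by (rule continuous_open_preimage[OF _ \<Omega>]) (intro continuous_intros E, simp)
  moreover have "z0 \<in> \<Omega> \<inter> (\<lambda>z. s * E z) -` {0<..}" using z0 s by simp
  ultimately obtain r where r: "r > 0" "cball z0 r \<subseteq> \<Omega> \<inter> (\<lambda>z. s * E z) -` {0<..}"
    using open_contains_cball by blast
  let ?q = "\<lambda>z. D z * (bump z0 r z * (s * E z))"
  have sub: "cball z0 r \<subseteq> \<Omega>" and pos: "\<And>z. z \<in> cball z0 r \<Longrightarrow> s * E z > 0" using r(2) by auto
  have sub2: "cball z0 (r / 2) \<subseteq> cball z0 r" using r(1) by auto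
  have bc: "continuous_on \<Omega> (bump z0 r)" unfolding bump_def
    by (rule continuous_on_compose2[of UNIV "flat 0"])
      (auto intro!: continuous_intros continuous_at_imp_continuous_on isCont_flat)
  have qc: "continuous_on \<Omega> ?q" by (intro continuous_intros D(1) E bc)
  have "cball z0 (r / 2) \<noteq> {}" using r(1) by auto
  from continuous_attains_inf[OF compact_cball this continuous_on_subset[OF qc order_trans[OF sub2 sub]]]
  obtain z1 where z1: "z1 \<in> cball z0 (r / 2)" "\<And>z. z \<in> cball z0 (r / 2) \<Longrightarrow> ?q z1 \<le> ?q z" by blast
  have "dist z1 z0 < r" using z1(1) r(1) by (simp add: dist_commute)
  then have b1: "bump z0 r z1 > 0" using bump_pos_iff[OF r(1)] by blast
  have z1r: "z1 \<in> cball z0 r" using z1(1) sub2 by blast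
  then have "z1 \<in> \<Omega>" using sub by blast
  then have q1: "?q z1 > 0" by (rule mult_pos_pos[OF D(2) mult_pos_pos[OF b1 pos[OF z1r]]])
  have ic: "integrable lborel (\<lambda>z. indicator (cball z0 r) z * ?q z)"
    using borel_integrable_compact[OF compact_cball continuous_on_subset[OF qc sub]] by simp
  have ii: "integrable lborel (\<lambda>z. ?q z1 * indicator (cball z0 (r / 2)) z)"
    using emeasure_bounded_finite[OF bounded_cball, of z0 "r / 2"]
    by (intro integrable_mult_right integrable_real_indicator) auto
  have "(\<integral>z. ?q z1 * indicator (cball z0 (r / 2)) z \<partial>lborel) \<le> (\<integral>z. indicator (cball z0 r) z * ?q z \<partial>lborel)"
  proof (rule integral_mono[OF ii ic])
    fix z
    show "?q z1 * indicator (cball z0 (r / 2)) z \<le> indicator (cball z0 r) z * ?q z"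
    proof (cases "z \<in> cball z0 (r / 2)")
      case True
      moreover have "z \<in> cball z0 r" using True sub2 by blast
      ultimately show ?thesis using z1(2)[OF True] by simp
    next
      case False
      have "0 \<le> indicator (cball z0 r) z * ?q z"
      proof (cases "z \<in> cball z0 r")
        case True
        have "0 \<le> D z" "0 \<le> bump z0 r z" "0 \<le> s * E z"
          using D(2)[of z] sub True pos[OF True] by (auto simp: bump_def flat_nonneg intro: less_imp_le)
        then show ?thesis using True by simp
      qed simp
      then show ?thesis using False by simp
    qed
  qed
  moreover have "(\<integral>z. ?q z1 * indicator (cball z0 (r / 2)) z \<partial>lborel) = ?q z1 * measure lborel (cball z0 (r / 2))"
    by simp
  moreover have "measure lborel (cball z0 (r / 2)) > 0" using r(1) by (intro content_cball_pos) simp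
  moreover have "(\<integral>z. indicator (cball z0 r) z * ?q z \<partial>lborel) = s * (\<integral>z. indicator (cball z0 r) z * (D z * (bump z0 r z * E z)) \<partial>lborel)"
    by (simp add: mult_ac flip: integral_mult_right_zero)
  ultimately have "?q z1 * measure lborel (cball z0 (r / 2)) \<le> 0" using t[OF r(1) sub] by simp
  then show False using q1 \<open>measure lborel (cball z0 (r / 2)) > 0\<close> mult_pos_pos[OF q1] by fastforce
qed

context poincare_setup
begin

text \<open>The coefficient of \<open>x\<^sup>n\<^sup>-\<^sup>2\<close> in the tangential flux of Green's identity for \<open>u\<close> and \<open>h\<close>, in the
  direction \<open>i\<close>.\<close>
definition flux :: "('m, 'n) chart \<Rightarrow> ('m \<times> real \<Rightarrow> real) \<Rightarrow> ('m \<times> real \<Rightarrow> real) \<Rightarrow> 'n \<Rightarrow> real^'n \<Rightarrow> real"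
  where "flux c u h i = tcoeff (CARD('n) - 2) (\<lambda>w. \<Sum>j\<in>UNIV. dens c w * boundary_chart.H (gmat c) w $ i $ j *
    (lift c u w * partial_deriv (Some j) (lift c h) w - lift c h w * partial_deriv (Some j) (lift c u) w))"

text \<open>The identity \<open>critical_identity\<close> in terms of \<open>f\<close>, the operators and the volume coefficients.  Odd
  indices drop out, and so does \<open>k = n\<close>, where the weight \<open>n - k\<close> is zero and \<open>u\<^sub>n\<close> is not determined by \<open>f\<close>.\<close>
lemma coefficient_identity:
  assumes v: "volume_coefficients A g gx v" and c: "c \<in> A" and z: "z \<in> chart_image c"
    and ub: "smooth_bd z (lift c u)" and hb: "smooth_bd z (lift c h)" and Bb: "smooth_bd z (lift c B)"
    and Lu: "\<And>j. j < CARD('n) \<Longrightarrow> tcoeff j (Lap c (lift c u)) z = 0"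
    and tu: "\<And>j. j < CARD('n) \<Longrightarrow> tcoeff j (lift c u) z = (if j = 0 then f (chart_inv c z) else if even j then P j f (chart_inv c z) else 0)"
    and h0: "tcoeff 0 (lift c h) z = 0"
    and S: "\<And>k. k \<le> CARD('n) \<Longrightarrow> tcoeff k (\<lambda>w. w $ None * partial_deriv None (dens c) w + Lap c (lift c h) w
        + real CARD('n) * (dens c w * lift c B w * (w $ None) ^ CARD('n))) z = 0"
  shows "tcoeff 0 (dens c) z * (f (chart_inv c z) * (real CARD('n) * v CARD('n) (chart_inv c z) + real CARD('n) * tcoeff 0 (lift c B) z)
      + (\<Sum>k = 1..CARD('n) div 2 - 1. real (CARD('n) - 2 * k) * (P (2 * k) f (chart_inv c z) * v (CARD('n) - 2 * k) (chart_inv c z))))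
    = - (\<Sum>i\<in>UNIV. partial_deriv i (flux c u h i) z)"
proof -
  let ?y = "chart_inv c z" and ?D = "tcoeff 0 (dens c) z" and ?n = "CARD('n)"
  obtain m where m: "?n = 2 * Suc m" 
  proof -
    obtain k where "?n = 2 * k" using n_even by (auto elim: evenE)
    then show ?thesis using that[of "k - 1"] n2 by (cases k) auto
  qed
  let ?t = "\<lambda>k. real (?n - k) * tcoeff k (lift c u) z * tcoeff (?n - k) (dens c) z"
  have "(\<Sum>k\<le>?n. ?t k) = (\<Sum>l\<le>Suc m. ?t (2 * l))"
    unfolding m
  proof (rule sum_atMost_even)
    fix k :: nat assume "k \<le> 2 * Suc m" "odd k"
    then have "k < ?n" "k \<noteq> 0" "odd k" unfolding m by (auto simp: le_less intro: odd_pos)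
    then show "real (2 * Suc m - k) * tcoeff k (lift c u) z * tcoeff (2 * Suc m - k) (dens c) z = 0" by (simp add: tu)
  qed
  also have "\<dots> = (\<Sum>l\<le>m. ?t (2 * l))" by (simp add: m)
  also have "\<dots> = ?t 0 + (\<Sum>l = 1..m. ?t (2 * l))"
    by (simp add: atMost_atLeast0 sum.atLeast_Suc_atMost[of 0 m])
  also have "?t 0 = ?D * (f ?y * (real ?n * v ?n ?y))"
    using tu[of 0] tcoeff_dens[OF v c z, of ?n] n_even n2 by simp
  also have "(\<Sum>l = 1..m. ?t (2 * l)) = (\<Sum>l = 1..m. ?D * (real (?n - 2 * l) * (P (2 * l) f ?y * v (?n - 2 * l) ?y)))"
  proof (rule sum.cong[OF refl])
    fix l assume l: "l \<in> {1..m}"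
    then have "2 * l < ?n" "2 * l \<noteq> 0" using m by auto
    then show "?t (2 * l) = ?D * (real (?n - 2 * l) * (P (2 * l) f ?y * v (?n - 2 * l) ?y))"
      using tu[of "2 * l"] tcoeff_dens[OF v c z, of "?n - 2 * l"] n_even by simp
  qed
  finally have sum: "(\<Sum>k\<le>?n. ?t k) = ?D * (f ?y * (real ?n * v ?n ?y))
    + (\<Sum>l = 1..m. ?D * (real (?n - 2 * l) * (P (2 * l) f ?y * v (?n - 2 * l) ?y)))" .
  have md: "?n div 2 - 1 = m" using m by simp
  have "(\<Sum>k\<le>?n. ?t k) + real ?n * tcoeff 0 (lift c u) z * ?D * tcoeff 0 (lift c B) z = - (\<Sum>i\<in>UNIV. partial_deriv i (flux c u h i) z)"
    unfolding flux_def by (rule boundary_chart.critical_identity[OF boundary_chart[OF c] z ub hb Bb S Lu h0])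
  moreover have "tcoeff 0 (lift c u) z = f ?y" using tu[of 0] n2 by simp
  ultimately show ?thesis unfolding sum md by (simp add: sum_distrib_left[symmetric] algebra_simps)
qed

lemma smooth_fun_chart:
  assumes "smooth_fun A f" "c \<in> A" shows "Cinf_on (chart_image c) (\<lambda>z. f (chart_inv c z))"
  using assms chartD(2)[OF chart[OF assms(2)]] smooth_on_open_imp unfolding smooth_fun_def by blast

definition chart_bump :: "('m, 'n) chart \<Rightarrow> real^'n \<Rightarrow> real \<Rightarrow> 'm \<Rightarrow> real"
  where "chart_bump c z0 r y = (if y \<in> fst c then bump z0 r (snd c y) else 0)"

text \<open>Smoothness is checked in an arbitrary chart \<open>d\<close>.  On the overlap with \<open>c\<close> the function is a bump in
  the smooth transition coordinates; elsewhere it vanishes in a neighbourhood, as the compact set \<open>K\<close>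
  is closed in the Hausdorff space.\<close>
lemma chart_bump:
  assumes c: "c \<in> A" and r: "r > 0" and sub: "cball z0 r \<subseteq> chart_image c"
  defines "K \<equiv> chart_inv c ` cball z0 r"
  shows "compact K" "K \<subseteq> fst c" "y \<notin> K \<Longrightarrow> chart_bump c z0 r y = 0"
    "smooth_fun A (chart_bump c z0 r)" "compact_support A (chart_bump c z0 r)"
    "z \<in> chart_image c \<Longrightarrow> chart_bump c z0 r (chart_inv c z) = bump z0 r z"
proof -
  note ch = chart[OF c]
  show K: "compact K" unfolding K_def
    by (rule compact_continuous_image[OF continuous_on_subset[OF chartD(4)[OF ch] sub] compact_cball])
  show Kc: "K \<subseteq> fst c" unfolding K_def using sub chartD(7)[OF ch] by blast
  show off: "chart_bump c z0 r y = 0" if "y \<notin> K" for y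
  proof (cases "y \<in> fst c")
    case True
    have "snd c y \<notin> cball z0 r"
    proof
      assume "snd c y \<in> cball z0 r"
      then have "y \<in> K" unfolding K_def using chartD(5)[OF ch True] by (metis imageI)
      then show False using that by simp
    qed
    then have "r \<le> dist (snd c y) z0" by (simp add: dist_commute)
    then have "bump z0 r (snd c y) = 0" using bump_zero_iff[OF r] by blast
    then show ?thesis by (simp add: chart_bump_def)
  qed (simp add: chart_bump_def)
  show "chart_bump c z0 r (chart_inv c z) = bump z0 r z" if "z \<in> chart_image c"
    using chartD(6,7)[OF ch that] by (simp add: chart_bump_def)
  show "compact_support A (chart_bump c z0 r)"
    unfolding compact_support_def using K Kc off c by (intro exI[of _ K]) (auto simp: carrier_def)
  show "smooth_fun A (chart_bump c z0 r)" unfolding smooth_fun_def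
  proof
    fix d assume d: "d \<in> A"
    note dh = chart[OF d]
    have oK: "open (- K)" using compact_imp_closed[OF K] by blast
    show "smooth_on (chart_image d) (\<lambda>z. chart_bump c z0 r (chart_inv d z))"
    proof (rule Cinf_on_imp_smooth_on[OF chartD(2)[OF dh]], rule Cinf_on_if_at)
      fix z assume z: "z \<in> chart_image d"
      let ?V = "chart_image d \<inter> chart_inv d -` fst c"
      let ?V' = "chart_image d \<inter> chart_inv d -` (- K)"
      have V: "open ?V" by (rule continuous_open_preimage[OF chartD(4)[OF dh] chartD(2)[OF dh] chartD(1)[OF ch]])
      have V': "open ?V'" by (rule continuous_open_preimage[OF chartD(4)[OF dh] chartD(2)[OF dh] oK])
      show "Cinf_at (\<lambda>z. chart_bump c z0 r (chart_inv d z)) z"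
      proof (cases "chart_inv d z \<in> fst c")
        case True
        have Veq: "snd d ` (fst d \<inter> fst c) = ?V"
        proof
          show "snd d ` (fst d \<inter> fst c) \<subseteq> ?V" using chartD(5,8)[OF dh] by auto
          show "?V \<subseteq> snd d ` (fst d \<inter> fst c)"
          proof
            fix z assume "z \<in> ?V"
            then show "z \<in> snd d ` (fst d \<inter> fst c)"
              using chartD(6,7)[OF dh, of z] by (intro image_eqI[of _ _ "chart_inv d z"]) auto
          qed
        qed
        have tr: "Cinf_on ?V (\<lambda>z. snd c (chart_inv d z) $ i)" for i
        proof (rule smooth_on_open_imp[OF V])
          show "smooth_on ?V (\<lambda>z. snd c (chart_inv d z) $ i)"
            using atlas c d unfolding smooth_atlas_def Veq[symmetric] by blast
        qed
        have "Cinf_on ?V (\<lambda>z. flat 0 (r\<^sup>2 - (\<Sum>j\<in>UNIV. (snd c (chart_inv d z) $ j - z0 $ j)\<^sup>2)))"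
          unfolding power2_eq_square
          by (intro Cinf_on_flat[OF V] Cinf_on_diff[OF V] Cinf_on_sum[OF V] Cinf_on_mult[OF V] Cinf_on_const tr)
        then have "Cinf_on ?V (\<lambda>z. chart_bump c z0 r (chart_inv d z))"
          by (rule Cinf_on_cong[OF V, rotated]) (simp add: chart_bump_def bump_def dist_square_sum)
        then show ?thesis unfolding Cinf_at_def using V z True by blast
      next
        case False
        have "Cinf_on ?V' (\<lambda>z. chart_bump c z0 r (chart_inv d z))"
          by (rule Cinf_on_cong[OF V' _ Cinf_on_const[of _ 0]]) (use off in auto)
        moreover have "z \<in> ?V'" using z False Kc by blast
        ultimately show ?thesis unfolding Cinf_at_def using V' by blast
      qed
    qed
  qed
qed

text \<open>For a bump function \<open>f\<close> the identity \<open>coefficient_identity\<close> is integrated over the chart.  By locality the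
  flux and the functions \<open>P (2 * k) f\<close> vanish off the ball, so the divergence integrates to zero and
  the integrals over the manifold in the definition of the formal adjoint become integrals over the
  ball.\<close>
lemma tested_formula:
  assumes v: "volume_coefficients A g gx v" and P: "harmonic_operators A a gp P"
    and dv: "volume_measure A g dv"
    and adj: "\<And>k. k \<in> {1..CARD('n) div 2 - 1} \<Longrightarrow> formal_adjoint A dv (P (2 * k)) (Padj (2 * k))"
    and hB: "\<And>z. z \<in> chart_image c \<Longrightarrow> smooth_bd z (lift c h) \<and> smooth_bd z (lift c B)"
    and h0: "\<And>z. z \<in> chart_image c \<Longrightarrow> tcoeff 0 (lift c h) z = 0"
    and S: "\<And>z k. z \<in> chart_image c \<Longrightarrow> k \<le> CARD('n) \<Longrightarrow>
      tcoeff k (\<lambda>w. w $ None * partial_deriv None (dens c) w + Lap c (lift c h) w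
        + real CARD('n) * (dens c w * lift c B w * (w $ None) ^ CARD('n))) z = 0"
    and c: "c \<in> A" and r: "r > 0" and sub: "cball z0 r \<subseteq> chart_image c"
  defines "E \<equiv> \<lambda>z. real CARD('n) * v CARD('n) (chart_inv c z) + real CARD('n) * tcoeff 0 (lift c B) z
      + (\<Sum>k = 1..CARD('n) div 2 - 1. real (CARD('n) - 2 * k) * Padj (2 * k) (v (CARD('n) - 2 * k)) (chart_inv c z))"
  shows "continuous_on (chart_image c) E"
    and "(\<integral>z. indicator (cball z0 r) z * (tcoeff 0 (dens c) z * (bump z0 r z * E z)) \<partial>lborel) = 0"
proof -
  let ?n = "CARD('n)" and ?\<Omega> = "chart_image c" and ?K = "cball z0 r"
  let ?I = "{1..?n div 2 - 1}"
  let ?D = "tcoeff 0 (dens c)"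
  define f where "f = chart_bump c z0 r"
  note ch = chart[OF c]
  have o\<Omega>: "open ?\<Omega>" by (rule chartD(2)[OF ch])
  note fb = chart_bump[OF c r sub, folded f_def]
  have idx: "0 < ?n - 2 * k" "?n - 2 * k = 2 * (?n div 2 - k)" "?n div 2 - k \<in> {0..?n div 2}" "2 * k < ?n" "2 * k \<noteq> 0" if "k \<in> ?I" for k
    using that n_even by (auto elim!: evenE)
  have vs: "smooth_fun A (v (?n - 2 * k))" if "k \<in> ?I" for k
    using v idx[OF that] unfolding volume_coefficients_def by metis
  have vn: "smooth_fun A (v ?n)"
  proof -
    have "smooth_fun A (v (2 * (?n div 2)))" using v unfolding volume_coefficients_def by auto
    then show ?thesis using n_even by simp
  qed
  have vadj: "smooth_fun A (Padj (2 * k) (v (?n - 2 * k)))" if "k \<in> ?I" for k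
    using adj[OF that] vs[OF that] unfolding formal_adjoint_def by blast
  note cont = Cinf_on_continuous[OF smooth_fun_chart[OF _ c]]
  have Bc: "continuous_on ?\<Omega> (tcoeff 0 (lift c B))"
    by (rule Cinf_on_continuous[OF tcoeff_Cinf_on_open[OF o\<Omega>]]) (use hB in blast)
  have Dc: "continuous_on ?\<Omega> ?D"
    by (rule Cinf_on_continuous[OF tcoeff_Cinf_on_open[OF o\<Omega> boundary_chart.J_smooth_bd[OF boundary_chart[OF c]]]])
  show Ec: "continuous_on ?\<Omega> E" unfolding E_def
    by (intro continuous_intros cont vn Bc vadj)
  have fc: "continuous_on ?\<Omega> (\<lambda>z. f (chart_inv c z))" by (rule cont[OF fb(4)])
  obtain u where ub: "\<And>c z. c \<in> A \<Longrightarrow> z \<in> chart_image c \<Longrightarrow> smooth_bd z (lift c u)"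
    and Lu: "\<And>c z j. c \<in> A \<Longrightarrow> z \<in> chart_image c \<Longrightarrow> j < ?n \<Longrightarrow> tcoeff j (Lap c (lift c u)) z = 0"
    and tu: "\<And>c z j. c \<in> A \<Longrightarrow> z \<in> chart_image c \<Longrightarrow> j < ?n \<Longrightarrow>
      tcoeff j (lift c u) z = (if j = 0 then f (chart_inv c z) else if even j then P j f (chart_inv c z) else 0)"
    by (rule harmonicE[OF P fb(4)]) blast
  have Ploc: "P (2 * k) f y = 0" if "k \<in> ?I" "y \<in> carrier A" "y \<notin> chart_inv c ` ?K" for k y
    by (rule harmonic_local[OF P fb(4), of "- (chart_inv c ` ?K)"])
      (use fb(3) that compact_imp_closed[OF fb(1)] in auto)
  have Pc: "continuous_on ?\<Omega> (\<lambda>z. P (2 * k) f (chart_inv c z))" if k: "k \<in> ?I" for k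
  proof -
    have "continuous_on ?\<Omega> (tcoeff (2 * k) (lift c u))"
      by (rule Cinf_on_continuous[OF tcoeff_Cinf_on_open[OF o\<Omega> ub[OF c]]])
    moreover have "tcoeff (2 * k) (lift c u) z = P (2 * k) f (chart_inv c z)" if "z \<in> ?\<Omega>" for z
      using tu[OF c that, of "2 * k"] idx[OF k] by simp
    ultimately show ?thesis using continuous_on_cong[OF refl, of ?\<Omega> "tcoeff (2 * k) (lift c u)"] by simp
  qed
  have int: "integrable lborel (\<lambda>z. indicator ?K z * F z)" if "continuous_on ?\<Omega> F" for F :: "real^'n \<Rightarrow> real"
    using borel_integrable_compact[OF compact_cball continuous_on_subset[OF that sub]] by simp

  \<comment> \<open>The flux vanishes off the support of the bump function.\<close>
  have flux0: "flux c u h i z = 0" if z: "z \<in> ?\<Omega>" "z \<notin> ?K" for i z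
  proof -
    let ?V = "?\<Omega> - ?K"
    have V: "open ?V" using o\<Omega> by (simp add: open_Diff)
    have zero: "tcoeff k (lift c u) z' = 0" if "k < ?n" "z' \<in> ?V" for k z'
    proof (rule boundary_chart.coefficients_local[OF boundary_chart[OF c] V])
      show "tcoeff 0 (lift c u) z = 0" if "z \<in> ?V" for z
      proof -
        have "f (chart_inv c z) = bump z0 r z" using fb(6) that by blast
        moreover have "r \<le> dist z z0" using that by (simp add: dist_commute)
        then have "bump z0 r z = 0" using bump_zero_iff[OF r] by blast
        ultimately show ?thesis using tu[OF c, of z 0] that n2 by simp
      qed
    qed (use ub[OF c] Lu[OF c] that in auto)
    have zV: "z \<in> ?V" using z by blast
    let ?w = "\<lambda>j w. dens c w * boundary_chart.H (gmat c) w $ i $ j"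
    have b: "smooth_bd z (lift c u)" "smooth_bd z (lift c h)" "smooth_bd z (?w j)" for j
      using ub[OF c z(1)] hB[OF z(1)] boundary_chart.J_smooth_bd[OF boundary_chart[OF c] z(1)] boundary_chart.H_smooth_bd[OF boundary_chart[OF c] z(1)]
      by (auto intro: smooth_bd_mult)
    have du: "tcoeff k (partial_deriv (Some j) (lift c u)) z = 0" if "k < ?n" for k j
    proof -
      have "tcoeff k (partial_deriv (Some j) (lift c u)) z = partial_deriv j (tcoeff k (lift c u)) z"
        by (rule tcoeff_partial_deriv[OF b(1)])
      also have "\<dots> = partial_deriv j (\<lambda>z. 0) z" by (rule partial_deriv_cong[OF V zV]) (rule zero[OF that])
      finally show ?thesis by simp
    qed
    have "tcoeff (?n - 2) (\<lambda>w. \<Sum>j\<in>UNIV. ?w j w * (lift c u w * partial_deriv (Some j) (lift c h) w - lift c h w * partial_deriv (Some j) (lift c u) w)) z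
      = fps_nth (\<Sum>j\<in>UNIV. jet (?w j) z * (jet (lift c u) z * jet (partial_deriv (Some j) (lift c h)) z
          - jet (lift c h) z * jet (partial_deriv (Some j) (lift c u)) z)) (?n - 2)"
    proof -
      have "jet (\<lambda>w. \<Sum>j\<in>UNIV. ?w j w * (lift c u w * partial_deriv (Some j) (lift c h) w - lift c h w * partial_deriv (Some j) (lift c u) w)) z
        = (\<Sum>j\<in>UNIV. jet (\<lambda>w. ?w j w * (lift c u w * partial_deriv (Some j) (lift c h) w - lift c h w * partial_deriv (Some j) (lift c u) w)) z)"
        by (intro jet_sum smooth_bd_mult[OF b(3)] smooth_bd_diff smooth_bd_mult smooth_bd_partial_deriv b)
      also have "\<dots> = (\<Sum>j\<in>UNIV. jet (?w j) z * (jet (lift c u) z * jet (partial_deriv (Some j) (lift c h)) z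
          - jet (lift c h) z * jet (partial_deriv (Some j) (lift c u)) z))"
      proof (rule sum.cong[OF refl])
        fix j
        have "jet (\<lambda>w. ?w j w * (lift c u w * partial_deriv (Some j) (lift c h) w - lift c h w * partial_deriv (Some j) (lift c u) w)) z
          = jet (?w j) z * jet (\<lambda>w. lift c u w * partial_deriv (Some j) (lift c h) w - lift c h w * partial_deriv (Some j) (lift c u) w) z"
          by (intro jet_mult b smooth_bd_diff smooth_bd_mult[OF b(1)] smooth_bd_mult[OF b(2)] smooth_bd_partial_deriv)
        also have "jet (\<lambda>w. lift c u w * partial_deriv (Some j) (lift c h) w - lift c h w * partial_deriv (Some j) (lift c u) w) z
          = jet (lift c u) z * jet (partial_deriv (Some j) (lift c h)) z - jet (lift c h) z * jet (partial_deriv (Some j) (lift c u)) z"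
          by (simp add: jet_diff jet_mult smooth_bd_mult smooth_bd_partial_deriv b)
        finally show "jet (\<lambda>w. ?w j w * (lift c u w * partial_deriv (Some j) (lift c h) w - lift c h w * partial_deriv (Some j) (lift c u) w)) z
          = jet (?w j) z * (jet (lift c u) z * jet (partial_deriv (Some j) (lift c h)) z
          - jet (lift c h) z * jet (partial_deriv (Some j) (lift c u)) z)" .
      qed
      finally show ?thesis by (simp only: jet_nth[symmetric])
    qed
    also have "\<dots> = 0"
    proof -
      have low: "fps_nth (jet (lift c u) z * F) k = 0" "fps_nth (G * jet (partial_deriv (Some j) (lift c u)) z) k = 0"
        if "k < ?n" for F G :: "real fps" and k j
        using that zero[OF _ zV] du by (auto simp: fps_mult_nth intro!: sum.neutral)
      have "fps_nth (F * (jet (lift c u) z * F1 - G * jet (partial_deriv (Some j) (lift c u)) z)) (?n - 2) = 0" for F F1 G :: "real fps" and j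
      proof -
        have lt: "k < ?n" if "k \<le> ?n - 2" for k using that n2 by linarith
        show ?thesis unfolding fps_mult_nth[of F] using low lt by (auto intro!: sum.neutral)
      qed
      then show ?thesis by (simp add: fps_sum_nth)
    qed
    finally show ?thesis by (simp add: flux_def)
  qed
  have fluxC: "Cinf_on ?\<Omega> (flux c u h i)" for i unfolding flux_def
  proof (rule tcoeff_Cinf_on_open[OF o\<Omega>])
    fix z assume z: "z \<in> ?\<Omega>"
    show "smooth_bd z (\<lambda>w. \<Sum>j\<in>UNIV. dens c w * boundary_chart.H (gmat c) w $ i $ j *
      (lift c u w * partial_deriv (Some j) (lift c h) w - lift c h w * partial_deriv (Some j) (lift c u) w))"
      using hB[OF z] by (intro smooth_bd_sum smooth_bd_mult smooth_bd_diff smooth_bd_partial_deriv ub[OF c z]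
          boundary_chart.J_smooth_bd[OF boundary_chart[OF c] z] boundary_chart.H_smooth_bd[OF boundary_chart[OF c] z]) auto
  qed
  define T1 where "T1 = (\<lambda>z. f (chart_inv c z) * (real ?n * v ?n (chart_inv c z) + real ?n * tcoeff 0 (lift c B) z) * ?D z)"
  define T2 where "T2 = (\<lambda>k z. P (2 * k) f (chart_inv c z) * v (?n - 2 * k) (chart_inv c z) * ?D z)"
  define T3 where "T3 = (\<lambda>k z. f (chart_inv c z) * Padj (2 * k) (v (?n - 2 * k)) (chart_inv c z) * ?D z)"
  have i1: "integrable lborel (\<lambda>z. indicator ?K z * T1 z)" unfolding T1_def
    by (intro int continuous_intros fc cont vn Bc Dc)
  have i2: "integrable lborel (\<lambda>z. indicator ?K z * T2 k z)" if "k \<in> ?I" for k unfolding T2_def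
    by (intro int continuous_intros Pc cont vs Dc that)
  have i3: "integrable lborel (\<lambda>z. indicator ?K z * T3 k z)" if "k \<in> ?I" for k unfolding T3_def
    by (intro int continuous_intros fc cont vadj Dc that)
  have Deq: "sqrt \<bar>det (g c (chart_inv c z))\<bar> = ?D z" if "z \<in> ?\<Omega>" for z
    using tcoeff_0_dens(1)[OF c that] by simp
  have gc: "continuous_on ?\<Omega> (\<lambda>z. sqrt \<bar>det (g c (chart_inv c z))\<bar>)"
    by (rule continuous_on_eq[OF Dc]) (simp add: Deq)
  have T23: "(\<integral>z. indicator ?K z * T2 k z \<partial>lborel) = (\<integral>z. indicator ?K z * T3 k z \<partial>lborel)" if k: "k \<in> ?I" for k
  proof -
    let ?v = "v (?n - 2 * k)"
    have eqD: "indicator ?K z * (t * sqrt \<bar>det (g c (chart_inv c z))\<bar>) = indicator ?K z * (t * ?D z)" for z and t :: real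
      using Deq[of z] sub by (cases "z \<in> ?K") auto
    have "(\<integral>y. P (2 * k) f y * ?v y \<partial>dv) = (\<integral>z. indicator ?K z * ((P (2 * k) f (chart_inv c z) * ?v (chart_inv c z))
        * sqrt \<bar>det (g c (chart_inv c z))\<bar>) \<partial>lborel)"
    proof (rule integral_in_chart[where F="\<lambda>y. P (2 * k) f y * ?v y", OF dv c ch gc _ sub])
      show "P (2 * k) f p * ?v p = 0" if "p \<in> carrier A" "p \<notin> chart_inv c ` ?K" for p using Ploc[OF k that] by simp
    qed (intro continuous_intros Pc[OF k] cont[OF vs[OF k]])
    then have "(\<integral>y. P (2 * k) f y * ?v y \<partial>dv) = (\<integral>z. indicator ?K z * T2 k z \<partial>lborel)"
      by (simp only: eqD T2_def)
    moreover have "(\<integral>y. f y * Padj (2 * k) ?v y \<partial>dv) = (\<integral>z. indicator ?K z * ((f (chart_inv c z) * Padj (2 * k) ?v (chart_inv c z))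
        * sqrt \<bar>det (g c (chart_inv c z))\<bar>) \<partial>lborel)"
    proof (rule integral_in_chart[where F="\<lambda>y. f y * Padj (2 * k) ?v y", OF dv c ch gc _ sub])
      show "f p * Padj (2 * k) ?v p = 0" if "p \<in> carrier A" "p \<notin> chart_inv c ` ?K" for p using fb(3)[OF that(2)] by simp
    qed (intro continuous_intros fc cont[OF vadj[OF k]])
    then have "(\<integral>y. f y * Padj (2 * k) ?v y \<partial>dv) = (\<integral>z. indicator ?K z * T3 k z \<partial>lborel)"
      by (simp only: eqD T3_def)
    moreover have "(\<integral>y. P (2 * k) f y * ?v y \<partial>dv) = (\<integral>y. f y * Padj (2 * k) ?v y \<partial>dv)"
      using adj[OF k] vs[OF k] fb(4,5) unfolding formal_adjoint_def by blast
    ultimately show ?thesis by simp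
  qed
  define G where "G = (\<lambda>i z. indicator ?K z * partial_deriv i (flux c u h i) z)"
  have point: "indicator ?K z * T1 z + (\<Sum>k\<in>?I. real (?n - 2 * k) * (indicator ?K z * T2 k z))
     = - (\<Sum>i\<in>UNIV. G i z)" for z
  proof (cases "z \<in> ?K")
    case True
    then have z: "z \<in> ?\<Omega>" using sub by blast
    have "?D z * (f (chart_inv c z) * (real ?n * v ?n (chart_inv c z) + real ?n * tcoeff 0 (lift c B) z)
      + (\<Sum>k\<in>?I. real (?n - 2 * k) * (P (2 * k) f (chart_inv c z) * v (?n - 2 * k) (chart_inv c z))))
      = - (\<Sum>i\<in>UNIV. partial_deriv i (flux c u h i) z)"
    proof (rule coefficient_identity[where u=u and h=h and B=B and f=f and P=P, OF v c z ub[OF c z]])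
      show "smooth_bd z (lift c h)" "smooth_bd z (lift c B)" using hB[OF z] by blast+
    qed (rule Lu[OF c z] h0[OF z] S[OF z] tu[OF c z], assumption?)+
    then show ?thesis using True by (simp add: T1_def T2_def G_def sum_distrib_left distrib_left mult_ac)
  qed (simp add: G_def)
  have "(\<integral>z. indicator ?K z * T1 z + (\<Sum>k\<in>?I. real (?n - 2 * k) * (indicator ?K z * T2 k z)) \<partial>lborel) = 0"
  proof -
    have "integrable lborel (G i)" for i
      unfolding G_def by (intro int Cinf_on_continuous[OF Cinf_on_partial_deriv[OF fluxC]])
    moreover have "(\<integral>z. G i z \<partial>lborel) = 0" for i
      unfolding G_def by (rule integral_partial_deriv_eq_0[OF o\<Omega> fluxC compact_cball sub flux0])
    ultimately show ?thesis unfolding point by simp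
  qed
  also have "(\<integral>z. indicator ?K z * T1 z + (\<Sum>k\<in>?I. real (?n - 2 * k) * (indicator ?K z * T2 k z)) \<partial>lborel)
     = (\<integral>z. indicator ?K z * T1 z \<partial>lborel) + (\<Sum>k\<in>?I. real (?n - 2 * k) * (\<integral>z. indicator ?K z * T2 k z \<partial>lborel))"
    using i1 i2 by (subst Bochner_Integration.integral_add) (auto simp: Bochner_Integration.integral_sum)
  also have "\<dots> = (\<integral>z. indicator ?K z * T1 z \<partial>lborel) + (\<Sum>k\<in>?I. real (?n - 2 * k) * (\<integral>z. indicator ?K z * T3 k z \<partial>lborel))"
    using T23 by simp
  also have "\<dots> = (\<integral>z. indicator ?K z * T1 z + (\<Sum>k\<in>?I. real (?n - 2 * k) * (indicator ?K z * T3 k z)) \<partial>lborel)"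
    using i1 i3 by (subst Bochner_Integration.integral_add) (auto simp: Bochner_Integration.integral_sum)
  also have "\<dots> = (\<integral>z. indicator ?K z * (?D z * (bump z0 r z * E z)) \<partial>lborel)"
  proof (rule Bochner_Integration.integral_cong[OF refl])
    fix z
    show "indicator ?K z * T1 z + (\<Sum>k\<in>?I. real (?n - 2 * k) * (indicator ?K z * T3 k z))
      = indicator ?K z * (?D z * (bump z0 r z * E z))"
    proof (cases "z \<in> ?K")
      case True
      then have "f (chart_inv c z) = bump z0 r z" using fb(6) sub by blast
      then show ?thesis using True
        by (simp add: T1_def T3_def E_def sum_distrib_left distrib_left mult_ac)
    qed simp
  qed
  finally show "(\<integral>z. indicator ?K z * (?D z * (bump z0 r z * E z)) \<partial>lborel) = 0" .
qed

end

theorem theorem1: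
  fixes A :: "('m::{t2_space, second_countable_topology}, 'n::finite) chart set"
    and g :: "('m, 'n) tensor2"
    and p q n :: nat
    and a :: real
    and gx :: "real \<Rightarrow> ('m, 'n) tensor2"
    and gp :: "('m \<times> real, 'n option) tensor2"
    and v :: "nat \<Rightarrow> 'm \<Rightarrow> real"
    and P Padj :: "nat \<Rightarrow> ('m \<Rightarrow> real) \<Rightarrow> 'm \<Rightarrow> real"
    and Q :: "'m \<Rightarrow> real"
    and dv :: "'m measure"
  assumes "n = CARD('n)" and "even n" and "n \<ge> 2"
    and "smooth_atlas A"
    and "pseudo_metric A p q g"
    and "poincare_metric A p q g a gx gp"
    and "volume_coefficients A g gx v"
    and "harmonic_operators A a gp P"
    and "Q_curvature A a gp Q"
    and "volume_measure A g dv"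
    and "\<And>k. k \<in> {1..n div 2 - 1} \<Longrightarrow> formal_adjoint A dv (P (2 * k)) (Padj (2 * k))"
  shows "\<forall>y\<in>carrier A.
    2 * real n * c_const (n div 2) * Q y =
      real n * v n y + (\<Sum>k = 1..n div 2 - 1. real (n - 2 * k) * Padj (2 * k) (v (n - 2 * k)) y)"
proof
  fix y assume "y \<in> carrier A"
  then obtain c where c: "c \<in> A" "y \<in> fst c" by (auto simp: carrier_def)
  interpret poincare_setup A p q g a gx gp
    using assms by unfold_locales auto
  note ch = chart[OF c(1)]
  show "2 * real n * c_const (n div 2) * Q y =
      real n * v n y + (\<Sum>k = 1..n div 2 - 1. real (n - 2 * k) * Padj (2 * k) (v (n - 2 * k)) y)"
  proof (rule Q_curvatureE[OF assms(9)])
    fix h B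
    assume hB: "\<And>c z. c \<in> A \<Longrightarrow> z \<in> chart_image c \<Longrightarrow> smooth_bd z (lift c h) \<and> smooth_bd z (lift c B)"
      and h0: "\<And>c z. c \<in> A \<Longrightarrow> z \<in> chart_image c \<Longrightarrow> tcoeff 0 (lift c h) z = 0"
      and B0: "\<And>c z. c \<in> A \<Longrightarrow> z \<in> chart_image c \<Longrightarrow> tcoeff 0 (lift c B) z = - 2 * c_const (CARD('n) div 2) * Q (chart_inv c z)"
      and S: "\<And>c z k. c \<in> A \<Longrightarrow> z \<in> chart_image c \<Longrightarrow> k \<le> CARD('n) \<Longrightarrow>
        tcoeff k (\<lambda>w. w $ None * partial_deriv None (dens c) w + Lap c (lift c h) w
        + real CARD('n) * (dens c w * lift c B w * (w $ None) ^ CARD('n))) z = 0"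
    let ?E = "\<lambda>z. real CARD('n) * v CARD('n) (chart_inv c z) + real CARD('n) * tcoeff 0 (lift c B) z
      + (\<Sum>k = 1..CARD('n) div 2 - 1. real (CARD('n) - 2 * k) * Padj (2 * k) (v (CARD('n) - 2 * k)) (chart_inv c z))"
    have z: "snd c y \<in> chart_image c" by (rule chartD(8)[OF ch c(2)])
    have o: "open (chart_image c)" by (rule chartD(2)[OF ch])
    obtain r where r: "r > 0" "cball (snd c y) r \<subseteq> chart_image c" using o z open_contains_cball by blast
    have Dc: "continuous_on (chart_image c) (tcoeff 0 (dens c))"
      by (rule Cinf_on_continuous[OF tcoeff_Cinf_on_open[OF o boundary_chart.J_smooth_bd[OF boundary_chart[OF c(1)]]]])
    have adj: "\<And>k. k \<in> {1..CARD('n) div 2 - 1} \<Longrightarrow> formal_adjoint A dv (P (2 * k)) (Padj (2 * k))"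
      using assms(11) unfolding assms(1) .
    have Ec: "continuous_on (chart_image c) ?E"
      by (rule tested_formula(1)[OF assms(7,8,10) adj hB[OF c(1)] h0[OF c(1)] S[OF c(1)] c(1) r]) assumption+
    have tested: "(\<integral>z. indicator (cball z0 r) z * (tcoeff 0 (dens c) z * (bump z0 r z * ?E z)) \<partial>lborel) = 0"
      if "r > 0" "cball z0 r \<subseteq> chart_image c" for z0 r
      by (rule tested_formula(2)[OF assms(7,8,10) adj hB[OF c(1)] h0[OF c(1)] S[OF c(1)] c(1) that]) assumption+
    have "?E (snd c y) = 0"
      by (rule eq_0_if_tested[OF o Ec Dc tcoeff_0_dens(2)[OF c(1)] tested z])
    then show ?thesis
      using B0[OF c(1) z] chartD(5)[OF ch c(2)] assms(1) by (simp add: algebra_simps)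
  qed
qed

end
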